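(* Let $m\ge1$, and let rational tableaux, their bideterminants viewed in $\mathbb Z[\mathrm{GL}_{m,\mathbb Z}]$, the modules $\nabla_{\mathbb Z}(\lambda),\tilde\nabla_{\mathbb Z}(\lambda)$ and the functor $O_\pi$ be as defined in the context, with respect to a fixed linear order $\preceq$ on $\{1,\dots,m\}$. (i) Let $\lambda\in X^+$. Then $\nabla_{\mathbb Z}(\lambda)=\mathrm{ind}_{B^-_{\mathbb Z}}^{\mathrm{GL}_{m,\mathbb Z}}(\lambda)$, and $\tilde\nabla_{\mathbb Z}(\lambda)$ is the induced module of the $B_{\mathbb Z}$-module $-\lambda$ in Jantzen's convention, i.e. $\tilde\nabla_{\mathbb Z}(\lambda)$ is the set of all $f\in\mathbb Z[\mathrm{GL}_{m,\mathbb Z}]$ with $f(gb)=\lambda(b)f(g)$ for all commutative rings $A$, all $g\in\mathrm{GL}_m(A)$ and all $b\in B(A)$. (ii) Let $\pi\subseteq X^+$ be saturated. Then $O_\pi(\mathbb Z[\mathrm{GL}_{m,\mathbb Z}])$ is spanned over $\mathbb Z$ by the bideterminants $(S\,|\,T)$ where $S$ and $T$ are rational tableaux of the same shape, this shape lying in $\pi$. Moreover, the $(S\,|\,T)$ with $S$ and $T$ standard of the same shape in $\pi$ form a basis.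
   Context: **Functions and actions.** In $\mathbb Z[\mathrm{GL}_{m,\mathbb Z}]$ let $x_{ij}$ be the $(i,j)$ entry function and $y_{ij}$ the function $A\mapsto((A^{-1})^T)_{ij}$. The right regular action of $\mathrm{GL}_{m,\mathbb Z}$ is $(h\cdot f)(A)=f(Ah)$. $B_{\mathbb Z}$ and $B_{\mathbb Z}^-$ are the subgroup schemes of upper and lower triangular matrices; $\lambda\in\mathbb Z^m$ defines a character of each by $b\mapsto\prod_i b_{ii}^{\lambda_i}$. $\mathrm{ind}_{B^-_{\mathbb Z}}^{\mathrm{GL}_{m,\mathbb Z}}(\lambda)$ is the set of $f\in\mathbb Z[\mathrm{GL}_{m,\mathbb Z}]$ such that $f(bg)=\lambda(b)f(g)$ for all commutative rings $A$, $b\in B^-(A)$, $g\in\mathrm{GL}_m(A)$. In Jantzen's convention the module induced from a character $\chi$ of $H$ consists of the $f$ with $f(gh)=\chi(h)^{-1}f(g)$. **Weights.** $X=\mathbb Z^m$; $X^+=\{\lambda\in\mathbb Z^m:\lambda_1\ge\cdots\ge\lambda_m\}$; $|\lambda|=\sum_i\lambda_i$. $\mu\le\lambda$ means $|\mu|=|\lambda|$ and $\sum_{i=1}^j\mu_i\le\sum_{i=1}^j\lambda_i$ for all $j$. A subset $\pi\subseteq X^+$ is saturated if $\mu\in X^+$, $\mu\le\lambda\in\pi$ imply $\mu\in\pi$. For a torsion-free $\mathrm{GL}_{m,\mathbb Z}$-module $N$, $O_\pi(N)$ is the sum of the submodules of $N$ that are finitely generated over $\mathbb Z$ and whose dominant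 weights (with respect to the diagonal torus) lie in $\pi$. In $O_\pi(\mathbb Z[\mathrm{GL}_{m,\mathbb Z}])$ the right regular action is used. The length $l(\lambda)$ of a partition is its number of nonzero parts. For $\lambda^1,\lambda^2\in\mathbb Z^m$ put $[\lambda^1,\lambda^2]:=\lambda^1-(\lambda^2)^{\rm rev}$, where $\rm rev$ reverses a tuple. Every $\lambda\in X^+$ is uniquely $[\lambda^1,\lambda^2]$ with $\lambda^1,\lambda^2$ partitions satisfying $l(\lambda^1)+l(\lambda^2)\le m$. **Tableaux.** A tableau of shape a partition $\lambda$ (length $\le m$) is a map from the Young diagram $\{(i,j):1\le j\le\lambda_i\}$ to $\{1,\dots,m\}$. It is standard if, with respect to $\preceq$, entries strictly increase down columns and weakly increase along rows from left to right. A rational tableau of shape $(\lambda^1,\lambda^2)$ is a pair $T=(T^1,T^2)$ with $T^i$ a tableau of shape $\lambda^i$. If $\lambda=[\lambda^1,\lambda^2]\in X^+$ with $l(\lambda^1)+l(\lambda^2)\le m$, a rational tableau of shape $(\lambda^1,\lambda^2)$ is said to have shape $\lambda$. A pair $(I^1,I^2)$ of subsets of $\{1,\dots,m\}$ is standard if $|\{i\in I^1:i\preceq j\}|+|\{i\in I^2:i\preceq j\}|\le|\{i:i\preceq j\}|$ for all $j\in\{1,\dots,m\}$. A rational tableau $(T^1,T^2)$ is standard if $T^1,T^2$ are standard and the pair of sets of entries of the first columns of $T^1$ and $T^2$ (possibly empty) is standard. The canonical rational tableau $T_\lambda=(T^1,T^2)$ of shape $\lambda=[\lambda^1,\lambda^2]$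 has all entries in row $i$ of $T^1$ equal to $i$ ($1\le i\le l(\lambda^1)$) and all entries in row $i$ of $T^2$ equal to $m-i+1$ ($1\le i\le l(\lambda^2)$). **Bideterminants.** For rational tableaux $S,T$ of the same shape $(\lambda^1,\lambda^2)$, $(S\,|\,T)=(S^1\,|\,T^1)_1(S^2\,|\,T^2)_2$, where $(S^1\,|\,T^1)_1$ is the product over all columns $c$ of $\lambda^1$ of the minors $\det\big(x_{S^1(a,c)\,T^1(b,c)}\big)_{a,b}$ ($a,b$ from $1$ to the length of column $c$), and $(S^2\,|\,T^2)_2$ is defined in the same way from $S^2,T^2,\lambda^2$ and the $y_{ij}$. $\nabla_{\mathbb Z}(\lambda)$ (resp. $\tilde\nabla_{\mathbb Z}(\lambda)$) is the $\mathbb Z$-span in $\mathbb Z[\mathrm{GL}_{m,\mathbb Z}]$ of the $(T_\lambda\,|\,S)$ (resp. $(S\,|\,T_\lambda)$), $S$ a rational tableau of shape $\lambda$. *)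

theory Defs
  imports
    "HOL-Library.Poly_Mapping"
    "HOL-Library.Nat_Bijection"
    "HOL-Library.FuncSet"
    "HOL-Computational_Algebra.Fraction_Field"
    "HOL-Algebra.Ring"
    "Jordan_Normal_Form.Determinant"
begin

text \<open>
  All matrix indices and all tableau positions and entries are counted from 0, so the index set
  of matrices of size \<open>m\<close> is \<open>{..<m}\<close>.  Weights are integer lists of length \<open>m\<close>; partitions of length
  at most \<open>m\<close> are lists of natural numbers of length \<open>m\<close>, padded by zeros.
\<close>

section \<open>The coordinate ring of the general linear group scheme\<close>

text \<open>
  The variable with number \<open>prod_encode (i, j)\<close> stands for the matrix entry at position \<open>(i, j)\<close>.
  The coordinate ring is the localisation of the polynomial ring in these variables at the
  determinant, as a subring of the field of fractions.
\<close>

type_synonym zpoly = "(nat \<Rightarrow>\<^sub>0 nat) \<Rightarrow>\<^sub>0 int"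
type_synonym zfrac = "zpoly fract"

definition entry_var :: "nat \<Rightarrow> nat \<Rightarrow> zpoly" where
  "entry_var i j = Poly_Mapping.single (Poly_Mapping.single (prod_encode (i, j)) 1) 1"

definition mat_polys :: "nat \<Rightarrow> zpoly set" where
  "mat_polys m = {p. \<forall>\<mu>\<in>Poly_Mapping.keys p. Poly_Mapping.keys \<mu> \<subseteq> prod_encode ` ({..<m} \<times> {..<m})}"

definition det_poly :: "nat \<Rightarrow> zpoly" where
  "det_poly m = det (mat m m (\<lambda>(i, j). entry_var i j))"

definition coord_ring :: "nat \<Rightarrow> zfrac set" where
  "coord_ring m = {Fract p (det_poly m ^ k) | p k. p \<in> mat_polys m}"

definition generic_mat :: "nat \<Rightarrow> zfrac mat" where
  "generic_mat m = mat m m (\<lambda>(i, j). Fract (entry_var i j) 1)"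

definition generic_inverse :: "nat \<Rightarrow> zfrac mat" where
  "generic_inverse m = (THE Z. Z \<in> carrier_mat m m \<and>
     generic_mat m * Z = 1\<^sub>m m \<and> Z * generic_mat m = 1\<^sub>m m)"

definition x_fun :: "nat \<Rightarrow> nat \<Rightarrow> nat \<Rightarrow> zfrac" where
  "x_fun m i j = generic_mat m $$ (i, j)"

definition y_fun :: "nat \<Rightarrow> nat \<Rightarrow> nat \<Rightarrow> zfrac" where
  "y_fun m i j = transpose_mat (generic_inverse m) $$ (i, j)"

global_interpretation zmod: Modules.module "\<lambda>(k::int) (f::zfrac). of_int k * f"
  by unfold_locales (simp_all add: algebra_simps)

section \<open>Points of the group scheme and evaluation of functions\<close>

definition mmul :: "('r, 'x) ring_scheme \<Rightarrow> nat \<Rightarrow> 'r mat \<Rightarrow> 'r mat \<Rightarrow> 'r mat" where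
  "mmul R m A B = mat m m (\<lambda>(i, j). \<Oplus>\<^bsub>R\<^esub>k\<in>{..<m}. A $$ (i, k) \<otimes>\<^bsub>R\<^esub> B $$ (k, j))"

definition mone :: "('r, 'x) ring_scheme \<Rightarrow> nat \<Rightarrow> 'r mat" where
  "mone R m = mat m m (\<lambda>(i, j). if i = j then \<one>\<^bsub>R\<^esub> else \<zero>\<^bsub>R\<^esub>)"

definition mats :: "('r, 'x) ring_scheme \<Rightarrow> nat \<Rightarrow> 'r mat set" where
  "mats R m = {A \<in> carrier_mat m m. \<forall>i<m. \<forall>j<m. A $$ (i, j) \<in> carrier R}"

definition GL :: "('r, 'x) ring_scheme \<Rightarrow> nat \<Rightarrow> 'r mat set" where
  "GL R m = {A \<in> mats R m. \<exists>B\<in>mats R m. mmul R m A B = mone R m \<and> mmul R m B A = mone R m}"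

definition borel_upper :: "('r, 'x) ring_scheme \<Rightarrow> nat \<Rightarrow> 'r mat set" where
  "borel_upper R m = {b \<in> GL R m. \<forall>i<m. \<forall>j<i. b $$ (i, j) = \<zero>\<^bsub>R\<^esub>}"

definition borel_lower :: "('r, 'x) ring_scheme \<Rightarrow> nat \<Rightarrow> 'r mat set" where
  "borel_lower R m = {b \<in> GL R m. \<forall>j<m. \<forall>i<j. b $$ (i, j) = \<zero>\<^bsub>R\<^esub>}"

definition torus :: "('r, 'x) ring_scheme \<Rightarrow> nat \<Rightarrow> 'r mat set" where
  "torus R m = {t \<in> GL R m. \<forall>i<m. \<forall>j<m. i \<noteq> j \<longrightarrow> t $$ (i, j) = \<zero>\<^bsub>R\<^esub>}"

definition weight_char :: "('r, 'x) ring_scheme \<Rightarrow> nat \<Rightarrow> int list \<Rightarrow> 'r mat \<Rightarrow> 'r" where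
  "weight_char R m lam b = (\<Otimes>\<^bsub>R\<^esub>i\<in>{..<m}. b $$ (i, i) [^]\<^bsub>R\<^esub> (lam ! i))"

definition poly_value :: "('r, 'x) ring_scheme \<Rightarrow> 'r mat \<Rightarrow> zpoly \<Rightarrow> 'r" where
  "poly_value R A p = (\<Oplus>\<^bsub>R\<^esub>\<mu>\<in>Poly_Mapping.keys p. [Poly_Mapping.lookup p \<mu>] \<cdot>\<^bsub>R\<^esub>
     (\<Otimes>\<^bsub>R\<^esub>v\<in>Poly_Mapping.keys \<mu>. (A $$ prod_decode v) [^]\<^bsub>R\<^esub> Poly_Mapping.lookup \<mu> v))"

text \<open>The value \<open>f(A)\<close> of \<open>f\<close> in the coordinate ring at \<open>A\<close> in \<open>GL R m\<close>, for a commutative ring \<open>R\<close>;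
  it does not depend on the representation of \<open>f\<close> as a fraction.\<close>

definition value_at :: "('r, 'x) ring_scheme \<Rightarrow> nat \<Rightarrow> zfrac \<Rightarrow> 'r mat \<Rightarrow> 'r" where
  "value_at R m f A = (THE r. \<exists>p\<in>mat_polys m. \<exists>k. f = Fract p (det_poly m ^ k) \<and>
     r = poly_value R A p \<otimes>\<^bsub>R\<^esub> inv\<^bsub>R\<^esub> (poly_value R A (det_poly m) [^]\<^bsub>R\<^esub> k))"

section \<open>Induced modules\<close>

text \<open>
  HOL has no quantifier over rings of all types.  The definitions below quantify over all
  commutative rings whose carrier lies in one type \<open>'r\<close>; this type is kept as a
  parameter, to be instantiated by any infinite type.
\<close>

definition ind_lower :: "'r itself \<Rightarrow> nat \<Rightarrow> int list \<Rightarrow> zfrac set" where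
  "ind_lower (ty :: 'r itself) m lam = {f \<in> coord_ring m.
     \<forall>R :: 'r ring. cring R \<longrightarrow> (\<forall>b\<in>borel_lower R m. \<forall>g\<in>GL R m.
       value_at R m f (mmul R m b g) = weight_char R m lam b \<otimes>\<^bsub>R\<^esub> value_at R m f g)}"

text \<open>Jantzen's convention, for a subgroup scheme \<open>H\<close> and a character \<open>chi\<close> of \<open>H\<close>.\<close>

definition jantzen_ind ::
  "nat \<Rightarrow> ('r ring \<Rightarrow> 'r mat set) \<Rightarrow> ('r ring \<Rightarrow> 'r mat \<Rightarrow> 'r) \<Rightarrow> zfrac set" where
  "jantzen_ind m H chi = {f \<in> coord_ring m.
     \<forall>R :: 'r ring. cring R \<longrightarrow> (\<forall>g\<in>GL R m. \<forall>h\<in>H R.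
       value_at R m f (mmul R m g h) = inv\<^bsub>R\<^esub> (chi R h) \<otimes>\<^bsub>R\<^esub> value_at R m f g)}"

section \<open>Weights\<close>

definition dominant :: "nat \<Rightarrow> int list set" where
  "dominant m = {lam. length lam = m \<and> sorted_wrt (\<ge>) lam}"

definition weight_le :: "int list \<Rightarrow> int list \<Rightarrow> bool" where
  "weight_le mu lam \<longleftrightarrow> length mu = length lam \<and> sum_list mu = sum_list lam \<and>
     (\<forall>j\<le>length lam. sum_list (take j mu) \<le> sum_list (take j lam))"

definition saturated :: "nat \<Rightarrow> int list set \<Rightarrow> bool" where
  "saturated m \<pi> \<longleftrightarrow> \<pi> \<subseteq> dominant m \<and>
     (\<forall>lam\<in>\<pi>. \<forall>mu\<in>dominant m. weight_le mu lam \<longrightarrow> mu \<in> \<pi>)"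

section \<open>The truncation functor on the right regular module\<close>

text \<open>
  A submodule is a subgroup \<open>M\<close> such that the comodule map \<open>f \<mapsto> ((g, h) \<mapsto> f (g h))\<close> sends \<open>M\<close> into
  the tensor product of \<open>M\<close> with the coordinate ring.
\<close>

definition gl_submodule :: "'r itself \<Rightarrow> nat \<Rightarrow> zfrac set \<Rightarrow> bool" where
  "gl_submodule (ty :: 'r itself) m M \<longleftrightarrow> M \<subseteq> coord_ring m \<and> zmod.subspace M \<and>
     (\<forall>f\<in>M. \<exists>(n::nat) u v. (\<forall>i<n. u i \<in> M \<and> v i \<in> coord_ring m) \<and>
       (\<forall>R :: 'r ring. cring R \<longrightarrow> (\<forall>g\<in>GL R m. \<forall>h\<in>GL R m.
          value_at R m f (mmul R m g h) =
            (\<Oplus>\<^bsub>R\<^esub>i\<in>{..<n}. value_at R m (u i) g \<otimes>\<^bsub>R\<^esub> value_at R m (v i) h))))"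

definition weight_space :: "'r itself \<Rightarrow> nat \<Rightarrow> zfrac set \<Rightarrow> int list \<Rightarrow> zfrac set" where
  "weight_space (ty :: 'r itself) m M mu = {f \<in> M.
     \<forall>R :: 'r ring. cring R \<longrightarrow> (\<forall>g\<in>GL R m. \<forall>t\<in>torus R m.
       value_at R m f (mmul R m g t) = weight_char R m mu t \<otimes>\<^bsub>R\<^esub> value_at R m f g)}"

definition O_trunc :: "'r itself \<Rightarrow> nat \<Rightarrow> int list set \<Rightarrow> zfrac set" where
  "O_trunc ty m \<pi> = zmod.span (\<Union> {M. gl_submodule ty m M \<and>
     (\<exists>B. finite B \<and> M = zmod.span B) \<and>
     (\<forall>mu\<in>dominant m. weight_space ty m M mu \<noteq> {0} \<longrightarrow> mu \<in> \<pi>)})"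

section \<open>Rational tableaux\<close>

definition partition_list :: "nat \<Rightarrow> nat list \<Rightarrow> bool" where
  "partition_list m lam \<longleftrightarrow> length lam = m \<and> sorted_wrt (\<ge>) lam"

definition nparts :: "nat list \<Rightarrow> nat" where
  "nparts lam = length (filter (\<lambda>a. a \<noteq> 0) lam)"

definition bracket :: "nat list \<Rightarrow> nat list \<Rightarrow> int list" where
  "bracket l1 l2 = map2 (\<lambda>a b. int a - int b) l1 (rev l2)"

definition diagram :: "nat list \<Rightarrow> (nat \<times> nat) set" where
  "diagram lam = {(i, j). i < length lam \<and> j < lam ! i}"

definition col_length :: "nat list \<Rightarrow> nat \<Rightarrow> nat" where
  "col_length lam c = card {i. (i, c) \<in> diagram lam}"

type_synonym tableau = "nat \<times> nat \<Rightarrow> nat"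
type_synonym shape = "nat list \<times> nat list"
type_synonym rat_tableau = "tableau \<times> tableau"

definition tableaux :: "nat \<Rightarrow> nat list \<Rightarrow> tableau set" where
  "tableaux m lam = diagram lam \<rightarrow>\<^sub>E {..<m}"

definition rat_tableaux :: "nat \<Rightarrow> shape \<Rightarrow> rat_tableau set" where
  "rat_tableaux m = (\<lambda>(l1, l2). tableaux m l1 \<times> tableaux m l2)"

text \<open>Membership means that a rational tableau of the given pair shape has shape \<open>lam\<close>.\<close>

definition shapes_of :: "nat \<Rightarrow> int list \<Rightarrow> shape set" where
  "shapes_of m lam = {(l1, l2). partition_list m l1 \<and> partition_list m l2 \<and>
     nparts l1 + nparts l2 \<le> m \<and> lam = bracket l1 l2}"

definition canonical_tableau :: "nat \<Rightarrow> shape \<Rightarrow> rat_tableau" where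
  "canonical_tableau m = (\<lambda>(l1, l2).
     (restrict (\<lambda>(i, j). i) (diagram l1), restrict (\<lambda>(i, j). m - 1 - i) (diagram l2)))"

text \<open>Standardness with respect to a linear order \<open>r\<close> on \<open>{..<m}\<close>, where \<open>(i, j) \<in> r\<close> means that \<open>i\<close> precedes or
  equals \<open>j\<close>.\<close>

definition std_tableau :: "(nat \<times> nat) set \<Rightarrow> nat list \<Rightarrow> tableau \<Rightarrow> bool" where
  "std_tableau r lam T \<longleftrightarrow>
     (\<forall>i i' j. i < i' \<and> (i, j) \<in> diagram lam \<and> (i', j) \<in> diagram lam \<longrightarrow>
        (T (i, j), T (i', j)) \<in> r \<and> T (i, j) \<noteq> T (i', j)) \<and>
     (\<forall>i j j'. j < j' \<and> (i, j) \<in> diagram lam \<and> (i, j') \<in> diagram lam \<longrightarrow>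
        (T (i, j), T (i, j')) \<in> r)"

definition std_pair :: "nat \<Rightarrow> (nat \<times> nat) set \<Rightarrow> nat set \<Rightarrow> nat set \<Rightarrow> bool" where
  "std_pair m r I1 I2 \<longleftrightarrow> (\<forall>j<m.
     card {i \<in> I1. (i, j) \<in> r} + card {i \<in> I2. (i, j) \<in> r} \<le> card {i \<in> {..<m}. (i, j) \<in> r})"

definition first_col :: "nat list \<Rightarrow> tableau \<Rightarrow> nat set" where
  "first_col lam T = {T (i, 0) | i. (i, 0) \<in> diagram lam}"

definition std_rat_tableaux :: "nat \<Rightarrow> (nat \<times> nat) set \<Rightarrow> shape \<Rightarrow> rat_tableau set" where
  "std_rat_tableaux m r = (\<lambda>(l1, l2). {(T1, T2) \<in> rat_tableaux m (l1, l2).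
     std_tableau r l1 T1 \<and> std_tableau r l2 T2 \<and> std_pair m r (first_col l1 T1) (first_col l2 T2)})"

section \<open>Bideterminants\<close>

definition bidet_part ::
  "(nat \<Rightarrow> nat \<Rightarrow> zfrac) \<Rightarrow> nat list \<Rightarrow> tableau \<Rightarrow> tableau \<Rightarrow> zfrac" where
  "bidet_part z lam S T = (\<Prod>c\<in>snd ` diagram lam.
     det (mat (col_length lam c) (col_length lam c) (\<lambda>(a, b). z (S (a, c)) (T (b, c)))))"

definition bideterminant :: "nat \<Rightarrow> shape \<Rightarrow> rat_tableau \<Rightarrow> rat_tableau \<Rightarrow> zfrac" where
  "bideterminant m = (\<lambda>(l1, l2) (S1, S2) (T1, T2).
     bidet_part (x_fun m) l1 S1 T1 * bidet_part (y_fun m) l2 S2 T2)"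

definition nabla :: "nat \<Rightarrow> int list \<Rightarrow> zfrac set" where
  "nabla m lam = zmod.span {bideterminant m sh (canonical_tableau m sh) S | sh S.
     sh \<in> shapes_of m lam \<and> S \<in> rat_tableaux m sh}"

definition nabla_tilde :: "nat \<Rightarrow> int list \<Rightarrow> zfrac set" where
  "nabla_tilde m lam = zmod.span {bideterminant m sh S (canonical_tableau m sh) | sh S.
     sh \<in> shapes_of m lam \<and> S \<in> rat_tableaux m sh}"

text \<open>Pairs of (standard) rational tableaux of the same shape in \<open>\<pi>\<close>.  The shape is recorded
  explicitly because a map on the diagram, being totalised, need not determine its domain.\<close>

definition bitableaux :: "nat \<Rightarrow> int list set \<Rightarrow> (shape \<times> rat_tableau \<times> rat_tableau) set" where
  "bitableaux m \<pi> = {(sh, S, T). (\<exists>lam\<in>\<pi>. sh \<in> shapes_of m lam) \<and>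
     S \<in> rat_tableaux m sh \<and> T \<in> rat_tableaux m sh}"

definition std_bitableaux ::
  "nat \<Rightarrow> (nat \<times> nat) set \<Rightarrow> int list set \<Rightarrow> (shape \<times> rat_tableau \<times> rat_tableau) set" where
  "std_bitableaux m r \<pi> = {(sh, S, T). (\<exists>lam\<in>\<pi>. sh \<in> shapes_of m lam) \<and>
     S \<in> std_rat_tableaux m r sh \<and> T \<in> std_rat_tableaux m r sh}"

end

theory Submission
  imports Defs "HOL-Library.Countable_Set"
begin

text \<open>
  Up to sign and a power of the determinant, Jacobi's theorem on complementary minors turns every bideterminant
  of a rational shape into a product of minors of the generic matrix: the columns of the second tableau
  are replaced by their complements, and standardness of a rational tableau says exactly that the
  resulting column sets form a chain (\<open>det_power_bideterminant\<close>, \<open>std_rat_cols_chain\<close>).  A minor is in turn a maximal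
  minor of the generic matrix extended by an identity matrix, so the classical exchange relation straightens any product of
  minors into products along chains (\<open>minors_straightening\<close>); hence the standard bideterminants span
  the coordinate ring.

  Independence and all statements on submodules rest on one extraction result,
  \<open>extract_maximal_shape\<close>.  Evaluate a combination of standard bideterminants at a product of a matrix \<open>A\<close> and a
  generic matrix \<open>Y\<close> in fresh variables and expand by Cauchy-Binet.  The coefficient of a suitable monomial in \<open>Y\<close>
  singles out the bideterminants of one maximal shape with one fixed right tableau, with the right
  tableau replaced by the canonical one; these have pairwise different leading monomials, so the coefficient
  is not zero.  If \<open>A\<close> is generic, this gives independence, and in a submodule \<open>M\<close> it produces a nonzero
  element of \<open>M\<close> in the span of bideterminants with canonical right tableau, which is a vector of weight the
  maximal shape.  That is why a function in the truncation to \<open>\<pi>\<close> only involves shapes in \<open>\<pi>\<close>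
  (\<open>extract_from_submodule\<close>).  If \<open>A\<close> is the generic lower triangular matrix, then for a function that transforms by a character
  under \<open>A\<close> the coefficient is a multiple of a monomial in the diagonal entries; this forces
  the maximal shape to be the given weight and the left tableau to be canonical, so that such functions lie in
  \<open>nabla\<close> by induction (\<open>lower_covariant_nabla\<close>).  The statement for \<open>nabla_tilde\<close> follows by transposition.
  Conversely the span of the bideterminants with a fixed left tableau is a submodule, because the
  columns of a product of matrices expand multilinearly, and its dominant weights are bounded by its shape by a
  content argument (\<open>bideterminant_comodule\<close>, \<open>right_weight_dominated\<close>).

  These arguments take place over the field of fractions of the polynomial ring.  Identities pass
  from there to an arbitrary commutative ring because every pair of points with prescribed zero entries
  is the image of generic matrices under a homomorphism defined on a localisation
  (\<open>generic_pair\<close>); they pass back because the function field is countable, so that a copy of it lives on every infinite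
  type (\<open>ex_function_field_model\<close>).
\<close>

section \<open>Determinants, minors and the Cauchy-Binet formula\<close>

abbreviation lookup :: "('a \<Rightarrow>\<^sub>0 'b::zero) => 'a => 'b" where
 "lookup \<equiv> Poly_Mapping.lookup"

abbreviation keys :: "('a \<Rightarrow>\<^sub>0 'b::zero) => 'a set" where
 "keys \<equiv> Poly_Mapping.keys"

abbreviation single :: "'a => 'b => ('a \<Rightarrow>\<^sub>0 'b::zero)" where
 "single \<equiv> Poly_Mapping.single"

text \<open>
  Reordering rows or columns changes a determinant by a sign; equality up to sign absorbs it.
\<close>

definition sign_eq :: "'a::ab_group_add => 'a => bool" (infix "\<asymp>" 50) where
 "x \<asymp> y \<longleftrightarrow> x = y \<or> x = - y"

lemma sign_eq_refl [simp]: "x \<asymp> x"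
 by (simp add: sign_eq_def)

lemma sign_eq_sym: "x \<asymp> y ==> y \<asymp> x"
 by (auto simp: sign_eq_def)

lemma sign_eq_trans [trans]: "x \<asymp> y ==> y \<asymp> z ==> x \<asymp> z"
 by (auto simp: sign_eq_def)

lemma sign_eq_mult: "x \<asymp> y ==> u \<asymp> v ==> x * u \<asymp> y * (v::'a::comm_ring_1)"
 by (auto simp: sign_eq_def)

lemma sign_eq_0 [simp]: "0 \<asymp> y \<longleftrightarrow> y = 0" "y \<asymp> 0 \<longleftrightarrow> y = 0"
 by (auto simp: sign_eq_def)

lemma sign_eq_prod: "(!!i. i \<in> A ==> f i \<asymp> g i) ==> prod f A \<asymp> prod g (A::'i set)"
 for f g :: "'i => 'a::comm_ring_1"
 by (induction A rule: infinite_finite_induct) (auto intro: sign_eq_mult)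

lemma sign_eq_witness: "x \<asymp> y ==> \<exists>e::int. (e = 1 \<or> e = -1) & x = of_int e * (y::'a::comm_ring_1)"
 unfolding sign_eq_def by (metis mult_1 mult_minus1 of_int_1 of_int_minus)

abbreviation (input) enum_set :: "nat set => nat => nat" where
 "enum_set K a \<equiv> sorted_list_of_set K ! a"

lemma enum_set_bij: "finite K ==> bij_betw (enum_set K) {..<card K} K"
 by (metis bij_betw_nth distinct_sorted_list_of_set length_sorted_list_of_set set_sorted_list_of_set)

lemma enum_set_in: "finite K ==> a < card K ==> enum_set K a \<in> K"
 by (metis length_sorted_list_of_set nth_mem set_sorted_list_of_set)

lemma enum_set_lessThan [simp]: "a < p ==> enum_set {..<p} a = a"
 by (simp add: lessThan_atLeast0)

text \<open>
  The determinant of a list of rows, each a function of the column index, so that rows of different origin can be concatenated.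
\<close>

definition rdet :: "nat => (nat => 'a::comm_ring_1) list => 'a" where
 "rdet n ws = det (mat n n (%(i, j). (ws ! i) j))"

lemma rdet_cong:
 assumes "length ws = n" "length ws' = n" "!!i j. i < n ==> j < n ==> (ws ! i) j = (ws' ! i) j"
 shows "rdet n ws = rdet n ws'"
 unfolding rdet_def by (intro arg_cong[where f = det] eq_matI) (use assms in auto)

lemma rdet_permute:
 assumes "p permutes {0..<n}" "length ws = n" "length ws' = n" "!!i. i < n ==> ws' ! i = ws ! p i"
 shows "rdet n ws' = signof p * rdet n ws"
proof -
 have p: "p i < n" if "i < n" for i
  using permutes_in_image[OF assms(1), of i] that by auto
 have "rdet n ws' = det (mat n n (%(i, j). mat n n (%(i, j). (ws ! i) j) $$ (p i, j)))"
  unfolding rdet_def by (intro arg_cong[where f = det] eq_matI) (use assms p in auto)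
 also have "... = signof p * rdet n ws"
  unfolding rdet_def by (rule det_permute_rows) (use assms in auto)
 finally show ?thesis .
qed

lemma rdet_mset:
 assumes "length ws = n" "mset ws = mset ws'"
 shows "rdet n ws \<asymp> rdet n ws'"
proof -
 obtain p where p: "p permutes {..<length ws'}" "permute_list p ws' = ws"
  using mset_eq_permutation[OF assms(2)] by blast
 have len: "length ws' = n" using assms mset_eq_length by metis
 have "rdet n ws = signof p * rdet n ws'"
  by (rule rdet_permute)
   (use p len assms(1) in \<open>auto simp: atLeast0LessThan permute_list_nth\<close>)
 then show ?thesis
  by (auto simp: sign_eq_def sign_def)
qed

lemma rdet_repeat:
 assumes "length ws = n" "\<not> distinct ws"
 shows "rdet n ws = 0"
proof -
 obtain i j where ij: "i < n" "j < n" "i ~= j" "ws ! i = ws ! j"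
  using assms by (auto simp: distinct_conv_nth)
 show ?thesis unfolding rdet_def
  by (rule det_identical_rows[OF _ ij(3,1,2)]) (use ij in \<open>auto intro!: eq_vecI\<close>)
qed

lemma rdet_eq_Leibniz:
 "rdet n ws = (\<Sum>\<pi> | \<pi> permutes {0..<n}. signof \<pi> * (\<Prod>i = 0..<n. (ws ! i) (\<pi> i)))"
proof -
 have "\<pi> i < n" if "\<pi> permutes {0..<n}" "i < n" for \<pi> i
  using permutes_in_image[OF that(1), of i] that(2) by simp
 then show ?thesis
  unfolding rdet_def by (subst det_def'[of _ n]) (auto intro!: sum.cong prod.cong)
qed

lemma rdet_multilinear:
 fixes v w :: "nat => nat => 'a::comm_ring_1"
 assumes "p + length us = n"
 shows "rdet n (map (%a j. \<Sum>l<N. v a l * w l j) [0..<p] @ us) =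
  (\<Sum>f \<in> {..<p} \<rightarrow>\<^sub>E {..<N}. (\<Prod>a<p. v a (f a)) * rdet n (map (%a. w (f a)) [0..<p] @ us))"
proof -
 let ?L = "map (%a j. \<Sum>l<N. v a l * w l j) [0..<p] @ us"
 let ?F = "%f. map (%a. w (f a)) [0..<p] @ us"
 have split: "(\<Prod>i = 0..<n. h i) = (\<Prod>i<p. h i) * (\<Prod>i = p..<n. h i)" for h :: "nat => 'a"
  using assms prod.atLeastLessThan_concat[of 0 p n h] by (simp add: atLeast0LessThan)
 have "(\<Prod>i = 0..<n. (?L ! i) (\<pi> i)) =
   (\<Sum>f \<in> {..<p} \<rightarrow>\<^sub>E {..<N}. (\<Prod>a<p. v a (f a)) * (\<Prod>i = 0..<n. (?F f ! i) (\<pi> i)))" for \<pi>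
 proof -
  have "(\<Prod>i = 0..<n. (?L ! i) (\<pi> i)) =
    (\<Prod>i<p. \<Sum>l<N. v i l * w l (\<pi> i)) * (\<Prod>i = p..<n. (us ! (i - p)) (\<pi> i))"
   unfolding split by (intro arg_cong2[where f = "(*)"] prod.cong) (auto simp: nth_append)
  also have "(\<Prod>i<p. \<Sum>l<N. v i l * w l (\<pi> i)) =
    (\<Sum>f \<in> {..<p} \<rightarrow>\<^sub>E {..<N}. \<Prod>i<p. v i (f i) * w (f i) (\<pi> i))"
   by (rule prod_sum_PiE) auto
  also have "... * (\<Prod>i = p..<n. (us ! (i - p)) (\<pi> i)) = (\<Sum>f \<in> {..<p} \<rightarrow>\<^sub>E {..<N}.
    (\<Prod>a<p. v a (f a)) * ((\<Prod>a<p. w (f a) (\<pi> a)) * (\<Prod>i = p..<n. (us ! (i - p)) (\<pi> i))))"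
   by (simp add: sum_distrib_right prod.distrib mult.assoc)
  also have "... = (\<Sum>f \<in> {..<p} \<rightarrow>\<^sub>E {..<N}.
    (\<Prod>a<p. v a (f a)) * (\<Prod>i = 0..<n. (?F f ! i) (\<pi> i)))"
   unfolding split by (intro sum.cong arg_cong2[where f = "(*)"] prod.cong) (auto simp: nth_append)
  finally show ?thesis .
 qed
 then have "rdet n ?L = (\<Sum>\<pi> | \<pi> permutes {0..<n}. \<Sum>f \<in> {..<p} \<rightarrow>\<^sub>E {..<N}.
   (\<Prod>a<p. v a (f a)) * (signof \<pi> * (\<Prod>i = 0..<n. (?F f ! i) (\<pi> i))))"
  unfolding rdet_eq_Leibniz by (simp add: sum_distrib_left mult.left_commute)
 also have "... = (\<Sum>f \<in> {..<p} \<rightarrow>\<^sub>E {..<N}. (\<Prod>a<p. v a (f a)) * rdet n (?F f))"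
  unfolding rdet_eq_Leibniz by (subst sum.swap) (simp add: sum_distrib_left)
 finally show ?thesis .
qed

text \<open>
  Choice functions with image \<open>K\<close> are the permutations of the increasing enumeration of \<open>K\<close>; choice functions with smaller image repeat a row and contribute nothing to a multilinear expansion.
\<close>

lemma bij_betw_permutations_onto:
 assumes K: "finite K" "card K = p"
 shows "bij_betw (%\<pi>. \<lambda>a\<in>{..<p}. enum_set K (\<pi> a)) {\<pi>. \<pi> permutes {0..<p}}
  {f \<in> {..<p} \<rightarrow>\<^sub>E K. f ` {..<p} = K}"
proof (rule bij_betw_byWitness[where f' = "%f a. if a < p then the_inv_into {..<p} (enum_set K) (f a) else a"])
 have b: "bij_betw (enum_set K) {..<p} K" using enum_set_bij K by blast
 note inj = bij_betw_imp_inj_on[OF b]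
 have lt: "\<pi> a < p \<longleftrightarrow> a < p" if "\<pi> permutes {0..<p}" for \<pi> a
  using permutes_in_image[OF that, of a] by auto
 show "\<forall>\<pi>\<in>{\<pi>. \<pi> permutes {0..<p}}. (%a. if a < p then the_inv_into {..<p} (enum_set K)
   ((\<lambda>a\<in>{..<p}. enum_set K (\<pi> a)) a) else a) = \<pi>"
  using lt by (auto intro!: ext simp: the_inv_into_f_f[OF inj] permutes_not_in)
 show "\<forall>f\<in>{f \<in> {..<p} \<rightarrow>\<^sub>E K. f ` {..<p} = K}. (\<lambda>a\<in>{..<p}. enum_set K
   (if a < p then the_inv_into {..<p} (enum_set K) (f a) else a)) = f"
  using f_the_inv_into_f_bij_betw[OF b]
  by (auto intro!: ext simp: restrict_def PiE_def extensional_def)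
 show "(%\<pi>. \<lambda>a\<in>{..<p}. enum_set K (\<pi> a)) ` {\<pi>. \<pi> permutes {0..<p}} \<subseteq> {f \<in> {..<p} \<rightarrow>\<^sub>E K. f ` {..<p} = K}"
 proof (rule image_subsetI)
  fix \<pi> assume "\<pi> \<in> {\<pi>. \<pi> permutes {0..<p}}"
  then have \<pi>: "\<pi> permutes {0..<p}" by simp
  have im: "\<pi> ` {..<p} = {..<p}" using permutes_image[OF \<pi>] by (simp add: atLeast0LessThan)
  have "(\<lambda>a\<in>{..<p}. enum_set K (\<pi> a)) ` {..<p} = enum_set K ` (\<pi> ` {..<p})" by auto
  also have "... = K" using bij_betw_imp_surj_on[OF b] im by simp
  finally show "(\<lambda>a\<in>{..<p}. enum_set K (\<pi> a)) \<in> {f \<in> {..<p} \<rightarrow>\<^sub>E K. f ` {..<p} = K}"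
   by auto
 qed
 show "(%f a. if a < p then the_inv_into {..<p} (enum_set K) (f a) else a) ` {f \<in> {..<p} \<rightarrow>\<^sub>E K. f ` {..<p} = K}
   \<subseteq> {\<pi>. \<pi> permutes {0..<p}}"
 proof (rule image_subsetI)
  fix f assume "f \<in> {f \<in> {..<p} \<rightarrow>\<^sub>E K. f ` {..<p} = K}"
  then have f: "f \<in> {..<p} \<rightarrow>\<^sub>E K" "K = f ` {..<p}" by auto
  have "inj_on f {..<p}" using K f(2) by (intro eq_card_imp_inj_on) auto
  then have "bij_betw f {..<p} K" using f(2) by (simp add: bij_betw_def)
  then have "bij_betw (the_inv_into {..<p} (enum_set K) \<circ> f) {..<p} {..<p}"
   using bij_betw_the_inv_into[OF b] bij_betw_trans by blast
  then have "bij_betw (%a. if a < p then the_inv_into {..<p} (enum_set K) (f a) else a) {0..<p} {0..<p}"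
   by (subst bij_betw_cong[where g = "the_inv_into {..<p} (enum_set K) \<circ> f"])
    (auto simp: atLeast0LessThan)
  then have "(%a. if a < p then the_inv_into {..<p} (enum_set K) (f a) else a) permutes {0..<p}"
   by (rule bij_imp_permutes) auto
  then show "(%a. if a < p then the_inv_into {..<p} (enum_set K) (f a) else a) \<in> {\<pi>. \<pi> permutes {0..<p}}"
   by simp
 qed
qed

definition minor :: "(nat => nat => 'a::comm_ring_1) => nat set => nat set => 'a" where
 "minor z I J = det (mat (card I) (card I) (%(a, b). z (enum_set I a) (enum_set J b)))"

lemma minor_eq_rdet: "minor z I J = rdet (card I) (map (%i b. z i (enum_set J b)) (sorted_list_of_set I))"
 unfolding minor_def rdet_def by (intro arg_cong[where f = det] eq_matI) auto

text \<open>
  Laplace expansion of the first \<open>p\<close> rows: the choice functions in the multilinear expansion are grouped by their image.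
\<close>

lemma rdet_expand:
 fixes v w :: "nat => nat => 'a::comm_ring_1"
 assumes "p + length us = n"
 shows "rdet n (map (%a j. \<Sum>l<N. v a l * w l j) [0..<p] @ us) =
  (\<Sum>K | K \<subseteq> {..<N} & card K = p. minor v {..<p} K * rdet n (map w (sorted_list_of_set K) @ us))"
proof -
 let ?F = "%f. map (%a. w (f a)) [0..<p] @ us"
 let ?h = "%f. (\<Prod>a<p. v a (f a)) * rdet n (?F f)"
 let ?S = "{f \<in> {..<p} \<rightarrow>\<^sub>E {..<N}. inj_on f {..<p}}"
 have fin: "finite ({..<p} \<rightarrow>\<^sub>E {..<N})" by (simp add: finite_PiE)
 have "rdet n (map (%a j. \<Sum>l<N. v a l * w l j) [0..<p] @ us) = sum ?h ({..<p} \<rightarrow>\<^sub>E {..<N})"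
  by (rule rdet_multilinear[OF assms])
 also have "... = sum ?h ?S"
 proof (rule sum.mono_neutral_right[OF fin])
  show "\<forall>f\<in>({..<p} \<rightarrow>\<^sub>E {..<N}) - ?S. ?h f = 0"
  proof
   fix f assume "f \<in> ({..<p} \<rightarrow>\<^sub>E {..<N}) - ?S"
   then have "\<not> inj_on f {..<p}" by auto
   then obtain a b where "a < p" "b < p" "a ~= b" "f a = f b" by (auto simp: inj_on_def)
   then have "map (%a. w (f a)) [0..<p] ! a = map (%a. w (f a)) [0..<p] ! b"
    "a < length (map (%a. w (f a)) [0..<p])" "b < length (map (%a. w (f a)) [0..<p])" "a ~= b"
    by simp_all
   then have "\<not> distinct (map (%a. w (f a)) [0..<p])"
    using nth_eq_iff_index_eq by blast
   then have "rdet n (?F f) = 0"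
    using assms by (intro rdet_repeat) auto
   then show "?h f = 0" by simp
  qed
 qed auto
 also have "... = (\<Sum>K | K \<subseteq> {..<N} & card K = p. sum ?h {f \<in> ?S. f ` {..<p} = K})"
 proof (rule sum.group[symmetric])
  show "finite ?S" using fin by simp
  show "finite {K. K \<subseteq> {..<N} & card K = p}" by simp
  show "(%f. f ` {..<p}) ` ?S \<subseteq> {K. K \<subseteq> {..<N} & card K = p}"
  proof (rule image_subsetI)
   fix f assume f: "f \<in> ?S"
   then have "card (f ` {..<p}) = card {..<p}" by (intro card_image) simp
   then show "f ` {..<p} \<in> {K. K \<subseteq> {..<N} & card K = p}" using f by auto
  qed
 qed
 also have "... = (\<Sum>K | K \<subseteq> {..<N} & card K = p.
   minor v {..<p} K * rdet n (map w (sorted_list_of_set K) @ us))"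
 proof (rule sum.cong[OF refl])
  fix K assume "K \<in> {K. K \<subseteq> {..<N} & card K = p}"
  then have K: "K \<subseteq> {..<N}" "card K = p" "finite K" by (auto intro: finite_subset)
  have eq: "{f \<in> ?S. f ` {..<p} = K} = {f \<in> {..<p} \<rightarrow>\<^sub>E K. f ` {..<p} = K}"
   using K by (auto simp: PiE_def Pi_def intro!: eq_card_imp_inj_on)
  have sgn: "rdet n (?F (\<lambda>a\<in>{..<p}. enum_set K (\<pi> a))) =
    signof \<pi> * rdet n (map w (sorted_list_of_set K) @ us)" if \<pi>: "\<pi> permutes {0..<p}" for \<pi>
  proof (rule rdet_permute)
   show "\<pi> permutes {0..<n}" using \<pi> assms by (auto intro: permutes_subset)
   have lt: "\<pi> i < p \<longleftrightarrow> i < p" for i using permutes_in_image[OF \<pi>, of i] by auto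
   show "?F (\<lambda>a\<in>{..<p}. enum_set K (\<pi> a)) ! i = (map w (sorted_list_of_set K) @ us) ! \<pi> i"
    if "i < n" for i
    using lt[of i] K permutes_not_in[OF \<pi>, of i] by (auto simp: nth_append)
  qed (use assms K in auto)
  have "sum ?h {f \<in> ?S. f ` {..<p} = K} =
    (\<Sum>\<pi> | \<pi> permutes {0..<p}. ?h (\<lambda>a\<in>{..<p}. enum_set K (\<pi> a)))"
   unfolding eq by (rule sum.reindex_bij_betw[symmetric, OF bij_betw_permutations_onto[OF K(3,2)]])
  also have "... = (\<Sum>\<pi> | \<pi> permutes {0..<p}. (signof \<pi> * (\<Prod>a = 0..<p. v a (enum_set K (\<pi> a)))) *
    rdet n (map w (sorted_list_of_set K) @ us))"
   by (rule sum.cong[OF refl], subst sgn) (auto simp: atLeast0LessThan mult_ac)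
  also have "... = minor v {..<p} K * rdet n (map w (sorted_list_of_set K) @ us)"
  proof -
   have "minor v {..<p} K = (\<Sum>\<pi> | \<pi> permutes {0..<p}. signof \<pi> * (\<Prod>a = 0..<p. v a (enum_set K (\<pi> a))))"
    unfolding minor_eq_rdet rdet_eq_Leibniz by (auto intro!: sum.cong prod.cong)
   then show ?thesis by (simp add: sum_distrib_right)
  qed
  finally show "sum ?h {f \<in> ?S. f ` {..<p} = K} =
   minor v {..<p} K * rdet n (map w (sorted_list_of_set K) @ us)" .
 qed
 finally show ?thesis .
qed

lemma minor_cong:
 assumes "finite I" "finite J" "card J = card I" "!!i j. i \<in> I ==> j \<in> J ==> z i j = z' i j"
 shows "minor z I J = minor z' I J"
 unfolding minor_def
 by (intro arg_cong[where f = det] eq_matI) (use assms in \<open>auto simp: enum_set_in\<close>)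

lemma minor_transpose:
 assumes "card J = card I"
 shows "minor (%i j. z j i) J I = minor z I J"
proof -
 have "minor z I J = det (transpose_mat (mat (card I) (card I) (%(a, b). z (enum_set I a) (enum_set J b))))"
  unfolding minor_def by (rule det_transpose[symmetric]) auto
 also have "transpose_mat (mat (card I) (card I) (%(a, b). z (enum_set I a) (enum_set J b))) =
   mat (card J) (card J) (%(a, b). z (enum_set I b) (enum_set J a))"
  using assms by (intro eq_matI) auto
 finally show ?thesis unfolding minor_def by simp
qed

lemma Cauchy_Binet:
 "minor (%i j. \<Sum>l<N. z i l * z' l j) I J =
  (\<Sum>K | K \<subseteq> {..<N} & card K = card I. minor z I K * minor z' K J)"
proof -
 let ?k = "card I"
 have "minor (%i j. \<Sum>l<N. z i l * z' l j) I J =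
   rdet ?k (map (%a b. \<Sum>l<N. z (enum_set I a) l * z' l (enum_set J b)) [0..<?k] @ [])"
  unfolding minor_def rdet_def by (intro arg_cong[where f = det] eq_matI) auto
 also have "... = (\<Sum>K | K \<subseteq> {..<N} & card K = ?k. minor (%a. z (enum_set I a)) {..<?k} K *
   rdet ?k (map (%l b. z' l (enum_set J b)) (sorted_list_of_set K) @ []))"
  by (rule rdet_expand) simp
 also have "... = (\<Sum>K | K \<subseteq> {..<N} & card K = card I. minor z I K * minor z' K J)"
 proof (rule sum.cong[OF refl])
  fix K assume "K \<in> {K. K \<subseteq> {..<N} & card K = ?k}"
  then have "card K = ?k" by simp
  then show "minor (%a. z (enum_set I a)) {..<?k} K *
    rdet ?k (map (%l b. z' l (enum_set J b)) (sorted_list_of_set K) @ []) = minor z I K * minor z' K J"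
   by (simp add: minor_eq_rdet rdet_def)
    (auto intro!: arg_cong2[where f = "(*)"] arg_cong[where f = det] eq_matI)
 qed
 finally show ?thesis .
qed

section \<open>Complementary minors\<close>

text \<open>
  If the remaining rows are themselves rows of \<open>u\<close>, only the complementary set of indices survives in the expansion; the other terms repeat a row.
\<close>

lemma rdet_expand_complement:
 fixes v u :: "nat => nat => 'a::comm_ring_1"
 assumes zs: "distinct zs" "set zs \<subseteq> {..<n}" "p + length zs = n"
 shows "rdet n (map (%a j. \<Sum>l<n. v a l * u l j) [0..<p] @ map u zs) \<asymp>
  minor v {..<p} ({..<n} - set zs) * rdet n (map u [0..<n])"
proof -
 define K0 where "K0 = {..<n} - set zs"
 have card: "card K0 = p"
  unfolding K0_def using zs distinct_card[OF zs(1)] by (subst card_Diff_subset) auto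
 have "rdet n (map (%a j. \<Sum>l<n. v a l * u l j) [0..<p] @ map u zs) =
   (\<Sum>K | K \<subseteq> {..<n} & card K = p. minor v {..<p} K * rdet n (map u (sorted_list_of_set K) @ map u zs))"
  by (rule rdet_expand) (use zs in simp)
 also have "... = (\<Sum>K\<in>{K0}. minor v {..<p} K * rdet n (map u (sorted_list_of_set K) @ map u zs))"
 proof (rule sum.mono_neutral_right)
  show "finite {K. K \<subseteq> {..<n} & card K = p}" by simp
  show "{K0} \<subseteq> {K. K \<subseteq> {..<n} & card K = p}" using card by (auto simp: K0_def)
  show "\<forall>K\<in>{K. K \<subseteq> {..<n} & card K = p} - {K0}.
    minor v {..<p} K * rdet n (map u (sorted_list_of_set K) @ map u zs) = 0"
  proof
   fix K assume "K \<in> {K. K \<subseteq> {..<n} & card K = p} - {K0}"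
   then have K: "K \<subseteq> {..<n}" "card K = p" "K ~= K0" by auto
   have fK: "finite K" using K(1) finite_subset by blast
   have "\<not> K \<subseteq> K0"
    using K card by (metis card_subset_eq finite_Diff finite_lessThan K0_def)
   then obtain x where "x \<in> K" "x \<in> set zs" using K by (auto simp: K0_def)
   then have "u x \<in> set (map u (sorted_list_of_set K)) \<inter> set (map u zs)"
    using fK by simp
   then have "\<not> distinct (map u (sorted_list_of_set K) @ map u zs)" by auto
   then show "minor v {..<p} K * rdet n (map u (sorted_list_of_set K) @ map u zs) = 0"
    using K zs fK by (subst rdet_repeat) auto
  qed
 qed
 also have "... = minor v {..<p} K0 * rdet n (map u (sorted_list_of_set K0 @ zs))" by simp
 also have "... \<asymp> minor v {..<p} K0 * rdet n (map u [0..<n])"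
 proof (rule sign_eq_mult[OF sign_eq_refl], rule rdet_mset)
  have "mset (sorted_list_of_set K0 @ zs) = mset [0..<n]"
   by (rule iffD1[OF set_eq_iff_mset_eq_distinct]) (use zs in \<open>auto simp: K0_def\<close>)
  then show "mset (map u (sorted_list_of_set K0 @ zs)) = mset (map u [0..<n])" by (metis mset_map)
 qed (use zs card in \<open>auto simp: K0_def\<close>)
 finally show ?thesis by (simp add: K0_def)
qed

abbreviation (input) unit_row :: "nat => nat => 'a::comm_ring_1" where
 "unit_row i \<equiv> %k. if k = i then 1 else 0"

abbreviation (input) column :: "(nat => nat => 'a) => nat => nat => 'a" where
 "column z j \<equiv> %i. z i j"

lemma rdet_unit_rows: "rdet n (map unit_row [0..<n]) = (1::'a::comm_ring_1)"
proof -
 have "mat n n (%(i, j). (map unit_row [0..<n] ! i) j) = (1\<^sub>m n :: 'a mat)"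
  by (intro eq_matI) auto
 then show ?thesis by (simp add: rdet_def)
qed

lemma minor_enum_rows:
 assumes "finite I" "card J = card I"
 shows "minor (%a. z (enum_set I a)) {..<card I} J = minor z I J"
 unfolding minor_def using assms by (intro arg_cong[where f = det] eq_matI) auto

text \<open>
  Rows of the identity matrix at the indices outside \<open>I\<close> strike out those coordinates. This is how a minor of any size becomes a determinant of full size.
\<close>

lemma minor_as_bracket:
 fixes z :: "nat => nat => 'a::comm_ring_1"
 assumes "I \<subseteq> {..<n}" "J \<subseteq> {..<n}" "card J = card I"
 shows "rdet n (map (column z) (sorted_list_of_set J) @ map unit_row (sorted_list_of_set ({..<n} - I))) \<asymp> minor z I J"
proof -
 have fin: "finite I" "finite J" using finite_subset[OF assms(1)] finite_subset[OF assms(2)] by simp_all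
 have len: "card J + (n - card I) = n" using assms card_mono[of "{..<n}" I] by auto
 let ?zs = "sorted_list_of_set ({..<n} - I)"
 have "rdet n (map (column z) (sorted_list_of_set J) @ map unit_row ?zs) =
  rdet n (map (%a j. \<Sum>l<n. column z (enum_set J a) l * unit_row l j) [0..<card J] @ map unit_row ?zs)"
  by (rule rdet_cong) (use fin len assms in \<open>auto simp: nth_append card_Diff_subset
   if_distrib cong: if_cong\<close>)
 also have "... \<asymp> minor (%a. column z (enum_set J a)) {..<card J} ({..<n} - set ?zs) *
   rdet n (map unit_row [0..<n])"
  by (rule rdet_expand_complement) (use fin len in \<open>auto simp: card_Diff_subset assms\<close>)
 also have "{..<n} - set ?zs = I" using assms by auto
 also have "minor (%a. column z (enum_set J a)) {..<card J} I = minor (%j i. z i j) J I"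
  by (rule minor_enum_rows) (use fin assms in auto)
 also have "... = minor z I J" using minor_transpose assms by metis
 finally show ?thesis by (simp add: rdet_unit_rows)
qed

text \<open>
  Jacobi: multiply the full-size determinant representing a minor of the inverse by the matrix itself; rows of the inverse become unit rows and unit rows become rows of the matrix.
\<close>

lemma Jacobi_complementary_minor:
 fixes z y :: "nat => nat => 'a::comm_ring_1"
 assumes "I \<subseteq> {..<n}" "J \<subseteq> {..<n}" "card J = card I"
  and inv: "!!i k. i < n ==> k < n ==> (\<Sum>j<n. z i j * y k j) = (if i = k then 1 else 0)"
 shows "det (mat n n (%(i, j). z i j)) * minor y I J \<asymp> minor z ({..<n} - I) ({..<n} - J)"
proof -
 have fin: "finite I" "finite J" using finite_subset[OF assms(1)] finite_subset[OF assms(2)] by simp_all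
 let ?I = "sorted_list_of_set I" and ?J = "sorted_list_of_set ({..<n} - J)"
 have cI: "card I \<le> n" using card_mono[of "{..<n}" I] assms by auto
 have len: "card I + length ?J = n" using assms fin cI by (simp add: card_Diff_subset)
 have "rdet n (map (column z) ?J @ map unit_row (sorted_list_of_set ({..<n} - ({..<n} - I)))) \<asymp>
   minor z ({..<n} - I) ({..<n} - J)"
  by (rule minor_as_bracket) (use assms fin in \<open>auto simp: card_Diff_subset\<close>)
 also have "{..<n} - ({..<n} - I) = I" using assms by auto
 finally have 1: "rdet n (map (column z) ?J @ map unit_row ?I) \<asymp> minor z ({..<n} - I) ({..<n} - J)" .
 have "rdet n (map unit_row ?I @ map (column z) ?J) =
   rdet n (map (%a i. \<Sum>l<n. y (enum_set I a) l * column z l i) [0..<card I] @ map (column z) ?J)"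
 proof (rule rdet_cong)
  fix i j assume "i < n" "j < n"
  then show "((map unit_row ?I @ map (column z) ?J) ! i) j =
   ((map (%a i. \<Sum>l<n. y (enum_set I a) l * column z l i) [0..<card I] @ map (column z) ?J) ! i) j"
   using inv[of j "enum_set I i"] enum_set_in[of I i] fin assms(1)
   by (auto simp: nth_append mult.commute)
 qed (use len in auto)
 also have "... \<asymp> minor (%a. y (enum_set I a)) {..<card I} ({..<n} - set ?J) * rdet n (map (column z) [0..<n])"
  by (rule rdet_expand_complement) (use len in auto)
 also have "{..<n} - set ?J = J" using assms by auto
 also have "minor (%a. y (enum_set I a)) {..<card I} J = minor y I J"
  by (rule minor_enum_rows) (use fin assms in auto)
 also have "rdet n (map (column z) [0..<n]) = det (mat n n (%(i, j). z i j))"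
  unfolding rdet_def
  by (subst det_transpose[symmetric, of _ n]) (auto intro!: arg_cong[where f = det] eq_matI)
 finally have 2: "rdet n (map unit_row ?I @ map (column z) ?J) \<asymp> minor y I J * det (mat n n (%(i, j). z i j))" .
 have 3: "rdet n (map (column z) ?J @ map unit_row ?I) \<asymp> rdet n (map unit_row ?I @ map (column z) ?J)"
 proof (rule rdet_mset)
  show "length (map (column z) ?J @ map unit_row ?I) = n" using len by simp
  show "mset (map (column z) ?J @ map unit_row ?I) = mset (map unit_row ?I @ map (column z) ?J)"
   unfolding mset_append by (rule union_commute)
 qed
 show ?thesis
  using sign_eq_trans[OF sign_eq_trans[OF sign_eq_sym[OF 2] sign_eq_sym[OF 3]] 1] by (simp add: mult.commute)
qed

definition bracket_of :: "nat => (nat => nat => 'a::comm_ring_1) => nat set => 'a" where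
 "bracket_of n u C = rdet n (map u (sorted_list_of_set C))"

lemma rdet_eq_bracket_of:
 assumes "distinct xs" "set xs = C" "length xs = n"
 shows "rdet n (map u xs) \<asymp> bracket_of n u C"
 unfolding bracket_of_def
proof (rule rdet_mset)
 have "mset xs = mset (sorted_list_of_set C)"
  by (rule iffD1[OF set_eq_iff_mset_eq_distinct]) (use assms in auto)
 then show "mset (map u xs) = mset (map u (sorted_list_of_set C))" by (metis mset_map)
qed (use assms in auto)

section \<open>Straightening products of minors\<close>

lemma index_mult_mat_sum:
 assumes "A \<in> carrier_mat n k" "B \<in> carrier_mat k p" "i < n" "j < p"
 shows "(A * B) $$ (i, j) = (\<Sum>l<k. A $$ (i, l) * B $$ (l, j))"
 using assms by (auto simp: scalar_prod_def atLeast0LessThan)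

text \<open>
  The exchange relation of Pluecker: write the columns in \<open>P\<close> as combinations of the columns in \<open>C\<close> by Cramer and expand. The cross terms that repeat a column vanish.
\<close>

lemma bracket_exchange:
 fixes u :: "nat => nat => 'a::field"
 assumes C: "finite C" "card C = n" and C': "finite C'" "card C' = n" and P: "P \<subseteq> C'"
 shows "\<exists>g. bracket_of n u C * bracket_of n u C' = (\<Sum>K | K \<subseteq> C & card K = card P. g K) &
  (\<forall>K. K \<subseteq> C & card K = card P --> g K = 0 \<or> (C - K) \<inter> P = {} & (C' - P) \<inter> K = {} &
   g K \<asymp> bracket_of n u ((C - K) \<union> P) * bracket_of n u ((C' - P) \<union> K))"
proof (cases "bracket_of n u C = 0")
 case True
 then show ?thesis by (intro exI[of _ "%_. 0"]) simp
next
 case False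
 define p where "p = card P"
 define A where "A = mat n n (%(i, j). (map u (sorted_list_of_set C) ! i) j)"
 have A: "A \<in> carrier_mat n n" "det A ~= 0"
  using False by (auto simp: A_def bracket_of_def rdet_def)
 define B where "B = inverse (det A) \<cdot>\<^sub>m adj_mat A"
 have B: "B \<in> carrier_mat n n" "B * A = 1\<^sub>m n"
 proof -
  show "B \<in> carrier_mat n n" using adj_mat(1)[OF A(1)] by (simp add: B_def)
  have "B * A = inverse (det A) \<cdot>\<^sub>m (adj_mat A * A)"
   unfolding B_def by (rule mult_smult_assoc_mat[OF adj_mat(1)[OF A(1)] A(1)])
  also have "... = 1\<^sub>m n"
   unfolding adj_mat(3)[OF A(1)] by (rule eq_matI) (use A(2) in auto)
  finally show "B * A = 1\<^sub>m n" .
 qed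
 define c where "c x l = (\<Sum>j<n. u x j * B $$ (j, l))" for x l
 have finP: "finite P" using P C' finite_subset by blast
 have pn: "p \<le> n" using card_mono[OF C'(1) P] C' by (simp add: p_def)
 have coord: "u x j = (\<Sum>l<n. c x l * u (enum_set C l) j)" if "j < n" for x j
 proof -
  have "(\<Sum>l<n. c x l * u (enum_set C l) j) = (\<Sum>l<n. \<Sum>i<n. u x i * (B $$ (i, l) * A $$ (l, j)))"
   using that C by (intro sum.cong) (auto simp: c_def A_def sum_distrib_right mult.assoc)
  also have "... = (\<Sum>i<n. u x i * (B * A) $$ (i, j))"
   by (subst sum.swap) (use that index_mult_mat_sum[OF B(1) A(1)] in \<open>auto intro!: sum.cong simp: sum_distrib_left\<close>)
  also have "... = (\<Sum>i<n. if i = j then u x i else 0)"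
   using B that by (intro sum.cong) auto
  finally show ?thesis using that by simp
 qed
 let ?e = "enum_set C"
 have bij: "bij_betw ?e {..<n} C" using enum_set_bij C by blast
 note inj = bij_betw_imp_inj_on[OF bij]
 let ?P = "sorted_list_of_set P" and ?Q = "sorted_list_of_set (C' - P)"
 have lenQ: "length ?Q = n - p" using C' finP P by (simp add: card_Diff_subset p_def)
 let ?M = "%K. minor (%a. c (enum_set P a)) {..<p} K"
 have rows: "rdet n (map u ?P @ us) = rdet n (map (%a j. \<Sum>l<n. c (enum_set P a) l * u (?e l) j) [0..<p] @ us)"
  if "length us = n - p" for us
  by (rule rdet_cong) (use that pn coord in \<open>auto simp: nth_append p_def\<close>)
 have "bracket_of n u C' \<asymp> rdet n (map u ?P @ map u ?Q)"
  using rdet_eq_bracket_of[of "?P @ ?Q" C' n u] C' P finP pn lenQ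
  by (auto intro: sign_eq_sym simp: p_def)
 also have "... = rdet n (map (%a j. \<Sum>l<n. c (enum_set P a) l * u (?e l) j) [0..<p] @ map u ?Q)"
  using rows lenQ by simp
 also have "... = (\<Sum>K' | K' \<subseteq> {..<n} & card K' = p. ?M K' *
   rdet n (map (%l. u (?e l)) (sorted_list_of_set K') @ map u ?Q))"
  by (rule rdet_expand) (use lenQ pn in auto)
 also have "... = (\<Sum>K | K \<subseteq> C & card K = p. ?M {l \<in> {..<n}. ?e l \<in> K} *
   rdet n (map (%l. u (?e l)) (sorted_list_of_set {l \<in> {..<n}. ?e l \<in> K}) @ map u ?Q))"
 proof (rule sum.reindex_bij_witness[where i = "%K. {l \<in> {..<n}. ?e l \<in> K}" and j = "%K'. ?e ` K'"])
  fix K assume K: "K \<in> {K. K \<subseteq> C & card K = p}"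
  show 1: "?e ` {l \<in> {..<n}. ?e l \<in> K} = K" using K bij_betw_imp_surj_on[OF bij] by (auto simp: image_iff)
  have "card (?e ` {l \<in> {..<n}. ?e l \<in> K}) = card {l \<in> {..<n}. ?e l \<in> K}"
   by (rule card_image) (rule inj_on_subset[OF inj], auto)
  then show "{l \<in> {..<n}. ?e l \<in> K} \<in> {K'. K' \<subseteq> {..<n} & card K' = p}" using 1 K by auto
 next
  fix K' assume K': "K' \<in> {K'. K' \<subseteq> {..<n} & card K' = p}"
  show 1: "{l \<in> {..<n}. ?e l \<in> ?e ` K'} = K'"
   using K' inj by (auto simp: inj_on_def)
  show "?e ` K' \<in> {K. K \<subseteq> C & card K = p}"
   using K' inj bij_betw_imp_surj_on[OF bij] by (auto simp: card_image inj_on_subset)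
  show "?M {l \<in> {..<n}. ?e l \<in> ?e ` K'} *
   rdet n (map (%l. u (?e l)) (sorted_list_of_set {l \<in> {..<n}. ?e l \<in> ?e ` K'}) @ map u ?Q) =
   ?M K' * rdet n (map (%l. u (?e l)) (sorted_list_of_set K') @ map u ?Q)"
   unfolding 1 ..
 qed
 finally obtain s :: int where s: "s = 1 \<or> s = -1"
  "bracket_of n u C' = of_int s * (\<Sum>K | K \<subseteq> C & card K = p. ?M {l \<in> {..<n}. ?e l \<in> K} *
   rdet n (map (%l. u (?e l)) (sorted_list_of_set {l \<in> {..<n}. ?e l \<in> K}) @ map u ?Q))"
  using sign_eq_witness by blast
 define g where "g K = bracket_of n u C * (of_int s * (?M {l \<in> {..<n}. ?e l \<in> K} *
   rdet n (map (%l. u (?e l)) (sorted_list_of_set {l \<in> {..<n}. ?e l \<in> K}) @ map u ?Q)))" for K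
 have "g K = 0 \<or> (C - K) \<inter> P = {} & (C' - P) \<inter> K = {} &
   g K \<asymp> bracket_of n u ((C - K) \<union> P) * bracket_of n u ((C' - P) \<union> K)"
  if K: "K \<subseteq> C" "card K = p" for K
 proof -
  have finK: "finite K" using K C finite_subset by blast
  define K' where "K' = {l \<in> {..<n}. ?e l \<in> K}"
  have K'im: "?e ` K' = K" using K bij_betw_imp_surj_on[OF bij] by (auto simp: K'_def image_iff)
  have K'sub: "K' \<subseteq> {..<n}" by (auto simp: K'_def)
  have K'c: "card K' = p" using card_image[OF inj_on_subset[OF inj K'sub]] K'im K by simp
  define zs where "zs = sorted_list_of_set ({..<n} - K')"
  have zs: "distinct zs" "set zs = {..<n} - K'" "length zs = n - p"
   using K'sub K'c by (auto simp: zs_def card_Diff_subset finite_subset)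
  have im: "?e ` ({..<n} - K') = C - K"
   using inj_on_image_set_diff[OF inj, of "{..<n}" K'] K'sub K'im bij_betw_imp_surj_on[OF bij] by auto
  have xs: "distinct (map ?e zs)" "set (map ?e zs) = C - K" "length (map ?e zs) = n - p"
   using zs im inj by (auto simp: distinct_map inj_on_subset)
  have ys: "distinct (map ?e (sorted_list_of_set K'))" "set (map ?e (sorted_list_of_set K')) = K"
   "length (map ?e (sorted_list_of_set K')) = p"
   using K'im K'c inj_on_subset[OF inj K'sub] finite_subset[OF K'sub] by (auto simp: distinct_map)
  have "rdet n (map u ?P @ map (%l. u (?e l)) zs) \<asymp> ?M ({..<n} - set zs) * rdet n (map (%l. u (?e l)) [0..<n])"
   using rdet_expand_complement[of zs n p "%a. c (enum_set P a)" "%l. u (?e l)"] zs pn rows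
   by auto
  also have "{..<n} - set zs = K'" using zs K'sub by auto
  also have "map (%l. u (?e l)) [0..<n] = map u (sorted_list_of_set C)"
   using C by (intro nth_equalityI) auto
  finally have 1: "rdet n (map u (?P @ map ?e zs)) \<asymp> ?M K' * bracket_of n u C"
   by (simp add: bracket_of_def comp_def)
  have gK: "g K = of_int s * (?M K' * bracket_of n u C * rdet n (map u (map ?e (sorted_list_of_set K') @ ?Q)))"
   by (simp add: g_def K'_def comp_def mult_ac)
  also have "... \<asymp> 1 * (rdet n (map u (?P @ map ?e zs)) * rdet n (map u (map ?e (sorted_list_of_set K') @ ?Q)))"
   by (intro sign_eq_mult sign_eq_refl sign_eq_sym[OF 1]) (use s in \<open>auto simp: sign_eq_def\<close>)
  finally have 2: "g K \<asymp> rdet n (map u (?P @ map ?e zs)) * rdet n (map u (map ?e (sorted_list_of_set K') @ ?Q))"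
   by simp
  show ?thesis
  proof (cases "(C - K) \<inter> P = {} & (C' - P) \<inter> K = {}")
   case True
   have a: "rdet n (map u (?P @ map ?e zs)) \<asymp> bracket_of n u ((C - K) \<union> P)"
    by (rule rdet_eq_bracket_of) (use xs True finP pn p_def in auto)
   have b: "rdet n (map u (map ?e (sorted_list_of_set K') @ ?Q)) \<asymp> bracket_of n u ((C' - P) \<union> K)"
    by (rule rdet_eq_bracket_of) (use ys True lenQ C' pn in auto)
   show ?thesis using sign_eq_trans[OF 2 sign_eq_mult[OF a b]] True by blast
  next
   case False
   have di: "distinct (map u xs) ==> distinct xs" for xs by (simp add: distinct_map)
   have "\<not> distinct (?P @ map ?e zs) \<or> \<not> distinct (map ?e (sorted_list_of_set K') @ ?Q)"
    using False xs ys finP C' by auto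
   then have "\<not> distinct (map u (?P @ map ?e zs)) \<or> \<not> distinct (map u (map ?e (sorted_list_of_set K') @ ?Q))"
    using di by blast
   moreover have "length (map u (?P @ map ?e zs)) = n" "length (map u (map ?e (sorted_list_of_set K') @ ?Q)) = n"
    using xs ys finP pn lenQ by (auto simp: p_def)
   ultimately have "rdet n (map u (?P @ map ?e zs)) = 0 \<or>
     rdet n (map u (map ?e (sorted_list_of_set K') @ ?Q)) = 0"
    using rdet_repeat by blast
   then show ?thesis using 2 by auto
  qed
 qed
 moreover have "bracket_of n u C * bracket_of n u C' = (\<Sum>K | K \<subseteq> C & card K = p. g K)"
  unfolding s(2) g_def by (simp add: sum_distrib_left)
 ultimately show ?thesis unfolding p_def by blast
qed

definition card_below :: "nat set => nat => nat" where
 "card_below C s = card {x \<in> C. x < s}"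

definition chain_le :: "nat set => nat set => bool" where
 "chain_le C C' \<longleftrightarrow> (\<forall>s. card_below C' s \<le> card_below C s)"

text \<open>
  Reading a set as a binary number orders sets lexicographically from the top element.
\<close>

definition binary_weight :: "nat set => nat" where
 "binary_weight C = (\<Sum>x\<in>C. 2 ^ x)"

lemma binary_weight_less:
 assumes "C \<subseteq> {..<s}"
 shows "binary_weight C < 2 ^ s"
proof -
 have "binary_weight C \<le> (\<Sum>x<s. 2 ^ x)"
  unfolding binary_weight_def by (rule sum_mono2) (use assms in auto)
 also have "... = 2 ^ s - 1" by (simp add: lessThan_atLeast0 mask_eq_sum_exp_nat[symmetric] sum_power2)
 also have "... < (2::nat) ^ s" by simp
 finally show ?thesis .
qed

lemma binary_weight_exchange:
 assumes "finite A" "K \<subseteq> A" "finite P" "(A - K) \<inter> P = {}"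
 shows "binary_weight ((A - K) \<union> P) + binary_weight K = binary_weight A + binary_weight P"
proof -
 have "binary_weight ((A - K) \<union> P) = binary_weight (A - K) + binary_weight P"
  unfolding binary_weight_def by (rule sum.union_disjoint) (use assms in auto)
 moreover have "binary_weight A = binary_weight (A - K) + binary_weight K"
  unfolding binary_weight_def using assms by (simp add: sum.subset_diff)
 ultimately show ?thesis by simp
qed

text \<open>
  An exchange at a violation of the chain condition preserves the sum of the two binary weights but moves them apart, so it increases the sum of squares; that sum is bounded, which gives the termination measure.
\<close>

lemma straightening:
 fixes u :: "nat => nat => zfrac"
 assumes "\<forall>C\<in>set Cs. C \<subseteq> {..<L} & card C = n"
 shows "prod_list (map (bracket_of n u) Cs) \<in> zmod.span {prod_list (map (bracket_of n u) Ds) | Ds.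
  length Ds = length Cs & (\<forall>D\<in>set Ds. D \<subseteq> {..<L} & card D = n) & sorted_wrt chain_le Ds}"
 using assms
proof (induction Cs rule: measure_induct_rule[where
   f = "%Cs. length Cs * 4 ^ L - (\<Sum>C\<leftarrow>Cs. binary_weight C ^ 2)"])
 case (less Cs)
 let ?w = binary_weight and ?b = "bracket_of n u"
 define G where "G k = {prod_list (map ?b Ds) | Ds.
  length Ds = k & (\<forall>D\<in>set Ds. D \<subseteq> {..<L} & card D = n) & sorted_wrt chain_le Ds}" for k
 have prod_mset: "prod_list (map ?b Xs) = prod_list (map ?b Ys)" if "mset Xs = mset Ys" for Xs Ys
  using that by (metis mset_map prod_mset_prod_list)
 have "prod_list (map ?b Cs) \<in> zmod.span (G (length Cs))"
 proof (cases "\<exists>A\<in>set Cs. \<exists>B\<in>set Cs. ?w A \<le> ?w B & \<not> chain_le A B")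
  case False
  have "sorted_wrt (%x y. ?w x \<le> ?w y) (sort_key ?w Cs)"
   using sorted_sort_key[of ?w Cs] by (simp add: sorted_map)
  then have "sorted_wrt chain_le (sort_key ?w Cs)"
   by (rule sorted_wrt_mono_rel[rotated]) (use False in auto)
  then have "prod_list (map ?b (sort_key ?w Cs)) \<in> G (length Cs)"
   unfolding G_def by (intro CollectI exI[of _ "sort_key ?w Cs"]) (use less.prems in auto)
  then show ?thesis
   using prod_mset[of "sort_key ?w Cs" Cs] zmod.span_base[of _ "G (length Cs)"] by simp
 next
  case True
  then obtain A B where AB: "A \<in> set Cs" "B \<in> set Cs" "?w A \<le> ?w B" "\<not> chain_le A B" by blast
  obtain s where s: "card_below A s < card_below B s"
   using AB(4) by (auto simp: chain_le_def not_le)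
  have "A ~= B" using s by auto
  define R where "R = remove1 B (remove1 A Cs)"
  have mset: "mset Cs = mset (A # B # R)"
  proof -
   have *: "mset Xs = add_mset X (mset (remove1 X Xs))" if "X \<in> set Xs" for X and Xs :: "nat set list"
    using that by simp
   have "B \<in> set (remove1 A Cs)" using AB \<open>A ~= B\<close> by simp
   from *[OF this, symmetric] *[OF AB(1), symmetric] show ?thesis
    by (simp only: R_def mset.simps)
  qed
  have len: "length Cs = length R + 2" using mset_eq_length[OF mset] by simp
  have setR: "set R \<subseteq> set Cs" 
   using set_remove1_subset[of B "remove1 A Cs"] set_remove1_subset[of A Cs] unfolding R_def by blast
  have A: "A \<subseteq> {..<L}" "card A = n" "finite A" and B: "B \<subseteq> {..<L}" "card B = n" "finite B"
   using less.prems AB(1,2) by (auto intro: finite_subset[of _ "{..<L}"])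
  define P where "P = {x \<in> B. x < s}"
  have P: "P \<subseteq> B" "finite P" "P \<subseteq> {..<s}" using B by (auto simp: P_def)
  obtain g where g': "?b A * ?b B = (\<Sum>K | K \<subseteq> A & card K = card P. g K) &
   (\<forall>K. K \<subseteq> A & card K = card P --> g K = 0 \<or> (A - K) \<inter> P = {} & (B - P) \<inter> K = {} &
    g K \<asymp> ?b ((A - K) \<union> P) * ?b ((B - P) \<union> K))"
   by (rule exE[OF bracket_exchange[OF A(3,2) B(3,2) P(1), of u]])
  note g = conjunct1[OF g'] mp[OF spec[OF conjunct2[OF g']], OF conjI]
  have "g K * prod_list (map ?b R) \<in> zmod.span (G (length Cs))" if K: "K \<subseteq> A" "card K = card P" for K
  proof (cases "g K = 0")
   case True
   then show ?thesis by (simp add: zmod.span_zero)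
  next
   case False
   have fK: "finite K" using K A finite_subset by blast
   define A' where "A' = (A - K) \<union> P"
   define B' where "B' = (B - P) \<union> K"
   have disj: "(A - K) \<inter> P = {}" "(B - P) \<inter> K = {}" and gK: "g K \<asymp> ?b A' * ?b B'"
    using g(2)[OF K] False by (auto simp: A'_def B'_def)
   have wA: "?w A' + ?w K = ?w A + ?w P"
    unfolding A'_def using binary_weight_exchange A K P disj by blast
   have wB: "?w B' + ?w P = ?w B + ?w K"
    unfolding B'_def using binary_weight_exchange[OF B(3) P(1) fK] disj by blast
   have "\<not> K \<subseteq> {x \<in> A. x < s}"
   proof
    assume "K \<subseteq> {x \<in> A. x < s}"
    then have "card K \<le> card_below A s" unfolding card_below_def using A by (intro card_mono) auto
    then show False using s K by (simp add: P_def card_below_def)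
   qed
   then obtain x where x: "x \<in> K" "s \<le> x" using K by force
   have "?w P < 2 ^ s" using P by (intro binary_weight_less)
   also have "(2::nat) ^ s \<le> 2 ^ x" using x by simp
   also have "... \<le> ?w K" unfolding binary_weight_def using x fK by (intro member_le_sum) auto
   finally obtain d where d: "?w K = ?w P + d" "d > 0" by (metis less_imp_add_positive)
   have a: "?w A = ?w A' + d" "?w B' = ?w B + d" using wA wB d by auto
   have "?w A' < ?w B" using a AB(3) d by simp
   then have "2 * (?w A' * d) < 2 * (?w B * d)" using d by simp
   then have sq: "?w A ^ 2 + ?w B ^ 2 < ?w A' ^ 2 + ?w B' ^ 2"
    unfolding a by (simp add: power2_sum mult_ac)
   have A': "A' \<subseteq> {..<L}" "card A' = n" and B': "B' \<subseteq> {..<L}" "card B' = n"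
   proof -
    show "A' \<subseteq> {..<L}" "B' \<subseteq> {..<L}" using A B K P by (auto simp: A'_def B'_def)
    have "card A' = card (A - K) + card P"
     unfolding A'_def using A P disj by (intro card_Un_disjoint) auto
    then show "card A' = n" using K A fK card_mono[OF A(3) K(1)] by (simp add: card_Diff_subset)
    have "card B' = card (B - P) + card K"
     unfolding B'_def using B fK disj by (intro card_Un_disjoint) auto
    then show "card B' = n" using K B P card_mono[OF B(3) P(1)] by (simp add: card_Diff_subset)
   qed
   let ?C' = "A' # B' # R"
   have prems': "\<forall>C\<in>set ?C'. C \<subseteq> {..<L} & card C = n" using A' B' setR less.prems by auto
   have bound: "(\<Sum>C\<leftarrow>Xs. ?w C ^ 2) \<le> length Xs * 4 ^ L" if "\<forall>C\<in>set Xs. C \<subseteq> {..<L} & card C = n" for Xs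
    using that
   proof (induction Xs)
    case (Cons X Xs)
    have "?w X ^ 2 \<le> (2 ^ L) ^ 2"
     using binary_weight_less[of X L] Cons.prems by (intro power_mono) auto
    then have "?w X ^ 2 \<le> 4 ^ L" by (simp add: power2_eq_square flip: power_mult_distrib)
    then show ?case using Cons by simp
   qed simp
   have eq: "(\<Sum>C\<leftarrow>Cs. ?w C ^ 2) = ?w A ^ 2 + ?w B ^ 2 + (\<Sum>C\<leftarrow>R. ?w C ^ 2)"
   proof -
    have "sum_mset (mset (map (%C. ?w C ^ 2) Cs)) = sum_mset (mset (map (%C. ?w C ^ 2) (A # B # R)))"
     by (simp only: mset_map mset)
    then show ?thesis by (simp only: sum_mset_sum_list) (simp add: add.assoc)
   qed
   have "length ?C' * 4 ^ L - (\<Sum>C\<leftarrow>?C'. ?w C ^ 2) < length Cs * 4 ^ L - (\<Sum>C\<leftarrow>Cs. ?w C ^ 2)"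
    using sq bound[OF prems'] len unfolding eq by (simp add: algebra_simps)
   from less.IH[OF this prems'] have IH: "prod_list (map ?b ?C') \<in> zmod.span (G (length Cs))"
    using len by (simp add: G_def)
   obtain e :: int where e: "g K = of_int e * (?b A' * ?b B')" using sign_eq_witness[OF gK] by blast
   have "g K * prod_list (map ?b R) = of_int e * prod_list (map ?b ?C')"
    unfolding e by (simp add: mult_ac)
   then show ?thesis using zmod.span_scale[OF IH] by metis
  qed
  then have "(\<Sum>K | K \<subseteq> A & card K = card P. g K * prod_list (map ?b R)) \<in> zmod.span (G (length Cs))"
   by (intro zmod.span_sum) auto
  moreover have "prod_list (map ?b Cs) = (\<Sum>K | K \<subseteq> A & card K = card P. g K * prod_list (map ?b R))"
   unfolding prod_mset[OF mset] by (simp add: g(1) flip: mult.assoc sum_distrib_right)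
  ultimately show ?thesis by simp
 qed
 then show ?case by (simp add: G_def)
qed

definition col_le :: "(nat => nat) => nat set => nat set => bool" where
 "col_le ro J J' \<longleftrightarrow> (\<forall>s. card {x \<in> J'. ro x < s} \<le> card {x \<in> J. ro x < s})"

definition minor_pairs :: "nat => (nat set \<times> nat set) set" where
 "minor_pairs m = {(I, J). I \<subseteq> {..<m} & J \<subseteq> {..<m} & card I = card J}"

text \<open>
  The minor with rows \<open>I\<close> and columns \<open>J\<close> is the maximal minor of the matrix extended by an identity block on the columns \<open>J\<close> and on the unit columns outside \<open>I\<close>. The unit columns are numbered in reverse, so that the chain order on symbols controls rows and columns simultaneously.
\<close>

definition symbols :: "nat => (nat => nat) => nat set \<times> nat set => nat set" where
 "symbols m ro = (%(I, J). ro ` J \<union> (%i. 2 * m - 1 - ro i) ` ({..<m} - I))"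

definition symbol_vector :: "nat => (nat => nat) => (nat => nat => 'a::comm_ring_1) => nat => nat => 'a" where
 "symbol_vector m ro z c = (if c < m then column z (the_inv_into {..<m} ro c)
  else unit_row (the_inv_into {..<m} ro (2 * m - 1 - c)))"

context
 fixes m :: nat and ro :: "nat => nat"
 assumes ro: "bij_betw ro {..<m} {..<m}"
begin

lemma rank_less: "i < m ==> ro i < m"
 using bij_betwE[OF ro] by auto

lemma inj_rank: "inj_on ro {..<m}"
 using ro by (rule bij_betw_imp_inj_on)

lemma inj_rank_sub: "J \<subseteq> {..<m} ==> inj_on ro J"
 using inj_rank inj_on_subset by blast

lemma inj_corank: "I \<subseteq> {..<m} ==> inj_on (%i. 2 * m - 1 - ro i) I"
proof (rule inj_onI)
 fix i i' assume I: "I \<subseteq> {..<m}" "i \<in> I" "i' \<in> I" and eq: "2 * m - 1 - ro i = 2 * m - 1 - ro i'"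
 have "ro i < m" "ro i' < m" using I rank_less by auto
 then have "ro i = ro i'" using eq by linarith
 then show "i = i'" using inj_onD[OF inj_rank_sub[OF I(1)]] I by blast
qed

lemma corank_bounds: "i < m ==> m \<le> 2 * m - 1 - ro i & 2 * m - 1 - ro i < 2 * m"
 using rank_less[of i] by linarith

lemma bracket_symbols:
 assumes "(I, J) \<in> minor_pairs m"
 shows "bracket_of m (symbol_vector m ro z) (symbols m ro (I, J)) \<asymp> minor z I J"
proof -
 have IJ: "I \<subseteq> {..<m}" "J \<subseteq> {..<m}" "card J = card I" using assms by (auto simp: minor_pairs_def)
 have fin: "finite I" "finite J" using IJ(1,2) by (auto intro: finite_subset)
 have cI: "card I \<le> m" using card_mono[OF _ IJ(1)] by simp
 let ?xs = "map ro (sorted_list_of_set J) @ map (%i. 2 * m - 1 - ro i) (sorted_list_of_set ({..<m} - I))"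
 have A: "rdet m (map (symbol_vector m ro z) ?xs) \<asymp> bracket_of m (symbol_vector m ro z) (symbols m ro (I, J))"
 proof (rule rdet_eq_bracket_of)
  have "ro ` J \<inter> (%i. 2 * m - 1 - ro i) ` ({..<m} - I) = {}"
   using IJ rank_less corank_bounds by (fastforce simp: disjoint_iff)
  then show "distinct ?xs" using fin IJ inj_rank_sub inj_corank by (auto simp: distinct_map)
  show "set ?xs = symbols m ro (I, J)" using fin by (auto simp: symbols_def)
  show "length ?xs = m" using fin IJ cI by (simp add: card_Diff_subset)
 qed
 have B: "map (symbol_vector m ro z) ?xs =
   map (column z) (sorted_list_of_set J) @ map unit_row (sorted_list_of_set ({..<m} - I))"
 proof -
  have 1: "symbol_vector m ro z (ro j) = column z j" if "j \<in> J" for j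
   using that IJ rank_less[of j] by (auto simp: symbol_vector_def the_inv_into_f_f[OF inj_rank])
  have 2: "symbol_vector m ro z (2 * m - 1 - ro i) = unit_row i" if "i < m" for i
  proof -
   have "\<not> 2 * m - 1 - ro i < m" "2 * m - 1 - (2 * m - 1 - ro i) = ro i"
    using rank_less[OF that] by linarith+
   then show ?thesis using that by (simp add: symbol_vector_def the_inv_into_f_f[OF inj_rank])
  qed
  show ?thesis using fin 1 2 by (auto simp del: One_nat_def)
 qed
 show ?thesis
  by (rule sign_eq_trans[OF sign_eq_sym[OF A]], unfold B, rule minor_as_bracket[OF IJ])
qed

lemma card_symbols:
 assumes "(I, J) \<in> minor_pairs m"
 shows "symbols m ro (I, J) \<subseteq> {..<2 * m} & card (symbols m ro (I, J)) = m"
proof -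
 have IJ: "I \<subseteq> {..<m}" "J \<subseteq> {..<m}" "card J = card I" using assms by (auto simp: minor_pairs_def)
 have fin: "finite I" "finite J" using IJ(1,2) by (auto intro: finite_subset)
 have cI: "card I \<le> m" using card_mono[OF _ IJ(1)] by simp
 have "ro ` J \<inter> (%i. 2 * m - 1 - ro i) ` ({..<m} - I) = {}"
  using IJ rank_less corank_bounds by (fastforce simp: disjoint_iff)
 then have "card (symbols m ro (I, J)) = card (ro ` J) + card ((%i. 2 * m - 1 - ro i) ` ({..<m} - I))"
  unfolding symbols_def using fin by (simp add: card_Un_disjoint)
 also have "... = card J + card ({..<m} - I)"
  using IJ inj_rank_sub[of J] inj_corank[of "{..<m} - I"] by (simp add: card_image)
 also have "... = m" using fin IJ cI by (simp add: card_Diff_subset)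
 finally have "card (symbols m ro (I, J)) = m" .
 moreover have "symbols m ro (I, J) \<subseteq> {..<2 * m}"
 proof
  fix x assume "x \<in> symbols m ro (I, J)"
  then consider j where "j \<in> J" "x = ro j" | i where "i < m" "x = 2 * m - 1 - ro i"
   by (auto simp: symbols_def)
  then show "x \<in> {..<2 * m}"
  proof cases
   case 1
   then have "x < m" using IJ rank_less by auto
   then show ?thesis by simp
  next
   case 2
   then show ?thesis using corank_bounds by simp
  qed
 qed
 ultimately show ?thesis by simp
qed

lemma symbols_surj:
 assumes C: "C \<subseteq> {..<2 * m}" "card C = m"
 obtains I J where "(I, J) \<in> minor_pairs m" "symbols m ro (I, J) = C"
proof -
 have surj: "\<exists>j<m. ro j = c" if "c < m" for c
  using bij_betw_imp_surj_on[OF ro] that by (metis imageE lessThan_iff)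
 define J where "J = {j. j < m & ro j \<in> C}"
 define I where "I = {i. i < m & 2 * m - 1 - ro i \<notin> C}"
 have sub: "I \<subseteq> {..<m}" "J \<subseteq> {..<m}" by (auto simp: I_def J_def)
 have fin: "finite I" "finite J" using sub by (auto intro: finite_subset)
 have eq: "symbols m ro (I, J) = C"
 proof
  show "symbols m ro (I, J) \<subseteq> C" by (auto simp: symbols_def I_def J_def)
  show "C \<subseteq> symbols m ro (I, J)"
  proof
   fix c assume c: "c \<in> C"
   show "c \<in> symbols m ro (I, J)"
   proof (cases "c < m")
    case True
    then obtain j where "j < m" "ro j = c" using surj by blast
    then show ?thesis using c by (auto simp: symbols_def J_def)
   next
    case False
    have c2: "c < 2 * m" using c C by auto
    then have "2 * m - 1 - c < m" using False by linarith
    then obtain i where i: "i < m" "ro i = 2 * m - 1 - c" using surj by blast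
    then have "c = 2 * m - 1 - ro i" using c2 by simp
    then show ?thesis using c i(1) by (auto simp: symbols_def I_def)
   qed
  qed
 qed
 have "ro ` J \<inter> (%i. 2 * m - 1 - ro i) ` ({..<m} - I) = {}"
  using sub rank_less corank_bounds by (fastforce simp: disjoint_iff)
 then have "card C = card (ro ` J) + card ((%i. 2 * m - 1 - ro i) ` ({..<m} - I))"
  unfolding eq[symmetric] symbols_def using fin by (simp add: card_Un_disjoint)
 also have "... = card J + card ({..<m} - I)"
  using sub inj_rank_sub[of J] inj_corank[of "{..<m} - I"] by (simp add: card_image)
 also have "... = card J + (m - card I)" using fin sub by (simp add: card_Diff_subset)
 finally have "card I = card J" using C(2) card_mono[OF _ sub(1)] by simp
 then show ?thesis using that eq sub by (auto simp: minor_pairs_def)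
qed

lemma chain_le_symbols:
 assumes "(I, J) \<in> minor_pairs m" "(I', J') \<in> minor_pairs m"
  and le: "chain_le (symbols m ro (I, J)) (symbols m ro (I', J'))"
 shows "col_le ro I I' & col_le ro J J'"
proof -
 have low: "card_below (symbols m ro (I, J)) s = card {x \<in> J. ro x < s}"
  if "(I, J) \<in> minor_pairs m" "s \<le> m" for I J s
 proof -
  have J: "J \<subseteq> {..<m}" using that by (auto simp: minor_pairs_def)
  have "{x \<in> symbols m ro (I, J). x < s} = ro ` {x \<in> J. ro x < s}"
   using corank_bounds that(2) by (fastforce simp: symbols_def)
  moreover have "inj_on ro {x \<in> J. ro x < s}" using J by (intro inj_rank_sub) auto
  ultimately show ?thesis by (simp add: card_below_def card_image)
 qed
 have high: "card_below (symbols m ro (I, J)) (2 * m - t) = m - t + card {x \<in> I. ro x < t}"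
  if IJ: "(I, J) \<in> minor_pairs m" and t: "t \<le> m" for I J t
 proof -
  have sub: "I \<subseteq> {..<m}" "J \<subseteq> {..<m}" "card J = card I" using that by (auto simp: minor_pairs_def)
  have fin: "finite I" "finite J" using sub(1,2) by (auto intro: finite_subset)
  let ?H = "{i \<in> {..<m} - I. t \<le> ro i}"
  have "2 * m - 1 - ro i < 2 * m - t \<longleftrightarrow> t \<le> ro i" if "i < m" for i
   using rank_less[OF that] t by linarith
  moreover have "ro j < 2 * m - t" if "j < m" for j using rank_less[OF that] t by linarith
  ultimately have "{x \<in> symbols m ro (I, J). x < 2 * m - t} = ro ` J \<union> (%i. 2 * m - 1 - ro i) ` ?H"
   using sub by (fastforce simp: symbols_def simp del: One_nat_def)
  moreover have "ro ` J \<inter> (%i. 2 * m - 1 - ro i) ` ?H = {}"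
   using sub rank_less corank_bounds by (fastforce simp: disjoint_iff)
  ultimately have "card_below (symbols m ro (I, J)) (2 * m - t) = card J + card ?H"
   using fin inj_rank_sub[OF sub(2)] inj_corank[of ?H]
   by (simp add: card_below_def card_Un_disjoint card_image subset_iff)
  moreover have "card {i \<in> {..<m}. t \<le> ro i} = m - t"
  proof -
   have "card {i \<in> {..<m}. t \<le> ro i} = card (ro ` {i \<in> {..<m}. t \<le> ro i})"
    by (rule card_image[symmetric], rule inj_rank_sub) auto
   also have "ro ` {i \<in> {..<m}. t \<le> ro i} = {c \<in> ro ` {..<m}. t \<le> c}" by auto
   also have "... = {t..<m}" unfolding bij_betw_imp_surj_on[OF ro] by auto
   finally show ?thesis by simp
  qed
  moreover have "card {i \<in> {..<m}. t \<le> ro i} = card ?H + card {i \<in> I. t \<le> ro i}"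
   using fin sub by (subst card_Un_disjoint[symmetric]) (auto intro!: arg_cong[where f = card])
  moreover have "card I = card {i \<in> I. t \<le> ro i} + card {i \<in> I. ro i < t}"
   using fin by (subst card_Un_disjoint[symmetric]) (auto intro!: arg_cong[where f = card])
  ultimately show ?thesis using sub(3) by linarith
 qed
 have le': "card_below (symbols m ro (I', J')) s \<le> card_below (symbols m ro (I, J)) s" for s
  using le by (simp add: chain_le_def)
 have col: "col_le ro A A'" if "A \<subseteq> {..<m}" "A' \<subseteq> {..<m}"
  and *: "!!s. s \<le> m ==> card {x \<in> A'. ro x < s} \<le> card {x \<in> A. ro x < s}" for A A'
  unfolding col_le_def
 proof
  fix s
  have "{x \<in> B. ro x < s} = {x \<in> B. ro x < min s m}" if "B \<subseteq> {..<m}" for B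
   using that rank_less by auto
  then show "card {x \<in> A'. ro x < s} \<le> card {x \<in> A. ro x < s}"
   using *[of "min s m"] that(1,2) by simp
 qed
 show ?thesis
 proof (intro conjI col)
  show "card {x \<in> J'. ro x < s} \<le> card {x \<in> J. ro x < s}" if "s \<le> m" for s
   using le'[of s] low[OF assms(1) that] low[OF assms(2) that] by simp
  show "card {x \<in> I'. ro x < s} \<le> card {x \<in> I. ro x < s}" if "s \<le> m" for s
   using le'[of "2 * m - s"] high[OF assms(1) that] high[OF assms(2) that] by simp
 qed (use assms in \<open>auto simp: minor_pairs_def\<close>)
qed

text \<open>
  This is the exchange-based straightening applied to symbols, translated back to pairs of row and column sets.
\<close>

lemma minors_straightening:
 fixes z :: "nat => nat => zfrac"
 assumes "set ps \<subseteq> minor_pairs m"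
 shows "(\<Prod>(I, J)\<leftarrow>ps. minor z I J) \<in> zmod.span {(\<Prod>(I, J)\<leftarrow>qs. minor z I J) | qs.
  length qs = length ps & set qs \<subseteq> minor_pairs m &
  sorted_wrt (%(I, J) (I', J'). col_le ro I I' & col_le ro J J') qs}" (is "_ \<in> zmod.span ?G")
proof -
 let ?b = "bracket_of m (symbol_vector m ro z)" and ?S = "symbols m ro"
 have sgn: "prod_list (map ?b (map ?S qs)) \<asymp> (\<Prod>(I, J)\<leftarrow>qs. minor z I J)"
  if "set qs \<subseteq> minor_pairs m" for qs
  using that by (induction qs) (auto intro!: sign_eq_mult bracket_symbols simp del: mult_cancel_left)
 have "prod_list (map ?b (map ?S ps)) \<in> zmod.span {prod_list (map ?b Ds) | Ds.
  length Ds = length (map ?S ps) & (\<forall>D\<in>set Ds. D \<subseteq> {..<2 * m} & card D = m) & sorted_wrt chain_le Ds}"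
  by (rule straightening) (use assms card_symbols in auto)
 also have "... \<subseteq> zmod.span ?G"
 proof (rule zmod.span_minimal[OF _ zmod.subspace_span], safe)
  fix Ds assume Ds: "length Ds = length (map ?S ps)" "\<forall>D\<in>set Ds. D \<subseteq> {..<2 * m} & card D = m"
   "sorted_wrt chain_le Ds"
  have "\<forall>D\<in>set Ds. \<exists>p. p \<in> minor_pairs m & ?S p = D"
   using Ds(2) symbols_surj by (metis)
  then obtain f where f: "!!D. D \<in> set Ds ==> f D \<in> minor_pairs m & ?S (f D) = D" by metis
  define qs where "qs = map f Ds"
  have qs: "set qs \<subseteq> minor_pairs m" "length qs = length ps" "map ?S qs = Ds"
   using f Ds(1) by (auto simp: qs_def map_idI)
  have "sorted_wrt (%(I, J) (I', J'). col_le ro I I' & col_le ro J J') qs"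
  proof -
   have "sorted_wrt (%x y. chain_le (?S x) (?S y)) qs" using Ds(3) qs(3) by (metis sorted_wrt_map)
   then show ?thesis
    by (rule sorted_wrt_mono_rel[rotated]) (use qs(1) chain_le_symbols in \<open>fastforce\<close>)
  qed
  then have G: "(\<Prod>(I, J)\<leftarrow>qs. minor z I J) \<in> ?G" using qs by blast
  obtain e :: int where "prod_list (map ?b (map ?S qs)) = of_int e * (\<Prod>(I, J)\<leftarrow>qs. minor z I J)"
   using sign_eq_witness[OF sgn[OF qs(1)]] by blast
  then show "prod_list (map ?b Ds) \<in> zmod.span ?G"
   using zmod.span_scale[OF zmod.span_base[OF G]] qs(3) by simp
 qed
 finally have "prod_list (map ?b (map ?S ps)) \<in> zmod.span ?G" .
 moreover obtain e :: int where "(\<Prod>(I, J)\<leftarrow>ps. minor z I J) = of_int e * prod_list (map ?b (map ?S ps))"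
  using sign_eq_witness[OF sign_eq_sym[OF sgn[OF assms]]] by blast
 ultimately show ?thesis using zmod.span_scale by simp
qed

end

section \<open>Polynomials and the coordinate ring\<close>

definition mono_val :: "(nat => 'a::comm_ring_1) => (nat \<Rightarrow>\<^sub>0 nat) => 'a" where
 "mono_val v \<mu> = (\<Prod>k\<in>keys \<mu>. v k ^ lookup \<mu> k)"

text \<open>
  Polynomials are finitely supported coefficient functions; this is their value under an assignment to the numbered variables.
\<close>

definition poly_eval :: "(nat => 'a::comm_ring_1) => zpoly => 'a" where
 "poly_eval v p = (\<Sum>\<mu>\<in>keys p. of_int (lookup p \<mu>) * mono_val v \<mu>)"

lemma mono_val_superset:
 assumes "finite S" "keys \<mu> \<subseteq> S"
 shows "mono_val v \<mu> = (\<Prod>k\<in>S. v k ^ lookup \<mu> k)"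
 unfolding mono_val_def
 by (rule prod.mono_neutral_left) (use assms in \<open>auto simp: in_keys_iff\<close>)

lemma mono_val_0 [simp]: "mono_val v 0 = 1"
 by (simp add: mono_val_def)

lemma mono_val_add: "mono_val v (\<mu> + \<nu>) = mono_val v \<mu> * mono_val v \<nu>"
proof -
 let ?S = "keys \<mu> \<union> keys \<nu>"
 have "mono_val v (\<mu> + \<nu>) = (\<Prod>k\<in>?S. v k ^ lookup (\<mu> + \<nu>) k)"
  by (rule mono_val_superset) (simp, rule keys_add)
 also have "... = (\<Prod>k\<in>?S. v k ^ lookup \<mu> k) * (\<Prod>k\<in>?S. v k ^ lookup \<nu> k)"
  by (simp add: lookup_add power_add prod.distrib)
 also have "... = mono_val v \<mu> * mono_val v \<nu>"
  by (simp add: mono_val_superset[of ?S])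
 finally show ?thesis .
qed

lemma mono_val_single: "mono_val v (single k n) = v k ^ n"
 by (cases "n = 0") (auto simp: mono_val_def)

lemma poly_eval_superset:
 assumes "finite S" "keys p \<subseteq> S"
 shows "poly_eval v p = (\<Sum>\<mu>\<in>S. of_int (lookup p \<mu>) * mono_val v \<mu>)"
 unfolding poly_eval_def
 by (rule sum.mono_neutral_left) (use assms in \<open>auto simp: in_keys_iff\<close>)

lemma poly_eval_add: "poly_eval v (p + q) = poly_eval v p + poly_eval v q"
proof -
 let ?S = "keys p \<union> keys q"
 have "poly_eval v (p + q) = (\<Sum>\<mu>\<in>?S. of_int (lookup (p + q) \<mu>) * mono_val v \<mu>)"
  by (rule poly_eval_superset) (simp, rule keys_add)
 then show ?thesis
  by (simp add: lookup_add distrib_right sum.distrib poly_eval_superset[of ?S])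
qed

lemma poly_eval_0 [simp]: "poly_eval v 0 = 0"
 by (simp add: poly_eval_def)

lemma poly_eval_single: "poly_eval v (single \<mu> c) = of_int c * mono_val v \<mu>"
 by (cases "c = 0") (auto simp: poly_eval_def)

lemma poly_eval_sum: "poly_eval v (sum f S) = (\<Sum>x\<in>S. poly_eval v (f x))"
 by (induction S rule: infinite_finite_induct) (auto simp: poly_eval_add)

lemma poly_as_sum: "(p::zpoly) = (\<Sum>\<mu>\<in>keys p. single \<mu> (lookup p \<mu>))"
 by (rule poly_mapping_eqI) (simp add: lookup_sum lookup_single when_def in_keys_iff)

lemma poly_eval_mult: "poly_eval v (p * q) = poly_eval v p * poly_eval v q"
proof -
 let ?t = "%p \<mu>. single \<mu> (lookup p \<mu>) :: zpoly"
 have "p * q = (\<Sum>\<mu>\<in>keys p. ?t p \<mu>) * (\<Sum>\<nu>\<in>keys q. ?t q \<nu>)"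
  using poly_as_sum by metis
 also have "... = (\<Sum>\<mu>\<in>keys p. \<Sum>\<nu>\<in>keys q. ?t p \<mu> * ?t q \<nu>)"
  by (rule sum_product)
 finally have "poly_eval v (p * q) =
   (\<Sum>\<mu>\<in>keys p. \<Sum>\<nu>\<in>keys q. poly_eval v (?t p \<mu> * ?t q \<nu>))"
  by (simp add: poly_eval_sum)
 also have "... = poly_eval v p * poly_eval v q"
  unfolding poly_eval_def[of v p] poly_eval_def[of v q] sum_product
  by (intro sum.cong refl) (simp add: mult_single poly_eval_single mono_val_add)
 finally show ?thesis .
qed

lemma poly_eval_1 [simp]: "poly_eval v 1 = 1"
 using poly_eval_single[of v 0 1] by simp

lemma poly_eval_hom: "comm_ring_hom (poly_eval v)"
 by standard (auto simp: poly_eval_add poly_eval_mult)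

lemma poly_eval_power: "poly_eval v (p ^ k) = poly_eval v p ^ k"
 by (induction k) (auto simp: poly_eval_mult)

lemma poly_eval_prod: "poly_eval v (prod f S) = (\<Prod>x\<in>S. poly_eval v (f x))"
 by (induction S rule: infinite_finite_induct) (auto simp: poly_eval_mult)

lemma poly_eval_entry_var: "poly_eval v (entry_var i j) = v (prod_encode (i, j))"
 by (simp add: entry_var_def poly_eval_single mono_val_single)

lemma poly_eval_det: "poly_eval v (det A) = det (map_mat (poly_eval v) A)"
 by (rule comm_ring_hom.hom_det[OF poly_eval_hom, symmetric])

lemma poly_eval_cong:
 assumes "!!\<mu> k. \<mu> \<in> keys p ==> k \<in> keys \<mu> ==> v k = v' k"
 shows "poly_eval v p = poly_eval v' p"
 unfolding poly_eval_def mono_val_def using assms by (intro sum.cong arg_cong2[where f = "(*)"] prod.cong) auto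

lemma mat_polys_0 [simp]: "0 \<in> mat_polys m"
 by (simp add: mat_polys_def)

lemma mat_polys_1 [simp]: "1 \<in> mat_polys m"
 by (simp add: mat_polys_def)

lemma mat_polys_add: "p \<in> mat_polys m ==> q \<in> mat_polys m ==> p + q \<in> mat_polys m"
 unfolding mat_polys_def using keys_add[of p q] by blast

lemma mat_polys_uminus: "p \<in> mat_polys m ==> - p \<in> mat_polys m"
 unfolding mat_polys_def by simp

lemma mat_polys_mult: "p \<in> mat_polys m ==> q \<in> mat_polys m ==> p * q \<in> mat_polys m"
proof -
 assume pq: "p \<in> mat_polys m" "q \<in> mat_polys m"
 show "p * q \<in> mat_polys m" unfolding mat_polys_def
 proof safe
  fix \<mu> k assume "\<mu> \<in> keys (p * q)" "k \<in> keys \<mu>"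
  then obtain a b where "\<mu> = a + b" "a \<in> keys p" "b \<in> keys q" "k \<in> keys (a + b)"
   using keys_mult[of p q] by blast
  then show "k \<in> prod_encode ` ({..<m} \<times> {..<m})"
   using pq keys_add[of a b] unfolding mat_polys_def by blast
 qed
qed

lemma mat_polys_sum: "(!!x. x \<in> S ==> f x \<in> mat_polys m) ==> sum f S \<in> mat_polys m"
 by (induction S rule: infinite_finite_induct) (auto intro: mat_polys_add)

lemma mat_polys_prod: "(!!x. x \<in> S ==> f x \<in> mat_polys m) ==> prod f S \<in> mat_polys m"
 by (induction S rule: infinite_finite_induct) (auto intro: mat_polys_mult)

lemma mat_polys_power: "p \<in> mat_polys m ==> p ^ k \<in> mat_polys m"
 by (induction k) (auto intro: mat_polys_mult)

lemma of_int_zpoly: "(of_int c :: zpoly) = single 0 c"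
 by (simp add: single_of_int[symmetric])

lemma mat_polys_of_int: "of_int c \<in> mat_polys m"
 by (auto simp: mat_polys_def of_int_zpoly)

lemma mat_polys_entry_var: "i < m ==> j < m ==> entry_var i j \<in> mat_polys m"
 by (auto simp: mat_polys_def entry_var_def)

lemma mat_polys_det:
 assumes "A \<in> carrier_mat n n" "!!i j. i < n ==> j < n ==> A $$ (i, j) \<in> mat_polys m"
 shows "det A \<in> mat_polys m"
 unfolding det_def'[OF assms(1)]
proof (intro mat_polys_sum mat_polys_mult mat_polys_prod mat_polys_of_int)
 fix \<pi> i assume "\<pi> \<in> {\<pi>. \<pi> permutes {0..<n}}" "i \<in> {0..<n}"
 then have "i < n" "\<pi> i < n" using permutes_in_image[of \<pi> "{0..<n}" i] by auto
 then show "A $$ (i, \<pi> i) \<in> mat_polys m" by (rule assms(2))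
qed

lemma det_poly_mat_polys: "det_poly m \<in> mat_polys m"
 unfolding det_poly_def by (rule mat_polys_det[of _ m]) (auto intro: mat_polys_entry_var)

definition entries :: "'a mat => nat => 'a" where
 "entries A k = A $$ prod_decode k"

lemma poly_eval_det_poly:
 assumes "A \<in> carrier_mat m m"
 shows "poly_eval (entries A) (det_poly m) = det A"
 unfolding det_poly_def poly_eval_det
 by (rule arg_cong[where f = det], rule eq_matI) (use assms in \<open>auto simp: poly_eval_entry_var entries_def\<close>)

lemma det_poly_nonzero [simp]: "det_poly m ~= 0"
proof
 assume "det_poly m = 0"
 then have "det (1\<^sub>m m :: int mat) = 0" using poly_eval_det_poly[of "1\<^sub>m m :: int mat" m] by simp
 then show False by simp
qed

lemma to_fract_hom: "comm_ring_hom (to_fract :: 'a::idom => 'a fract)"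
 by standard auto

lemma to_fract_power: "to_fract (p ^ k) = to_fract p ^ k"
 by (induction k) auto

lemma to_fract_sum: "to_fract (sum f S) = (\<Sum>x\<in>S. to_fract (f x))"
 by (induction S rule: infinite_finite_induct) auto

lemma to_fract_prod: "to_fract (prod f S) = (\<Prod>x\<in>S. to_fract (f x))"
 by (induction S rule: infinite_finite_induct) auto

lemma to_fract_of_int: "to_fract (of_int c) = of_int c"
proof -
 have nat: "to_fract (of_nat n :: 'a) = of_nat n" for n by (induction n) auto
 show ?thesis by (cases c rule: int_cases2) (auto simp: nat)
qed

lemma to_fract_det: "to_fract (det A) = det (map_mat to_fract A)"
 by (rule comm_ring_hom.hom_det[OF to_fract_hom, symmetric])

abbreviation det_fract :: "nat => zfrac" where
 "det_fract m \<equiv> to_fract (det_poly m)"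

lemma det_fract_nonzero [simp]: "det_fract m ~= 0"
 by (simp add: det_poly_nonzero)

lemma Fract_det_power: "Fract p (det_poly m ^ k) = to_fract p / det_fract m ^ k"
 by (simp add: Fract_conv_to_fract to_fract_power)

lemma coord_ring_iff: "f \<in> coord_ring m \<longleftrightarrow> (\<exists>p\<in>mat_polys m. \<exists>k. f = to_fract p / det_fract m ^ k)"
 unfolding coord_ring_def Fract_det_power by blast

lemma coord_ringI: "p \<in> mat_polys m ==> f * det_fract m ^ k = to_fract p ==> f \<in> coord_ring m"
 unfolding coord_ring_iff by (metis det_fract_nonzero nonzero_eq_divide_eq power_not_zero)

lemma coord_ringE:
 assumes "f \<in> coord_ring m"
 obtains p k where "p \<in> mat_polys m" "f * det_fract m ^ k = to_fract p"
 using assms unfolding coord_ring_iff by (metis det_fract_nonzero nonzero_eq_divide_eq power_not_zero)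

lemma coord_ring_raise:
 assumes "p \<in> mat_polys m" "f * det_fract m ^ k = to_fract p" "k \<le> l"
 shows "\<exists>q\<in>mat_polys m. f * det_fract m ^ l = to_fract q"
proof
 show "p * det_poly m ^ (l - k) \<in> mat_polys m"
  using assms by (intro mat_polys_mult mat_polys_power det_poly_mat_polys)
 show "f * det_fract m ^ l = to_fract (p * det_poly m ^ (l - k))"
 proof -
  have "det_fract m ^ l = det_fract m ^ k * det_fract m ^ (l - k)"
   using assms(3) by (simp flip: power_add)
  then show ?thesis by (simp only: to_fract_mult to_fract_power mult.assoc[symmetric] assms(2))
 qed
qed

lemma coord_ring_poly: "p \<in> mat_polys m ==> to_fract p \<in> coord_ring m"
 by (rule coord_ringI[of p m _ 0]) auto

lemma coord_ring_add:
 assumes "f \<in> coord_ring m" "g \<in> coord_ring m"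
 shows "f + g \<in> coord_ring m"
proof -
 obtain p k where p: "p \<in> mat_polys m" "f * det_fract m ^ k = to_fract p" using assms(1) by (rule coord_ringE)
 obtain q l where q: "q \<in> mat_polys m" "g * det_fract m ^ l = to_fract q" using assms(2) by (rule coord_ringE)
 obtain p' where p': "p' \<in> mat_polys m" "f * det_fract m ^ (k + l) = to_fract p'"
  using coord_ring_raise[OF p, of "k + l"] by auto
 obtain q' where q': "q' \<in> mat_polys m" "g * det_fract m ^ (k + l) = to_fract q'"
  using coord_ring_raise[OF q, of "k + l"] by auto
 show ?thesis
  by (rule coord_ringI[of "p' + q'" m _ "k + l"]) (use p' q' in \<open>auto intro: mat_polys_add simp: distrib_right\<close>)
qed

lemma coord_ring_mult:
 assumes "f \<in> coord_ring m" "g \<in> coord_ring m"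
 shows "f * g \<in> coord_ring m"
proof -
 obtain p k where p: "p \<in> mat_polys m" "f * det_fract m ^ k = to_fract p" using assms(1) by (rule coord_ringE)
 obtain q l where q: "q \<in> mat_polys m" "g * det_fract m ^ l = to_fract q" using assms(2) by (rule coord_ringE)
 have "f * g * det_fract m ^ (k + l) = (f * det_fract m ^ k) * (g * det_fract m ^ l)"
  by (simp add: power_add mult_ac)
 then show ?thesis
  using p q by (intro coord_ringI[of "p * q" m _ "k + l"]) (auto intro: mat_polys_mult)
qed

lemma coord_ring_of_int [simp]: "of_int c \<in> coord_ring m"
 using coord_ring_poly[OF mat_polys_of_int[of c m]] by (simp add: to_fract_of_int)

lemma coord_ring_0 [simp]: "0 \<in> coord_ring m" and coord_ring_1 [simp]: "1 \<in> coord_ring m"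
 using coord_ring_of_int[where c = 0] coord_ring_of_int[where c = 1] by auto

lemma coord_ring_sum: "(!!x. x \<in> S ==> f x \<in> coord_ring m) ==> sum f S \<in> coord_ring m"
 by (induction S rule: infinite_finite_induct) (auto intro: coord_ring_add)

lemma coord_ring_prod: "(!!x. x \<in> S ==> f x \<in> coord_ring m) ==> prod f S \<in> coord_ring m"
 by (induction S rule: infinite_finite_induct) (auto intro: coord_ring_mult)

lemma coord_ring_det:
 assumes "A \<in> carrier_mat n n" "!!i j. i < n ==> j < n ==> A $$ (i, j) \<in> coord_ring m"
 shows "det A \<in> coord_ring m"
 unfolding det_def'[OF assms(1)]
proof (intro coord_ring_sum coord_ring_mult coord_ring_prod coord_ring_of_int)
 fix \<pi> i assume "\<pi> \<in> {\<pi>. \<pi> permutes {0..<n}}" "i \<in> {0..<n}"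
 then have "i < n" "\<pi> i < n" using permutes_in_image[of \<pi> "{0..<n}" i] by auto
 then show "A $$ (i, \<pi> i) \<in> coord_ring m" by (rule assms(2))
qed

lemma subspace_coord_ring: "zmod.subspace (coord_ring m)"
 unfolding zmod.subspace_def by (auto intro: coord_ring_add coord_ring_mult)

section \<open>Evaluation over the function field\<close>

definition GLF :: "nat => zfrac mat set" where
 "GLF m = {A \<in> carrier_mat m m. det A ~= 0}"

text \<open>
  The value of a function at a matrix over the function field. It agrees with the value at a point of an arbitrary ring, but lives in a field, where determinants are available.
\<close>

definition feval :: "nat => zfrac mat => zfrac => zfrac" where
 "feval m A f = (THE r. \<exists>p\<in>mat_polys m. \<exists>k. f = Fract p (det_poly m ^ k) &
  r = poly_eval (entries A) p / det A ^ k)"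

lemma feval_eq:
 assumes A: "A \<in> GLF m" and p: "p \<in> mat_polys m" "f * det_fract m ^ k = to_fract p"
 shows "feval m A f * det A ^ k = poly_eval (entries A) p"
proof -
 have cA: "A \<in> carrier_mat m m" "det A ~= 0" using A by (auto simp: GLF_def)
 have "feval m A f = poly_eval (entries A) p / det A ^ k"
  unfolding feval_def
 proof (rule the_equality)
  have "f = Fract p (det_poly m ^ k)" using p by (simp add: Fract_det_power nonzero_eq_divide_eq)
  then show "\<exists>q\<in>mat_polys m. \<exists>l. f = Fract q (det_poly m ^ l) &
    poly_eval (entries A) p / det A ^ k = poly_eval (entries A) q / det A ^ l"
   using p by blast
  fix r assume "\<exists>q\<in>mat_polys m. \<exists>l. f = Fract q (det_poly m ^ l) & r = poly_eval (entries A) q / det A ^ l"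
  then obtain q l where q: "q \<in> mat_polys m" "f = to_fract q / det_fract m ^ l"
   "r = poly_eval (entries A) q / det A ^ l" unfolding Fract_det_power by blast
  have "to_fract (p * det_poly m ^ l) = to_fract (q * det_poly m ^ k)"
   using p(2) q(2) by (simp add: to_fract_power field_simps)
  then have "p * det_poly m ^ l = q * det_poly m ^ k" by (simp only: to_fract_eq_iff)
  then have "poly_eval (entries A) p * det A ^ l = poly_eval (entries A) q * det A ^ k"
   using poly_eval_mult[of "entries A"] poly_eval_power[of "entries A"] poly_eval_det_poly[OF cA(1)] by metis
  then show "r = poly_eval (entries A) p / det A ^ k"
   unfolding q(3) using cA(2) by (simp add: field_simps)
 qed
 then show ?thesis using cA by simp
qed

lemma feval_poly: "A \<in> GLF m ==> p \<in> mat_polys m ==> feval m A (to_fract p) = poly_eval (entries A) p"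
 using feval_eq[of A m p "to_fract p" 0] by simp

lemma feval_of_int: "A \<in> GLF m ==> feval m A (of_int c) = of_int c"
 using feval_poly[OF _ mat_polys_of_int[of c m], of A]
 unfolding to_fract_of_int by (simp add: of_int_zpoly poly_eval_single)

lemma feval_0 [simp]: "A \<in> GLF m ==> feval m A 0 = 0" and feval_1 [simp]: "A \<in> GLF m ==> feval m A 1 = 1"
 using feval_of_int[where c = 0] feval_of_int[where c = 1] by auto

lemma feval_add:
 assumes A: "A \<in> GLF m" and "f \<in> coord_ring m" "g \<in> coord_ring m"
 shows "feval m A (f + g) = feval m A f + feval m A g"
proof -
 obtain p k where p: "p \<in> mat_polys m" "f * det_fract m ^ k = to_fract p" using assms(2) by (rule coord_ringE)
 obtain q l where q: "q \<in> mat_polys m" "g * det_fract m ^ l = to_fract q" using assms(3) by (rule coord_ringE)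
 obtain p' where p': "p' \<in> mat_polys m" "f * det_fract m ^ (k + l) = to_fract p'"
  using coord_ring_raise[OF p, of "k + l"] by auto
 obtain q' where q': "q' \<in> mat_polys m" "g * det_fract m ^ (k + l) = to_fract q'"
  using coord_ring_raise[OF q, of "k + l"] by auto
 have "(f + g) * det_fract m ^ (k + l) = to_fract (p' + q')" using p' q' by (simp add: distrib_right)
 from feval_eq[OF A mat_polys_add[OF p'(1) q'(1)] this] feval_eq[OF A p'] feval_eq[OF A q']
 have "feval m A (f + g) * det A ^ (k + l) = (feval m A f + feval m A g) * det A ^ (k + l)"
  by (simp add: poly_eval_add distrib_right)
 then show ?thesis using A by (simp add: GLF_def)
qed

lemma feval_mult:
 assumes A: "A \<in> GLF m" and "f \<in> coord_ring m" "g \<in> coord_ring m"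
 shows "feval m A (f * g) = feval m A f * feval m A g"
proof -
 obtain p k where p: "p \<in> mat_polys m" "f * det_fract m ^ k = to_fract p" using assms(2) by (rule coord_ringE)
 obtain q l where q: "q \<in> mat_polys m" "g * det_fract m ^ l = to_fract q" using assms(3) by (rule coord_ringE)
 have "f * g * det_fract m ^ (k + l) = (f * det_fract m ^ k) * (g * det_fract m ^ l)"
  by (simp add: power_add mult_ac)
 then have "f * g * det_fract m ^ (k + l) = to_fract (p * q)" using p q by simp
 from feval_eq[OF A mat_polys_mult[OF p(1) q(1)] this] feval_eq[OF A p] feval_eq[OF A q]
 have "feval m A (f * g) * det A ^ (k + l) = (feval m A f * det A ^ k) * (feval m A g * det A ^ l)"
  by (simp add: poly_eval_mult)
 also have "... = (feval m A f * feval m A g) * det A ^ (k + l)" by (simp add: power_add mult_ac)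
 finally show ?thesis using A by (simp add: GLF_def)
qed

lemma feval_sum:
 assumes "A \<in> GLF m" "!!x. x \<in> S ==> f x \<in> coord_ring m"
 shows "feval m A (sum f S) = (\<Sum>x\<in>S. feval m A (f x))"
 using assms(2) by (induction S rule: infinite_finite_induct) (auto simp: assms(1) feval_add coord_ring_sum)

lemma feval_prod:
 assumes "A \<in> GLF m" "!!x. x \<in> S ==> f x \<in> coord_ring m"
 shows "feval m A (prod f S) = (\<Prod>x\<in>S. feval m A (f x))"
 using assms(2) by (induction S rule: infinite_finite_induct) (auto simp: assms(1) feval_mult coord_ring_prod)

lemma feval_det:
 assumes A: "A \<in> GLF m" and M: "M \<in> carrier_mat n n" "!!i j. i < n ==> j < n ==> M $$ (i, j) \<in> coord_ring m"
 shows "feval m A (det M) = det (map_mat (feval m A) M)"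
proof -
 have lt: "\<pi> i < n" if "\<pi> permutes {0..<n}" "i < n" for \<pi> i
  using permutes_in_image[OF that(1), of i] that(2) by simp
 have prod: "(\<Prod>i = 0..<n. M $$ (i, \<pi> i)) \<in> coord_ring m" if "\<pi> permutes {0..<n}" for \<pi>
  by (rule coord_ring_prod) (use M lt[OF that] in auto)
 have "feval m A (det M) = (\<Sum>\<pi> | \<pi> permutes {0..<n}. feval m A (signof \<pi> * (\<Prod>i = 0..<n. M $$ (i, \<pi> i))))"
  unfolding det_def'[OF M(1)] by (rule feval_sum[OF A]) (auto intro!: coord_ring_mult prod)
 also have "... = (\<Sum>\<pi> | \<pi> permutes {0..<n}. signof \<pi> * (\<Prod>i = 0..<n. map_mat (feval m A) M $$ (i, \<pi> i)))"
  by (rule sum.cong[OF refl], subst feval_mult[OF A _ prod], simp_all add: feval_of_int[OF A], subst feval_prod[OF A])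
   (use M lt in \<open>auto intro!: prod.cong\<close>)
 also have "... = det (map_mat (feval m A) M)" by (subst det_def'[of _ n]) (use M in auto)
 finally show ?thesis .
qed

lemma generic_mat_carrier: "generic_mat m \<in> carrier_mat m m"
 by (simp add: generic_mat_def)

lemma generic_mat_entry: "i < m ==> j < m ==> generic_mat m $$ (i, j) = to_fract (entry_var i j)"
 by (simp add: generic_mat_def to_fract_def)

lemma det_generic: "det (generic_mat m) = det_fract m"
 unfolding det_poly_def to_fract_det
 by (rule arg_cong[where f = det], rule eq_matI) (auto simp: generic_mat_def to_fract_def)

lemma generic_GLF: "generic_mat m \<in> GLF m"
 using generic_mat_carrier[of m] by (simp add: GLF_def det_generic del: to_fract_eq_0_iff)

lemma mono_val_to_fract:
 "mono_val (%k. to_fract (single (single k 1) 1)) \<mu> = to_fract (single \<mu> 1 :: zpoly)"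
proof -
 have pow: "(single (single k 1) 1 :: zpoly) ^ n = single (single k n) 1" for k n
  by (induction n) (auto simp: mult_single single_add[symmetric])
 have "(\<Prod>k\<in>S. single (single k (f k)) 1 :: zpoly) =
  single (\<Sum>k\<in>S. single k (f k)) 1" if "finite S" for S f
  using that by (induction S) (auto simp: mult_single)
 moreover have "(\<Sum>k\<in>keys \<mu>. single k (lookup \<mu> k)) = \<mu>"
  by (rule poly_mapping_eqI) (simp add: lookup_sum lookup_single when_def in_keys_iff)
 ultimately show ?thesis
  by (simp add: mono_val_def to_fract_power[symmetric] to_fract_prod[symmetric] pow del: One_nat_def)
qed

lemma poly_eval_generic:
 assumes "p \<in> mat_polys m"
 shows "poly_eval (entries (generic_mat m)) p = to_fract p"
proof -
 have "poly_eval (entries (generic_mat m)) p =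
   poly_eval (%k. to_fract (single (single k 1) 1)) p"
  by (rule poly_eval_cong) (use assms in \<open>force simp: mat_polys_def entries_def generic_mat_entry entry_var_def\<close>)
 also have "... = to_fract (\<Sum>\<mu>\<in>keys p. of_int (lookup p \<mu>) * single \<mu> 1)"
  unfolding poly_eval_def mono_val_to_fract by (simp add: to_fract_sum to_fract_of_int)
 also have "(\<Sum>\<mu>\<in>keys p. of_int (lookup p \<mu>) * single \<mu> 1) = p"
  by (subst (4) poly_as_sum) (simp add: single_of_int[symmetric] mult_single)
 finally show ?thesis .
qed

text \<open>
  The generic matrix is the universal point: a function is its own value there. Equality of functions is therefore equality of values.
\<close>

lemma feval_generic:
 assumes "f \<in> coord_ring m"
 shows "feval m (generic_mat m) f = f"
proof -
 obtain p k where p: "p \<in> mat_polys m" "f * det_fract m ^ k = to_fract p" using assms by (rule coord_ringE)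
 have "feval m (generic_mat m) f * det_fract m ^ k = f * det_fract m ^ k"
  using feval_eq[OF generic_GLF p] unfolding p(2) poly_eval_generic[OF p(1)] det_generic .
 then show ?thesis by simp
qed

lemma GLF_mult: "A \<in> GLF m ==> B \<in> GLF m ==> A * B \<in> GLF m"
 by (auto simp: GLF_def det_mult)

definition inv_GLF :: "nat => zfrac mat => zfrac mat" where
 "inv_GLF m A = inverse (det A) \<cdot>\<^sub>m adj_mat A"

lemma inv_GLF:
 assumes "A \<in> GLF m"
 shows "inv_GLF m A \<in> carrier_mat m m" "A * inv_GLF m A = 1\<^sub>m m" "inv_GLF m A * A = 1\<^sub>m m"
proof -
 have A: "A \<in> carrier_mat m m" "det A ~= 0" using assms by (auto simp: GLF_def)
 show "inv_GLF m A \<in> carrier_mat m m" using adj_mat(1)[OF A(1)] by (simp add: inv_GLF_def)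
 have "A * inv_GLF m A = inverse (det A) \<cdot>\<^sub>m (A * adj_mat A)"
  unfolding inv_GLF_def by (rule mult_smult_distrib[OF A(1) adj_mat(1)[OF A(1)]])
 also have "... = 1\<^sub>m m" unfolding adj_mat(2)[OF A(1)] by (rule eq_matI) (use A(2) in auto)
 finally show "A * inv_GLF m A = 1\<^sub>m m" .
 have "inv_GLF m A * A = inverse (det A) \<cdot>\<^sub>m (adj_mat A * A)"
  unfolding inv_GLF_def by (rule mult_smult_assoc_mat[OF adj_mat(1)[OF A(1)] A(1)])
 also have "... = 1\<^sub>m m" unfolding adj_mat(3)[OF A(1)] by (rule eq_matI) (use A(2) in auto)
 finally show "inv_GLF m A * A = 1\<^sub>m m" .
qed

lemma inv_GLF_unique:
 assumes A: "A \<in> GLF m" and B: "B \<in> carrier_mat m m" "A * B = 1\<^sub>m m"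
 shows "B = inv_GLF m A"
proof -
 have cA: "A \<in> carrier_mat m m" using A by (simp add: GLF_def)
 have "B = (inv_GLF m A * A) * B" using inv_GLF(3)[OF A] B by simp
 also have "... = inv_GLF m A * (A * B)" by (rule assoc_mult_mat[OF inv_GLF(1)[OF A] cA B(1)])
 also have "... = inv_GLF m A" using B inv_GLF(1)[OF A] by simp
 finally show ?thesis .
qed

lemma inv_GLF_mult:
 assumes "A \<in> GLF m" "B \<in> GLF m"
 shows "inv_GLF m (A * B) = inv_GLF m B * inv_GLF m A"
proof (rule inv_GLF_unique[OF GLF_mult[OF assms], symmetric])
 note A = inv_GLF[OF assms(1)] and B = inv_GLF[OF assms(2)]
 have c: "A \<in> carrier_mat m m" "B \<in> carrier_mat m m" using assms by (auto simp: GLF_def)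
 show "inv_GLF m B * inv_GLF m A \<in> carrier_mat m m" using A B by simp
 have "A * B * (inv_GLF m B * inv_GLF m A) = A * (B * (inv_GLF m B * inv_GLF m A))"
  using A B c by (intro assoc_mult_mat) auto
 also have "B * (inv_GLF m B * inv_GLF m A) = B * inv_GLF m B * inv_GLF m A"
  using A B c by (intro assoc_mult_mat[symmetric]) auto
 finally show "A * B * (inv_GLF m B * inv_GLF m A) = 1\<^sub>m m" using A B by simp
qed

lemma generic_inverse: "generic_inverse m = inv_GLF m (generic_mat m)"
 unfolding generic_inverse_def
 by (rule the_equality) (use inv_GLF[OF generic_GLF] inv_GLF_unique[OF generic_GLF] in auto)

definition ycoord :: "nat => zfrac mat => nat => nat => zfrac" where
 "ycoord m A i j = inv_GLF m A $$ (j, i)"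

abbreviation xcoord :: "zfrac mat => nat => nat => zfrac" where
 "xcoord A i j \<equiv> A $$ (i, j)"

lemma ycoord_inverse:
 assumes "A \<in> GLF m" "i < m" "k < m"
 shows "(\<Sum>j<m. xcoord A i j * ycoord m A k j) = (if i = k then 1 else 0)"
 using index_mult_mat_sum[of A m m "inv_GLF m A" m i k] inv_GLF[OF assms(1)] assms
 by (auto simp: ycoord_def GLF_def)

lemma y_fun_eq: "i < m ==> j < m ==> y_fun m i j = ycoord m (generic_mat m) i j"
 using inv_GLF(1)[OF generic_GLF, of m] by (auto simp: y_fun_def ycoord_def generic_inverse)

lemma x_fun_coord: "i < m ==> j < m ==> x_fun m i j \<in> coord_ring m"
 unfolding x_fun_def generic_mat_entry by (intro coord_ring_poly mat_polys_entry_var)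

lemma y_fun_coord: "i < m ==> j < m ==> y_fun m i j \<in> coord_ring m"
proof -
 assume ij: "i < m" "j < m"
 let ?X = "generic_mat m"
 let ?P = "mat m m (%(i, j). entry_var i j)"
 have X: "?X = map_mat to_fract ?P" by (rule eq_matI) (auto simp: generic_mat_def to_fract_def)
 have "y_fun m i j = inverse (det_fract m) * cofactor ?X i j"
  using ij generic_mat_carrier[of m] unfolding y_fun_eq[OF ij] ycoord_def inv_GLF_def
  by (auto simp: adj_mat_def det_generic)
 also have "cofactor ?X i j = to_fract ((- 1) ^ (i + j) * det (mat_delete ?P i j))"
 proof -
  have "mat_delete ?X i j = map_mat to_fract (mat_delete ?P i j)"
   unfolding X mat_delete_def by (rule eq_matI) auto
  then show ?thesis by (simp add: cofactor_def to_fract_det to_fract_power)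
 qed
 finally have "y_fun m i j * det_fract m ^ 1 = to_fract ((- 1) ^ (i + j) * det (mat_delete ?P i j))"
  by (simp add: mult.commute[of "inverse _"] mult.assoc)
 moreover have "(- 1) ^ (i + j) * det (mat_delete ?P i j) \<in> mat_polys m"
  by (intro mat_polys_mult mat_polys_power mat_polys_uminus mat_polys_1 mat_polys_det[of _ "m - 1"])
   (use ij in \<open>auto simp: mat_delete_def intro!: mat_polys_entry_var\<close>)
 ultimately show ?thesis using coord_ringI by blast
qed

lemma feval_x_fun: "A \<in> GLF m ==> i < m ==> j < m ==> feval m A (x_fun m i j) = xcoord A i j"
 unfolding x_fun_def generic_mat_entry
 by (simp add: feval_poly mat_polys_entry_var poly_eval_entry_var entries_def)

lemma feval_y_fun:
 assumes A: "A \<in> GLF m" and ij: "i < m" "j < m"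
 shows "feval m A (y_fun m i j) = ycoord m A i j"
proof -
 let ?W = "mat m m (%(j, k). feval m A (y_fun m k j))"
 have "A * ?W = 1\<^sub>m m"
 proof (rule eq_matI)
  fix i k assume "i < dim_row (1\<^sub>m m :: zfrac mat)" "k < dim_col (1\<^sub>m m :: zfrac mat)"
  then have ik: "i < m" "k < m" by auto
  have "(A * ?W) $$ (i, k) = (\<Sum>j<m. feval m A (x_fun m i j) * feval m A (y_fun m k j))"
   using A ik by (subst index_mult_mat_sum[of _ m m]) (auto simp: GLF_def feval_x_fun[OF A] intro!: sum.cong)
  also have "... = feval m A (\<Sum>j<m. x_fun m i j * y_fun m k j)"
   by (subst feval_sum[OF A])
    (use ik in \<open>auto simp: feval_mult[OF A] x_fun_coord y_fun_coord intro!: coord_ring_mult\<close>)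
  also have "(\<Sum>j<m. x_fun m i j * y_fun m k j) = (\<Sum>j<m. xcoord (generic_mat m) i j * ycoord m (generic_mat m) k j)"
   using ik by (intro sum.cong) (auto simp: x_fun_def y_fun_eq)
  also have "... = (if i = k then 1 else 0)" using ik by (rule ycoord_inverse[OF generic_GLF])
  finally show "(A * ?W) $$ (i, k) = 1\<^sub>m m $$ (i, k)" using ik A by auto
 qed (use A in \<open>auto simp: GLF_def\<close>)
 then have "?W = inv_GLF m A" by (intro inv_GLF_unique[OF A]) auto
 then show ?thesis using ij unfolding ycoord_def by (metis (no_types, lifting) case_prod_conv index_mat(1))
qed

section \<open>Columns of rational tableaux\<close>

lemma down_closed_eq_lessThan:
 fixes S :: "nat set"
 assumes "finite S" "!!i j. j \<in> S ==> i < j ==> i \<in> S"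
 shows "S = {..<card S}"
proof (cases "S = {}")
 case False
 have "S = {..Max S}"
 proof
  show "S \<subseteq> {..Max S}" using assms(1) by auto
  show "{..Max S} \<subseteq> S"
   using assms(2)[OF Max_in[OF assms(1) False]] Max_in[OF assms(1) False] by (auto simp: le_less)
 qed
 moreover have "{..Max S} = {..<Suc (Max S)}" by auto
 ultimately have "S = {..<Suc (Max S)}" by simp
 then show ?thesis by (metis card_lessThan)
qed simp

lemma partition_nth_mono:
 assumes "partition_list m l" "i \<le> j" "j < m"
 shows "l ! j \<le> l ! i"
 using assms sorted_wrt_nth_less[of "(\<ge>)" l i j] by (cases "i = j") (auto simp: partition_list_def)

text \<open>
  Columns of a partition diagram are initial segments, so a diagram is known by its column lengths.
\<close>

lemma diagram_iff:
 assumes "partition_list m l"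
 shows "(i, c) \<in> diagram l \<longleftrightarrow> i < col_length l c"
proof -
 let ?S = "{i. (i, c) \<in> diagram l}"
 have "finite ?S" by (rule finite_subset[of _ "{..<m}"]) (use assms in \<open>auto simp: diagram_def partition_list_def\<close>)
 moreover have "i \<in> ?S" if "j \<in> ?S" "i < j" for i j
  using that partition_nth_mono[OF assms, of i j] assms by (auto simp: diagram_def partition_list_def)
 ultimately have "?S = {..<card ?S}" by (rule down_closed_eq_lessThan)
 then show ?thesis unfolding col_length_def by auto
qed

lemma col_length_le: "partition_list m l ==> col_length l c \<le> m"
 unfolding col_length_def
 by (rule order_trans[OF card_mono[of "{..<m}"]]) (auto simp: diagram_def partition_list_def)

lemma col_length_antimono: "partition_list m l ==> c \<le> c' ==> col_length l c' \<le> col_length l c"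
 unfolding col_length_def
 by (rule card_mono) (auto simp: diagram_def intro: finite_subset[of _ "{..<length l}"])

lemma nparts_col_length: "nparts l = col_length l 0"
 unfolding nparts_def col_length_def length_filter_conv_card diagram_def
 by (rule arg_cong[where f = card]) auto

definition fits :: "nat list => nat => bool" where
 "fits l w \<longleftrightarrow> (\<forall>c\<ge>w. col_length l c = 0)"

lemma fits_less:
 assumes "fits l w" "0 < col_length l c"
 shows "c < w"
proof (rule ccontr)
 assume "\<not> c < w"
 then have "w \<le> c" by simp
 then have "col_length l c = 0" using assms(1)[unfolded fits_def, rule_format] by simp
 then show False using assms(2) by simp
qed

lemma fits_mono: "fits l w ==> w \<le> w' ==> fits l w'"
 by (auto simp: fits_def)

lemma ex_fits: "\<exists>w. fits l w"
proof -
 have "col_length l c = 0" if "sum_list l \<le> c" for c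
 proof -
  have "\<not> c < l ! i" if "i < length l" for i
   using that \<open>sum_list l \<le> c\<close> elem_le_sum_list[of i l] by simp
  then show ?thesis by (auto simp: col_length_def diagram_def)
 qed
 then show ?thesis by (auto simp: fits_def)
qed

definition col_set :: "nat list => tableau => nat => nat set" where
 "col_set l T c = (%i. T (i, c)) ` {..<col_length l c}"

definition col_inj :: "nat list => tableau => bool" where
 "col_inj l T \<longleftrightarrow> (\<forall>c. inj_on (%i. T (i, c)) {..<col_length l c})"

lemma card_col_set: "col_inj l T ==> card (col_set l T c) = col_length l c"
 by (simp add: col_inj_def col_set_def card_image)

lemma tableau_entry:
 assumes "partition_list m l" "T \<in> tableaux m l" "i < col_length l c"
 shows "T (i, c) < m"
proof -
 have "(i, c) \<in> diagram l" using assms diagram_iff by blast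
 then show ?thesis using assms(2) by (auto simp: tableaux_def)
qed

lemma col_set_sub: "partition_list m l ==> T \<in> tableaux m l ==> col_set l T c \<subseteq> {..<m}"
 using tableau_entry by (auto simp: col_set_def)

definition col_det :: "(nat => nat => 'a::comm_ring_1) => nat list => tableau => tableau => nat => 'a" where
 "col_det z l S T c = det (mat (col_length l c) (col_length l c) (%(a, b). z (S (a, c)) (T (b, c))))"

lemma bidet_part_eq_prod:
 assumes "fits l w"
 shows "bidet_part z l S T = (\<Prod>c<w. col_det z l S T c)"
 unfolding bidet_part_def col_det_def
proof (rule prod.mono_neutral_left)
 show "snd ` diagram l \<subseteq> {..<w}"
 proof (rule image_subsetI)
  fix ic assume "ic \<in> diagram l"
  then obtain i c where ic: "ic = (i, c)" "(i, c) \<in> diagram l" by (metis surj_pair)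
  then have "{i. (i, c) \<in> diagram l} ~= {}" by blast
  moreover have "finite {i. (i, c) \<in> diagram l}"
   by (rule finite_subset[of _ "{..<length l}"]) (auto simp: diagram_def)
  ultimately have "0 < card {i. (i, c) \<in> diagram l}" unfolding card_gt_0_iff by blast
  then have "0 < col_length l c" by (simp only: col_length_def)
  then show "snd ic \<in> {..<w}" using fits_less[OF assms] ic by simp
 qed
 show "\<forall>c\<in>{..<w} - snd ` diagram l.
   det (mat (col_length l c) (col_length l c) (%(a, b). z (S (a, c)) (T (b, c)))) = 1"
 proof
  fix c assume "c \<in> {..<w} - snd ` diagram l"
  then have "{i. (i, c) \<in> diagram l} = {}" by force
  then show "det (mat (col_length l c) (col_length l c) (%(a, b). z (S (a, c)) (T (b, c)))) = 1"
   by (simp add: col_length_def)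
 qed
qed simp

text \<open>
  Listing rows and columns in another order than the increasing one changes a minor by a sign only.
\<close>

lemma det_enumerated_minor:
 assumes "inj_on s {..<k}" "inj_on t {..<k}"
 shows "det (mat k k (%(a, b). z (s a) (t b))) \<asymp> minor z (s ` {..<k}) (t ` {..<k})"
proof -
 have perm: "det (mat k k (%(a, b). y (u a) b)) \<asymp> det (mat k k (%(a, b). y (enum_set (u ` {..<k}) a) b))"
  if u: "inj_on u {..<k}" for u and y :: "nat => nat => 'a"
 proof -
  have len: "length (sorted_list_of_set (u ` {..<k})) = k" using u by (simp add: card_image)
  have "mset (map u [0..<k]) = mset (sorted_list_of_set (u ` {..<k}))"
   by (rule iffD1[OF set_eq_iff_mset_eq_distinct]) (use u in \<open>auto simp: distinct_map atLeast0LessThan\<close>)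
  then have "mset (map y (map u [0..<k])) = mset (map y (sorted_list_of_set (u ` {..<k})))"
   by (simp only: mset_map)
  then have "rdet k (map y (map u [0..<k])) \<asymp> rdet k (map y (sorted_list_of_set (u ` {..<k})))"
   by (intro rdet_mset) auto
  moreover have "rdet k (map y (map u [0..<k])) = det (mat k k (%(a, b). y (u a) b))"
   unfolding rdet_def by (intro arg_cong[where f = det] eq_matI) auto
  moreover have "rdet k (map y (sorted_list_of_set (u ` {..<k}))) = det (mat k k (%(a, b). y (enum_set (u ` {..<k}) a) b))"
   unfolding rdet_def by (intro arg_cong[where f = det] eq_matI) (use len in auto)
  ultimately show ?thesis by simp
 qed
 let ?I = "s ` {..<k}" and ?J = "t ` {..<k}"
 have cards: "card ?I = k" "card ?J = k" using assms by (auto simp: card_image)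
 have tr: "det (mat k k (%(a, b). f a b)) = det (mat k k (%(a, b). f b a))" for f :: "nat => nat => 'a"
  by (subst det_transpose[symmetric, of _ k]) (auto intro!: arg_cong[where f = det] eq_matI)
 have "det (mat k k (%(a, b). z (s a) (t b))) \<asymp> det (mat k k (%(a, b). z (enum_set ?I a) (t b)))"
  using perm[OF assms(1), of "%i b. z i (t b)"] .
 also have "... = det (mat k k (%(a, b). z (enum_set ?I b) (t a)))" by (rule tr)
 also have "... \<asymp> det (mat k k (%(a, b). z (enum_set ?I b) (enum_set ?J a)))"
  using perm[OF assms(2), of "%j b. z (enum_set ?I b) j"] .
 also have "... = minor z ?I ?J" unfolding minor_def cards by (rule tr)
 finally show ?thesis .
qed

lemma col_det_minor:
 assumes "col_inj l S" "col_inj l T"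
 shows "col_det z l S T c \<asymp> minor z (col_set l S c) (col_set l T c)"
 unfolding col_det_def col_set_def
 using det_enumerated_minor[of "%i. S (i, c)" "col_length l c" "%i. T (i, c)" z] assms
 by (simp add: col_inj_def)

lemma bidet_part_eq_0:
 assumes "\<not> col_inj l T"
 shows "bidet_part z l S T = 0"
proof -
 obtain c where c: "\<not> inj_on (%i. T (i, c)) {..<col_length l c}" using assms by (auto simp: col_inj_def)
 then obtain a b where ab: "a < col_length l c" "b < col_length l c" "a ~= b" "T (a, c) = T (b, c)"
  by (auto simp: inj_on_def)
 obtain w where w: "fits l w" using ex_fits by blast
 have "c < w" using fits_less[OF w, of c] ab(1) by simp
 moreover have "col_det z l S T c = 0"
  unfolding col_det_def by (rule det_identical_columns[OF _ ab(3,1,2)]) (use ab in \<open>auto intro!: eq_vecI\<close>)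
 ultimately show ?thesis unfolding bidet_part_eq_prod[OF w] by (auto intro!: prod_zero)
qed

text \<open>
  The first \<open>N\<close> sets are the complements of the columns of the second tableau in reverse order, padded by full sets; then come the columns of the first tableau. The sizes of these sets decrease.
\<close>

definition rat_cols :: "nat => nat => shape => rat_tableau => nat => nat set" where
 "rat_cols m N sh T c = (if c < N then {..<m} - col_set (snd sh) (snd T) (N - Suc c)
  else col_set (fst sh) (fst T) (c - N))"

definition rat_fits :: "nat => nat => shape => bool" where
 "rat_fits N n sh \<longleftrightarrow> N \<le> n & fits (snd sh) N & fits (fst sh) (n - N)"

definition rat_shape :: "nat => shape => bool" where
 "rat_shape m sh \<longleftrightarrow> partition_list m (fst sh) & partition_list m (snd sh) &
  nparts (fst sh) + nparts (snd sh) \<le> m"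

definition rat_inj :: "shape => rat_tableau => bool" where
 "rat_inj sh T \<longleftrightarrow> col_inj (fst sh) (fst T) & col_inj (snd sh) (snd T)"

lemma rat_tableaux_iff: "T \<in> rat_tableaux m sh \<longleftrightarrow> fst T \<in> tableaux m (fst sh) & snd T \<in> tableaux m (snd sh)"
 by (cases sh; cases T) (auto simp: rat_tableaux_def)

lemma bideterminant_eq:
 "bideterminant m sh S T = bidet_part (x_fun m) (fst sh) (fst S) (fst T) * bidet_part (y_fun m) (snd sh) (snd S) (snd T)"
 by (cases sh; cases S; cases T) (simp add: bideterminant_def)

definition col_height :: "nat => nat => shape => nat => nat" where
 "col_height m N sh c = (if c < N then m - col_length (snd sh) (N - Suc c) else col_length (fst sh) (c - N))"

lemma rat_cols_sub:
 assumes "rat_shape m sh" "T \<in> rat_tableaux m sh"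
 shows "rat_cols m N sh T c \<subseteq> {..<m}"
 using assms col_set_sub by (auto simp: rat_cols_def rat_shape_def rat_tableaux_iff)

lemma card_rat_cols:
 assumes "rat_shape m sh" "T \<in> rat_tableaux m sh" "rat_inj sh T"
 shows "card (rat_cols m N sh T c) = col_height m N sh c"
proof -
 have "col_set (snd sh) (snd T) c' \<subseteq> {..<m}" for c'
  using assms col_set_sub[of m "snd sh" "snd T"] by (auto simp: rat_shape_def rat_tableaux_iff)
 then have "card ({..<m} - col_set (snd sh) (snd T) c') = m - card (col_set (snd sh) (snd T) c')" for c'
  by (subst card_Diff_subset) (auto intro: finite_subset)
 then show ?thesis
  using assms by (auto simp: rat_cols_def col_height_def card_col_set rat_inj_def)
qed

text \<open>
  Each minor in the functions \<open>y_fun\<close> costs one factor \<open>det_fract\<close> and becomes the complementary minor of the generic matrix.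
\<close>

lemma det_power_bideterminant:
 assumes sh: "rat_shape m sh" and ST: "S \<in> rat_tableaux m sh" "T \<in> rat_tableaux m sh"
  and inj: "rat_inj sh S" "rat_inj sh T" and fit: "rat_fits N n sh"
 shows "det_fract m ^ N * bideterminant m sh S T \<asymp>
  (\<Prod>c<n. minor (x_fun m) (rat_cols m N sh S c) (rat_cols m N sh T c))"
proof -
 let ?x = "x_fun m" and ?y = "y_fun m" and ?X = "generic_mat m"
 let ?f = "%c. minor ?x (rat_cols m N sh S c) (rat_cols m N sh T c)"
 have part: "partition_list m (fst sh)" "partition_list m (snd sh)" using sh by (auto simp: rat_shape_def)
 have tab: "fst S \<in> tableaux m (fst sh)" "fst T \<in> tableaux m (fst sh)"
  "snd S \<in> tableaux m (snd sh)" "snd T \<in> tableaux m (snd sh)" using ST by (auto simp: rat_tableaux_iff)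
 have ci: "col_inj (fst sh) (fst S)" "col_inj (fst sh) (fst T)" "col_inj (snd sh) (snd S)" "col_inj (snd sh) (snd T)"
  using inj by (auto simp: rat_inj_def)
 have Nn: "N \<le> n" "fits (snd sh) N" "fits (fst sh) (n - N)" using fit by (auto simp: rat_fits_def)
 have "(\<Prod>c<n. ?f c) = (\<Prod>c<N. ?f c) * (\<Prod>c = N..<n. ?f c)"
  using prod.atLeastLessThan_concat[of 0 N n ?f] Nn(1) by (simp add: atLeast0LessThan)
 moreover have "(\<Prod>c = N..<n. ?f c) = (\<Prod>c<n - N. ?f (c + N))"
  using prod.shift_bounds_nat_ivl[of ?f 0 N "n - N"] Nn(1) by (simp add: atLeast0LessThan)
 moreover have "(\<Prod>c<N. ?f c) = (\<Prod>c<N. ?f (N - Suc c))" by (rule prod.nat_diff_reindex[symmetric])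
 ultimately have split: "(\<Prod>c<n. ?f c) = (\<Prod>c<N. ?f (N - Suc c)) * (\<Prod>c<n - N. ?f (c + N))" by simp
 have xdet: "det (mat m m (%(i, j). ?x i j)) = det_fract m"
  unfolding det_generic[symmetric]
  by (rule arg_cong[where f = det], rule eq_matI) (auto simp: x_fun_def generic_mat_def)
 have xy: "(\<Sum>j<m. ?x i j * ?y k j) = (if i = k then 1 else 0)" if "i < m" "k < m" for i k
 proof -
  have "(\<Sum>j<m. ?x i j * ?y k j) = (\<Sum>j<m. xcoord ?X i j * ycoord m ?X k j)"
   using that by (intro sum.cong) (auto simp: x_fun_def y_fun_eq)
  then show ?thesis using ycoord_inverse[OF generic_GLF that] by simp
 qed
 have A: "det_fract m * col_det ?y (snd sh) (snd S) (snd T) c \<asymp> ?f (N - Suc c)" if "c < N" for c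
 proof -
  have "det_fract m * col_det ?y (snd sh) (snd S) (snd T) c \<asymp>
    det_fract m * minor ?y (col_set (snd sh) (snd S) c) (col_set (snd sh) (snd T) c)"
   by (intro sign_eq_mult sign_eq_refl col_det_minor ci)
  also have "... \<asymp> minor ?x ({..<m} - col_set (snd sh) (snd S) c) ({..<m} - col_set (snd sh) (snd T) c)"
   unfolding xdet[symmetric]
   by (rule Jacobi_complementary_minor[OF col_set_sub[OF part(2) tab(3)] col_set_sub[OF part(2) tab(4)] _ xy])
    (simp_all add: card_col_set ci)
  also have "... = ?f (N - Suc c)" using that by (simp add: rat_cols_def Suc_diff_Suc)
  finally show ?thesis .
 qed
 have eq: "det_fract m ^ N * bideterminant m sh S T =
   (\<Prod>c<N. det_fract m * col_det ?y (snd sh) (snd S) (snd T) c) * (\<Prod>c<n - N. col_det ?x (fst sh) (fst S) (fst T) c)"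
  unfolding bideterminant_eq bidet_part_eq_prod[OF Nn(2)] bidet_part_eq_prod[OF Nn(3)] prod.distrib
  by (simp add: mult_ac)
 show ?thesis
  unfolding eq split
 proof (intro sign_eq_mult sign_eq_prod)
  fix c assume "c \<in> {..<N}"
  then show "det_fract m * col_det ?y (snd sh) (snd S) (snd T) c \<asymp> ?f (N - Suc c)" using A by simp
 next
  fix c
  show "col_det ?x (fst sh) (fst S) (fst T) c \<asymp> ?f (c + N)"
   using col_det_minor[OF ci(1,2), of ?x c] by (simp add: rat_cols_def)
 qed
qed

section \<open>Standard tableaux as chains of column sets\<close>

text \<open>
  The linear order is replaced by its rank function, so that comparisons take place between natural numbers.
\<close>

definition is_rank :: "nat => (nat \<times> nat) set => (nat => nat) => bool" where
 "is_rank m r ro \<longleftrightarrow> bij_betw ro {..<m} {..<m} & (\<forall>i<m. \<forall>j<m. (i, j) \<in> r \<longleftrightarrow> ro i \<le> ro j)"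

lemma ex_rank:
 assumes "linear_order_on {..<m} r"
 shows "\<exists>ro. is_rank m r ro"
proof -
 define ro where "ro i = card {j \<in> {..<m}. (j, i) \<in> r & j ~= i}" for i
 have lin: "refl_on {..<m} r" "trans r" "antisym r" "total_on {..<m} r"
  using assms by (simp_all add: linear_order_on_def partial_order_on_def preorder_on_def)
 have refl: "(i, i) \<in> r" if "i < m" for i using refl_onD[OF lin(1)] that by simp
 have trans: "(i, k) \<in> r" if "(i, j) \<in> r" "(j, k) \<in> r" for i j k using transD[OF lin(2) that] .
 have anti: "i = j" if "(i, j) \<in> r" "(j, i) \<in> r" for i j using antisymD[OF lin(3) that] .
 have total: "(i, j) \<in> r \<or> (j, i) \<in> r" if "i < m" "j < m" for i j
  using lin(4) refl[of i] that unfolding total_on_def by (cases "i = j") auto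
 have less: "ro i < ro j" if "(i, j) \<in> r" "i ~= j" "i < m" for i j
  unfolding ro_def
 proof (rule psubset_card_mono)
  show "{k \<in> {..<m}. (k, i) \<in> r & k ~= i} \<subset> {k \<in> {..<m}. (k, j) \<in> r & k ~= j}"
   using that trans anti by blast
 qed simp
 have lt: "ro i < m" if "i < m" for i
 proof -
  have "ro i < card {..<m}" unfolding ro_def by (rule psubset_card_mono) (use that in auto)
  then show ?thesis by simp
 qed
 have inj: "inj_on ro {..<m}"
 proof (rule inj_onI)
  fix i j assume ij: "i \<in> {..<m}" "j \<in> {..<m}" "ro i = ro j"
  then show "i = j" using total[of i j] less[of i j] less[of j i] by force
 qed
 have "ro ` {..<m} = {..<m}" using lt inj by (intro endo_inj_surj) auto
 then have "bij_betw ro {..<m} {..<m}" using inj by (simp add: bij_betw_def)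
 moreover have "(i, j) \<in> r \<longleftrightarrow> ro i \<le> ro j" if "i < m" "j < m" for i j
  using that total[of i j] less[of i j] less[of j i] refl by (cases "i = j") force+
 ultimately show ?thesis unfolding is_rank_def by blast
qed

lemma col_le_trans: "col_le ro A B ==> col_le ro B C ==> col_le ro A C"
 unfolding col_le_def using le_trans by blast

lemma col_le_complement:
 assumes "A \<subseteq> {..<m}" "B \<subseteq> {..<m}" "col_le ro A B"
 shows "col_le ro ({..<m} - B) ({..<m} - A)"
proof -
 have eq: "card {x \<in> {..<m} - A. ro x < s} = card {x \<in> {..<m}. ro x < s} - card {x \<in> A. ro x < s}"
  if "A \<subseteq> {..<m}" for A s
 proof -
  have "{x \<in> {..<m} - A. ro x < s} = {x \<in> {..<m}. ro x < s} - {x \<in> A. ro x < s}" by auto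
  then show ?thesis using that by (simp add: card_Diff_subset finite_subset[of "{x \<in> A. ro x < s}" "{..<m}"] subset_iff)
 qed
 show ?thesis using assms(3) unfolding col_le_def eq[OF assms(1)] eq[OF assms(2)] by (simp add: diff_le_mono2)
qed

context
 fixes m :: nat and r :: "(nat \<times> nat) set" and ro :: "nat => nat"
 assumes rank: "is_rank m r ro"
begin

lemma rank_bij: "bij_betw ro {..<m} {..<m}"
 using rank by (simp add: is_rank_def)

lemma rank_iff: "i < m ==> j < m ==> (i, j) \<in> r \<longleftrightarrow> ro i \<le> ro j"
 using rank by (simp add: is_rank_def)

lemma rank_eq_iff: "i < m ==> j < m ==> ro i = ro j \<longleftrightarrow> i = j"
 using inj_rank[OF rank_bij] by (auto simp: inj_on_def)

lemma rank_less_iff: "i < m ==> j < m ==> (i, j) \<in> r & i ~= j \<longleftrightarrow> ro i < ro j"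
 by (auto simp: rank_iff rank_eq_iff[symmetric] order_less_le)

lemma std_tableau_iff:
 assumes l: "partition_list m l" and T: "T \<in> tableaux m l"
 shows "std_tableau r l T \<longleftrightarrow>
  (\<forall>c a a'. a < a' & a' < col_length l c --> ro (T (a, c)) < ro (T (a', c))) &
  (\<forall>c c' a. c < c' & a < col_length l c' --> ro (T (a, c)) \<le> ro (T (a, c')))"
proof -
 note e = tableau_entry[OF l T]
 have "(T (i, j), T (i', j)) \<in> r & T (i, j) ~= T (i', j) \<longleftrightarrow> ro (T (i, j)) < ro (T (i', j))"
  if "(i, j) \<in> diagram l" "(i', j) \<in> diagram l" for i i' j
  using that unfolding diagram_iff[OF l] by (intro rank_less_iff e)
 moreover have "(T (i, j), T (i, j')) \<in> r \<longleftrightarrow> ro (T (i, j)) \<le> ro (T (i, j'))"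
  if "(i, j) \<in> diagram l" "(i, j') \<in> diagram l" for i j j'
  using that unfolding diagram_iff[OF l] by (intro rank_iff e)
 ultimately have "std_tableau r l T \<longleftrightarrow>
  (\<forall>i i' j. i < i' & (i, j) \<in> diagram l & (i', j) \<in> diagram l --> ro (T (i, j)) < ro (T (i', j))) &
  (\<forall>i j j'. j < j' & (i, j) \<in> diagram l & (i, j') \<in> diagram l --> ro (T (i, j)) \<le> ro (T (i, j')))"
  unfolding std_tableau_def by (simp cong: imp_cong conj_cong)
 also have "... \<longleftrightarrow> (\<forall>c a a'. a < a' & a' < col_length l c --> ro (T (a, c)) < ro (T (a', c))) &
  (\<forall>c c' a. c < c' & a < col_length l c' --> ro (T (a, c)) \<le> ro (T (a, c')))"
 proof -
  have "a < a' & a < col_length l c & a' < col_length l c \<longleftrightarrow> a < a' & a' < col_length l c" for a a' c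
   by auto
  moreover have "c < c' & a < col_length l c & a < col_length l c' \<longleftrightarrow> c < c' & a < col_length l c'" for a c c'
   using col_length_antimono[OF l, of c c'] by auto
  ultimately show ?thesis unfolding diagram_iff[OF l] by simp blast
 qed
 finally show ?thesis .
qed

lemma std_tableau_col_inj:
 assumes l: "partition_list m l" and T: "T \<in> tableaux m l" and std: "std_tableau r l T"
 shows "col_inj l T"
 unfolding col_inj_def
proof (intro allI inj_onI)
 fix c a a' assume "a \<in> {..<col_length l c}" "a' \<in> {..<col_length l c}" "T (a, c) = T (a', c)"
 then show "a = a'" using std unfolding std_tableau_iff[OF l T]
  by (metis lessThan_iff less_irrefl nat_neq_iff)
qed

lemma std_tableau_col_le:
 assumes l: "partition_list m l" and T: "T \<in> tableaux m l" and std: "std_tableau r l T" and c: "c \<le> c'"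
 shows "col_le ro (col_set l T c) (col_set l T c')"
 unfolding col_le_def
proof
 fix s
 have inj: "inj_on (%i. T (i, c)) {..<col_length l c}" for c
  using std_tableau_col_inj[OF l T std] by (simp add: col_inj_def)
 have card: "card {x \<in> col_set l T c. ro x < s} = card {a. a < col_length l c & ro (T (a, c)) < s}" for c
 proof -
  have "{x \<in> col_set l T c. ro x < s} = (%a. T (a, c)) ` {a. a < col_length l c & ro (T (a, c)) < s}"
   by (auto simp: col_set_def)
  then show ?thesis using inj by (simp add: card_image inj_on_subset[OF inj] subset_iff)
 qed
 show "card {x \<in> col_set l T c'. ro x < s} \<le> card {x \<in> col_set l T c. ro x < s}"
  unfolding card
 proof (rule card_mono)
  show "{a. a < col_length l c' & ro (T (a, c')) < s} \<subseteq> {a. a < col_length l c & ro (T (a, c)) < s}"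
  proof (cases "c = c'")
   case False
   then have "c < c'" using c by simp
   then show ?thesis
    using std col_length_antimono[OF l c] unfolding std_tableau_iff[OF l T] by fastforce
  qed simp
 qed simp
qed

text \<open>
  Passing to the complement in the second set turns the counting condition into comparability of columns.
\<close>

lemma std_pair_iff:
 assumes F: "F1 \<subseteq> {..<m}" "F2 \<subseteq> {..<m}"
 shows "std_pair m r F1 F2 \<longleftrightarrow> col_le ro ({..<m} - F2) F1"
proof -
 have fin: "finite F1" "finite F2" using F by (auto intro: finite_subset)
 have count: "card {i \<in> F. (i, j) \<in> r} = card {x \<in> F. ro x < Suc (ro j)}" if "F \<subseteq> {..<m}" "j < m" for F j
  by (rule arg_cong[where f = card]) (use that rank_iff in \<open>auto simp: less_Suc_eq_le\<close>)
 have compl: "card {x \<in> {..<m} - F2. ro x < s} + card {x \<in> F2. ro x < s} = card {x \<in> {..<m}. ro x < s}" for s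
  using fin F by (subst card_Un_disjoint[symmetric]) (auto intro!: arg_cong[where f = card])
 have "std_pair m r F1 F2 \<longleftrightarrow> (\<forall>j<m. card {x \<in> F1. ro x < Suc (ro j)} \<le> card {x \<in> {..<m} - F2. ro x < Suc (ro j)})"
  unfolding std_pair_def
 proof (intro all_cong)
  fix j assume j: "j < m"
  show "(card {i \<in> F1. (i, j) \<in> r} + card {i \<in> F2. (i, j) \<in> r} \<le> card {i \<in> {..<m}. (i, j) \<in> r}) =
   (card {x \<in> F1. ro x < Suc (ro j)} \<le> card {x \<in> {..<m} - F2. ro x < Suc (ro j)})"
   using compl[of "Suc (ro j)"] unfolding count[OF F(1) j] count[OF F(2) j] count[OF subset_refl j] by linarith
 qed
 also have "... \<longleftrightarrow> col_le ro ({..<m} - F2) F1"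
 proof
  assume *: "\<forall>j<m. card {x \<in> F1. ro x < Suc (ro j)} \<le> card {x \<in> {..<m} - F2. ro x < Suc (ro j)}"
  show "col_le ro ({..<m} - F2) F1"
   unfolding col_le_def
  proof
   fix s
   have min: "{x \<in> F. ro x < s} = {x \<in> F. ro x < min s m}" if "F \<subseteq> {..<m}" for F
    using that rank_less[OF rank_bij] by auto
   show "card {x \<in> F1. ro x < s} \<le> card {x \<in> {..<m} - F2. ro x < s}"
   proof (cases "min s m")
    case 0
    have "card {x \<in> F1. ro x < s} = 0" unfolding min[OF F(1)] 0 by simp
    then show ?thesis by linarith
   next
    case (Suc t)
    then have "t \<in> ro ` {..<m}" unfolding bij_betw_imp_surj_on[OF rank_bij] by simp
    then obtain j where "j < m" "ro j = t" by auto
    then have "card {x \<in> F1. ro x < Suc t} \<le> card {x \<in> {..<m} - F2. ro x < Suc t}" using * by blast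
    then show ?thesis unfolding min[OF F(1)] min[OF Diff_subset, of F2] Suc .
   qed
  qed
 qed (auto simp: col_le_def)
 finally show ?thesis .
qed

lemma std_rat_iff:
 "T \<in> std_rat_tableaux m r sh \<longleftrightarrow> T \<in> rat_tableaux m sh & std_tableau r (fst sh) (fst T) &
  std_tableau r (snd sh) (snd T) & std_pair m r (first_col (fst sh) (fst T)) (first_col (snd sh) (snd T))"
 by (cases sh; cases T) (auto simp: std_rat_tableaux_def)

lemma first_col_eq: "partition_list m l ==> first_col l T = col_set l T 0"
 unfolding first_col_def col_set_def by (auto simp: diagram_iff)

lemma std_rat_inj:
 assumes "rat_shape m sh" "T \<in> std_rat_tableaux m r sh"
 shows "rat_inj sh T"
 using assms std_tableau_col_inj by (auto simp: std_rat_iff rat_shape_def rat_inj_def rat_tableaux_iff)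

text \<open>
  The three standardness conditions are the comparisons inside the complemented columns, inside the plain columns, and at the place where the two meet.
\<close>

lemma std_rat_cols_chain:
 assumes sh: "rat_shape m sh" and T: "T \<in> std_rat_tableaux m r sh" and c: "c \<le> c'"
 shows "col_le ro (rat_cols m N sh T c) (rat_cols m N sh T c')"
proof -
 let ?C1 = "col_set (fst sh) (fst T)" and ?C2 = "col_set (snd sh) (snd T)"
 have part: "partition_list m (fst sh)" "partition_list m (snd sh)" using sh by (auto simp: rat_shape_def)
 have tab: "fst T \<in> tableaux m (fst sh)" "snd T \<in> tableaux m (snd sh)"
  and std: "std_tableau r (fst sh) (fst T)" "std_tableau r (snd sh) (snd T)"
  and pair: "std_pair m r (?C1 0) (?C2 0)"
  using T by (auto simp: std_rat_iff rat_tableaux_iff first_col_eq part)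
 have sub: "?C1 c \<subseteq> {..<m}" "?C2 c \<subseteq> {..<m}" for c
  using col_set_sub part tab by blast+
 have one: "col_le ro (?C1 a) (?C1 b)" if "a \<le> b" for a b
  using std_tableau_col_le[OF part(1) tab(1) std(1) that] .
 have two: "col_le ro ({..<m} - ?C2 b) ({..<m} - ?C2 a)" if "a \<le> b" for a b
  using col_le_complement[OF sub(2) sub(2) std_tableau_col_le[OF part(2) tab(2) std(2) that]] .
 have mid: "col_le ro ({..<m} - ?C2 0) (?C1 0)" using pair std_pair_iff sub by blast
 consider "c' < N" | "c < N" "N \<le> c'" | "N \<le> c" using c by linarith
 then show ?thesis
 proof cases
  case 1
  then show ?thesis using two[of "N - Suc c'" "N - Suc c"] c by (auto simp: rat_cols_def)
 next
  case 2
  have "col_le ro ({..<m} - ?C2 (N - Suc c)) (?C1 (c' - N))"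
   by (rule col_le_trans[OF two[of 0] col_le_trans[OF mid one[of 0]]]) auto
  then show ?thesis using 2 by (simp add: rat_cols_def)
 next
  case 3
  then show ?thesis using one[of "c - N" "c' - N"] c by (auto simp: rat_cols_def)
 qed
qed

lemma increasing_enum_unique:
 fixes k :: nat
 assumes "!!a b. a < b ==> b < k ==> ro (f a) < ro (f b)" "!!a b. a < b ==> b < k ==> ro (g a) < ro (g b)"
  and "f ` {..<k} = g ` {..<k}" "!!a. a < k ==> f a < m" and a: "a < k"
 shows "f a = g a"
proof -
 have sorted: "sorted_wrt (<) (map (%a. ro (f a)) [0..<k])"
  if "!!a b. a < b ==> b < k ==> ro (f a) < ro (f b)" for f
  using that by (auto simp: sorted_wrt_iff_nth_less)
 have "(%a. ro (f a)) ` {..<k} = (%a. ro (g a)) ` {..<k}" using assms(3) by (metis image_image)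
 then have "map (%a. ro (f a)) [0..<k] = map (%a. ro (g a)) [0..<k]"
  by (intro strict_sorted_equal sorted assms(1,2)) (auto simp: atLeast0LessThan)
 then have "ro (f a) = ro (g a)" using a by (simp add: list_eq_iff_nth_eq)
 moreover have "g a < m" using assms(3,4) a by (metis imageE imageI lessThan_iff)
 ultimately show ?thesis using rank_eq_iff assms(4)[OF a] by blast
qed

text \<open>
  The entries of a standard column are the increasing enumeration of its set, so the column sets determine the tableau.
\<close>

lemma std_rat_cols_inject:
 assumes sh: "rat_shape m sh" and T: "T \<in> std_rat_tableaux m r sh" and T': "T' \<in> std_rat_tableaux m r sh"
  and fit: "rat_fits N n sh" and eq: "!!c. c < n ==> rat_cols m N sh T c = rat_cols m N sh T' c"
 shows "T = T'"
proof -
 have part: "partition_list m (fst sh)" "partition_list m (snd sh)" using sh by (auto simp: rat_shape_def)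
 have Nn: "N \<le> n" "fits (snd sh) N" "fits (fst sh) (n - N)" using fit by (auto simp: rat_fits_def)
 have tab: "t = t'" if l: "partition_list m l" and t: "t \<in> tableaux m l" "std_tableau r l t"
  and t': "t' \<in> tableaux m l" "std_tableau r l t'" and w: "fits l w"
  and cols: "!!c. c < w ==> col_set l t c = col_set l t' c" for l t t' w
 proof
  fix ic show "t ic = t' ic"
  proof (cases "ic \<in> diagram l")
   case True
   obtain i c where ic: "ic = (i, c)" by force
   have i: "i < col_length l c" using True ic diagram_iff[OF l] by blast
   then have "c < w" using fits_less[OF w, of c] by simp
   then have "(%i. t (i, c)) ` {..<col_length l c} = (%i. t' (i, c)) ` {..<col_length l c}"
    using cols by (simp add: col_set_def)
   then have "t (i, c) = t' (i, c)"
    using increasing_enum_unique[of "col_length l c" "%i. t (i, c)" "%i. t' (i, c)" i] i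
     t t' std_tableau_iff[OF l] tableau_entry[OF l t(1)] by blast
   then show ?thesis using ic by simp
  next
   case False
   then show ?thesis using PiE_arb t(1) t'(1) unfolding tableaux_def by metis
  qed
 qed
 have "fst T = fst T'"
 proof (rule tab[OF part(1) _ _ _ _ Nn(3)])
  fix c assume "c < n - N"
  then show "col_set (fst sh) (fst T) c = col_set (fst sh) (fst T') c"
   using eq[of "c + N"] by (simp add: rat_cols_def)
 qed (use T T' in \<open>auto simp: std_rat_iff rat_tableaux_iff\<close>)
 moreover have "snd T = snd T'"
 proof (rule tab[OF part(2) _ _ _ _ Nn(2)])
  fix c assume c: "c < N"
  then have "{..<m} - col_set (snd sh) (snd T) c = {..<m} - col_set (snd sh) (snd T') c"
   using eq[of "N - Suc c"] Nn(1) by (simp add: rat_cols_def Suc_diff_Suc)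
  moreover have "col_set (snd sh) (snd T) c \<subseteq> {..<m}" "col_set (snd sh) (snd T') c \<subseteq> {..<m}"
   using T T' col_set_sub[OF part(2)] by (auto simp: std_rat_iff rat_tableaux_iff)
  ultimately show "col_set (snd sh) (snd T) c = col_set (snd sh) (snd T') c" by blast
 qed (use T T' in \<open>auto simp: std_rat_iff rat_tableaux_iff\<close>)
 ultimately show ?thesis by (simp add: prod_eq_iff)
qed

end

section \<open>Standard bideterminants span\<close>

lemma enum_set_less_iff:
 assumes A: "finite A" and a: "a < card A"
 shows "enum_set A a < s \<longleftrightarrow> a < card {x \<in> A. x < s}"
proof -
 let ?I = "{i. i < card A & enum_set A i < s}"
 have "j < card A ==> i < j ==> enum_set A i < enum_set A j" for i j
  using sorted_wrt_nth_less[OF strict_sorted_list_of_set, of i j A] by simp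
 then have "?I = {..<card ?I}"
  by (intro down_closed_eq_lessThan) (auto intro: less_trans)
 moreover have "card ?I = card {x \<in> A. x < s}"
 proof -
  have bij: "bij_betw (enum_set A) {..<card A} A" using enum_set_bij[OF A] .
  have "card ?I = card (enum_set A ` ?I)"
   by (rule card_image[symmetric]) (rule inj_on_subset[OF bij_betw_imp_inj_on[OF bij]], auto)
  also have "enum_set A ` ?I = {x \<in> enum_set A ` {..<card A}. x < s}" by auto
  also have "... = {x \<in> A. x < s}" unfolding bij_betw_imp_surj_on[OF bij] ..
  finally show ?thesis .
 qed
 ultimately have "?I = {..<card {x \<in> A. x < s}}" by simp
 then have "a \<in> ?I \<longleftrightarrow> a \<in> {..<card {x \<in> A. x < s}}" by (rule arg_cong)
 then show ?thesis using a by simp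
qed

text \<open>
  The partition with prescribed column lengths is obtained by counting the columns that reach each row.
\<close>

lemma conjugate_partition:
 assumes h: "!!c c'. c \<le> c' ==> h c' \<le> h c" "!!c. h c \<le> m" "!!c. w \<le> c ==> h c = 0"
 shows "\<exists>l. partition_list m l & fits l w & (\<forall>c. col_length l c = h c)"
proof -
 define l where "l = map (%i. card {c. c < w & i < h c}) [0..<m]"
 have part: "partition_list m l"
  unfolding partition_list_def
 proof
  show "length l = m" by (simp add: l_def)
  show "sorted_wrt (\<ge>) l"
   unfolding sorted_wrt_iff_nth_less
   by (auto simp: l_def intro!: card_mono)
 qed
 have nth: "c < l ! i \<longleftrightarrow> i < h c" if "i < m" for i c
 proof -
  have "{c. c < w & i < h c} = {..<card {c. c < w & i < h c}}"
   by (rule down_closed_eq_lessThan) (use h(1) in \<open>auto intro: less_le_trans\<close>)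
  then have "c \<in> {..<l ! i} \<longleftrightarrow> c < w & i < h c" using that by (auto simp: l_def)
  moreover have "c < w" if "i < h c" using h(3)[of c] that by (cases "w \<le> c") auto
  ultimately show ?thesis by auto
 qed
 have "col_length l c = h c" for c
 proof -
  have "{i. (i, c) \<in> diagram l} = {..<h c}"
   using nth h(2)[of c] by (auto simp: diagram_def l_def)
  then show ?thesis by (simp add: col_length_def)
 qed
 moreover from this have "fits l w" using h(3) by (simp add: fits_def)
 ultimately show ?thesis using part by blast
qed

lemma col_le_empty: "col_le ro A {}"
 by (simp add: col_le_def)

lemma col_le_full: "F \<subseteq> {..<m} ==> col_le ro {..<m} F"
 unfolding col_le_def by (intro allI card_mono) auto

lemma ex_rat_shape:
 assumes k: "!!c c'. c \<le> c' ==> c' < n ==> k c' \<le> k c" "!!c. c < n ==> k c \<le> m" and N: "N \<le> n"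
 shows "\<exists>sh. rat_shape m sh & rat_fits N n sh & (\<forall>c<n. col_height m N sh c = k c)"
proof -
 define h1 where "h1 c = (if c + N < n then k (c + N) else 0)" for c
 define h2 where "h2 c = (if c < N then m - k (N - Suc c) else 0)" for c
 have "\<exists>l. partition_list m l & fits l (n - N) & (\<forall>c. col_length l c = h1 c)"
 proof (rule conjugate_partition)
  show "h1 c' \<le> h1 c" if "c \<le> c'" for c c'
   using k(1)[of "c + N" "c' + N"] that by (simp add: h1_def)
  show "h1 c \<le> m" for c using k(2)[of "c + N"] by (simp add: h1_def)
  show "h1 c = 0" if "n - N \<le> c" for c using that by (simp add: h1_def)
 qed
 then obtain l1 where l1: "partition_list m l1" "fits l1 (n - N)" "!!c. col_length l1 c = h1 c"
  by blast
 have "\<exists>l. partition_list m l & fits l N & (\<forall>c. col_length l c = h2 c)"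
 proof (rule conjugate_partition)
  show "h2 c' \<le> h2 c" if "c \<le> c'" for c c'
  proof (cases "c' < N")
   case True
   then have "k (N - Suc c) \<le> k (N - Suc c')" using k(1)[of "N - Suc c'" "N - Suc c"] that N by simp
   then show ?thesis using True that by (simp add: h2_def)
  qed (simp add: h2_def)
 qed (simp_all add: h2_def)
 then obtain l2 where l2: "partition_list m l2" "fits l2 N" "!!c. col_length l2 c = h2 c"
  by blast
 have "nparts l1 + nparts l2 \<le> m"
  unfolding nparts_col_length l1(3) l2(3) using k(1)[of "N - Suc 0" N] k(2)[of N] k(2)[of "N - Suc 0"] N
  by (auto simp: h1_def h2_def)
 then have "rat_shape m (l1, l2)" using l1 l2 by (simp add: rat_shape_def)
 moreover have "rat_fits N n (l1, l2)" using l1 l2 N by (simp add: rat_fits_def)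
 moreover have "col_height m N (l1, l2) c = k c" if "c < n" for c
  using that k(2)[OF that] N by (auto simp: col_height_def l1(3) l2(3) h1_def h2_def Suc_diff_Suc)
 ultimately show ?thesis by blast
qed

lemma bracket_dominant:
 assumes "rat_shape m sh"
 shows "bracket (fst sh) (snd sh) \<in> dominant m"
proof -
 let ?l1 = "fst sh" and ?l2 = "snd sh"
 have p: "partition_list m ?l1" "partition_list m ?l2" using assms by (auto simp: rat_shape_def)
 then have len: "length ?l1 = m" "length ?l2 = m" by (auto simp: partition_list_def)
 have nth: "bracket ?l1 ?l2 ! i = int (?l1 ! i) - int (?l2 ! (m - Suc i))" if "i < m" for i
  using that len by (simp add: bracket_def rev_nth)
 have "bracket ?l1 ?l2 ! j \<le> bracket ?l1 ?l2 ! i" if "i < j" "j < m" for i j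
 proof -
  have "?l1 ! j \<le> ?l1 ! i" using that by (intro partition_nth_mono[OF p(1)]) auto
  moreover have "?l2 ! (m - Suc i) \<le> ?l2 ! (m - Suc j)" using that by (intro partition_nth_mono[OF p(2)]) auto
  ultimately show ?thesis using that by (simp add: nth)
 qed
 then show ?thesis
  using len by (auto simp: dominant_def bracket_def sorted_wrt_iff_nth_less)
qed

lemma shapes_of_iff: "sh \<in> shapes_of m lam \<longleftrightarrow> rat_shape m sh & lam = bracket (fst sh) (snd sh)"
 by (cases sh) (auto simp: shapes_of_def rat_shape_def)

lemma std_bitableaux_iff:
 "(sh, S, T) \<in> std_bitableaux m r \<pi> \<longleftrightarrow> rat_shape m sh & bracket (fst sh) (snd sh) \<in> \<pi> &
  S \<in> std_rat_tableaux m r sh & T \<in> std_rat_tableaux m r sh"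
 by (auto simp: std_bitableaux_def shapes_of_iff)

lemma bitableaux_iff:
 "(sh, S, T) \<in> bitableaux m \<pi> \<longleftrightarrow> rat_shape m sh & bracket (fst sh) (snd sh) \<in> \<pi> &
  S \<in> rat_tableaux m sh & T \<in> rat_tableaux m sh"
 by (auto simp: bitableaux_def shapes_of_iff)

abbreviation bidet :: "nat => shape \<times> rat_tableau \<times> rat_tableau => zfrac" where
 "bidet m \<equiv> (%(sh, S, T). bideterminant m sh S T)"

context
 fixes m :: nat and r :: "(nat \<times> nat) set" and ro :: "nat => nat"
 assumes rank: "is_rank m r ro"
begin

definition rank_enum :: "nat set => nat => nat" where
 "rank_enum J a = the_inv_into {..<m} ro (enum_set (ro ` J) a)"

lemma rank_enum:
 assumes J: "J \<subseteq> {..<m}"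
 shows "a < card J ==> ro (rank_enum J a) = enum_set (ro ` J) a" "rank_enum J ` {..<card J} = J"
proof -
 note bij = rank_bij[OF rank]
 have fin: "finite J" using J by (auto intro: finite_subset)
 have card: "card (ro ` J) = card J" using inj_rank_sub[OF bij J] by (rule card_image)
 have b: "bij_betw (enum_set (ro ` J)) {..<card J} (ro ` J)" using enum_set_bij[of "ro ` J"] fin card by simp
 have in_im: "enum_set (ro ` J) a \<in> ro ` J" if "a < card J" for a using b that by (auto simp: bij_betw_def)
 show "ro (rank_enum J a) = enum_set (ro ` J) a" if "a < card J" for a
  unfolding rank_enum_def using in_im[OF that] J by (intro f_the_inv_into_f inj_rank[OF bij]) auto
 have inv: "the_inv_into {..<m} ro ` ro ` J = J"
  using J the_inv_into_f_f[OF inj_rank[OF bij]] by (force simp: image_iff)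
 have "rank_enum J ` {..<card J} = the_inv_into {..<m} ro ` enum_set (ro ` J) ` {..<card J}"
  by (auto simp: rank_enum_def)
 then show "rank_enum J ` {..<card J} = J" using inv bij_betw_imp_surj_on[OF b] by simp
qed

lemma rank_enum_mono:
 assumes A: "A \<subseteq> {..<m}" and B: "B \<subseteq> {..<m}" and le: "col_le ro A B" and a: "a < card A" "a < card B"
 shows "ro (rank_enum A a) \<le> ro (rank_enum B a)"
proof -
 let ?s = "Suc (enum_set (ro ` B) a)"
 have cnt: "card {y \<in> ro ` J. y < s} = card {x \<in> J. ro x < s}" if "J \<subseteq> {..<m}" for J s
 proof -
  have "{y \<in> ro ` J. y < s} = ro ` {x \<in> J. ro x < s}" by auto
  moreover have "inj_on ro {x \<in> J. ro x < s}"
   using that by (intro inj_rank_sub[OF rank_bij[OF rank]]) auto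
  ultimately show ?thesis by (simp add: card_image)
 qed
 have card: "card (ro ` J) = card J" "finite (ro ` J)" if "J \<subseteq> {..<m}" for J
  using that card_image[OF inj_rank_sub[OF rank_bij[OF rank] that]] by (auto intro: finite_subset)
 have "a < card {y \<in> ro ` B. y < ?s}"
  using enum_set_less_iff[OF card(2)[OF B], of a ?s] a card(1)[OF B] by simp
 also have "... \<le> card {y \<in> ro ` A. y < ?s}"
  unfolding cnt[OF A] cnt[OF B] using le by (simp add: col_le_def)
 finally have "enum_set (ro ` A) a < ?s"
  using enum_set_less_iff[OF card(2)[OF A], of a ?s] a card(1)[OF A] by simp
 then show ?thesis using rank_enum(1)[OF A a(1)] rank_enum(1)[OF B a(2)] by simp
qed

lemma rank_enum_less:
 assumes "J \<subseteq> {..<m}" "a < b" "b < card J"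
 shows "ro (rank_enum J a) < ro (rank_enum J b)"
proof -
 have "card (ro ` J) = card J" using inj_rank_sub[OF rank_bij[OF rank] assms(1)] by (rule card_image)
 then have "enum_set (ro ` J) a < enum_set (ro ` J) b"
  using sorted_wrt_nth_less[OF strict_sorted_list_of_set, of a b "ro ` J"] assms by simp
 then show ?thesis using rank_enum(1)[OF assms(1)] assms by simp
qed

lemma ex_std_tableau:
 assumes l: "partition_list m l" and J: "!!c. J c \<subseteq> {..<m}" "!!c. card (J c) = col_length l c"
  "!!c c'. c \<le> c' ==> col_le ro (J c) (J c')"
 shows "\<exists>T \<in> tableaux m l. std_tableau r l T & (\<forall>c. col_set l T c = J c)"
proof
 define T where "T = restrict (%(a, c). rank_enum (J c) a) (diagram l)"
 have nth: "T (a, c) = rank_enum (J c) a" if "a < col_length l c" for a c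
  using that diagram_iff[OF l] by (simp add: T_def)
 have sets: "col_set l T c = J c" for c
  using rank_enum(2)[OF J(1)[of c]] nth unfolding col_set_def J(2) by simp
 show tab: "T \<in> tableaux m l"
  unfolding tableaux_def
 proof (rule PiE_I)
  fix ic assume "ic \<in> diagram l"
  then obtain i c where "ic = (i, c)" "i < col_length l c" using diagram_iff[OF l] by (metis surj_pair)
  then have "T ic \<in> col_set l T c" by (auto simp: col_set_def)
  then show "T ic \<in> {..<m}" using J(1) sets by auto
 qed (simp add: T_def)
 have "std_tableau r l T"
  unfolding std_tableau_iff[OF rank l tab]
 proof (intro conjI allI impI)
  fix c a a' assume "a < a' & a' < col_length l c"
  then show "ro (T (a, c)) < ro (T (a', c))"
   using rank_enum_less[OF J(1)[of c], of a a'] by (simp add: nth J(2))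
 next
  fix c c' a assume a: "c < c' & a < col_length l c'"
  then have "a < col_length l c" using col_length_antimono[OF l, of c c'] by simp
  then show "ro (T (a, c)) \<le> ro (T (a, c'))"
   using rank_enum_mono[OF J(1) J(1) J(3)[of c c'], of a] a by (simp add: nth J(2))
 qed
 then show "std_tableau r l T & (\<forall>c. col_set l T c = J c)" using sets by blast
qed

lemma ex_std_rat_tableau:
 assumes sh: "rat_shape m sh" and fit: "rat_fits N n sh"
  and K: "!!c. c < n ==> K c \<subseteq> {..<m}" "!!c. c < n ==> card (K c) = col_height m N sh c"
  "!!c c'. c \<le> c' ==> c' < n ==> col_le ro (K c) (K c')"
 shows "\<exists>T \<in> std_rat_tableaux m r sh. \<forall>c<n. rat_cols m N sh T c = K c"
proof -
 have part: "partition_list m (fst sh)" "partition_list m (snd sh)" using sh by (auto simp: rat_shape_def)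
 have Nn: "N \<le> n" "fits (snd sh) N" "fits (fst sh) (n - N)" using fit by (auto simp: rat_fits_def)
 define J1 where "J1 c = (if c + N < n then K (c + N) else {})" for c
 define J2 where "J2 c = (if c < N then {..<m} - K (N - Suc c) else {})" for c
 have "\<exists>T \<in> tableaux m (fst sh). std_tableau r (fst sh) T & (\<forall>c. col_set (fst sh) T c = J1 c)"
 proof (rule ex_std_tableau[OF part(1)])
  show "J1 c \<subseteq> {..<m}" for c using K(1) by (auto simp: J1_def)
  show "card (J1 c) = col_length (fst sh) c" for c
   using K(2)[of "c + N"] Nn(3) by (auto simp: J1_def col_height_def fits_def)
  show "col_le ro (J1 c) (J1 c')" if "c \<le> c'" for c c'
   using K(3)[of "c + N" "c' + N"] that by (auto simp: J1_def col_le_empty)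
 qed
 then obtain T1 where T1: "T1 \<in> tableaux m (fst sh)" "std_tableau r (fst sh) T1"
  "!!c. col_set (fst sh) T1 c = J1 c" by blast
 have "\<exists>T \<in> tableaux m (snd sh). std_tableau r (snd sh) T & (\<forall>c. col_set (snd sh) T c = J2 c)"
 proof (rule ex_std_tableau[OF part(2)])
  show "J2 c \<subseteq> {..<m}" for c by (auto simp: J2_def)
  show "card (J2 c) = col_length (snd sh) c" for c
  proof (cases "c < N")
   case True
   then have *: "N - Suc c < n" "N - Suc c < N" using Nn(1) by auto
   have "card ({..<m} - K (N - Suc c)) = m - card (K (N - Suc c))"
    using K(1)[OF *(1)] by (subst card_Diff_subset) (auto intro: finite_subset)
   also have "... = m - (m - col_length (snd sh) c)"
    unfolding K(2)[OF *(1)] using True by (simp add: col_height_def Suc_diff_Suc)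
   finally show ?thesis using True col_length_le[OF part(2), of c] by (simp add: J2_def)
  next
   case False
   then show ?thesis using Nn(2) by (simp add: J2_def fits_def)
  qed
  show "col_le ro (J2 c) (J2 c')" if "c \<le> c'" for c c'
  proof (cases "c' < N")
   case True
   have "col_le ro ({..<m} - K (N - Suc c)) ({..<m} - K (N - Suc c'))"
    using that True Nn(1) by (intro col_le_complement K(1) K(3)) auto
   then show ?thesis using True that by (simp add: J2_def)
  qed (simp add: J2_def col_le_empty)
 qed
 then obtain T2 where T2: "T2 \<in> tableaux m (snd sh)" "std_tableau r (snd sh) T2"
  "!!c. col_set (snd sh) T2 c = J2 c" by blast
 have J1m: "J1 0 \<subseteq> {..<m}" using K(1) by (auto simp: J1_def)
 have "col_le ro ({..<m} - J2 0) (J1 0)"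
 proof (cases "N = 0")
  case True
  then show ?thesis using J1m by (simp add: J2_def col_le_full)
 next
  case False
  then have "K (N - Suc 0) \<subseteq> {..<m}" using Nn(1) by (intro K(1)) simp
  then have "{..<m} - J2 0 = K (N - Suc 0)" using False by (auto simp: J2_def)
  then show ?thesis using K(3)[of "N - Suc 0" N] by (simp add: J1_def col_le_empty)
 qed
 then have pair: "std_pair m r (J1 0) (J2 0)"
  using std_pair_iff[OF rank J1m, of "J2 0"] by (auto simp: J2_def)
 have "(T1, T2) \<in> std_rat_tableaux m r sh"
  unfolding std_rat_iff[OF rank] rat_tableaux_iff first_col_eq[OF rank part(1)] first_col_eq[OF rank part(2)]
  using T1 T2 pair by simp
 moreover have "rat_cols m N sh (T1, T2) c = K c" if "c < n" for c
  using K(1)[OF that] that Nn(1) by (auto simp: rat_cols_def T1(3) T2(3) J1_def J2_def Suc_diff_Suc)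
 ultimately show ?thesis by blast
qed

text \<open>
  A chain of at least \<open>N\<close> pairs of sets is cut after \<open>N\<close> of them; complements of the first part fill the second tableau and the rest fills the first one.
\<close>

lemma chain_is_std_bideterminant:
 assumes qs: "set qs \<subseteq> minor_pairs m" "sorted_wrt (%(I, J) (I', J'). col_le ro I I' & col_le ro J J') qs"
  and N: "N \<le> length qs"
 shows "\<exists>ka \<in> std_bitableaux m r (dominant m). det_fract m ^ N * bidet m ka \<asymp> (\<Prod>(I, J)\<leftarrow>qs. minor (x_fun m) I J)"
proof -
 let ?n = "length qs" and ?I = "%c. fst (qs ! c)" and ?J = "%c. snd (qs ! c)"
 have IJ: "?I c \<subseteq> {..<m}" "?J c \<subseteq> {..<m}" "card (?I c) = card (?J c)" if "c < ?n" for c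
 proof -
  have "qs ! c \<in> minor_pairs m" using qs(1) nth_mem[OF that] by blast
  then show "?I c \<subseteq> {..<m}" "?J c \<subseteq> {..<m}" "card (?I c) = card (?J c)"
   by (cases "qs ! c"; simp add: minor_pairs_def)+
 qed
 have refl: "col_le ro A A" for A by (simp add: col_le_def)
 have chain: "col_le ro (?I c) (?I c') & col_le ro (?J c) (?J c')" if "c \<le> c'" "c' < ?n" for c c'
  using sorted_wrt_nth_less[OF qs(2), of c c'] that refl by (cases "c = c'") (auto simp: case_prod_beta)
 have "card (?I c') \<le> card (?I c)" if "c \<le> c'" "c' < ?n" for c c'
 proof -
  have "{x \<in> ?I c. ro x < m} = ?I c" if "c < ?n" for c
   using IJ(1)[OF that] rank_less[OF rank_bij[OF rank]] by auto
  moreover have "card {x \<in> ?I c'. ro x < m} \<le> card {x \<in> ?I c. ro x < m}"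
   using chain[OF that] by (simp add: col_le_def)
  ultimately show ?thesis using that by simp
 qed
 moreover have "card (?I c) \<le> m" if "c < ?n" for c
  using card_mono[OF _ IJ(1)[OF that]] by simp
 ultimately obtain sh where sh: "rat_shape m sh" "rat_fits N ?n sh" "!!c. c < ?n ==> col_height m N sh c = card (?I c)"
  using ex_rat_shape[of ?n "%c. card (?I c)" m N] N by blast
 obtain S where S: "S \<in> std_rat_tableaux m r sh" "!!c. c < ?n ==> rat_cols m N sh S c = ?I c"
  using ex_std_rat_tableau[OF sh(1,2), of ?I] IJ sh(3) chain by auto
 obtain T where T: "T \<in> std_rat_tableaux m r sh" "!!c. c < ?n ==> rat_cols m N sh T c = ?J c"
  using ex_std_rat_tableau[OF sh(1,2), of ?J] IJ sh(3) chain by auto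
 have "(sh, S, T) \<in> std_bitableaux m r (dominant m)"
  using sh S T bracket_dominant by (simp add: std_bitableaux_iff)
 moreover have "det_fract m ^ N * bideterminant m sh S T \<asymp>
   (\<Prod>c<?n. minor (x_fun m) (rat_cols m N sh S c) (rat_cols m N sh T c))"
  by (rule det_power_bideterminant[OF sh(1) _ _ _ _ sh(2)])
   (use S T std_rat_inj[OF rank sh(1)] in \<open>auto simp: std_rat_iff[OF rank]\<close>)
 moreover have "(\<Prod>c<?n. minor (x_fun m) (rat_cols m N sh S c) (rat_cols m N sh T c)) =
   (\<Prod>(I, J)\<leftarrow>qs. minor (x_fun m) I J)"
  by (simp add: prod.list_conv_set_nth S(2) T(2) atLeast0LessThan case_prod_beta)
 ultimately show ?thesis by force
qed

text \<open>
  A matrix entry is a minor of size one.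
\<close>

lemma monomial_minor_product:
 assumes "keys \<mu> \<subseteq> prod_encode ` ({..<m} \<times> {..<m})"
 shows "\<exists>ps. set ps \<subseteq> minor_pairs m & to_fract (single \<mu> 1) = (\<Prod>(I, J)\<leftarrow>ps. minor (x_fun m) I J)"
proof -
 define P where "P = {x. \<exists>ps. set ps \<subseteq> minor_pairs m & x = (\<Prod>(I, J)\<leftarrow>ps. minor (x_fun m) I J)}"
 have one: "1 \<in> P" unfolding P_def by (auto intro!: exI[of _ "[]"])
 have mult: "x * y \<in> P" if "x \<in> P" "y \<in> P" for x y
 proof -
  obtain ps qs where "set ps \<subseteq> minor_pairs m" "x = (\<Prod>(I, J)\<leftarrow>ps. minor (x_fun m) I J)"
   "set qs \<subseteq> minor_pairs m" "y = (\<Prod>(I, J)\<leftarrow>qs. minor (x_fun m) I J)" using \<open>x \<in> P\<close> \<open>y \<in> P\<close> by (auto simp: P_def)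
  then show ?thesis unfolding P_def by (auto intro!: exI[of _ "ps @ qs"])
 qed
 have pow: "x ^ k \<in> P" if "x \<in> P" for x k using that by (induction k) (auto intro: one mult)
 have prod: "prod f A \<in> P" if "!!x. x \<in> A ==> f x \<in> P" for f and A :: "nat set"
  using that by (induction A rule: infinite_finite_induct) (auto intro: one mult)
 have var: "to_fract (single (single k 1) 1) \<in> P" if "k \<in> keys \<mu>" for k
 proof -
  obtain i j where ij: "i < m" "j < m" "k = prod_encode (i, j)" using assms \<open>k \<in> keys \<mu>\<close> by auto
  have "minor (x_fun m) {i} {j} = to_fract (single (single k 1) 1)"
   using ij by (simp add: minor_def det_single x_fun_def generic_mat_entry entry_var_def)
  moreover have "({i}, {j}) \<in> minor_pairs m" using ij by (simp add: minor_pairs_def)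
  ultimately show ?thesis unfolding P_def by (auto intro!: exI[of _ "[({i}, {j})]"])
 qed
 have "to_fract (single \<mu> 1 :: zpoly) \<in> P"
  by (subst mono_val_to_fract[symmetric], unfold mono_val_def, intro prod pow var)
 then show ?thesis by (simp add: P_def)
qed

text \<open>
  Write a function as a polynomial over \<open>det_fract m ^ N\<close>; the polynomial is a sum of products of minors, padded so that there are at least \<open>N\<close> columns to cut off after straightening.
\<close>

theorem std_bideterminants_span:
 "coord_ring m \<subseteq> zmod.span (bidet m ` std_bitableaux m r (dominant m))" (is "_ \<subseteq> ?V")
proof
 fix f assume "f \<in> coord_ring m"
 then obtain p N where p: "p \<in> mat_polys m" "f = to_fract p / det_fract m ^ N"
  unfolding coord_ring_iff by blast
 define W where "W = {x. x / det_fract m ^ N \<in> ?V}"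
 have W: "zmod.subspace W"
  unfolding zmod.subspace_def W_def
  using zmod.span_zero zmod.span_add zmod.span_scale by (auto simp: add_divide_distrib times_divide_eq_right[symmetric]
    simp del: times_divide_eq_right)
 have mono: "to_fract (single \<mu> 1) \<in> W" if \<mu>: "\<mu> \<in> keys p" for \<mu>
 proof -
  have "keys \<mu> \<subseteq> prod_encode ` ({..<m} \<times> {..<m})" using p(1) \<mu> by (auto simp: mat_polys_def)
  then obtain ps where ps: "set ps \<subseteq> minor_pairs m"
   "to_fract (single \<mu> 1) = (\<Prod>(I, J)\<leftarrow>ps. minor (x_fun m) I J)"
   using monomial_minor_product by blast
  define ps' where "ps' = ps @ replicate N ({}, {})"
  have ps': "set ps' \<subseteq> minor_pairs m" "N \<le> length ps'"
   "to_fract (single \<mu> 1) = (\<Prod>(I, J)\<leftarrow>ps'. minor (x_fun m) I J)"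
   using ps by (auto simp: ps'_def minor_pairs_def minor_def)
  have "(\<Prod>(I, J)\<leftarrow>ps'. minor (x_fun m) I J) \<in> zmod.span {(\<Prod>(I, J)\<leftarrow>qs. minor (x_fun m) I J) | qs.
    length qs = length ps' & set qs \<subseteq> minor_pairs m &
    sorted_wrt (%(I, J) (I', J'). col_le ro I I' & col_le ro J J') qs}"
   by (rule minors_straightening[OF rank_bij[OF rank] ps'(1)])
  also have "... \<subseteq> W"
  proof (rule zmod.span_minimal[OF _ W], rule subsetI)
   fix x assume "x \<in> {(\<Prod>(I, J)\<leftarrow>qs. minor (x_fun m) I J) | qs.
    length qs = length ps' & set qs \<subseteq> minor_pairs m &
    sorted_wrt (%(I, J) (I', J'). col_le ro I I' & col_le ro J J') qs}"
   then obtain qs where qs: "x = (\<Prod>(I, J)\<leftarrow>qs. minor (x_fun m) I J)" "length qs = length ps'"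
    "set qs \<subseteq> minor_pairs m" "sorted_wrt (%(I, J) (I', J'). col_le ro I I' & col_le ro J J') qs" by blast
   obtain ka where ka: "ka \<in> std_bitableaux m r (dominant m)"
    "det_fract m ^ N * bidet m ka \<asymp> (\<Prod>(I, J)\<leftarrow>qs. minor (x_fun m) I J)"
    using chain_is_std_bideterminant[OF qs(3,4), of N] qs(2) ps'(2) by auto
   obtain e :: int where "x = of_int e * (det_fract m ^ N * bidet m ka)"
    using sign_eq_witness[OF sign_eq_sym[OF ka(2)]] qs(1) by blast
   then have "x / det_fract m ^ N = of_int e * bidet m ka" by simp
   then show "x \<in> W"
    using zmod.span_scale[OF zmod.span_base[OF imageI[OF ka(1)]], of e "bidet m"] by (simp add: W_def)
  qed
  finally show ?thesis unfolding ps'(3) .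
 qed
 have "to_fract p = (\<Sum>\<mu>\<in>keys p. of_int (lookup p \<mu>) * to_fract (single \<mu> 1))"
 proof -
  have "p = (\<Sum>\<mu>\<in>keys p. of_int (lookup p \<mu>) * single \<mu> 1)"
   by (subst (1) poly_as_sum) (simp add: of_int_zpoly mult_single)
  from arg_cong[OF this, of to_fract] show ?thesis
   by (simp only: to_fract_sum to_fract_mult to_fract_of_int)
 qed
 also have "... \<in> W"
  by (intro zmod.subspace_sum[OF W] zmod.subspace_scale[OF W] mono)
 finally show "f \<in> ?V" unfolding p(2) by (simp add: W_def)
qed

end

section \<open>Leading monomials of products of minors\<close>

definition mono_weight :: "(nat => nat) => (nat \<Rightarrow>\<^sub>0 nat) => nat" where
 "mono_weight g \<nu> = (\<Sum>k\<in>keys \<nu>. lookup \<nu> k * g k)"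

lemma mono_weight_superset:
 assumes "finite S" "keys \<nu> \<subseteq> S"
 shows "mono_weight g \<nu> = (\<Sum>k\<in>S. lookup \<nu> k * g k)"
 unfolding mono_weight_def
 by (rule sum.mono_neutral_left) (use assms in \<open>auto simp: in_keys_iff\<close>)

lemma mono_weight_add: "mono_weight g (\<mu> + \<nu>) = mono_weight g \<mu> + mono_weight g \<nu>"
proof -
 let ?S = "keys \<mu> \<union> keys \<nu>"
 have "mono_weight g (\<mu> + \<nu>) = (\<Sum>k\<in>?S. lookup (\<mu> + \<nu>) k * g k)"
  by (rule mono_weight_superset) (simp, rule keys_add)
 then show ?thesis
  by (simp add: lookup_add distrib_right sum.distrib mono_weight_superset[of ?S])
qed

lemma mono_weight_0 [simp]: "mono_weight g 0 = 0"
 by (simp add: mono_weight_def)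

lemma mono_weight_single [simp]: "mono_weight g (single k n) = n * g k"
 by (cases "n = 0") (auto simp: mono_weight_def)

lemma mono_weight_sum: "mono_weight g (sum f S) = (\<Sum>x\<in>S. mono_weight g (f x))"
 by (induction S rule: infinite_finite_induct) (auto simp: mono_weight_add)

lemma lookup_times:
 "lookup (p * q :: zpoly) ka = (\<Sum>a\<in>keys p. \<Sum>b\<in>keys q.
  if a + b = ka then lookup p a * lookup q b else 0)"
proof -
 let ?t = "%p \<mu>. single \<mu> (lookup p \<mu>) :: zpoly"
 have "p * q = (\<Sum>\<mu>\<in>keys p. ?t p \<mu>) * (\<Sum>\<nu>\<in>keys q. ?t q \<nu>)"
  using poly_as_sum[of p] poly_as_sum[of q] by (rule arg_cong2)
 also have "... = (\<Sum>\<mu>\<in>keys p. \<Sum>\<nu>\<in>keys q. ?t p \<mu> * ?t q \<nu>)"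
  by (rule sum_product)
 finally show ?thesis
  by (simp add: lookup_sum mult_single lookup_single when_def)
qed

text \<open>
  The monomial \<open>\<mu>\<close> is the unique heaviest one and has coefficient 1 or -1. Unlike a monomial order this only needs one weight function, and it is stable under products.
\<close>

definition leads :: "(nat => nat) => zpoly => (nat \<Rightarrow>\<^sub>0 nat) => bool" where
 "leads g p \<mu> \<longleftrightarrow> \<bar>lookup p \<mu>\<bar> = 1 &
  (\<forall>\<nu>\<in>keys p. \<nu> ~= \<mu> --> mono_weight g \<nu> < mono_weight g \<mu>)"

lemma leads_in_keys: "leads g p \<mu> ==> \<mu> \<in> keys p"
 by (auto simp: leads_def in_keys_iff)

lemma leads_le: "leads g p \<mu> ==> \<nu> \<in> keys p ==> mono_weight g \<nu> \<le> mono_weight g \<mu>"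
 by (cases "\<nu> = \<mu>") (auto simp: leads_def intro: less_imp_le)

lemma leads_1 [simp]: "leads g 1 0"
 by (simp add: leads_def)

lemma leads_uminus: "leads g p \<mu> ==> leads g (- p) \<mu>"
 by (simp add: leads_def)

lemma leads_sign_eq: "leads g p \<mu> ==> p \<asymp> q ==> leads g q \<mu>"
 using leads_uminus[of g p \<mu>] by (auto simp: sign_eq_def)

lemma leads_mult:
 assumes p: "leads g p \<mu>" and q: "leads g q \<nu>"
 shows "leads g (p * q) (\<mu> + \<nu>)"
proof -
 have uniq: "a = \<mu> & b = \<nu>" if "a \<in> keys p" "b \<in> keys q"
  "mono_weight g (\<mu> + \<nu>) \<le> mono_weight g (a + b)" for a b
 proof -
  have "mono_weight g a \<le> mono_weight g \<mu>" "mono_weight g b \<le> mono_weight g \<nu>"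
   using leads_le p q that by auto
  then have "\<not> mono_weight g a < mono_weight g \<mu>" "\<not> mono_weight g b < mono_weight g \<nu>"
   using that(3) by (auto simp: mono_weight_add)
  then show ?thesis using p q that by (auto simp: leads_def)
 qed
 have summand: "(if a + b = \<mu> + \<nu> then lookup p a * lookup q b else 0) =
   (if a = \<mu> then if b = \<nu> then lookup p \<mu> * lookup q \<nu> else 0 else 0)"
  if "a \<in> keys p" "b \<in> keys q" for a b
 proof (cases "a + b = \<mu> + \<nu>")
  case True
  then have "a = \<mu> & b = \<nu>" using uniq[OF that] by simp
  then show ?thesis by simp
 qed auto
 have "lookup (p * q) (\<mu> + \<nu>) = (\<Sum>a\<in>keys p. \<Sum>b\<in>keys q.
   if a = \<mu> then if b = \<nu> then lookup p \<mu> * lookup q \<nu> else 0 else 0)"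
  unfolding lookup_times by (intro sum.cong refl summand)
 also have "... = (\<Sum>a\<in>keys p. if a = \<mu> then lookup p \<mu> * lookup q \<nu> else 0)"
  using leads_in_keys[OF q] by (intro sum.cong refl) (auto simp: sum.delta)
 also have "... = lookup p \<mu> * lookup q \<nu>"
  using leads_in_keys[OF p] by (simp add: sum.delta)
 finally have "\<bar>lookup (p * q) (\<mu> + \<nu>)\<bar> = 1"
  using p q by (simp add: leads_def abs_mult)
 moreover have "mono_weight g ka < mono_weight g (\<mu> + \<nu>)" if ka: "ka \<in> keys (p * q)" "ka ~= \<mu> + \<nu>" for ka
 proof -
  obtain a b where ab: "ka = a + b" "a \<in> keys p" "b \<in> keys q"
   using ka(1) keys_mult[of p q] by blast
  then show ?thesis using uniq[of a b] ka(2) by fastforce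
 qed
 ultimately show ?thesis by (simp add: leads_def)
qed

lemma leads_prod:
 assumes "!!x. x \<in> S ==> leads g (f x) (\<mu> x)"
 shows "leads g (prod f S) (sum \<mu> S)"
 using assms by (induction S rule: infinite_finite_induct) (auto intro: leads_mult)

lemma lookup_of_int_times: "lookup (of_int d * p :: zpoly) \<nu> = d * lookup p \<nu>"
 by (simp add: of_int_zpoly flip: mult_map_scale_conv_mult) (simp add: Poly_Mapping.map.rep_eq when_def)

text \<open>
  Among the leading monomials take a heaviest one; no other member of the family contains it.
\<close>

lemma leads_combination:
 assumes S: "finite S" "S ~= {}" and l: "!!x. x \<in> S ==> leads g (f x) (\<mu> x)" and inj: "inj_on \<mu> S"
  and c: "!!x. x \<in> S ==> (c x :: int) ~= 0"
 shows "\<exists>x\<in>S. lookup (\<Sum>y\<in>S. of_int (c y) * f y) (\<mu> x) ~= 0"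
proof -
 let ?h = "%y. mono_weight g (\<mu> y)"
 have "Max (?h ` S) \<in> ?h ` S" using S by (intro Max_in) auto
 then obtain x where "x \<in> S" "Max (?h ` S) = ?h x" by blast
 then have x: "x \<in> S" "!!y. y \<in> S ==> ?h y \<le> ?h x"
  using Max_ge[of "?h ` S"] S(1) by auto
 have zero: "lookup (f y) (\<mu> x) = 0" if "y \<in> S" "y ~= x" for y
 proof (rule ccontr)
  assume "lookup (f y) (\<mu> x) ~= 0"
  then have "\<mu> x \<in> keys (f y)" by (simp add: in_keys_iff)
  moreover have "\<mu> x ~= \<mu> y" using inj that x(1) by (auto simp: inj_on_def)
  ultimately have "mono_weight g (\<mu> x) < mono_weight g (\<mu> y)"
   using l[OF that(1)] by (auto simp: leads_def)
  then show False using x(2)[OF that(1)] by simp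
 qed
 have "lookup (\<Sum>y\<in>S. of_int (c y) * f y) (\<mu> x) = (\<Sum>y\<in>S. c y * lookup (f y) (\<mu> x))"
  by (simp add: lookup_sum lookup_of_int_times)
 also have "... = (\<Sum>y\<in>S. if y = x then c x * lookup (f x) (\<mu> x) else 0)"
  by (rule sum.cong) (use zero in auto)
 also have "... = c x * lookup (f x) (\<mu> x)" using S x(1) by simp
 finally have eq: "lookup (\<Sum>y\<in>S. of_int (c y) * f y) (\<mu> x) = c x * lookup (f x) (\<mu> x)" .
 have "lookup (f x) (\<mu> x) ~= 0" using l[OF x(1)] by (auto simp: leads_def)
 then show ?thesis using eq c[OF x(1)] x(1) by (intro bexI[of _ x]) simp_all
qed

text \<open>
  The strict rearrangement inequality makes the diagonal term of a determinant heavier than all other terms.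
\<close>

lemma rearrangement_less:
 fixes x y :: "nat => int"
 assumes "\<pi> permutes {..<k}" "\<pi> ~= id"
  and "!!a b. a < b ==> b < k ==> x a < x b" "!!a b. a < b ==> b < k ==> y a < y b"
 shows "(\<Sum>a<k. x a * y (\<pi> a)) < (\<Sum>a<k. x a * y a)"
 using assms
proof (induction k arbitrary: \<pi>)
 case 0
 then show ?case by (auto simp: permutes_empty)
next
 case (Suc k)
 have perm_k: "\<tau> permutes {..<k}" if "\<tau> permutes {..<Suc k}" "\<tau> k = k" for \<tau>
  by (rule permutes_superset[OF that(1)]) (use that(2) in auto)
 show ?case
 proof (cases "\<pi> k = k")
  case True
  then show ?thesis
   using Suc.IH[OF perm_k[OF Suc.prems(1) True] Suc.prems(2)] Suc.prems(3,4) by simp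
 next
  case False
  obtain j where j: "\<pi> j = k" using permutes_surj[OF Suc.prems(1)] by (metis surjD)
  have jk: "j < k" using j False permutes_in_image[OF Suc.prems(1), of j]
   by (cases "j = k") auto
  have ik: "\<pi> k < k" using False permutes_in_image[OF Suc.prems(1), of k] by auto
  define \<tau> where "\<tau> = \<pi> \<circ> transpose j k"
  have \<tau>: "\<tau> permutes {..<Suc k}" unfolding \<tau>_def
   by (rule permutes_compose[OF permutes_swap_id Suc.prems(1)]) (use jk in auto)
  have \<tau>k: "\<tau> k = k" "\<tau> j = \<pi> k" using j jk by (auto simp: \<tau>_def)
  have other: "\<tau> a = \<pi> a" if "a ~= j" "a ~= k" for a using that by (simp add: \<tau>_def transpose_def)
  have split: "(\<Sum>a<Suc k. h a) = h k + h j + (\<Sum>a\<in>{..<k} - {j}. h a)" for h :: "nat => int"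
   using jk by (simp add: sum.remove[of "{..<k}" j])
  have "(\<Sum>a\<in>{..<k} - {j}. x a * y (\<pi> a)) = (\<Sum>a\<in>{..<k} - {j}. x a * y (\<tau> a))"
   by (rule sum.cong) (use other in auto)
  moreover have "x k * y (\<pi> k) + x j * y k < x k * y k + x j * y (\<pi> k)"
  proof -
   have "0 < (x k - x j) * (y k - y (\<pi> k))"
    using Suc.prems(3)[of j k] Suc.prems(4)[of "\<pi> k" k] jk ik by simp
   then show ?thesis by (simp add: algebra_simps)
  qed
  ultimately have "(\<Sum>a<Suc k. x a * y (\<pi> a)) < (\<Sum>a<Suc k. x a * y (\<tau> a))"
   unfolding split \<tau>k j by simp
  also have "... \<le> (\<Sum>a<Suc k. x a * y a)"
  proof (cases "\<tau> = id")
   case False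
   then show ?thesis
    using Suc.IH[OF perm_k[OF \<tau> \<tau>k(1)] False] Suc.prems(3,4) \<tau>k(1) by simp
  qed simp
  finally show ?thesis .
 qed
qed

text \<open>
  Generic matrices with prescribed zero entries; the triangular case computes functions on a Borel subgroup.
\<close>

definition masked_var :: "(nat => nat => bool) => nat => nat => zpoly" where
 "masked_var Z i j = (if Z i j then entry_var i j else 0)"

definition perm_mono :: "(nat => nat) => (nat => nat) => nat => (nat => nat) => (nat \<Rightarrow>\<^sub>0 nat)" where
 "perm_mono s t k \<pi> = (\<Sum>a<k. single (prod_encode (s a, t (\<pi> a))) 1)"

lemma masked_det_expansion:
 "det (mat k k (%(a, b). masked_var Z (s a) (t b))) = (\<Sum>\<pi> | \<pi> permutes {..<k}.
  single (perm_mono s t k \<pi>) (if \<forall>a<k. Z (s a) (t (\<pi> a)) then sign \<pi> else 0))"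
proof -
 have prod: "(\<Prod>a = 0..<k. masked_var Z (s a) (t (\<pi> a))) =
   single (perm_mono s t k \<pi>) (if \<forall>a<k. Z (s a) (t (\<pi> a)) then 1 else 0)" for \<pi>
  by (induction k) (auto simp: perm_mono_def masked_var_def entry_var_def mult_single less_Suc_eq)
 have "det (mat k k (%(a, b). masked_var Z (s a) (t b))) =
   (\<Sum>\<pi> | \<pi> permutes {0..<k}. signof \<pi> * (\<Prod>a = 0..<k. masked_var Z (s a) (t (\<pi> a))))"
  by (subst det_def'[of _ k]) (auto intro!: sum.cong prod.cong dest: permutes_in_image)
 also have "... = (\<Sum>\<pi> | \<pi> permutes {0..<k}. single (perm_mono s t k \<pi>)
   (if \<forall>a<k. Z (s a) (t (\<pi> a)) then sign \<pi> else 0))"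
  unfolding prod by (intro sum.cong refl) (auto simp: of_int_zpoly mult_single)
 finally show ?thesis by (simp add: atLeast0LessThan)
qed

lemma masked_det_keys:
 assumes "\<nu> \<in> keys (det (mat k k (%(a, b). masked_var Z (s a) (t b))))"
 obtains \<pi> where "\<pi> permutes {..<k}" "\<nu> = perm_mono s t k \<pi>"
proof -
 have "\<nu> \<in> (\<Union>\<pi>\<in>{\<pi>. \<pi> permutes {..<k}}. keys (single (perm_mono s t k \<pi>)
   (if \<forall>a<k. Z (s a) (t (\<pi> a)) then sign \<pi> else 0)))"
  using assms unfolding masked_det_expansion by (rule subsetD[OF keys_sum])
 then show ?thesis using that by (auto split: if_splits)
qed

lemma mono_weight_perm_mono: "mono_weight g (perm_mono s t k \<pi>) = (\<Sum>a<k. g (prod_encode (s a, t (\<pi> a))))"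
 by (simp add: perm_mono_def mono_weight_sum)

lemma leads_masked_det:
 assumes s: "!!a b. a < b ==> b < k ==> \<sigma> (s a) < \<sigma> (s b)" and t: "!!a b. a < b ==> b < k ==> \<tau> (t a) < \<tau> (t b)"
  and Z: "!!a. a < k ==> Z (s a) (t a)" and g: "!!i j. g (prod_encode (i, j)) = \<sigma> i * \<tau> j"
 shows "leads g (det (mat k k (%(a, b). masked_var Z (s a) (t b)))) (perm_mono s t k id)"
proof -
 let ?D = "det (mat k k (%(a, b). masked_var Z (s a) (t b)))"
 have less: "mono_weight g (perm_mono s t k \<pi>) < mono_weight g (perm_mono s t k id)"
  if "\<pi> permutes {..<k}" "\<pi> ~= id" for \<pi>
 proof -
  have "(\<Sum>a<k. int (\<sigma> (s a)) * int (\<tau> (t (\<pi> a)))) < (\<Sum>a<k. int (\<sigma> (s a)) * int (\<tau> (t a)))"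
   by (rule rearrangement_less[OF that, of "%a. int (\<sigma> (s a))" "%a. int (\<tau> (t a))"]) (use s t in auto)
  then have "int (\<Sum>a<k. \<sigma> (s a) * \<tau> (t (\<pi> a))) < int (\<Sum>a<k. \<sigma> (s a) * \<tau> (t a))" by simp
  then show ?thesis by (simp only: of_nat_less_iff mono_weight_perm_mono g id_apply)
 qed
 have "lookup ?D (perm_mono s t k id) = (\<Sum>\<pi> | \<pi> permutes {..<k}. if \<pi> = id then 1 else 0)"
  unfolding masked_det_expansion lookup_sum
 proof (rule sum.cong[OF refl])
  fix \<pi> assume "\<pi> \<in> {\<pi>. \<pi> permutes {..<k}}"
  then have "perm_mono s t k \<pi> ~= perm_mono s t k id" if "\<pi> ~= id" using less[of \<pi>] that by auto
  then show "lookup (single (perm_mono s t k \<pi>)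
    (if \<forall>a<k. Z (s a) (t (\<pi> a)) then sign \<pi> else 0)) (perm_mono s t k id) = (if \<pi> = id then 1 else 0)"
   using Z by (auto simp: lookup_single when_def sign_id)
 qed
 also have "... = 1" by (subst sum.delta) (auto simp: permutes_id finite_permutations)
 finally have "\<bar>lookup ?D (perm_mono s t k id)\<bar> = 1" by simp
 moreover have "mono_weight g \<nu> < mono_weight g (perm_mono s t k id)"
  if "\<nu> \<in> keys ?D" "\<nu> ~= perm_mono s t k id" for \<nu>
  using masked_det_keys[OF that(1)] less that(2) by metis
 ultimately show ?thesis by (simp add: leads_def)
qed

definition row_degree :: "nat => (nat \<Rightarrow>\<^sub>0 nat) => nat" where
 "row_degree i = mono_weight (%k. if fst (prod_decode k) = i then 1 else 0)"

lemma row_degree_minor: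
 assumes "finite I" "finite J" "card J = card I" "\<nu> \<in> keys (minor (masked_var Z) I J)"
 shows "row_degree i \<nu> = (if i \<in> I then 1 else 0)"
proof -
 have "\<nu> \<in> keys (det (mat (card I) (card I) (%(a, b). masked_var Z (enum_set I a) (enum_set J b))))"
  using assms(4) by (simp add: minor_def)
 then obtain \<pi> where \<pi>: "\<nu> = perm_mono (enum_set I) (enum_set J) (card I) \<pi>" by (rule masked_det_keys)
 have "row_degree i \<nu> = (\<Sum>a<card I. if enum_set I a = i then 1 else 0)"
  unfolding \<pi> row_degree_def mono_weight_perm_mono by simp
 also have "... = (\<Sum>j\<in>I. if j = i then 1 else 0)"
  by (rule sum.reindex_bij_betw[OF enum_set_bij[OF assms(1)], of "%j. if j = i then 1 else 0"])
 finally show ?thesis using assms(1) by simp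
qed

text \<open>
  Each minor is linear in each of its rows, hence row degrees of a product of minors count columns.
\<close>

lemma row_degree_minor_prod:
 assumes "finite S" "!!c. c \<in> S ==> finite (I c) & finite (J c) & card (J c) = card (I c)"
  and "\<nu> \<in> keys (\<Prod>c\<in>S. minor (masked_var Z) (I c) (J c))"
 shows "row_degree i \<nu> = card {c \<in> S. i \<in> I c}"
 using assms
proof (induction S arbitrary: \<nu> rule: finite_induct)
 case empty
 then show ?case by (simp add: row_degree_def)
next
 case (insert c S)
 have "\<nu> \<in> keys (minor (masked_var Z) (I c) (J c) * (\<Prod>c\<in>S. minor (masked_var Z) (I c) (J c)))"
  using insert.prems(2) insert.hyps by simp
 then obtain a b where ab: "\<nu> = a + b" "a \<in> keys (minor (masked_var Z) (I c) (J c))"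
  "b \<in> keys (\<Prod>c\<in>S. minor (masked_var Z) (I c) (J c))"
  using keys_mult by blast
 have "row_degree i \<nu> = row_degree i a + row_degree i b" by (simp add: ab(1) row_degree_def mono_weight_add)
 also have "row_degree i a = (if i \<in> I c then 1 else 0)" using insert.prems(1) ab(2) by (intro row_degree_minor) auto
 also have "row_degree i b = card {c \<in> S. i \<in> I c}" using insert.IH[OF _ ab(3)] insert.prems(1) by simp
 also have "(if i \<in> I c then 1 else 0) + card {c \<in> S. i \<in> I c} = card {d \<in> insert c S. i \<in> I d}"
 proof (cases "i \<in> I c")
  case True
  then have "{d \<in> insert c S. i \<in> I d} = insert c {d \<in> S. i \<in> I d}" by auto
  then show ?thesis using True insert.hyps by simp
 next
  case False
  then have "{d \<in> insert c S. i \<in> I d} = {d \<in> S. i \<in> I d}" by auto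
  then show ?thesis using False by simp
 qed
 finally show ?case .
qed

text \<open>
  The product of the diagonal terms of the minors of a chain: column \<open>c\<close> contributes the entries at \<open>(a, u c a)\<close>.
\<close>

definition chain_mono :: "(nat \<times> nat => nat) => nat => (nat => nat) => (nat => nat => nat) => (nat \<Rightarrow>\<^sub>0 nat)" where
 "chain_mono e n k u = (\<Sum>c<n. \<Sum>a<k c. single (e (a, u c a)) 1)"

lemma lookup_chain_mono:
 assumes "inj e"
 shows "lookup (chain_mono e n k u) (e (a, j)) = card {c. c < n & a < k c & u c a = j}"
proof -
 have "lookup (chain_mono e n k u) (e (a, j)) =
   (\<Sum>c<n. \<Sum>b<k c. if b = a & u c b = j then 1 else 0)"
  unfolding chain_mono_def lookup_sum
  by (intro sum.cong refl) (use inj_eq[OF assms] in \<open>auto simp: lookup_single when_def\<close>)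
 also have "... = (\<Sum>c<n. if a < k c & u c a = j then 1 else 0)"
 proof (rule sum.cong[OF refl])
  fix c
  have "(\<Sum>b<k c. if b = a & u c b = j then 1 else 0) = (\<Sum>b<k c. if b = a then (if u c a = j then 1 else 0) else (0::nat))"
   by (rule sum.cong) auto
  then show "(\<Sum>b<k c. if b = a & u c b = j then 1 else 0) = (if a < k c & u c a = j then 1 else (0::nat))"
   by simp
 qed
 also have "... = card {c. c < n & a < k c & u c a = j}"
  by (simp add: sum.If_cases Int_def)
 finally show ?thesis .
qed

text \<open>
  A weakly increasing sequence is determined by the multiplicities of its values. This is why the leading monomial remembers a chain.
\<close>

lemma mono_seq_eq_of_counts:
 fixes f g :: "nat => nat"
 assumes "!!c c'. c \<le> c' ==> c' < w ==> f c \<le> f c'" "!!c c'. c \<le> c' ==> c' < w ==> g c \<le> g c'"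
  and "!!v. card {c. c < w & f c = v} = card {c. c < w & g c = v}" and "c < w"
 shows "f c = g c"
proof -
 have cnt: "count (mset (map f [0..<w])) v = card {c. c < w & f c = v}" for f v
  unfolding count_mset count_list_eq_length_filter length_filter_conv_card
  by (rule arg_cong[where f = card]) auto
 have "mset (map f [0..<w]) = mset (map g [0..<w])"
  by (rule multiset_eqI) (simp only: cnt assms(3))
 moreover have "sorted (map f [0..<w])" "sorted (map g [0..<w])"
  using assms(1,2) by (auto simp: sorted_iff_nth_mono)
 ultimately have "map f [0..<w] = map g [0..<w]"
  by (metis properties_for_sort)
 then show ?thesis using assms(4) by (simp add: list_eq_iff_nth_eq)
qed

section \<open>Separating two sets of variables\<close>

definition shift_var :: "nat => nat => nat" where
 "shift_var m k = (case prod_decode k of (i, j) => prod_encode (m + i, m + j))"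

definition shift_mono :: "nat => (nat \<Rightarrow>\<^sub>0 nat) => (nat \<Rightarrow>\<^sub>0 nat)" where
 "shift_mono m \<mu> = (\<Sum>k\<in>keys \<mu>. single (shift_var m k) (lookup \<mu> k))"

text \<open>
  The same polynomial in a second, disjoint set of variables.
\<close>

definition shift_poly :: "nat => zpoly => zpoly" where
 "shift_poly m = poly_eval (%k. single (single (shift_var m k) 1) 1)"

lemma inj_shift_var: "inj (shift_var m)"
proof (rule injI)
 fix k l assume "shift_var m k = shift_var m l"
 then have "prod_decode k = prod_decode l"
  by (cases "prod_decode k"; cases "prod_decode l") (simp add: shift_var_def prod_encode_eq)
 then show "k = l" by (simp only: prod_decode_eq)
qed

lemma lookup_shift_mono: "lookup (shift_mono m \<mu>) (shift_var m k) = lookup \<mu> k"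
 unfolding shift_mono_def lookup_sum
 by (simp add: lookup_single when_def inj_eq[OF inj_shift_var] in_keys_iff)

lemma keys_shift_mono: "keys (shift_mono m \<mu>) \<subseteq> shift_var m ` keys \<mu>"
proof -
 have "keys (sum f S) \<subseteq> (\<Union>x\<in>S. keys (f x))" for f :: "nat => (nat \<Rightarrow>\<^sub>0 nat)" and S
  by (induction S rule: infinite_finite_induct) (use keys_add in \<open>fastforce+\<close>)
 then show ?thesis unfolding shift_mono_def by (rule order_trans) auto
qed

lemma shift_poly_eq: "shift_poly m p = (\<Sum>\<mu>\<in>keys p. single (shift_mono m \<mu>) (lookup p \<mu>))"
proof -
 have pow: "(single (single k 1) 1 :: zpoly) ^ n = single (single k n) 1" for k n
  by (induction n) (auto simp: mult_single single_add[symmetric])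
 have prod: "(\<Prod>k\<in>S. single (f k) 1 :: zpoly) = single (\<Sum>k\<in>S. f k) 1"
  if "finite S" for S and f :: "nat => (nat \<Rightarrow>\<^sub>0 nat)"
  using that by (induction S) (auto simp: mult_single)
 have "mono_val (%k. single (single (shift_var m k) 1) 1) \<mu> =
   (single (shift_mono m \<mu>) 1 :: zpoly)" for \<mu>
  unfolding mono_val_def pow shift_mono_def by (rule prod) simp
 then show ?thesis
  unfolding shift_poly_def poly_eval_def by (simp add: of_int_zpoly mult_single)
qed

definition base_mono :: "nat => (nat \<Rightarrow>\<^sub>0 nat) => bool" where
 "base_mono m \<mu> \<longleftrightarrow> keys \<mu> \<subseteq> prod_encode ` ({..<m} \<times> {..<m})"

lemma mat_polys_base_mono: "p \<in> mat_polys m ==> \<mu> \<in> keys p ==> base_mono m \<mu>"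
 by (auto simp: mat_polys_def base_mono_def)

lemma base_shift_unique:
 assumes "base_mono m \<alpha>" "base_mono m \<alpha>'" and eq: "\<alpha> + shift_mono m \<beta> = \<alpha>' + shift_mono m \<beta>'"
 shows "\<alpha> = \<alpha>' & \<beta> = \<beta>'"
proof -
 have sh: "lookup (shift_mono m \<gamma>) k = 0" if "k \<in> prod_encode ` ({..<m} \<times> {..<m})" for \<gamma> k
 proof -
  have "k ~= shift_var m l" for l
   using that by (auto simp: shift_var_def prod_encode_eq split: prod.splits)
  then have "k \<notin> keys (shift_mono m \<gamma>)" using keys_shift_mono[of m \<gamma>] by blast
  then show ?thesis by (simp add: in_keys_iff)
 qed
 have b0: "lookup \<gamma> k = 0" if "base_mono m \<gamma>" "k \<notin> prod_encode ` ({..<m} \<times> {..<m})" for \<gamma> k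
  using that by (auto simp: base_mono_def in_keys_iff)
 have eq': "lookup \<alpha> k + lookup (shift_mono m \<beta>) k =
   lookup \<alpha>' k + lookup (shift_mono m \<beta>') k" for k
  using eq by (metis lookup_add)
 have "\<alpha> = \<alpha>'"
 proof (rule poly_mapping_eqI)
  fix k show "lookup \<alpha> k = lookup \<alpha>' k"
   using eq'[of k] sh b0 assms by (cases "k \<in> prod_encode ` ({..<m} \<times> {..<m})") auto
 qed
 then have "lookup (shift_mono m \<beta>) k = lookup (shift_mono m \<beta>') k" for k
  using eq' by simp
 then have "lookup \<beta> k = lookup \<beta>' k" for k
  by (metis lookup_shift_mono)
 then show ?thesis using \<open>\<alpha> = \<alpha>'\<close> by (auto intro: poly_mapping_eqI)
qed

lemma lookup_times_shift_poly:
 assumes q: "q \<in> mat_polys m" and \<alpha>: "base_mono m \<alpha>"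
 shows "lookup (q * shift_poly m p) (\<alpha> + shift_mono m \<beta>) = lookup p \<beta> * lookup q \<alpha>"
proof -
 let ?t = "%p \<mu>. single \<mu> (lookup p \<mu>) :: zpoly"
 have "q * shift_poly m p = (\<Sum>a\<in>keys q. ?t q a) *
   (\<Sum>b\<in>keys p. single (shift_mono m b) (lookup p b))"
  using poly_as_sum[of q] shift_poly_eq[of m p] by (rule arg_cong2)
 also have "... = (\<Sum>a\<in>keys q. \<Sum>b\<in>keys p.
   single (a + shift_mono m b) (lookup q a * lookup p b))"
  by (simp add: sum_product mult_single)
 finally have "lookup (q * shift_poly m p) (\<alpha> + shift_mono m \<beta>) =
  (\<Sum>a\<in>keys q. \<Sum>b\<in>keys p.
   if a + shift_mono m b = \<alpha> + shift_mono m \<beta> then lookup q a * lookup p b else 0)"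
  by (simp add: lookup_sum lookup_single when_def)
 also have "... = (\<Sum>a\<in>keys q. \<Sum>b\<in>keys p.
   if a = \<alpha> then if b = \<beta> then lookup q \<alpha> * lookup p \<beta> else 0 else 0)"
 proof (intro sum.cong refl)
  fix a b assume "a \<in> keys q"
  then have "base_mono m a" using mat_polys_base_mono[OF q] by blast
  then have "a + shift_mono m b = \<alpha> + shift_mono m \<beta> \<longleftrightarrow> a = \<alpha> & b = \<beta>"
   using base_shift_unique[OF _ \<alpha>] by blast
  then show "(if a + shift_mono m b = \<alpha> + shift_mono m \<beta> then lookup q a * lookup p b else 0) =
   (if a = \<alpha> then if b = \<beta> then lookup q \<alpha> * lookup p \<beta> else 0 else 0)" by auto
 qed
 also have "... = (\<Sum>a\<in>keys q. if a = \<alpha> then lookup q \<alpha> * lookup p \<beta> else 0)"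
  by (intro sum.cong refl) (simp add: sum.delta in_keys_iff)
 also have "... = lookup q \<alpha> * lookup p \<beta>" by (simp add: sum.delta in_keys_iff)
 finally show ?thesis by (simp add: mult.commute)
qed

text \<open>
  Comparing coefficients in the second set of variables, for an identity in both sets.
\<close>

lemma separate_shifted_variables:
 assumes q: "!!x. x \<in> A ==> q x \<in> mat_polys m" "!!y. y \<in> B ==> q' y \<in> mat_polys m"
  and eq: "(\<Sum>x\<in>A. q x * shift_poly m (p x)) = (\<Sum>y\<in>B. q' y * shift_poly m (p' y))"
 shows "(\<Sum>x\<in>A. of_int (lookup (p x) \<beta>) * q x) = (\<Sum>y\<in>B. of_int (lookup (p' y) \<beta>) * q' y)"
proof (rule poly_mapping_eqI)
 fix \<alpha>
 show "lookup (\<Sum>x\<in>A. of_int (lookup (p x) \<beta>) * q x) \<alpha> =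
  lookup (\<Sum>y\<in>B. of_int (lookup (p' y) \<beta>) * q' y) \<alpha>"
 proof (cases "base_mono m \<alpha>")
  case True
  have "lookup (\<Sum>x\<in>A. q x * shift_poly m (p x)) (\<alpha> + shift_mono m \<beta>) =
   lookup (\<Sum>y\<in>B. q' y * shift_poly m (p' y)) (\<alpha> + shift_mono m \<beta>)" using eq by simp
  then show ?thesis
   using q by (simp add: lookup_sum lookup_of_int_times lookup_times_shift_poly[OF _ True])
 next
  case False
  then have "lookup p \<alpha> = 0" if "p \<in> mat_polys m" for p
   using mat_polys_base_mono[OF that] by (auto simp: in_keys_iff)
  then show ?thesis using q by (simp add: lookup_sum lookup_of_int_times)
 qed
qed

section \<open>Shapes, contents and dominance\<close>

lemma card_as_sum: "finite S ==> card {c \<in> S. P c} = (\<Sum>c\<in>S. if P c then 1 else 0)"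
 by (simp add: sum.If_cases Int_def)

lemma card_below_as_sum: "card {c. c < n & P c} = (\<Sum>c<n. if P c then 1 else (0::nat))" for n :: nat
 using card_as_sum[of "{..<n}" P] by simp

lemma partition_nth_card:
 assumes "partition_list m l" "fits l w" "i < m"
 shows "l ! i = card {c. c < w & i < col_length l c}"
proof -
 have "c < l ! i \<longleftrightarrow> c < w & i < col_length l c" for c
 proof -
  have "c < l ! i \<longleftrightarrow> (i, c) \<in> diagram l" using assms(1,3) by (simp add: diagram_def partition_list_def)
  also have "... \<longleftrightarrow> i < col_length l c" by (rule diagram_iff[OF assms(1)])
  finally show ?thesis using fits_less[OF assms(2), of c] by auto
 qed
 then have "{c. c < w & i < col_length l c} = {..<l ! i}" by auto
 then show ?thesis by simp
qed

lemma bracket_nth: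
 assumes "rat_shape m sh" "i < m"
 shows "bracket (fst sh) (snd sh) ! i = int (fst sh ! i) - int (snd sh ! (m - Suc i))"
 using assms by (auto simp: bracket_def rev_nth rat_shape_def partition_list_def)

lemma length_bracket: "rat_shape m sh ==> length (bracket (fst sh) (snd sh)) = m"
 by (auto simp: bracket_def rat_shape_def partition_list_def)

text \<open>
  The weight attached to a shape counts, after adding \<open>N\<close>, how many of the column sets reach a given row.
\<close>

lemma bracket_count:
 assumes sh: "rat_shape m sh" and fit: "rat_fits N n sh" and i: "i < m"
 shows "bracket (fst sh) (snd sh) ! i + int N = int (card {c. c < n & i < col_height m N sh c})"
proof -
 have part: "partition_list m (fst sh)" "partition_list m (snd sh)" using sh by (auto simp: rat_shape_def)
 have Nn: "N \<le> n" "fits (snd sh) N" "fits (fst sh) (n - N)" using fit by (auto simp: rat_fits_def)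
 let ?f = "%c. if i < col_height m N sh c then 1 else (0::nat)"
 have "card {c. c < n & i < col_height m N sh c} = (\<Sum>c<n. ?f c)" by (rule card_below_as_sum)
 also have "... = (\<Sum>c<N. ?f c) + (\<Sum>c = N..<n. ?f c)"
  using sum.atLeastLessThan_concat[of 0 N n ?f] Nn(1) by (simp add: atLeast0LessThan)
 also have "(\<Sum>c = N..<n. ?f c) = (\<Sum>c<n - N. ?f (c + N))"
  using sum.shift_bounds_nat_ivl[of ?f 0 N "n - N"] Nn(1) by (simp add: atLeast0LessThan)
 also have "... = fst sh ! i"
  unfolding partition_nth_card[OF part(1) Nn(3) i] card_below_as_sum by (simp add: col_height_def)
 also have "(\<Sum>c<N. ?f c) = (\<Sum>c<N. ?f (N - Suc c))" by (rule sum.nat_diff_reindex[symmetric])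
 finally have 1: "card {c. c < n & i < col_height m N sh c} = (\<Sum>c<N. ?f (N - Suc c)) + fst sh ! i" .
 have 2: "(\<Sum>c<N. ?f (N - Suc c)) + snd sh ! (m - Suc i) = N"
 proof -
  have "m - Suc i < m" using i by simp
  then have "snd sh ! (m - Suc i) = (\<Sum>c<N. if m - Suc i < col_length (snd sh) c then 1 else 0)"
   using partition_nth_card[OF part(2) Nn(2), unfolded card_below_as_sum] by blast
  moreover have "?f (N - Suc c) + (if m - Suc i < col_length (snd sh) c then 1 else 0) = 1" if "c < N" for c
  proof -
   have "col_height m N sh (N - Suc c) = m - col_length (snd sh) c"
    using that by (simp add: col_height_def Suc_diff_Suc)
   then show ?thesis using i col_length_le[OF part(2), of c] by auto
  qed
  ultimately show ?thesis by (simp add: sum.distrib[symmetric])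
 qed
 show ?thesis using 1 2 unfolding bracket_nth[OF sh i] by linarith
qed

lemma sum_card_slices:
 fixes n j :: nat
 shows "(\<Sum>i<j. card {c. c < n & i \<in> K c}) = (\<Sum>c<n. card (K c \<inter> {..<j}))"
proof -
 have "(\<Sum>i<j. card {c. c < n & i \<in> K c}) = (\<Sum>c<n. \<Sum>i<j. if i \<in> K c then 1 else 0)"
  unfolding card_below_as_sum by (rule sum.swap)
 also have "... = (\<Sum>c<n. card (K c \<inter> {..<j}))"
  by (rule sum.cong[OF refl]) (simp add: sum.If_cases Int_commute)
 finally show ?thesis .
qed

lemma sum_bracket_take:
 assumes sh: "rat_shape m sh" and fit: "rat_fits N n sh" and j: "j \<le> m"
 shows "sum_list (take j (bracket (fst sh) (snd sh))) + int (j * N) =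
  int (\<Sum>c<n. card ({..<col_height m N sh c} \<inter> {..<j}))"
proof -
 have "sum_list (take j (bracket (fst sh) (snd sh))) = (\<Sum>i<j. bracket (fst sh) (snd sh) ! i)"
  using j length_bracket[OF sh] by (simp add: sum_list_sum_nth atLeast0LessThan)
 then have "sum_list (take j (bracket (fst sh) (snd sh))) + int (j * N) = (\<Sum>i<j. bracket (fst sh) (snd sh) ! i + int N)"
  by (simp add: sum.distrib)
 also have "... = (\<Sum>i<j. int (card {c. c < n & i \<in> {..<col_height m N sh c}}))"
  by (rule sum.cong[OF refl]) (use j bracket_count[OF sh fit] in auto)
 also have "... = int (\<Sum>c<n. card ({..<col_height m N sh c} \<inter> {..<j}))"
  unfolding sum_card_slices[symmetric] by simp
 finally show ?thesis .
qed

lemma col_height_le: "rat_shape m sh ==> col_height m N sh c \<le> m"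
 using col_length_le by (auto simp: col_height_def rat_shape_def)

text \<open>
  Column sets of given sizes contain at most as many elements below \<open>j\<close> as the initial segments of the same sizes, with equality everywhere only if they are these initial segments.
\<close>

lemma content_dominance:
 assumes sh: "rat_shape m sh" "rat_fits N n sh" and sh': "rat_shape m sh'" "rat_fits N n sh'"
  and K: "!!c. c < n ==> K c \<subseteq> {..<m}" "!!c. c < n ==> card (K c) = col_height m N sh' c"
  and content: "!!i. i < m ==> card {c. c < n & i \<in> K c} = card {c. c < n & i < col_height m N sh c}"
 shows "weight_le (bracket (fst sh) (snd sh)) (bracket (fst sh') (snd sh'))"
  and "sh = sh' ==> c < n ==> K c = {..<col_height m N sh c}"
proof -
 have fin: "finite (K c)" if "c < n" for c using K(1)[OF that] by (auto intro: finite_subset)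
 have cut: "card ({..<k} \<inter> {..<j}) = min k j" for k j :: nat
 proof -
  have "{..<k} \<inter> {..<j} = {..<min k j}" by auto
  then show ?thesis by simp
 qed
 have eq: "(\<Sum>c<n. card ({..<col_height m N sh c} \<inter> {..<j})) = (\<Sum>c<n. card (K c \<inter> {..<j}))" if "j \<le> m" for j
  unfolding sum_card_slices[symmetric] by (rule sum.cong[OF refl]) (use that content in auto)
 have le: "card (K c \<inter> {..<j}) \<le> card ({..<col_height m N sh' c} \<inter> {..<j})" if "c < n" for c j
 proof -
  have "card (K c \<inter> {..<j}) \<le> card (K c)" using fin[OF that] by (intro card_mono) auto
  moreover have "card (K c \<inter> {..<j}) \<le> j" using card_mono[of "{..<j}" "K c \<inter> {..<j}"] by simp
  ultimately show ?thesis unfolding cut using K(2)[OF that] by simp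
 qed
 have sums: "sum_list (take j (bracket (fst sh) (snd sh))) \<le> sum_list (take j (bracket (fst sh') (snd sh')))"
  if "j \<le> m" for j
 proof -
  have "(\<Sum>c<n. card ({..<col_height m N sh c} \<inter> {..<j})) \<le> (\<Sum>c<n. card ({..<col_height m N sh' c} \<inter> {..<j}))"
   unfolding eq[OF that] by (rule sum_mono) (use le in auto)
  then have "int (\<Sum>c<n. card ({..<col_height m N sh c} \<inter> {..<j})) \<le> int (\<Sum>c<n. card ({..<col_height m N sh' c} \<inter> {..<j}))"
   by (simp only: of_nat_le_iff)
  then show ?thesis using sum_bracket_take[OF sh that] sum_bracket_take[OF sh' that] by linarith
 qed
 have "(\<Sum>c<n. card ({..<col_height m N sh c} \<inter> {..<m})) = (\<Sum>c<n. card ({..<col_height m N sh' c} \<inter> {..<m}))"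
  unfolding eq[OF order_refl]
 proof (rule sum.cong[OF refl])
  fix c assume "c \<in> {..<n}"
  then have c: "c < n" by simp
  have "K c \<inter> {..<m} = K c" using K(1)[OF c] by blast
  then show "card (K c \<inter> {..<m}) = card ({..<col_height m N sh' c} \<inter> {..<m})"
   unfolding cut using K(2)[OF c] col_height_le[OF sh'(1), of N c] by simp
 qed
 then have "sum_list (take m (bracket (fst sh) (snd sh))) = sum_list (take m (bracket (fst sh') (snd sh')))"
  using sum_bracket_take[OF sh order_refl] sum_bracket_take[OF sh' order_refl] by linarith
 then show "weight_le (bracket (fst sh) (snd sh)) (bracket (fst sh') (snd sh'))"
  using sums by (simp add: weight_le_def length_bracket[OF sh(1)] length_bracket[OF sh'(1)])
 show "K c = {..<col_height m N sh c}" if "sh = sh'" and c: "c < n"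
 proof -
  let ?h = "col_height m N sh c"
  have "?h \<le> m" by (rule col_height_le[OF sh(1)])
  have "card (K c \<inter> {..<?h}) = card ({..<?h} \<inter> {..<?h})"
  proof (rule ccontr)
   assume "card (K c \<inter> {..<?h}) ~= card ({..<?h} \<inter> {..<?h})"
   then have "card (K c \<inter> {..<?h}) < card ({..<?h} \<inter> {..<?h})" using le[OF c, of ?h] that(1) by simp
   then have "(\<Sum>d<n. card (K d \<inter> {..<?h})) < (\<Sum>d<n. card ({..<col_height m N sh d} \<inter> {..<?h}))"
   proof (intro sum_strict_mono_ex1)
    show "\<forall>d\<in>{..<n}. card (K d \<inter> {..<?h}) \<le> card ({..<col_height m N sh d} \<inter> {..<?h})"
     using le that(1) by auto
    show "\<exists>d\<in>{..<n}. card (K d \<inter> {..<?h}) < card ({..<col_height m N sh d} \<inter> {..<?h})"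
     using c \<open>card (K c \<inter> {..<?h}) < card ({..<?h} \<inter> {..<?h})\<close> by blast
   qed simp
   then show False using eq[OF \<open>?h \<le> m\<close>] by simp
  qed
  then have full: "K c \<inter> {..<?h} = {..<?h}"
   by (intro card_subset_eq) auto
  then have "{..<?h} \<subseteq> K c" by blast
  moreover have "card {..<?h} = card (K c)" using K(2)[OF c] that(1) by simp
  ultimately have "{..<?h} = K c" by (rule card_subset_eq[OF fin[OF c]])
  then show ?thesis by (rule sym)
 qed
qed

lemma bracket_inject:
 assumes sh: "rat_shape m sh" and sh': "rat_shape m sh'"
  and eq: "bracket (fst sh) (snd sh) = bracket (fst sh') (snd sh')"
 shows "sh = sh'"
proof -
 have zero: "fst sh ! i = 0 \<or> snd sh ! (m - Suc i) = 0" if sh: "rat_shape m sh" and i: "i < m" for sh i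
 proof (rule ccontr)
  have part: "partition_list m (fst sh)" "partition_list m (snd sh)" using sh by (auto simp: rat_shape_def)
  assume "\<not> (fst sh ! i = 0 \<or> snd sh ! (m - Suc i) = 0)"
  then have "(i, 0) \<in> diagram (fst sh)" "(m - Suc i, 0) \<in> diagram (snd sh)"
   using i part by (auto simp: diagram_def partition_list_def)
  then have "i < col_length (fst sh) 0" "m - Suc i < col_length (snd sh) 0"
   using diagram_iff part by blast+
  moreover have "col_length (fst sh) 0 + col_length (snd sh) 0 \<le> m"
   using sh by (simp add: rat_shape_def nparts_col_length)
  ultimately show False using i by linarith
 qed
 have nth: "fst sh ! i = fst sh' ! i & snd sh ! (m - Suc i) = snd sh' ! (m - Suc i)" if "i < m" for i
  using zero[OF sh that] zero[OF sh' that] arg_cong[OF eq, of "%l. l ! i"]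
  unfolding bracket_nth[OF sh that] bracket_nth[OF sh' that] by auto
 have len: "length (fst sh) = m" "length (snd sh) = m" "length (fst sh') = m" "length (snd sh') = m"
  using sh sh' by (auto simp: rat_shape_def partition_list_def)
 have "fst sh = fst sh'" by (rule nth_equalityI) (use nth len in auto)
 moreover have "snd sh = snd sh'"
 proof (rule nth_equalityI)
  fix i assume "i < length (snd sh)"
  then show "snd sh ! i = snd sh' ! i" using nth[of "m - Suc i"] len by simp
 qed (use len in simp)
 ultimately show ?thesis by (simp add: prod_eq_iff)
qed

section \<open>Minors of generic matrices\<close>

lemma minor_to_fract: "to_fract (minor z I J) = minor (%i j. to_fract (z i j)) I J"
 unfolding minor_def to_fract_det by (intro arg_cong[where f = det] eq_matI) auto

lemma poly_eval_minor: "poly_eval v (minor z I J) = minor (%i j. poly_eval v (z i j)) I J"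
 unfolding minor_def poly_eval_det by (intro arg_cong[where f = det] eq_matI) auto

lemma minor_mat_polys:
 assumes "finite I" "finite J" "card J = card I" "!!i j. i \<in> I ==> j \<in> J ==> z i j \<in> mat_polys m"
 shows "minor z I J \<in> mat_polys m"
 unfolding minor_def by (rule mat_polys_det[of _ "card I"]) (use assms in \<open>auto simp: enum_set_in\<close>)

lemma coord_ring_minor:
 assumes "I \<subseteq> {..<m}" "J \<subseteq> {..<m}" "card J = card I"
 shows "minor (x_fun m) I J \<in> coord_ring m"
proof -
 have "finite I" "finite J" using finite_subset[OF assms(1)] finite_subset[OF assms(2)] by simp_all
 then have "enum_set I a < m" "enum_set J a < m" if "a < card I" for a
  using enum_set_in[of I a] enum_set_in[of J a] that assms by auto
 then show ?thesis unfolding minor_def by (intro coord_ring_det[of _ "card I"]) (auto intro: x_fun_coord)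
qed

lemma feval_minor:
 assumes A: "A \<in> GLF m" and "I \<subseteq> {..<m}" "J \<subseteq> {..<m}" "card J = card I"
 shows "feval m A (minor (x_fun m) I J) = minor (xcoord A) I J"
proof -
 have "finite I" "finite J" using finite_subset[OF assms(2)] finite_subset[OF assms(3)] by simp_all
 then have lt: "enum_set I a < m" "enum_set J a < m" if "a < card I" for a
  using enum_set_in[of I a] enum_set_in[of J a] that assms by auto
 have "feval m A (minor (x_fun m) I J) =
   det (map_mat (feval m A) (mat (card I) (card I) (%(a, b). x_fun m (enum_set I a) (enum_set J b))))"
  unfolding minor_def by (rule feval_det[OF A, of _ "card I"]) (use lt in \<open>auto intro: x_fun_coord\<close>)
 also have "... = minor (xcoord A) I J"
  unfolding minor_def by (intro arg_cong[where f = det] eq_matI) (use lt feval_x_fun[OF A] in auto)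
 finally show ?thesis .
qed

lemma feval_det_fract: "A \<in> GLF m ==> feval m A (det_fract m) = det A"
 using feval_poly[of A m "det_poly m"] poly_eval_det_poly[of A m] det_poly_mat_polys by (simp add: GLF_def)

lemma feval_power: "A \<in> GLF m ==> f \<in> coord_ring m ==> feval m A (f ^ k) = feval m A f ^ k"
 using feval_prod[of A m "{..<k}" "%_. f"] by simp

text \<open>
  Cauchy-Binet for matrices over the function field.
\<close>

lemma minor_mult_mat:
 assumes "A \<in> carrier_mat m m" "B \<in> carrier_mat m m" "I \<subseteq> {..<m}" "J \<subseteq> {..<m}" "card J = card I"
 shows "minor (xcoord (A * B)) I J = (\<Sum>K | K \<subseteq> {..<m} & card K = card I. minor (xcoord A) I K * minor (xcoord B) K J)"
proof -
 have fin: "finite I" "finite J" using finite_subset[OF assms(3)] finite_subset[OF assms(4)] by simp_all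
 have "minor (xcoord (A * B)) I J = minor (%i j. \<Sum>l<m. A $$ (i, l) * B $$ (l, j)) I J"
 proof (rule minor_cong[OF fin assms(5)])
  fix i j assume "i \<in> I" "j \<in> J"
  then have "i < m" "j < m" using assms by auto
  then show "xcoord (A * B) i j = (\<Sum>l<m. A $$ (i, l) * B $$ (l, j))" by (rule index_mult_mat_sum[OF assms(1,2)])
 qed
 then show ?thesis by (simp add: Cauchy_Binet)
qed

text \<open>
  A second generic matrix, independent of the first one.
\<close>

definition shifted_generic :: "nat => zfrac mat" where
 "shifted_generic m = mat m m (%(i, j). to_fract (entry_var (m + i) (m + j)))"

lemma shift_poly_entry_var: "shift_poly m (entry_var i j) = entry_var (m + i) (m + j)"
 unfolding shift_poly_def poly_eval_entry_var by (simp add: entry_var_def shift_var_def)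

lemma to_fract_poly_eval: "to_fract (poly_eval v p) = poly_eval (%k. to_fract (v k)) p"
 unfolding poly_eval_def mono_val_def
 by (simp add: to_fract_sum to_fract_of_int to_fract_prod to_fract_power)

lemma poly_eval_shifted:
 assumes "p \<in> mat_polys m"
 shows "poly_eval (entries (shifted_generic m)) p = to_fract (shift_poly m p)"
 unfolding shift_poly_def to_fract_poly_eval
 by (rule poly_eval_cong)
  (use assms in \<open>force simp: mat_polys_def entries_def shifted_generic_def shift_var_def entry_var_def\<close>)

lemma shift_poly_nonzero: "p ~= 0 ==> shift_poly m p ~= 0"
proof
 assume p: "p ~= 0" "shift_poly m p = 0"
 obtain \<beta> where "lookup p \<beta> ~= 0" using p(1) by (metis lookup_zero poly_mapping_eqI)
 moreover have "lookup (1 * shift_poly m p) (0 + shift_mono m \<beta>) = lookup p \<beta> * lookup (1::zpoly) 0"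
  by (rule lookup_times_shift_poly) (auto simp: base_mono_def)
 ultimately show False using p(2) by simp
qed

lemma shifted_generic_GLF: "shifted_generic m \<in> GLF m"
proof -
 have c: "shifted_generic m \<in> carrier_mat m m" by (simp add: shifted_generic_def)
 have "det (shifted_generic m) = to_fract (shift_poly m (det_poly m))"
  using poly_eval_det_poly[OF c] poly_eval_shifted[OF det_poly_mat_polys] by simp
 then show ?thesis using c shift_poly_nonzero[of "det_poly m"] by (simp add: GLF_def)
qed

lemma shift_poly_prod: "shift_poly m (prod f S) = (\<Prod>x\<in>S. shift_poly m (f x))"
 unfolding shift_poly_def by (rule poly_eval_prod)

abbreviation full_var :: "nat => nat => zpoly" where
 "full_var \<equiv> masked_var (%_ _. True)"

lemma minor_shifted:
 assumes "I \<subseteq> {..<m}" "J \<subseteq> {..<m}" "card J = card I"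
 shows "minor (xcoord (shifted_generic m)) I J = to_fract (shift_poly m (minor full_var I J))"
proof -
 have fin: "finite I" "finite J" using finite_subset[OF assms(1)] finite_subset[OF assms(2)] by simp_all
 have eq: "shift_poly m (minor full_var I J) = minor (%i j. entry_var (m + i) (m + j)) I J"
  unfolding shift_poly_def poly_eval_minor
  unfolding shift_poly_def[symmetric] masked_var_def by (simp add: shift_poly_entry_var)
 show ?thesis
  unfolding eq minor_to_fract
 proof (rule minor_cong[OF fin assms(3)])
  fix i j assume "i \<in> I" "j \<in> J"
  then have "i < m" "j < m" using assms by auto
  then show "xcoord (shifted_generic m) i j = to_fract (entry_var (m + i) (m + j))"
   by (simp add: shifted_generic_def)
 qed
qed

context
 fixes m :: nat and r :: "(nat \<times> nat) set" and ro :: "nat => nat"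
 assumes rank: "is_rank m r ro"
begin

lemma leads_minor_canonical_rows:
 assumes J: "!!c. c < n ==> J c \<subseteq> {..<m}"
  and g: "!!i j. g (prod_encode (i, j)) = i * ro j"
 shows "leads g (\<Prod>c<n. minor full_var {..<card (J c)} (J c)) (chain_mono prod_encode n (%c. card (J c)) (%c. rank_enum m ro (J c)))"
 unfolding chain_mono_def
proof (rule leads_prod)
 fix c assume "c \<in> {..<n}"
 then have Jc: "J c \<subseteq> {..<m}" using J by simp
 let ?k = "card (J c)" and ?t = "rank_enum m ro (J c)"
 have im: "?t ` {..<?k} = J c" by (rule rank_enum(2)[OF rank Jc])
 have "inj_on ?t {..<?k}" using im by (intro eq_card_imp_inj_on) auto
 then have "det (mat ?k ?k (%(a, b). full_var (id a) (?t b))) \<asymp> minor full_var (id ` {..<?k}) (?t ` {..<?k})"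
  by (intro det_enumerated_minor) auto
 moreover have "leads g (det (mat ?k ?k (%(a, b). full_var (id a) (?t b)))) (perm_mono id ?t ?k id)"
  by (rule leads_masked_det[where \<sigma> = id and \<tau> = ro]) (use g rank_enum_less[OF rank Jc] in auto)
 ultimately show "leads g (minor full_var {..<?k} (J c)) (\<Sum>a<?k. single (prod_encode (a, ?t a)) 1)"
  using leads_sign_eq unfolding im by (simp add: perm_mono_def)
qed

lemma leads_minor_canonical_cols:
 assumes I: "!!c. c < n ==> I c \<subseteq> {..<m}"
  and g: "!!i j. g (prod_encode (i, j)) = ro i * j"
  and Z: "!!c a. c < n ==> a < card (I c) ==> Z (rank_enum m ro (I c) a) a"
 shows "leads g (\<Prod>c<n. minor (masked_var Z) (I c) {..<card (I c)})
  (chain_mono (prod_encode \<circ> prod.swap) n (%c. card (I c)) (%c. rank_enum m ro (I c)))"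
 unfolding chain_mono_def
proof (rule leads_prod)
 fix c assume "c \<in> {..<n}"
 then have c: "c < n" and Ic: "I c \<subseteq> {..<m}" using I by auto
 let ?k = "card (I c)" and ?s = "rank_enum m ro (I c)"
 have im: "?s ` {..<?k} = I c" by (rule rank_enum(2)[OF rank Ic])
 have "inj_on ?s {..<?k}" using im by (intro eq_card_imp_inj_on) auto
 then have "det (mat ?k ?k (%(a, b). masked_var Z (?s a) (id b))) \<asymp> minor (masked_var Z) (?s ` {..<?k}) (id ` {..<?k})"
  by (intro det_enumerated_minor) auto
 moreover have "leads g (det (mat ?k ?k (%(a, b). masked_var Z (?s a) (id b)))) (perm_mono ?s id ?k id)"
  by (rule leads_masked_det[where \<sigma> = ro and \<tau> = id]) (use g Z[OF c] rank_enum_less[OF rank Ic] in auto)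
 ultimately show "leads g (minor (masked_var Z) (I c) {..<?k}) (\<Sum>a<?k. single ((prod_encode \<circ> prod.swap) (a, ?s a)) 1)"
  using leads_sign_eq unfolding im by (simp add: perm_mono_def)
qed

text \<open>
  The leading monomial counts, for every position \<open>a\<close>, how often each index occurs as the \<open>a\<close>-th entry of a column set, and along a chain these entries increase weakly.
\<close>

lemma chain_mono_inject:
 assumes e: "inj e"
  and J: "!!c. c < n ==> J c \<subseteq> {..<m}" "!!c. c < n ==> card (J c) = k c"
   "!!c c'. c \<le> c' ==> c' < n ==> col_le ro (J c) (J c')"
  and J': "!!c. c < n ==> J' c \<subseteq> {..<m}" "!!c. c < n ==> card (J' c) = k c"
   "!!c c'. c \<le> c' ==> c' < n ==> col_le ro (J' c) (J' c')"
  and eq: "chain_mono e n k (%c. rank_enum m ro (J c)) = chain_mono e n k (%c. rank_enum m ro (J' c))"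
  and c: "c < n"
 shows "J c = J' c"
proof -
 have anti: "k c' \<le> k c" if "c \<le> c'" "c' < n" for c c'
 proof -
  have "{x \<in> J d. ro x < m} = J d" if "d < n" for d
   using J(1)[OF that] rank_less[OF rank_bij[OF rank]] by auto
  moreover have "card {x \<in> J c'. ro x < m} \<le> card {x \<in> J c. ro x < m}"
   using J(3)[OF that] by (simp add: col_le_def)
  ultimately show ?thesis using J(2) that by simp
 qed
 have mem: "rank_enum m ro (J c) a < m" "rank_enum m ro (J' c) a < m" if "c < n" "a < k c" for c a
 proof -
  have "rank_enum m ro A a \<in> A" if "A \<subseteq> {..<m}" "card A = k c" for A
   using rank_enum(2)[OF rank that(1)] that(2) \<open>a < k c\<close> by auto
  then show "rank_enum m ro (J c) a < m" "rank_enum m ro (J' c) a < m"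
   using J(1,2)[OF that(1)] J'(1,2)[OF that(1)] by auto
 qed
 have same: "rank_enum m ro (J c) a = rank_enum m ro (J' c) a" if a: "a < k c" for a
 proof -
  let ?S = "{c. c < n & a < k c}"
  define w where "w = card ?S"
  have S: "?S = {..<w}" unfolding w_def
   by (rule down_closed_eq_lessThan) (use anti in \<open>auto intro: less_le_trans\<close>)
  have w: "d < w \<longleftrightarrow> d < n & a < k d" for d using S by blast
  have rk: "ro (rank_enum m ro (J c) a) = ro (rank_enum m ro (J' c) a)"
  proof (rule mono_seq_eq_of_counts[where w = w and f = "%d. ro (rank_enum m ro (J d) a)"
     and g = "%d. ro (rank_enum m ro (J' d) a)"])
   fix d d' assume d: "d \<le> d'" "d' < w"
   then have "d < w" by simp
   with d(2) have dn: "d < n" "d' < n" "a < k d" "a < k d'" using w[of d] w[of d'] by blast+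
   show "ro (rank_enum m ro (J d) a) \<le> ro (rank_enum m ro (J d') a)"
    by (rule rank_enum_mono[OF rank J(1) J(1) J(3)]) (use d dn J(2) in auto)
   show "ro (rank_enum m ro (J' d) a) \<le> ro (rank_enum m ro (J' d') a)"
    by (rule rank_enum_mono[OF rank J'(1) J'(1) J'(3)]) (use d dn J'(2) in auto)
  next
   fix v
   show "card {d. d < w & ro (rank_enum m ro (J d) a) = v} = card {d. d < w & ro (rank_enum m ro (J' d) a) = v}"
   proof (cases "\<exists>j<m. ro j = v")
    case True
    then obtain j where j: "j < m" "ro j = v" by blast
    have "{d. d < w & ro (rank_enum m ro (J d) a) = v} = {d. d < n & a < k d & rank_enum m ro (J d) a = j}"
     using w mem(1) rank_eq_iff[OF rank _ j(1)] j(2) by auto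
    moreover have "{d. d < w & ro (rank_enum m ro (J' d) a) = v} = {d. d < n & a < k d & rank_enum m ro (J' d) a = j}"
     using w mem(2) rank_eq_iff[OF rank _ j(1)] j(2) by auto
    ultimately show ?thesis
     using arg_cong[OF eq, of "%p. lookup p (e (a, j))"] unfolding lookup_chain_mono[OF e] by simp
   next
    case False
    then have "{d. d < w & ro (rank_enum m ro (J d) a) = v} = {}" "{d. d < w & ro (rank_enum m ro (J' d) a) = v} = {}"
     using w mem by blast+
    then show ?thesis by (simp only:)
   qed
  next
   show "c < w" using w c a by blast
  qed
  then show ?thesis using rank_eq_iff[OF rank mem(1)[OF c a] mem(2)[OF c a]] by blast
 qed
 have "J c = rank_enum m ro (J c) ` {..<k c}" using rank_enum(2)[OF rank J(1)[OF c]] J(2)[OF c] by simp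
 also have "... = rank_enum m ro (J' c) ` {..<k c}" using same by simp
 also have "... = J' c" using rank_enum(2)[OF rank J'(1)[OF c]] J'(2)[OF c] by simp
 finally show ?thesis .
qed

end

section \<open>Extracting the part of a maximal shape\<close>

text \<open>
  The columns of the canonical tableau become initial segments, also after complementing.
\<close>

lemma canonical_tableau:
 assumes sh: "rat_shape m sh"
 shows "canonical_tableau m sh \<in> rat_tableaux m sh" "rat_inj sh (canonical_tableau m sh)"
  "rat_cols m N sh (canonical_tableau m sh) c = {..<col_height m N sh c}"
proof -
 have part: "partition_list m (fst sh)" "partition_list m (snd sh)" using sh by (auto simp: rat_shape_def)
 have fst: "fst (canonical_tableau m sh) (i, c) = i" if "i < col_length (fst sh) c" for i c
  using that diagram_iff[OF part(1)] by (cases sh) (simp add: canonical_tableau_def)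
 have snd: "snd (canonical_tableau m sh) (i, c) = m - 1 - i" if "i < col_length (snd sh) c" for i c
  using that diagram_iff[OF part(2)] by (cases sh) (simp add: canonical_tableau_def)
 have lt: "i < m" if "i < col_length l c" "partition_list m l" for i c l
  using that col_length_le[of m l c] by simp
 show "canonical_tableau m sh \<in> rat_tableaux m sh"
  unfolding rat_tableaux_iff tableaux_def
 proof (intro conjI PiE_I)
  fix ic assume ic: "ic \<in> diagram (fst sh)"
  obtain i c where "ic = (i, c)" by force
  then show "fst (canonical_tableau m sh) ic \<in> {..<m}"
   using ic fst diagram_iff[OF part(1)] lt[OF _ part(1)] by auto
 next
  fix ic assume ic: "ic \<in> diagram (snd sh)"
  obtain i c where "ic = (i, c)" by force
  then show "snd (canonical_tableau m sh) ic \<in> {..<m}"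
   using ic snd[of i c] diagram_iff[OF part(2)] lt[of i "snd sh" c] part(2) by auto
 qed (cases sh, simp add: canonical_tableau_def)+
 show "rat_inj sh (canonical_tableau m sh)"
  unfolding rat_inj_def col_inj_def
 proof (intro conjI allI)
  show "inj_on (%i. fst (canonical_tableau m sh) (i, c)) {..<col_length (fst sh) c}" for c
   using fst by (auto simp: inj_on_def)
  show "inj_on (%i. snd (canonical_tableau m sh) (i, c)) {..<col_length (snd sh) c}" for c
  proof (rule inj_onI)
   fix i j assume ij: "i \<in> {..<col_length (snd sh) c}" "j \<in> {..<col_length (snd sh) c}"
    "snd (canonical_tableau m sh) (i, c) = snd (canonical_tableau m sh) (j, c)"
   then have "m - 1 - i = m - 1 - j" using snd by simp
   moreover have "i < m" "j < m" using ij lt[OF _ part(2)] by auto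
   ultimately show "i = j" by simp
  qed
 qed
 have "col_set (fst sh) (fst (canonical_tableau m sh)) c = {..<col_length (fst sh) c}" for c
  using fst by (simp add: col_set_def)
 moreover have "{..<m} - col_set (snd sh) (snd (canonical_tableau m sh)) c = {..<m - col_length (snd sh) c}" for c
 proof -
  let ?k = "col_length (snd sh) c"
  have "col_set (snd sh) (snd (canonical_tableau m sh)) c = (%i. m - 1 - i) ` {..<?k}"
   using snd by (simp add: col_set_def)
  also have "... = {m - ?k..<m}"
  proof
   show "(%i. m - 1 - i) ` {..<?k} \<subseteq> {m - ?k..<m}"
    using col_length_le[OF part(2), of c] by auto
   show "{m - ?k..<m} \<subseteq> (%i. m - 1 - i) ` {..<?k}"
   proof
    fix x assume "x \<in> {m - ?k..<m}"
    then have "x = m - 1 - (m - 1 - x)" "m - 1 - x < ?k" by auto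
    then show "x \<in> (%i. m - 1 - i) ` {..<?k}" by blast
   qed
  qed
  finally show ?thesis by auto
 qed
 ultimately show "rat_cols m N sh (canonical_tableau m sh) c = {..<col_height m N sh c}"
  by (simp add: rat_cols_def col_height_def)
qed

lemma bidet_part_coord_ring:
 assumes l: "partition_list m l" and S: "S \<in> tableaux m l" and T: "T \<in> tableaux m l"
  and z: "!!i j. i < m ==> j < m ==> z i j \<in> coord_ring m"
 shows "bidet_part z l S T \<in> coord_ring m"
proof -
 obtain w where w: "fits l w" using ex_fits by blast
 show ?thesis
  unfolding bidet_part_eq_prod[OF w]
 proof (rule coord_ring_prod)
  fix c
  show "col_det z l S T c \<in> coord_ring m"
   unfolding col_det_def
   by (rule coord_ring_det[of _ "col_length l c"])
    (use tableau_entry[OF l S] tableau_entry[OF l T] z in auto)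
 qed
qed

lemma bideterminant_coord_ring:
 assumes "rat_shape m sh" "S \<in> rat_tableaux m sh" "T \<in> rat_tableaux m sh"
 shows "bideterminant m sh S T \<in> coord_ring m"
 unfolding bideterminant_eq
 by (intro coord_ring_mult bidet_part_coord_ring)
  (use assms x_fun_coord y_fun_coord in \<open>auto simp: rat_shape_def rat_tableaux_iff\<close>)

lemma ex_rat_fits: "\<exists>N0 w0. \<forall>N\<ge>N0. \<forall>n\<ge>N + w0. rat_fits N n sh"
proof -
 obtain w1 w2 where "fits (fst sh) w1" "fits (snd sh) w2" using ex_fits by metis
 then have "rat_fits N n sh" if "w2 \<le> N" "N + w1 \<le> n" for N n
  using that fits_mono[of "fst sh" w1 "n - N"] fits_mono[of "snd sh" w2 N] by (simp add: rat_fits_def)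
 then show ?thesis by blast
qed

lemma ex_rat_fits_finite:
 assumes "finite X"
 shows "\<exists>N0 w0. \<forall>N\<ge>N0. \<forall>n\<ge>N + w0. \<forall>ka\<in>X. rat_fits N n (fst ka)"
 using assms
proof (induction X)
 case (insert x X)
 then obtain N0 w0 where 1: "!!N n. N0 \<le> N ==> N + w0 \<le> n ==> \<forall>ka\<in>X. rat_fits N n (fst ka)" by blast
 obtain N1 w1 where 2: "!!N n. N1 \<le> N ==> N + w1 \<le> n ==> rat_fits N n (fst x)"
  using ex_rat_fits[of "fst x"] by blast
 have "\<forall>ka\<in>insert x X. rat_fits N n (fst ka)" if "max N0 N1 \<le> N" "N + max w0 w1 \<le> n" for N n
  using 1[of N n] 2[of N n] that by simp
 then show ?case by blast
qed simp

context
 fixes m :: nat and r :: "(nat \<times> nat) set" and ro :: "nat => nat"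
 assumes rank: "is_rank m r ro"
begin

abbreviation row_cols :: "nat => shape \<times> rat_tableau \<times> rat_tableau => nat => nat set" where
 "row_cols N ka \<equiv> rat_cols m N (fst ka) (fst (snd ka))"

abbreviation col_cols :: "nat => shape \<times> rat_tableau \<times> rat_tableau => nat => nat set" where
 "col_cols N ka \<equiv> rat_cols m N (fst ka) (snd (snd ka))"

lemma std_bitableau_facts:
 assumes "ka \<in> std_bitableaux m r \<pi>"
 shows "rat_shape m (fst ka)" "bracket (fst (fst ka)) (snd (fst ka)) \<in> \<pi>"
  "fst (snd ka) \<in> std_rat_tableaux m r (fst ka)" "snd (snd ka) \<in> std_rat_tableaux m r (fst ka)"
 using assms by (cases ka; simp add: std_bitableaux_iff)+

lemma std_rat_cols_facts:
 assumes sh: "rat_shape m sh" and T: "T \<in> std_rat_tableaux m r sh"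
 shows "rat_cols m N sh T c \<subseteq> {..<m}" "card (rat_cols m N sh T c) = col_height m N sh c"
  "c \<le> c' ==> col_le ro (rat_cols m N sh T c) (rat_cols m N sh T c')"
proof -
 have t: "T \<in> rat_tableaux m sh" using T std_rat_iff[OF rank] by blast
 show "rat_cols m N sh T c \<subseteq> {..<m}" by (rule rat_cols_sub[OF sh t])
 show "card (rat_cols m N sh T c) = col_height m N sh c"
  by (rule card_rat_cols[OF sh t std_rat_inj[OF rank sh T]])
 show "c \<le> c' ==> col_le ro (rat_cols m N sh T c) (rat_cols m N sh T c')"
  by (rule std_rat_cols_chain[OF rank sh T])
qed

lemma std_bidet_minors:
 assumes ka: "ka \<in> std_bitableaux m r \<pi>" and fit: "rat_fits N n (fst ka)"
 shows "det_fract m ^ N * bidet m ka \<asymp> (\<Prod>c<n. minor (x_fun m) (row_cols N ka c) (col_cols N ka c))"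
proof -
 note f = std_bitableau_facts[OF ka]
 have "fst (snd ka) \<in> rat_tableaux m (fst ka)" "snd (snd ka) \<in> rat_tableaux m (fst ka)"
  using f std_rat_iff[OF rank] by blast+
 from det_power_bideterminant[OF f(1) this std_rat_inj[OF rank f(1,3)] std_rat_inj[OF rank f(1,4)] fit]
 show ?thesis by (simp add: case_prod_beta)
qed

lemma bidet_coord_ring: "ka \<in> std_bitableaux m r \<pi> ==> bidet m ka \<in> coord_ring m"
 using std_bitableau_facts[of ka \<pi>] std_rat_iff[OF rank] bideterminant_coord_ring[of m "fst ka" "fst (snd ka)" "snd (snd ka)"]
 by (simp add: case_prod_beta)

text \<open>
  The leading monomial of the product of minors on the rows of the left tableau and initial columns.
\<close>

definition row_lead :: "nat => nat => shape \<times> rat_tableau \<times> rat_tableau => (nat \<Rightarrow>\<^sub>0 nat)" where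
 "row_lead N n ka = chain_mono (prod_encode \<circ> prod.swap) n (col_height m N (fst ka)) (%c. rank_enum m ro (row_cols N ka c))"

definition col_lead :: "nat => nat => shape \<times> rat_tableau \<times> rat_tableau => (nat \<Rightarrow>\<^sub>0 nat)" where
 "col_lead N n ka = chain_mono prod_encode n (col_height m N (fst ka)) (%c. rank_enum m ro (col_cols N ka c))"

lemma leads_col_lead:
 assumes "ka \<in> std_bitableaux m r \<pi>"
 shows "leads (%k. case prod_decode k of (i, j) => i * ro j)
  (\<Prod>c<n. minor full_var {..<col_height m N (fst ka) c} (col_cols N ka c)) (col_lead N n ka)"
proof -
 note f = std_bitableau_facts[OF assms]
 note c = std_rat_cols_facts[OF f(1,4)]
 show ?thesis
  using leads_minor_canonical_rows[OF rank, of n "col_cols N ka" "%k. case prod_decode k of (i, j) => i * ro j"]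
  unfolding c(2) col_lead_def using c(1) by simp
qed

lemma leads_row_lead:
 assumes "ka \<in> std_bitableaux m r \<pi>"
  and Z: "!!c a. c < n ==> a < col_height m N (fst ka) c ==> Z (rank_enum m ro (row_cols N ka c) a) a"
 shows "leads (%k. case prod_decode k of (i, j) => ro i * j)
  (\<Prod>c<n. minor (masked_var Z) (row_cols N ka c) {..<col_height m N (fst ka) c}) (row_lead N n ka)"
proof -
 note f = std_bitableau_facts[OF assms(1)]
 note c = std_rat_cols_facts[OF f(1,3)]
 show ?thesis
  using leads_minor_canonical_cols[OF rank, of n "row_cols N ka" "%k. case prod_decode k of (i, j) => ro i * j" Z]
  unfolding c(2) row_lead_def using c(1) Z by simp
qed

lemma col_lead_inject:
 assumes ka: "ka \<in> std_bitableaux m r \<pi>" "ka' \<in> std_bitableaux m r \<pi>" "fst ka = fst ka'"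
  and fit: "rat_fits N n (fst ka)" and eq: "col_lead N n ka = col_lead N n ka'"
 shows "snd (snd ka) = snd (snd ka')"
proof -
 note f = std_bitableau_facts[OF ka(1)] and f' = std_bitableau_facts[OF ka(2), folded ka(3)]
 note c = std_rat_cols_facts[OF f(1,4)] and c' = std_rat_cols_facts[OF f'(1,4)]
 show ?thesis
 proof (rule std_rat_cols_inject[OF rank f(1,4) f'(4) fit])
  fix d assume "d < n"
  then show "rat_cols m N (fst ka) (snd (snd ka)) d = rat_cols m N (fst ka) (snd (snd ka')) d"
   by (intro chain_mono_inject[OF rank inj_prod_encode, of n _ "col_height m N (fst ka)"])
    (use c c' eq ka(3) in \<open>simp_all add: col_lead_def\<close>)
 qed
qed

lemma row_lead_inject:
 assumes ka: "ka \<in> std_bitableaux m r \<pi>" "ka' \<in> std_bitableaux m r \<pi>" "fst ka = fst ka'"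
  and fit: "rat_fits N n (fst ka)" and eq: "row_lead N n ka = row_lead N n ka'"
 shows "fst (snd ka) = fst (snd ka')"
proof -
 note f = std_bitableau_facts[OF ka(1)] and f' = std_bitableau_facts[OF ka(2), folded ka(3)]
 note c = std_rat_cols_facts[OF f(1,3)] and c' = std_rat_cols_facts[OF f'(1,3)]
 have inj: "inj (prod_encode \<circ> prod.swap)" using inj_prod_encode[of UNIV] by (intro inj_compose) auto
 show ?thesis
 proof (rule std_rat_cols_inject[OF rank f(1,3) f'(3) fit])
  fix d assume "d < n"
  then show "rat_cols m N (fst ka) (fst (snd ka)) d = rat_cols m N (fst ka) (fst (snd ka')) d"
   by (intro chain_mono_inject[OF rank inj, of n _ "col_height m N (fst ka)"])
    (use c c' eq ka(3) in \<open>simp_all add: row_lead_def\<close>)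
 qed
qed

text \<open>
  After expanding by Cauchy-Binet, take the coefficient of the leading monomial of the right tableaux in the variables of the second matrix, for a right tableau of the maximal shape. By dominance a term that contributes has this shape and initial middle column sets, so what remains is a combination of products of minors of \<open>A\<close> on initial columns. The left tableaux that occur have pairwise different leading monomials, so one of these survives.
\<close>

theorem extract_maximal_shape:
 fixes a :: "shape \<times> rat_tableau \<times> rat_tableau => int" and U p :: "'b => zpoly"
 assumes fin: "finite Ks" and std: "Ks \<subseteq> std_bitableaux m r (dominant m)"
  and nz: "!!ka. ka \<in> Ks ==> a ka ~= 0" and fit: "!!ka. ka \<in> Ks ==> rat_fits N n (fst ka)"
  and sh0: "sh0 \<in> fst ` Ks"
  and max: "!!ka. ka \<in> Ks ==> weight_le (bracket (fst sh0) (snd sh0)) (bracket (fst (fst ka)) (snd (fst ka))) ==> fst ka = sh0"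
  and A: "A = mat m m (%(i, j). to_fract (masked_var Z i j))" "A \<in> GLF m"
  and Z: "!!ka c a. ka \<in> Ks ==> c < n ==> a < col_height m N (fst ka) c ==> Z (rank_enum m ro (row_cols N ka c) a) a"
  and B: "finite B" "!!b. b \<in> B ==> U b \<in> mat_polys m" "!!b. b \<in> B ==> p b \<in> mat_polys m"
   "!!b. b \<in> B ==> v b * det_fract m ^ N = to_fract (p b)"
  and eq: "feval m (A * shifted_generic m) (\<Sum>ka\<in>Ks. of_int (a ka) * bidet m ka) * det A ^ N =
   (\<Sum>b\<in>B. to_fract (U b) * feval m (shifted_generic m) (v b))"
 shows "\<exists>K0 e nb. K0 \<subseteq> Ks & (\<forall>ka\<in>K0. fst ka = sh0) &
  (\<Sum>ka\<in>K0. of_int (e ka) * (\<Prod>c<n. minor (masked_var Z) (row_cols N ka c) {..<col_height m N sh0 c})) =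
   (\<Sum>b\<in>B. of_int (nb b) * U b) &
  (\<exists>ka\<in>K0. lookup (\<Sum>b\<in>B. of_int (nb b) * U b) (row_lead N n ka) ~= 0)"
proof -
 let ?Y = "shifted_generic m" and ?h = "col_height m N sh0" and ?mv = "masked_var Z"
 note Y = shifted_generic_GLF[of m]
 have AY: "A * ?Y \<in> GLF m" using A(2) Y by (rule GLF_mult)
 have cA: "A \<in> carrier_mat m m" "?Y \<in> carrier_mat m m" using A(2) Y by (auto simp: GLF_def)
 have facts: "rat_shape m (fst ka)" "fst (snd ka) \<in> std_rat_tableaux m r (fst ka)" "snd (snd ka) \<in> std_rat_tableaux m r (fst ka)"
  if "ka \<in> Ks" for ka using std_bitableau_facts[of ka "dominant m"] std that by blast+
 have Icols: "row_cols N ka c \<subseteq> {..<m}" "card (row_cols N ka c) = col_height m N (fst ka) c"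
  and Jcols: "col_cols N ka c \<subseteq> {..<m}" "card (col_cols N ka c) = col_height m N (fst ka) c"
  if "ka \<in> Ks" for ka c
  using std_rat_cols_facts(1,2)[OF facts(1,2)[OF that]] std_rat_cols_facts(1,2)[OF facts(1,3)[OF that]] by auto
 have "\<forall>ka\<in>Ks. \<exists>s::int. (s = 1 \<or> s = -1) & det_fract m ^ N * bidet m ka =
   of_int s * (\<Prod>c<n. minor (x_fun m) (row_cols N ka c) (col_cols N ka c))"
  (is "\<forall>ka\<in>Ks. \<exists>s. ?Q ka s")
 proof
  fix ka assume k: "ka \<in> Ks"
  show "\<exists>s. ?Q ka s"
   by (rule sign_eq_witness[OF std_bidet_minors[OF subsetD[OF std k] fit[OF k]]])
 qed
 then obtain s :: "_ => int" where s0: "\<forall>ka\<in>Ks. ?Q ka (s ka)" by (rule bchoice[THEN exE])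
 note s = conjunct1[OF bspec[OF s0]] conjunct2[OF bspec[OF s0]]
 let ?f = "\<Sum>ka\<in>Ks. of_int (a ka) * bidet m ka"
 have fc: "?f \<in> coord_ring m"
  using std bidet_coord_ring[of _ "dominant m"] by (intro coord_ring_sum coord_ring_mult coord_ring_of_int) blast
 have minc: "minor (x_fun m) (row_cols N ka c) (col_cols N ka c) \<in> coord_ring m" if "ka \<in> Ks" for ka c
  using Icols[OF that] Jcols[OF that] by (intro coord_ring_minor) auto
 \<comment> \<open>Clear denominators and expand everything by Cauchy-Binet.\<close>
 define Fs where "Fs ka = PiE {..<n} (%c. {K. K \<subseteq> {..<m} & card K = card (row_cols N ka c)})" for ka
 have finFs: "finite (Fs ka)" for ka unfolding Fs_def by (intro finite_PiE) auto
 define q where "q = (%(ka, F). of_int (a ka * s ka) * (\<Prod>c<n. minor ?mv (row_cols N ka c) (F c)))"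
 define P where "P = (%(ka, F). \<Prod>c<n. minor full_var (F c) (col_cols N ka c))"
 have Fs: "F c \<subseteq> {..<m}" "card (F c) = card (row_cols N ka c)" if "F \<in> Fs ka" "c < n" for F ka c
  using that by (auto simp: Fs_def PiE_def Pi_def)
 have expand: "(\<Prod>c<n. minor (xcoord (A * ?Y)) (row_cols N ka c) (col_cols N ka c)) =
   (\<Sum>F\<in>Fs ka. to_fract ((\<Prod>c<n. minor ?mv (row_cols N ka c) (F c)) * shift_poly m (P (ka, F))))"
  if ka: "ka \<in> Ks" for ka
 proof -
  have "minor (xcoord (A * ?Y)) (row_cols N ka c) (col_cols N ka c) =
   (\<Sum>K | K \<subseteq> {..<m} & card K = card (row_cols N ka c).
    to_fract (minor ?mv (row_cols N ka c) K) * to_fract (shift_poly m (minor full_var K (col_cols N ka c))))" for c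
  proof -
   have eqK: "minor (xcoord A) (row_cols N ka c) K = to_fract (minor ?mv (row_cols N ka c) K)"
    "minor (xcoord ?Y) K (col_cols N ka c) = to_fract (shift_poly m (minor full_var K (col_cols N ka c)))"
    if K: "K \<subseteq> {..<m}" "card K = card (row_cols N ka c)" for K
   proof -
    show "minor (xcoord A) (row_cols N ka c) K = to_fract (minor ?mv (row_cols N ka c) K)"
     unfolding minor_to_fract
    proof (rule minor_cong)
     show "finite (row_cols N ka c)" "finite K" using finite_subset[OF Icols(1)[OF ka]] finite_subset[OF K(1)] by simp_all
     fix i j assume "i \<in> row_cols N ka c" "j \<in> K"
     then have "i < m" "j < m" using Icols(1)[OF ka, of c] K(1) by auto
     then show "xcoord A i j = to_fract (?mv i j)" by (simp add: A(1))
    qed (rule K(2))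
    show "minor (xcoord ?Y) K (col_cols N ka c) = to_fract (shift_poly m (minor full_var K (col_cols N ka c)))"
     by (rule minor_shifted[OF K(1) Jcols(1)[OF ka]]) (simp add: K(2) Icols(2)[OF ka] Jcols(2)[OF ka])
   qed
   have "minor (xcoord (A * ?Y)) (row_cols N ka c) (col_cols N ka c) =
    (\<Sum>K | K \<subseteq> {..<m} & card K = card (row_cols N ka c). minor (xcoord A) (row_cols N ka c) K * minor (xcoord ?Y) K (col_cols N ka c))"
    by (rule minor_mult_mat[OF cA Icols(1)[OF ka] Jcols(1)[OF ka]]) (simp add: Icols(2)[OF ka] Jcols(2)[OF ka])
   also have "... = (\<Sum>K | K \<subseteq> {..<m} & card K = card (row_cols N ka c).
    to_fract (minor ?mv (row_cols N ka c) K) * to_fract (shift_poly m (minor full_var K (col_cols N ka c))))"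
    by (rule sum.cong[OF refl]) (simp only: mem_Collect_eq eqK)
   finally show ?thesis .
  qed
  then have "(\<Prod>c<n. minor (xcoord (A * ?Y)) (row_cols N ka c) (col_cols N ka c)) =
   (\<Prod>c<n. \<Sum>K | K \<subseteq> {..<m} & card K = card (row_cols N ka c).
    to_fract (minor ?mv (row_cols N ka c) K) * to_fract (shift_poly m (minor full_var K (col_cols N ka c))))" by simp
  also have "... = (\<Sum>F\<in>Fs ka. \<Prod>c<n. to_fract (minor ?mv (row_cols N ka c) (F c)) *
    to_fract (shift_poly m (minor full_var (F c) (col_cols N ka c))))"
   unfolding Fs_def by (rule prod_sum_PiE) auto
  also have "... = (\<Sum>F\<in>Fs ka. to_fract ((\<Prod>c<n. minor ?mv (row_cols N ka c) (F c)) * shift_poly m (P (ka, F))))"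
   by (rule sum.cong[OF refl]) (simp add: P_def prod.distrib to_fract_prod shift_poly_prod)
  finally show ?thesis .
 qed
 have "feval m (A * ?Y) ?f * det A ^ N * det ?Y ^ N = feval m (A * ?Y) (det_fract m ^ N * ?f)"
  using feval_mult[OF AY _ fc, of "det_fract m ^ N"] feval_power[OF AY, of "det_fract m" N] feval_det_fract[OF AY]
   coord_ring_poly[OF mat_polys_power[OF det_poly_mat_polys], of m N] coord_ring_poly[OF det_poly_mat_polys, of m]
   det_mult[OF cA] by (simp add: to_fract_power power_mult_distrib mult_ac)
 also have "det_fract m ^ N * ?f = (\<Sum>ka\<in>Ks. of_int (a ka * s ka) * (\<Prod>c<n. minor (x_fun m) (row_cols N ka c) (col_cols N ka c)))"
  unfolding sum_distrib_left
 proof (rule sum.cong[OF refl])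
  fix ka assume "ka \<in> Ks"
  then show "det_fract m ^ N * (of_int (a ka) * bidet m ka) =
   of_int (a ka * s ka) * (\<Prod>c<n. minor (x_fun m) (row_cols N ka c) (col_cols N ka c))"
   using s(2)[of ka] by (simp only: of_int_mult mult.assoc mult.left_commute[of "det_fract m ^ N"])
 qed
 also have "feval m (A * ?Y) ... = (\<Sum>ka\<in>Ks. of_int (a ka * s ka) * (\<Prod>c<n. minor (xcoord (A * ?Y)) (row_cols N ka c) (col_cols N ka c)))"
 proof -
  have t: "feval m (A * ?Y) (of_int (a ka * s ka) * (\<Prod>c<n. minor (x_fun m) (row_cols N ka c) (col_cols N ka c))) =
   of_int (a ka * s ka) * (\<Prod>c<n. minor (xcoord (A * ?Y)) (row_cols N ka c) (col_cols N ka c))" if ka: "ka \<in> Ks" for ka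
  proof -
   have "feval m (A * ?Y) (\<Prod>c<n. minor (x_fun m) (row_cols N ka c) (col_cols N ka c)) =
    (\<Prod>c<n. feval m (A * ?Y) (minor (x_fun m) (row_cols N ka c) (col_cols N ka c)))"
    by (rule feval_prod[OF AY]) (rule minc[OF ka])
   also have "... = (\<Prod>c<n. minor (xcoord (A * ?Y)) (row_cols N ka c) (col_cols N ka c))"
    by (rule prod.cong[OF refl], rule feval_minor[OF AY Icols(1)[OF ka] Jcols(1)[OF ka]])
     (simp add: Icols(2)[OF ka] Jcols(2)[OF ka])
   finally have ev: "feval m (A * ?Y) (\<Prod>c<n. minor (x_fun m) (row_cols N ka c) (col_cols N ka c)) =
    (\<Prod>c<n. minor (xcoord (A * ?Y)) (row_cols N ka c) (col_cols N ka c))" .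
   have c: "(\<Prod>c<n. minor (x_fun m) (row_cols N ka c) (col_cols N ka c)) \<in> coord_ring m"
    by (rule coord_ring_prod) (rule minc[OF ka])
   show ?thesis unfolding feval_mult[OF AY coord_ring_of_int c] feval_of_int[OF AY] ev ..
  qed
  have "feval m (A * ?Y) (\<Sum>ka\<in>Ks. of_int (a ka * s ka) * (\<Prod>c<n. minor (x_fun m) (row_cols N ka c) (col_cols N ka c))) =
   (\<Sum>ka\<in>Ks. feval m (A * ?Y) (of_int (a ka * s ka) * (\<Prod>c<n. minor (x_fun m) (row_cols N ka c) (col_cols N ka c))))"
   by (rule feval_sum[OF AY]) (intro coord_ring_mult coord_ring_of_int coord_ring_prod minc)
  also have "... = (\<Sum>ka\<in>Ks. of_int (a ka * s ka) * (\<Prod>c<n. minor (xcoord (A * ?Y)) (row_cols N ka c) (col_cols N ka c)))"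
   by (rule sum.cong[OF refl]) (rule t)
  finally show ?thesis .
 qed
 also have "... = (\<Sum>ka\<in>Ks. \<Sum>F\<in>Fs ka. to_fract (q (ka, F) * shift_poly m (P (ka, F))))"
 proof (rule sum.cong[OF refl])
  fix ka assume ka: "ka \<in> Ks"
  show "of_int (a ka * s ka) * (\<Prod>c<n. minor (xcoord (A * ?Y)) (row_cols N ka c) (col_cols N ka c)) =
   (\<Sum>F\<in>Fs ka. to_fract (q (ka, F) * shift_poly m (P (ka, F))))"
   unfolding expand[OF ka] sum_distrib_left q_def
   by (rule sum.cong[OF refl]) (simp only: prod.case to_fract_mult to_fract_of_int mult.assoc)
 qed
 also have "... = (\<Sum>x\<in>Sigma Ks Fs. to_fract (q x * shift_poly m (P x)))"
 proof (subst sum.Sigma[OF fin])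
  show "\<forall>ka\<in>Ks. finite (Fs ka)" using finFs by blast
  show "(\<Sum>(ka, F)\<in>Sigma Ks Fs. to_fract (q (ka, F) * shift_poly m (P (ka, F)))) =
   (\<Sum>x\<in>Sigma Ks Fs. to_fract (q x * shift_poly m (P x)))"
  proof (rule sum.cong[OF refl])
   fix x show "(case x of (ka, F) => to_fract (q (ka, F) * shift_poly m (P (ka, F)))) = to_fract (q x * shift_poly m (P x))"
    by (cases x) (simp only: prod.case)
  qed
 qed
 also have "... = to_fract (\<Sum>x\<in>Sigma Ks Fs. q x * shift_poly m (P x))" by (simp only: to_fract_sum)
 finally have lhs: "feval m (A * ?Y) ?f * det A ^ N * det ?Y ^ N = to_fract (\<Sum>x\<in>Sigma Ks Fs. q x * shift_poly m (P x))" .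
 have vdet: "feval m ?Y (v b) * det ?Y ^ N = to_fract (shift_poly m (p b))" if "b \<in> B" for b
  using feval_eq[OF Y B(3,4)[OF that]] poly_eval_shifted[OF B(3)[OF that]] by simp
 have "feval m (A * ?Y) ?f * det A ^ N * det ?Y ^ N = (\<Sum>b\<in>B. to_fract (U b) * (feval m ?Y (v b) * det ?Y ^ N))"
  unfolding eq by (simp add: sum_distrib_right mult.assoc)
 also have "... = (\<Sum>b\<in>B. to_fract (U b * shift_poly m (p b)))"
  by (rule sum.cong[OF refl]) (simp add: vdet)
 also have "... = to_fract (\<Sum>b\<in>B. U b * shift_poly m (p b))" by (simp only: to_fract_sum)
 finally have main: "(\<Sum>x\<in>Sigma Ks Fs. q x * shift_poly m (P x)) = (\<Sum>b\<in>B. U b * shift_poly m (p b))"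
  unfolding lhs by (simp only: to_fract_eq_iff)
 \<comment> \<open>The monomial to be read off.\<close>
 let ?g = "%k. case prod_decode k of (i, j) => i * ro j"
 let ?K = "{ka \<in> Ks. fst ka = sh0}"
 have "Max ((%ka. mono_weight ?g (col_lead N n ka)) ` ?K) \<in> (%ka. mono_weight ?g (col_lead N n ka)) ` ?K"
 proof (rule Max_in)
  show "finite ((%ka. mono_weight ?g (col_lead N n ka)) ` ?K)" using fin by simp
  have "?K ~= {}" using sh0 by blast
  then show "(%ka. mono_weight ?g (col_lead N n ka)) ` ?K ~= {}" by blast
 qed
 then obtain ka1 where ka1: "ka1 \<in> Ks" "fst ka1 = sh0"
  "Max ((%ka. mono_weight ?g (col_lead N n ka)) ` ?K) = mono_weight ?g (col_lead N n ka1)" by blast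
 have ka1max: "mono_weight ?g (col_lead N n ka) \<le> mono_weight ?g (col_lead N n ka1)" if "ka \<in> Ks" "fst ka = sh0" for ka
  unfolding ka1(3)[symmetric] using that fin by (intro Max_ge) auto
 define \<beta> where "\<beta> = col_lead N n ka1"
 define K0 where "K0 = {ka \<in> Ks. fst ka = sh0 & snd (snd ka) = snd (snd ka1)}"
 define F0 where "F0 = (\<lambda>c\<in>{..<n}. {..<?h c})"
 have sh0': "rat_shape m sh0" "rat_fits N n sh0" using facts(1)[OF ka1(1)] fit[OF ka1(1)] ka1(2) by auto
 have leadk: "leads ?g (\<Prod>c<n. minor full_var {..<?h c} (col_cols N ka c)) (col_lead N n ka)"
  if "ka \<in> Ks" "fst ka = sh0" for ka
  using leads_col_lead[OF subsetD[OF std that(1)], where n = n and N = N] unfolding that(2) .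
 have rowdeg: "row_degree i \<beta> = card {c. c < n & i < ?h c}" for i
 proof -
  have "\<beta> \<in> keys (\<Prod>c\<in>{..<n}. minor full_var {..<?h c} (col_cols N ka1 c))"
   unfolding \<beta>_def by (rule leads_in_keys[OF leadk[OF ka1(1,2)]])
  then have "row_degree i \<beta> = card {c \<in> {..<n}. i \<in> {..<?h c}}"
   by (rule row_degree_minor_prod[rotated 2])
    (use finite_subset[OF Jcols(1)[OF ka1(1)]] Jcols(2)[OF ka1(1)] ka1(2) in auto)
  then show ?thesis by simp
 qed
 have only: "ka \<in> K0 & F = F0" if ka: "ka \<in> Ks" and F: "F \<in> Fs ka" and nz: "lookup (P (ka, F)) \<beta> ~= 0" for ka F
 proof -
  have keys: "\<beta> \<in> keys (\<Prod>c\<in>{..<n}. minor full_var (F c) (col_cols N ka c))"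
   using nz by (simp add: P_def in_keys_iff)
  have "row_degree i \<beta> = card {c \<in> {..<n}. i \<in> F c}" for i
   by (rule row_degree_minor_prod[OF _ _ keys])
    (use Fs[OF F] Icols(2)[OF ka] finite_subset[OF Jcols(1)[OF ka]] Jcols(2)[OF ka] finite_subset[OF Fs(1)[OF F]] in auto)
  then have content: "card {c. c < n & i \<in> F c} = card {c. c < n & i < ?h c}" for i
   using rowdeg by simp
  have F2: "card (F c) = col_height m N (fst ka) c" if "c < n" for c
   using Fs(2)[OF F that] Icols(2)[OF ka] by simp
  have "weight_le (bracket (fst sh0) (snd sh0)) (bracket (fst (fst ka)) (snd (fst ka)))"
   by (rule content_dominance(1)[OF sh0' facts(1)[OF ka] fit[OF ka], where K = F])
    (erule Fs(1)[OF F], erule F2, rule content)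
  then have sh: "fst ka = sh0" by (rule max[OF ka])
  have Fc: "F c = {..<?h c}" if "c < n" for c
   by (rule content_dominance(2)[OF sh0' facts(1)[OF ka] fit[OF ka], where K = F])
    (erule Fs(1)[OF F], erule F2, rule content, rule sh[symmetric], rule that)
  have FF0: "F = F0"
  proof
   fix c show "F c = F0 c"
   proof (cases "c < n")
    case False
    then show ?thesis using PiE_arb[OF F[unfolded Fs_def], of c] by (simp add: F0_def)
   qed (simp add: Fc F0_def)
  qed
  have "(\<Prod>c\<in>{..<n}. minor full_var (F c) (col_cols N ka c)) = (\<Prod>c<n. minor full_var {..<?h c} (col_cols N ka c))"
   by (rule prod.cong[OF refl]) (simp add: FF0 F0_def)
  then have keys': "\<beta> \<in> keys (\<Prod>c<n. minor full_var {..<?h c} (col_cols N ka c))" using keys by simp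
  have "\<beta> = col_lead N n ka"
  proof (rule ccontr)
   assume "\<beta> ~= col_lead N n ka"
   then have "mono_weight ?g \<beta> < mono_weight ?g (col_lead N n ka)"
    using leadk[OF ka sh] keys' unfolding leads_def by blast
   then show False using ka1max[OF ka sh] by (simp add: \<beta>_def)
  qed
  then have "snd (snd ka) = snd (snd ka1)"
   unfolding \<beta>_def using sh ka1(2)
   by (intro col_lead_inject[OF subsetD[OF std ka] subsetD[OF std ka1(1)] _ fit[OF ka]]) simp_all
  then show ?thesis using FF0 sh ka by (simp add: K0_def)
 qed
 have F0_mem: "F0 \<in> Fs ka" if "ka \<in> K0" for ka
  using that Icols(2)[of ka] col_height_le[OF sh0'(1), of N] by (auto simp: F0_def Fs_def K0_def)
 define l where "l ka = lookup (P (ka, F0)) \<beta>" for ka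
 have l: "l ka ~= 0" if "ka \<in> K0" for ka
 proof -
  have "col_cols N ka = col_cols N ka1" using that ka1 by (simp add: K0_def)
  then have "P (ka, F0) = (\<Prod>c<n. minor full_var {..<?h c} (col_cols N ka1 c))"
   unfolding P_def by (auto intro!: prod.cong simp: F0_def)
  then show ?thesis using leadk[OF ka1(1,2)] by (auto simp: l_def \<beta>_def leads_def)
 qed
 define e where "e ka = l ka * (a ka * s ka)" for ka
 have e: "e ka ~= 0" if "ka \<in> K0" for ka
  using l[OF that] nz[of ka] s(1)[of ka] that by (auto simp: e_def K0_def)
 have mvpoly: "masked_var Z i j \<in> mat_polys m" if "i < m" "j < m" for i j
  using that mat_polys_entry_var by (simp add: masked_var_def)
 have qpoly: "q x \<in> mat_polys m" if x_in: "x \<in> Sigma Ks Fs" for x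
 proof -
  obtain ka F where x: "x = (ka, F)" "ka \<in> Ks" "F \<in> Fs ka" using x_in by (rule SigmaE)
  have "minor ?mv (row_cols N ka c) (F c) \<in> mat_polys m" if "c < n" for c
   using Icols(1)[OF x(2), of c] Fs[OF x(3) that]
   by (intro minor_mat_polys) (auto intro: mvpoly finite_subset[of _ "{..<m}"])
  then show ?thesis unfolding x(1) q_def by (auto intro!: mat_polys_mult mat_polys_of_int mat_polys_prod)
 qed
 have "(\<Sum>x\<in>Sigma Ks Fs. of_int (lookup (P x) \<beta>) * q x) = (\<Sum>b\<in>B. of_int (lookup (p b) \<beta>) * U b)"
  by (rule separate_shifted_variables[OF qpoly B(2) main])
 moreover have "(\<Sum>x\<in>Sigma Ks Fs. of_int (lookup (P x) \<beta>) * q x) =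
   (\<Sum>ka\<in>K0. of_int (l ka) * q (ka, F0))"
 proof -
  have "(\<Sum>x\<in>Sigma Ks Fs. of_int (lookup (P x) \<beta>) * q x) =
    (\<Sum>x\<in>(%ka. (ka, F0)) ` K0. of_int (lookup (P x) \<beta>) * q x)"
  proof (rule sum.mono_neutral_right)
   show "finite (Sigma Ks Fs)" using fin finFs by auto
   show "(%ka. (ka, F0)) ` K0 \<subseteq> Sigma Ks Fs"
   proof (rule image_subsetI)
    fix ka assume k: "ka \<in> K0"
    then have "ka \<in> Ks" by (simp add: K0_def)
    then show "(ka, F0) \<in> Sigma Ks Fs" using F0_mem[OF k] by (rule SigmaI)
   qed
   show "\<forall>x\<in>Sigma Ks Fs - (%ka. (ka, F0)) ` K0. of_int (lookup (P x) \<beta>) * q x = 0"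
   proof
    fix x assume x: "x \<in> Sigma Ks Fs - (%ka. (ka, F0)) ` K0"
    then obtain ka F where kaF: "x = (ka, F)" "ka \<in> Ks" "F \<in> Fs ka" by (elim DiffE SigmaE)
    have "lookup (P x) \<beta> = 0"
    proof (rule ccontr)
     assume "lookup (P x) \<beta> ~= 0"
     then have "ka \<in> K0 & F = F0" using only[OF kaF(2,3)] kaF(1) by simp
     then show False using x kaF(1) by blast
    qed
    then show "of_int (lookup (P x) \<beta>) * q x = 0" by simp
   qed
  qed
  also have "... = (\<Sum>ka\<in>K0. of_int (l ka) * q (ka, F0))"
   by (subst sum.reindex) (auto simp: inj_on_def l_def)
  finally show ?thesis .
 qed
 moreover have "of_int (l ka) * q (ka, F0) = of_int (e ka) * (\<Prod>c<n. minor ?mv (row_cols N ka c) {..<?h c})" for ka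
 proof -
  have "(\<Prod>c<n. minor ?mv (row_cols N ka c) (F0 c)) = (\<Prod>c<n. minor ?mv (row_cols N ka c) {..<?h c})"
   by (rule prod.cong) (auto simp: F0_def)
  then show ?thesis by (simp add: q_def e_def mult.assoc)
 qed
 ultimately have result: "(\<Sum>ka\<in>K0. of_int (e ka) * (\<Prod>c<n. minor ?mv (row_cols N ka c) {..<?h c})) =
   (\<Sum>b\<in>B. of_int (lookup (p b) \<beta>) * U b)" by simp
 have "\<exists>ka\<in>K0. lookup (\<Sum>ka\<in>K0. of_int (e ka) * (\<Prod>c<n. minor ?mv (row_cols N ka c) {..<?h c})) (row_lead N n ka) ~= 0"
 proof (rule leads_combination)
  show "finite K0" using fin by (simp add: K0_def)
  have "ka1 \<in> K0" using ka1 by (simp add: K0_def)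
  then show "K0 ~= {}" by blast
  show "e ka ~= 0" if "ka \<in> K0" for ka using e[OF that] .
  show "leads (%k. case prod_decode k of (i, j) => ro i * j) (\<Prod>c<n. minor ?mv (row_cols N ka c) {..<?h c}) (row_lead N n ka)"
   if "ka \<in> K0" for ka
  proof -
   have k: "ka \<in> Ks" "fst ka = sh0" using that by (simp_all add: K0_def)
   show ?thesis
    using leads_row_lead[OF subsetD[OF std k(1)], where n = n and N = N and Z = Z] Z[OF k(1)]
    unfolding k(2) by blast
  qed
  show "inj_on (row_lead N n) K0"
  proof (rule inj_onI)
   fix ka ka' assume k: "ka \<in> K0" "ka' \<in> K0" "row_lead N n ka = row_lead N n ka'"
   then have kk: "ka \<in> Ks" "ka' \<in> Ks" "fst ka = fst ka'" by (simp_all add: K0_def)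
   have "fst (snd ka) = fst (snd ka')"
    by (rule row_lead_inject[OF subsetD[OF std kk(1)] subsetD[OF std kk(2)] kk(3) fit[OF kk(1)] k(3)])
   moreover have "snd (snd ka) = snd (snd ka')" using k by (simp add: K0_def)
   ultimately show "ka = ka'" using kk(3) by (simp add: prod_eq_iff)
  qed
 qed
 note nonzero = this[unfolded result]
 have K0: "K0 \<subseteq> Ks" "\<forall>ka\<in>K0. fst ka = sh0" unfolding K0_def by blast+
 show ?thesis
  by (intro exI[of _ K0] exI[of _ e] exI[of _ "%b. lookup (p b) \<beta>"] conjI K0 result nonzero)
qed

end

section \<open>Independence and extraction from submodules\<close>

text \<open>
  A linear function that is strictly monotone for the dominance order, used to find maximal shapes.
\<close>

definition weight_height :: "int list => int" where
 "weight_height lam = (\<Sum>j\<le>length lam. sum_list (take j lam))"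

lemma weight_le_height:
 assumes le: "weight_le mu lam" and "mu ~= lam"
 shows "weight_height mu < weight_height lam"
proof -
 have len: "length mu = length lam" and part: "sum_list (take j mu) \<le> sum_list (take j lam)" if "j \<le> length lam" for j
  using le that by (auto simp: weight_le_def)
 have len: "length mu = length lam" using le by (simp add: weight_le_def)
 have "\<exists>j\<in>{..length lam}. sum_list (take j mu) < sum_list (take j lam)"
 proof (rule ccontr)
  assume "\<not> ?thesis"
  then have eq: "sum_list (take j mu) = sum_list (take j lam)" if "j \<le> length lam" for j
   using part that by (force simp: not_less)
  have "mu ! i = lam ! i" if "i < length lam" for i
   using eq[of i] eq[of "Suc i"] that len by (simp add: take_Suc_conv_app_nth)
  then have "mu = lam" using len by (intro nth_equalityI) auto
  then show False using assms(2) by simp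
 qed
 then show ?thesis
  unfolding weight_height_def len using part by (intro sum_strict_mono_ex1) auto
qed

lemma ex_top_shape:
 assumes "finite X" "X ~= {}" and sh: "!!ka. ka \<in> X ==> rat_shape m (fst ka)"
 shows "\<exists>ka0\<in>X. \<forall>ka\<in>X. weight_le (bracket (fst (fst ka0)) (snd (fst ka0))) (bracket (fst (fst ka)) (snd (fst ka))) --> fst ka = fst ka0"
proof -
 let ?b = "%ka. bracket (fst (fst ka)) (snd (fst ka))" and ?H = "%ka. weight_height (bracket (fst (fst ka)) (snd (fst ka)))"
 have "Max (?H ` X) \<in> ?H ` X" using assms(1,2) by (intro Max_in finite_imageI) simp_all
 then obtain ka0 where ka0: "ka0 \<in> X" "Max (?H ` X) = ?H ka0" by blast
 have "fst ka = fst ka0" if ka: "ka \<in> X" and le: "weight_le (?b ka0) (?b ka)" for ka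
 proof -
  have "?H ka \<le> ?H ka0" unfolding ka0(2)[symmetric] using assms(1) ka by (intro Max_ge finite_imageI imageI)
  then have "?b ka0 = ?b ka" using weight_le_height[OF le] by linarith
  then show ?thesis using bracket_inject[OF sh[OF ka] sh[OF ka0(1)]] by simp
 qed
 then show ?thesis using ka0(1) by blast
qed

lemma ex_common_power:
 assumes "finite B" "!!b. b \<in> B ==> v b \<in> coord_ring m"
 shows "\<exists>N0. \<forall>N\<ge>N0. \<forall>b\<in>B. \<exists>p\<in>mat_polys m. v b * det_fract m ^ N = to_fract p"
 using assms
proof (induction B)
 case (insert b B)
 then obtain N0 where 1: "!!N. N0 \<le> N ==> \<forall>b\<in>B. \<exists>p\<in>mat_polys m. v b * det_fract m ^ N = to_fract p" by blast
 have "v b \<in> coord_ring m" using insert.prems by blast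
 then obtain p k where p: "p \<in> mat_polys m" "v b * det_fract m ^ k = to_fract p" by (rule coord_ringE)
 have "\<forall>b\<in>insert b B. \<exists>p\<in>mat_polys m. v b * det_fract m ^ N = to_fract p" if "max N0 k \<le> N" for N
  using 1[of N] coord_ring_raise[OF p, of N] that by simp
 then show ?case by blast
qed simp

lemma choose_power:
 assumes "\<forall>b\<in>B. \<exists>p\<in>mat_polys m. v b * det_fract m ^ N = to_fract p"
 obtains p where "!!b. b \<in> B ==> p b \<in> mat_polys m" "!!b. b \<in> B ==> v b * det_fract m ^ N = to_fract (p b)"
proof -
 have "\<forall>b\<in>B. \<exists>p. p \<in> mat_polys m & v b * det_fract m ^ N = to_fract p" using assms by blast
 then obtain p where "\<forall>b\<in>B. p b \<in> mat_polys m & v b * det_fract m ^ N = to_fract (p b)"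
  by (rule bchoice[THEN exE])
 then show ?thesis using that by blast
qed

lemma std_bitableauxI:
 assumes "rat_shape m (fst ka)" "bracket (fst (fst ka)) (snd (fst ka)) \<in> \<pi>"
  "fst (snd ka) \<in> std_rat_tableaux m r (fst ka)" "snd (snd ka) \<in> std_rat_tableaux m r (fst ka)"
 shows "ka \<in> std_bitableaux m r \<pi>"
 using assms by (cases ka) (simp add: std_bitableaux_iff)

lemma span_finite_sum:
 assumes "f \<in> zmod.span X"
 obtains Y and a :: "zfrac => int" where "finite Y" "Y \<subseteq> X" "f = (\<Sum>x\<in>Y. of_int (a x) * x)"
 using assms unfolding zmod.span_explicit by blast

lemma generic_full: "generic_mat m = mat m m (%(i, j). to_fract (full_var i j))"
 by (rule eq_matI) (auto simp: generic_mat_def to_fract_def masked_var_def)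

lemma to_fract_full_minor:
 assumes "I \<subseteq> {..<m}" "J \<subseteq> {..<m}" "card J = card I"
 shows "to_fract (minor full_var I J) = minor (x_fun m) I J"
proof -
 have fin: "finite I" "finite J" using finite_subset[OF assms(1)] finite_subset[OF assms(2)] by simp_all
 show ?thesis
  unfolding minor_to_fract
 proof (rule minor_cong[OF fin assms(3)])
  fix i j assume "i \<in> I" "j \<in> J"
  then have "i < m" "j < m" using assms by auto
  then show "to_fract (full_var i j) = x_fun m i j"
   by (simp add: x_fun_def generic_mat_entry masked_var_def)
 qed
qed

context
 fixes m :: nat and r :: "(nat \<times> nat) set" and ro :: "nat => nat"
 assumes rank: "is_rank m r ro"
begin

lemma span_std_expansion:
 assumes "f \<in> coord_ring m"
 obtains Ks and a :: "shape \<times> rat_tableau \<times> rat_tableau => int" where "finite Ks" "Ks \<subseteq> std_bitableaux m r (dominant m)"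
  "!!ka. ka \<in> Ks ==> a ka ~= 0" "f = (\<Sum>ka\<in>Ks. of_int (a ka) * bidet m ka)"
proof -
 have "f \<in> zmod.span (bidet m ` std_bitableaux m r (dominant m))"
  using std_bideterminants_span[OF rank] assms by blast
 then obtain Y and a :: "zfrac => int" where Y: "finite Y" "Y \<subseteq> bidet m ` std_bitableaux m r (dominant m)"
  "f = (\<Sum>x\<in>Y. of_int (a x) * x)" by (rule span_finite_sum)
 obtain Ks where Ks: "Ks \<subseteq> std_bitableaux m r (dominant m)" "inj_on (bidet m) Ks" "Y = bidet m ` Ks"
  using Y(2) by (meson subset_image_inj)
 have finK: "finite Ks" using Y(1) Ks(2,3) finite_image_iff by blast
 have f: "f = (\<Sum>ka\<in>Ks. of_int (a (bidet m ka)) * bidet m ka)"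
  unfolding Y(3) Ks(3) by (subst sum.reindex[OF Ks(2)]) simp
 let ?Ks = "{ka \<in> Ks. a (bidet m ka) ~= 0}"
 have "f = (\<Sum>ka\<in>?Ks. of_int (a (bidet m ka)) * bidet m ka)"
  unfolding f
 proof (rule sum.mono_neutral_right[OF finK])
  show "\<forall>ka\<in>Ks - ?Ks. of_int (a (bidet m ka)) * bidet m ka = 0"
  proof
   fix ka assume "ka \<in> Ks - ?Ks"
   then have "a (bidet m ka) = 0" by blast
   then show "of_int (a (bidet m ka)) * bidet m ka = 0" by (simp only: of_int_0 mult_zero_left)
  qed
 qed blast
 moreover have "finite ?Ks" using finK by simp
 moreover have "?Ks \<subseteq> std_bitableaux m r (dominant m)" using Ks(1) by blast
 ultimately show ?thesis by (intro that[of ?Ks "%ka. a (bidet m ka)"]) simp_all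
qed

text \<open>
  A relation is evaluated at a product of two generic matrices; the extracted combination is zero on one side and contains a leading monomial on the other.
\<close>

theorem std_bideterminants_independent:
 fixes a :: "shape \<times> rat_tableau \<times> rat_tableau => int"
 assumes fin: "finite Ks" and std: "Ks \<subseteq> std_bitableaux m r (dominant m)"
  and zero: "(\<Sum>ka\<in>Ks. of_int (a ka) * bidet m ka) = 0" and ka: "ka \<in> Ks"
 shows "a ka = 0"
proof (rule ccontr)
 assume "a ka ~= 0"
 let ?Ks = "{ka \<in> Ks. a ka ~= 0}"
 have "finite ?Ks" using fin by simp
 moreover have "ka \<in> ?Ks" using ka \<open>a ka ~= 0\<close> by (intro CollectI conjI)
 then have "?Ks ~= {}" by blast
 moreover have "?Ks \<subseteq> std_bitableaux m r (dominant m)" using std by blast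
 ultimately have K: "finite ?Ks" "?Ks ~= {}" "?Ks \<subseteq> std_bitableaux m r (dominant m)" .
 have "(\<Sum>ka\<in>Ks. of_int (a ka) * bidet m ka) = (\<Sum>ka\<in>?Ks. of_int (a ka) * bidet m ka)"
 proof (rule sum.mono_neutral_right[OF fin])
  show "\<forall>ka\<in>Ks - ?Ks. of_int (a ka) * bidet m ka = 0"
  proof
   fix ka assume "ka \<in> Ks - ?Ks"
   then have "a ka = 0" by blast
   then show "of_int (a ka) * bidet m ka = 0" by (simp only: of_int_0 mult_zero_left)
  qed
 qed blast
 then have zero': "(\<Sum>ka\<in>?Ks. of_int (a ka) * bidet m ka) = 0" using zero by (rule trans[OF sym])
 have sh: "rat_shape m (fst ka)" if "ka \<in> ?Ks" for ka
  by (rule std_bitableau_facts(1)[OF rank subsetD[OF K(3) that]])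
 obtain ka0 where ka0: "ka0 \<in> ?Ks" and top: "!!ka. ka \<in> ?Ks ==>
   weight_le (bracket (fst (fst ka0)) (snd (fst ka0))) (bracket (fst (fst ka)) (snd (fst ka))) ==> fst ka = fst ka0"
  using ex_top_shape[OF K(1,2) sh] by blast
 obtain N w where "\<forall>N'\<ge>N. \<forall>n\<ge>N' + w. \<forall>ka\<in>?Ks. rat_fits N' n (fst ka)" using ex_rat_fits_finite[OF K(1)] by blast
 then have fit: "rat_fits N (N + w) (fst ka)" if "ka \<in> ?Ks" for ka using that by blast
 have ev: "feval m (generic_mat m * shifted_generic m) (\<Sum>ka\<in>?Ks. of_int (a ka) * bidet m ka) * det (generic_mat m) ^ N =
  (\<Sum>b\<in>({}::nat set). to_fract 0 * feval m (shifted_generic m) 0)"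
  unfolding zero' feval_0[OF GLF_mult[OF generic_GLF shifted_generic_GLF]] by simp
 have nz: "a ka ~= 0" if "ka \<in> ?Ks" for ka using that by blast
 have shK: "fst ka0 \<in> fst ` ?Ks" using ka0 by (rule imageI)
 have none: "b \<in> ({}::nat set) ==> (0::zpoly) \<in> mat_polys m" "b \<in> ({}::nat set) ==> (0::zfrac) * det_fract m ^ N = to_fract 0" for b
  by simp_all
 show False
  using extract_maximal_shape[where U = "%_. 0" and p = "%_. 0" and v = "%_. 0" and B = "{}::nat set",
    OF rank K(1,3) nz fit shK top generic_full generic_GLF TrueI finite.emptyI none(1) none(1) none(2) ev]
  by simp
qed

text \<open>
  The coefficients of the comodule identity in the second variables are integral combinations of the elements \<open>u i\<close> of \<open>M\<close>. Choose a maximal shape among those outside \<open>\<pi>\<close>; as \<open>\<pi>\<close> is saturated, no shape of the expansion that lies in \<open>\<pi>\<close> dominates it.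
\<close>

lemma extract_from_submodule:
 fixes k :: nat
 assumes M: "zmod.subspace M" "M \<subseteq> coord_ring m" and f: "f \<in> coord_ring m" and \<pi>: "saturated m \<pi>"
  and uv: "!!i. i < k ==> u i \<in> M" "!!i. i < k ==> v i \<in> coord_ring m"
  and comod: "!!A B. A \<in> GLF m ==> B \<in> GLF m ==> feval m (A * B) f = (\<Sum>i<k. feval m A (u i) * feval m B (v i))"
  and notin: "f \<notin> zmod.span (bidet m ` std_bitableaux m r \<pi>)"
 shows "\<exists>sh F. rat_shape m sh & bracket (fst sh) (snd sh) \<notin> \<pi> & F \<in> M & F ~= 0 &
  F \<in> zmod.span {bideterminant m sh S (canonical_tableau m sh) | S. S \<in> rat_tableaux m sh}"
proof -
 obtain Ks and a :: "shape \<times> rat_tableau \<times> rat_tableau => int" where K: "finite Ks" "Ks \<subseteq> std_bitableaux m r (dominant m)"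
  and nz: "!!ka. ka \<in> Ks ==> a ka ~= 0" and fK: "f = (\<Sum>ka\<in>Ks. of_int (a ka) * bidet m ka)"
  using span_std_expansion[OF f] by blast
 note facts = std_bitableau_facts[OF rank subsetD[OF K(2)]]
 let ?b = "%ka. bracket (fst (fst ka)) (snd (fst ka))"
 let ?X = "{ka \<in> Ks. ?b ka \<notin> \<pi>}"
 have "?X ~= {}"
 proof
  assume empty: "?X = {}"
  have "ka \<in> std_bitableaux m r \<pi>" if "ka \<in> Ks" for ka
  proof (rule std_bitableauxI)
   show "?b ka \<in> \<pi>" using empty that by blast
  qed (use facts[OF that] in simp_all)
  then have "f \<in> zmod.span (bidet m ` std_bitableaux m r \<pi>)"
   unfolding fK by (intro zmod.span_sum zmod.span_scale zmod.span_base imageI)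
  then show False using notin by contradiction
 qed
 moreover have "finite ?X" using K(1) by simp
 moreover have "rat_shape m (fst ka)" if "ka \<in> ?X" for ka using facts(1) that by blast
 ultimately obtain ka0 where ka0: "ka0 \<in> ?X" and top0: "!!ka. ka \<in> ?X ==> weight_le (?b ka0) (?b ka) ==> fst ka = fst ka0"
  using ex_top_shape[of ?X m] by blast
 define sh where "sh = fst ka0"
 have ka0K: "ka0 \<in> Ks" "?b ka0 \<notin> \<pi>" using ka0 by blast+
 have sh: "rat_shape m sh" "bracket (fst sh) (snd sh) \<notin> \<pi>" using facts(1)[OF ka0K(1)] ka0K(2) by (simp_all add: sh_def)
 have top: "fst ka = sh" if ka: "ka \<in> Ks" and le: "weight_le (bracket (fst sh) (snd sh)) (?b ka)" for ka
 proof (cases "?b ka \<in> \<pi>")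
  case True
  then have "bracket (fst sh) (snd sh) \<in> \<pi>"
   using \<pi> le bracket_dominant[OF sh(1)] unfolding saturated_def by blast
  then show ?thesis using sh(2) by contradiction
 next
  case False
  then show ?thesis using top0[of ka] ka le by (simp add: sh_def)
 qed
 obtain N0 w where fit0: "!!N n. N0 \<le> N ==> N + w \<le> n ==> \<forall>ka\<in>Ks. rat_fits N n (fst ka)"
  using ex_rat_fits_finite[OF K(1)] by blast
 have "\<exists>N0. \<forall>N\<ge>N0. \<forall>b\<in>{..<k}. \<exists>p\<in>mat_polys m. u b * det_fract m ^ N = to_fract p"
  by (rule ex_common_power) (use uv(1) M(2) in auto)
 then obtain N1 where N1: "\<forall>N\<ge>N1. \<forall>b\<in>{..<k}. \<exists>p\<in>mat_polys m. u b * det_fract m ^ N = to_fract p" ..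
 have "\<exists>N0. \<forall>N\<ge>N0. \<forall>b\<in>{..<k}. \<exists>p\<in>mat_polys m. v b * det_fract m ^ N = to_fract p"
  by (rule ex_common_power) (use uv(2) in auto)
 then obtain N2 where N2: "\<forall>N\<ge>N2. \<forall>b\<in>{..<k}. \<exists>p\<in>mat_polys m. v b * det_fract m ^ N = to_fract p" ..
 define N where "N = max N0 (max N1 N2)"
 define n where "n = N + w"
 have fit: "rat_fits N n (fst ka)" if "ka \<in> Ks" for ka using fit0[of N n] that by (simp add: N_def n_def)
 obtain U where U: "!!b. b \<in> {..<k} ==> U b \<in> mat_polys m" "!!b. b \<in> {..<k} ==> u b * det_fract m ^ N = to_fract (U b)"
  by (rule choose_power[OF spec[OF N1, of N, THEN mp]]) (auto simp: N_def)
 obtain p where p: "!!b. b \<in> {..<k} ==> p b \<in> mat_polys m" "!!b. b \<in> {..<k} ==> v b * det_fract m ^ N = to_fract (p b)"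
  by (rule choose_power[OF spec[OF N2, of N, THEN mp]]) (auto simp: N_def)
 have ev: "feval m (generic_mat m * shifted_generic m) (\<Sum>ka\<in>Ks. of_int (a ka) * bidet m ka) * det (generic_mat m) ^ N =
  (\<Sum>b\<in>{..<k}. to_fract (U b) * feval m (shifted_generic m) (v b))"
 proof -
  have "feval m (generic_mat m * shifted_generic m) f * det_fract m ^ N =
    (\<Sum>i<k. feval m (generic_mat m) (u i) * feval m (shifted_generic m) (v i)) * det_fract m ^ N"
   unfolding comod[OF generic_GLF shifted_generic_GLF] ..
  also have "... = (\<Sum>i<k. (u i * det_fract m ^ N) * feval m (shifted_generic m) (v i))"
   unfolding sum_distrib_right
  proof (rule sum.cong[OF refl])
   fix i assume "i \<in> {..<k}"
   then have "feval m (generic_mat m) (u i) = u i" using uv(1) M(2) by (intro feval_generic) auto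
   then show "feval m (generic_mat m) (u i) * feval m (shifted_generic m) (v i) * det_fract m ^ N =
    (u i * det_fract m ^ N) * feval m (shifted_generic m) (v i)" by (simp only: mult_ac)
  qed
  also have "... = (\<Sum>b\<in>{..<k}. to_fract (U b) * feval m (shifted_generic m) (v b))"
   by (rule sum.cong[OF refl]) (simp only: U(2))
  finally show ?thesis unfolding fK det_generic .
 qed
 have shK: "sh \<in> fst ` Ks" unfolding sh_def using ka0K(1) by (rule imageI)
 have "\<exists>K0 e nb. K0 \<subseteq> Ks & (\<forall>ka\<in>K0. fst ka = sh) &
  (\<Sum>ka\<in>K0. of_int (e ka) * (\<Prod>c<n. minor full_var (row_cols m N ka c) {..<col_height m N sh c})) =
   (\<Sum>b\<in>{..<k}. of_int (nb b) * U b) &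
  (\<exists>ka\<in>K0. lookup (\<Sum>b\<in>{..<k}. of_int (nb b) * U b) (row_lead m ro N n ka) ~= 0)"
  by (rule extract_maximal_shape[OF rank K(1,2) nz fit shK top generic_full generic_GLF TrueI finite_lessThan U(1) p ev])
 then obtain K0 e nb where K0: "K0 \<subseteq> Ks" "\<forall>ka\<in>K0. fst ka = sh"
  and W: "(\<Sum>ka\<in>K0. of_int (e ka) * (\<Prod>c<n. minor full_var (row_cols m N ka c) {..<col_height m N sh c})) =
   (\<Sum>b\<in>{..<k}. of_int (nb b) * U b)"
  and lead: "\<exists>ka\<in>K0. lookup (\<Sum>b\<in>{..<k}. of_int (nb b) * U b) (row_lead m ro N n ka) ~= 0"
  by (elim exE conjE) (rule that)
 define F where "F = (\<Sum>b\<in>{..<k}. of_int (nb b) * u b)"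
 have FM: "F \<in> M"
  unfolding F_def by (intro zmod.subspace_sum[OF M(1)] zmod.subspace_scale[OF M(1)] uv(1)) simp
 have FW: "F * det_fract m ^ N = to_fract (\<Sum>b\<in>{..<k}. of_int (nb b) * U b)"
  unfolding F_def sum_distrib_right to_fract_sum
  by (rule sum.cong[OF refl]) (simp only: to_fract_mult to_fract_of_int mult.assoc U(2))
 have "F ~= 0"
 proof
  assume "F = 0"
  then have "to_fract (\<Sum>b\<in>{..<k}. of_int (nb b) * U b) = 0" using FW by (metis mult_zero_left)
  then have "(\<Sum>b\<in>{..<k}. of_int (nb b) * U b) = 0" by (simp only: to_fract_eq_0_iff)
  then show False using lead by simp
 qed
 let ?G = "{bideterminant m sh S (canonical_tableau m sh) | S. S \<in> rat_tableaux m sh}"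
 have "F = (\<Sum>ka\<in>K0. of_int (e ka) * (to_fract (\<Prod>c<n. minor full_var (row_cols m N ka c) {..<col_height m N sh c}) / det_fract m ^ N))"
 proof -
  have "F = to_fract (\<Sum>ka\<in>K0. of_int (e ka) * (\<Prod>c<n. minor full_var (row_cols m N ka c) {..<col_height m N sh c})) / det_fract m ^ N"
   unfolding W FW[symmetric] by simp
  then show ?thesis by (simp only: to_fract_sum to_fract_mult to_fract_of_int sum_divide_distrib times_divide_eq_right)
 qed
 also have "... \<in> zmod.span ?G"
 proof (intro zmod.span_sum zmod.span_scale)
  fix ka assume ka: "ka \<in> K0"
  have kaK: "ka \<in> Ks" "fst ka = sh" using K0 ka by blast+
  let ?S = "fst (snd ka)"
  have S: "?S \<in> std_rat_tableaux m r sh" using facts(3)[OF kaK(1)] kaK(2) by simp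
  have S': "?S \<in> rat_tableaux m sh" using S std_rat_iff[OF rank] by blast
  note cols = std_rat_cols_facts[OF rank sh(1) S]
  have "det_fract m ^ N * bideterminant m sh ?S (canonical_tableau m sh) \<asymp>
    (\<Prod>c<n. minor (x_fun m) (rat_cols m N sh ?S c) (rat_cols m N sh (canonical_tableau m sh) c))"
   by (rule det_power_bideterminant[OF sh(1) S' canonical_tableau(1)[OF sh(1)] std_rat_inj[OF rank sh(1) S]
     canonical_tableau(2)[OF sh(1)]]) (use fit[OF kaK(1)] kaK(2) in simp)
  also have "(\<Prod>c<n. minor (x_fun m) (rat_cols m N sh ?S c) (rat_cols m N sh (canonical_tableau m sh) c)) =
    to_fract (\<Prod>c<n. minor full_var (row_cols m N ka c) {..<col_height m N sh c})"
   unfolding to_fract_prod canonical_tableau(3)[OF sh(1)] kaK(2)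
   by (rule prod.cong[OF refl], rule to_fract_full_minor[symmetric])
    (use cols(1,2) col_height_le[OF sh(1), of N] in auto)
  finally obtain s :: int where "to_fract (\<Prod>c<n. minor full_var (row_cols m N ka c) {..<col_height m N sh c}) =
    of_int s * (det_fract m ^ N * bideterminant m sh ?S (canonical_tableau m sh))"
   using sign_eq_witness[OF sign_eq_sym] by blast
  then have "to_fract (\<Prod>c<n. minor full_var (row_cols m N ka c) {..<col_height m N sh c}) / det_fract m ^ N =
    of_int s * bideterminant m sh ?S (canonical_tableau m sh)" by simp
  moreover have "bideterminant m sh ?S (canonical_tableau m sh) \<in> ?G" using S' by blast
  ultimately show "to_fract (\<Prod>c<n. minor full_var (row_cols m N ka c) {..<col_height m N sh c}) / det_fract m ^ N \<in> zmod.span ?G"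
   using zmod.span_scale[OF zmod.span_base] by simp
 qed
 finally show ?thesis using sh FM \<open>F ~= 0\<close> by blast
qed

end

section \<open>Values of bideterminants and transposition\<close>

lemma feval_bidet_part:
 assumes B: "B \<in> GLF m" and l: "partition_list m l" and ST: "S \<in> tableaux m l" "T \<in> tableaux m l"
  and z: "!!i j. i < m ==> j < m ==> z i j \<in> coord_ring m" "!!i j. i < m ==> j < m ==> feval m B (z i j) = w i j"
 shows "feval m B (bidet_part z l S T) = bidet_part w l S T"
proof -
 obtain n where n: "fits l n" using ex_fits by blast
 note e = tableau_entry[OF l ST(1)] tableau_entry[OF l ST(2)]
 have c: "feval m B (col_det z l S T c) = col_det w l S T c" "col_det z l S T c \<in> coord_ring m" for c
 proof -
  let ?M = "mat (col_length l c) (col_length l c) (%(a, b). z (S (a, c)) (T (b, c)))"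
  have M: "?M \<in> carrier_mat (col_length l c) (col_length l c)" "!!i j. i < col_length l c ==> j < col_length l c ==> ?M $$ (i, j) \<in> coord_ring m"
   using e z(1) by simp_all
  have "feval m B (det ?M) = det (map_mat (feval m B) ?M)" by (rule feval_det[OF B M(1)]) (rule M(2))
  also have "... = col_det w l S T c"
   unfolding col_det_def by (intro arg_cong[where f = det] eq_matI) (use e z(2) in auto)
  finally show "feval m B (col_det z l S T c) = col_det w l S T c" unfolding col_det_def .
  show "col_det z l S T c \<in> coord_ring m" unfolding col_det_def by (rule coord_ring_det[OF M])
 qed
 show ?thesis
  unfolding bidet_part_eq_prod[OF n] using feval_prod[OF B, of "{..<n}" "col_det z l S T"] c by simp
qed

lemma feval_bideterminant:
 assumes B: "B \<in> GLF m" and sh: "rat_shape m sh" and ST: "S \<in> rat_tableaux m sh" "T \<in> rat_tableaux m sh"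
 shows "feval m B (bideterminant m sh S T) =
  bidet_part (xcoord B) (fst sh) (fst S) (fst T) * bidet_part (ycoord m B) (snd sh) (snd S) (snd T)"
proof -
 have p: "partition_list m (fst sh)" "partition_list m (snd sh)" using sh by (auto simp: rat_shape_def)
 have t: "fst S \<in> tableaux m (fst sh)" "fst T \<in> tableaux m (fst sh)" "snd S \<in> tableaux m (snd sh)" "snd T \<in> tableaux m (snd sh)"
  using ST by (auto simp: rat_tableaux_iff)
 show ?thesis
  unfolding bideterminant_eq
  using feval_mult[OF B bidet_part_coord_ring[OF p(1) t(1,2) x_fun_coord] bidet_part_coord_ring[OF p(2) t(3,4) y_fun_coord]]
   feval_bidet_part[OF B p(1) t(1,2) x_fun_coord feval_x_fun[OF B]]
   feval_bidet_part[OF B p(2) t(3,4) y_fun_coord feval_y_fun[OF B]] by simp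
qed

lemma coord_ring_eqI:
 assumes "f \<in> coord_ring m" "g \<in> coord_ring m" "!!B. B \<in> GLF m ==> feval m B f = feval m B g"
 shows "f = g"
 using assms(3)[OF generic_GLF] feval_generic[OF assms(1)] feval_generic[OF assms(2)] by simp

lemma bidet_part_cong:
 assumes l: "partition_list m l" and ST: "S \<in> tableaux m l" "T \<in> tableaux m l"
  and "!!i j. i < m ==> j < m ==> z i j = w i j"
 shows "bidet_part z l S T = bidet_part w l S T"
proof -
 obtain n where n: "fits l n" using ex_fits by blast
 show ?thesis
  unfolding bidet_part_eq_prod[OF n] col_det_def
  by (intro prod.cong arg_cong[where f = det] eq_matI)
   (use assms(4) tableau_entry[OF l ST(1)] tableau_entry[OF l ST(2)] in auto)
qed

lemma bidet_part_swap: "bidet_part (%i j. z j i) l S T = bidet_part z l T S"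
proof -
 obtain n where n: "fits l n" using ex_fits by blast
 have "col_det (%i j. z j i) l S T c = col_det z l T S c" for c
  unfolding col_det_def
  by (subst det_transpose[symmetric, of _ "col_length l c"]) (auto intro!: arg_cong[where f = det] eq_matI)
 then show ?thesis unfolding bidet_part_eq_prod[OF n] by simp
qed

lemma transpose_GLF: "B \<in> GLF m ==> transpose_mat B \<in> GLF m"
 by (auto simp: GLF_def det_transpose)

lemma ycoord_transpose:
 assumes B: "B \<in> GLF m" and "i < m" "j < m"
 shows "ycoord m (transpose_mat B) i j = ycoord m B j i"
proof -
 note b = inv_GLF[OF B]
 have c: "B \<in> carrier_mat m m" using B by (simp add: GLF_def)
 have "transpose_mat (inv_GLF m B) = inv_GLF m (transpose_mat B)"
 proof (rule inv_GLF_unique[OF transpose_GLF[OF B]])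
  show "transpose_mat B * transpose_mat (inv_GLF m B) = 1\<^sub>m m"
   using transpose_mult[OF b(1) c] b(3) by simp
 qed (use b in simp)
 then show ?thesis unfolding ycoord_def using b(1) assms(2,3) by (metis index_transpose_mat(1) carrier_matD)
qed

lemma feval_transpose:
 assumes B: "B \<in> GLF m" and sh: "rat_shape m sh" and ST: "S \<in> rat_tableaux m sh" "T \<in> rat_tableaux m sh"
 shows "feval m (transpose_mat B) (bideterminant m sh S T) = feval m B (bideterminant m sh T S)"
proof -
 have p: "partition_list m (fst sh)" "partition_list m (snd sh)" using sh by (auto simp: rat_shape_def)
 have t: "fst S \<in> tableaux m (fst sh)" "fst T \<in> tableaux m (fst sh)" "snd S \<in> tableaux m (snd sh)" "snd T \<in> tableaux m (snd sh)"
  using ST by (auto simp: rat_tableaux_iff)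
 have "bidet_part (xcoord (transpose_mat B)) (fst sh) (fst S) (fst T) = bidet_part (%i j. xcoord B j i) (fst sh) (fst S) (fst T)"
  by (rule bidet_part_cong[OF p(1) t(1,2)]) (use B in \<open>auto simp: GLF_def\<close>)
 moreover have "bidet_part (ycoord m (transpose_mat B)) (snd sh) (snd S) (snd T) = bidet_part (%i j. ycoord m B j i) (snd sh) (snd S) (snd T)"
  by (rule bidet_part_cong[OF p(2) t(3,4)]) (rule ycoord_transpose[OF B])
 ultimately show ?thesis
  unfolding feval_bideterminant[OF transpose_GLF[OF B] sh ST] feval_bideterminant[OF B sh ST(2,1)]
  by (simp only: bidet_part_swap[of "xcoord B"] bidet_part_swap[of "ycoord m B"])
qed

text \<open>
  Transposing the argument exchanges the two tableaux. This relates the two kinds of modules without a transposition map on the coordinate ring.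
\<close>

lemma bideterminant_swap_sum:
 assumes "!!ka. ka \<in> Ks ==> rat_shape m (sh ka)" "!!ka. ka \<in> Ks ==> S ka \<in> rat_tableaux m (sh ka)" "!!ka. ka \<in> Ks ==> T ka \<in> rat_tableaux m (sh ka)"
  and B: "B \<in> GLF m"
 shows "feval m (transpose_mat B) (\<Sum>ka\<in>Ks. of_int (a ka) * bideterminant m (sh ka) (S ka) (T ka)) =
  feval m B (\<Sum>ka\<in>Ks. of_int (a ka) * bideterminant m (sh ka) (T ka) (S ka))"
proof -
 note c = bideterminant_coord_ring[OF assms(1) assms(2) assms(3)] bideterminant_coord_ring[OF assms(1) assms(3) assms(2)]
 have "feval m (transpose_mat B) (\<Sum>ka\<in>Ks. of_int (a ka) * bideterminant m (sh ka) (S ka) (T ka)) =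
  (\<Sum>ka\<in>Ks. of_int (a ka) * feval m (transpose_mat B) (bideterminant m (sh ka) (S ka) (T ka)))"
  by (subst feval_sum[OF transpose_GLF[OF B]]) (auto intro!: sum.cong coord_ring_mult c simp: feval_mult[OF transpose_GLF[OF B] coord_ring_of_int c(1)] feval_of_int[OF transpose_GLF[OF B]])
 moreover have "feval m B (\<Sum>ka\<in>Ks. of_int (a ka) * bideterminant m (sh ka) (T ka) (S ka)) =
  (\<Sum>ka\<in>Ks. of_int (a ka) * feval m B (bideterminant m (sh ka) (T ka) (S ka)))"
  by (subst feval_sum[OF B]) (auto intro!: sum.cong coord_ring_mult c simp: feval_mult[OF B coord_ring_of_int c(2)] feval_of_int[OF B])
 moreover have "(\<Sum>ka\<in>Ks. of_int (a ka) * feval m (transpose_mat B) (bideterminant m (sh ka) (S ka) (T ka))) =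
  (\<Sum>ka\<in>Ks. of_int (a ka) * feval m B (bideterminant m (sh ka) (T ka) (S ka)))"
  by (rule sum.cong[OF refl]) (simp only: feval_transpose[OF B assms(1) assms(2) assms(3)])
 ultimately show ?thesis by simp
qed

section \<open>Triangular matrices\<close>

definition lower_GLF :: "nat => zfrac mat set" where
 "lower_GLF m = {L \<in> GLF m. \<forall>j<m. \<forall>i<j. L $$ (i, j) = 0}"

definition char_at :: "nat => int list => zfrac mat => zfrac" where
 "char_at m lam L = (\<Prod>i<m. L $$ (i, i) powi (lam ! i))"

lemma det_lower:
 assumes "L \<in> carrier_mat m m" "!!i j. i < j ==> j < m ==> L $$ (i, j) = 0"
 shows "det L = (\<Prod>i<m. L $$ (i, i))"
 using det_lower_triangular[OF assms(2,1)] assms(1) by (simp add: prod_list_diag_prod atLeast0LessThan)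

lemma lower_diag_nonzero:
 assumes L: "L \<in> lower_GLF m" and "i < m"
 shows "L $$ (i, i) ~= 0"
 using det_lower[of L m] assms by (auto simp: lower_GLF_def GLF_def)

text \<open>
  Forward substitution: the equations for the inverse are solved row by row.
\<close>

lemma lower_inverse:
 assumes L: "L \<in> lower_GLF m" and i: "i < m"
 shows "j < m ==> i < j ==> inv_GLF m L $$ (i, j) = 0" "inv_GLF m L $$ (i, i) = inverse (L $$ (i, i))"
proof -
 let ?X = "inv_GLF m L"
 have G: "L \<in> GLF m" using L by (simp add: lower_GLF_def)
 note inv = inv_GLF[OF G]
 have zero: "L $$ (i, j) = 0" if "i < j" "j < m" for i j using L that by (simp add: lower_GLF_def)
 have prod: "(\<Sum>l<m. L $$ (i, l) * ?X $$ (l, j)) = (if i = j then 1 else 0)" if "i < m" "j < m" for i j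
  using index_mult_mat_sum[of L m m ?X m i j] inv G that by (auto simp: GLF_def)
 have upper: "?X $$ (i, j) = 0" if "i < j" "j < m" for i j
  using that
 proof (induction i rule: less_induct)
  case (less i)
  have "(\<Sum>l<m. L $$ (i, l) * ?X $$ (l, j)) = (\<Sum>l\<in>{i}. L $$ (i, l) * ?X $$ (l, j))"
  proof (rule sum.mono_neutral_right)
   show "\<forall>l\<in>{..<m} - {i}. L $$ (i, l) * ?X $$ (l, j) = 0"
   proof
    fix l assume "l \<in> {..<m} - {i}"
    then have "l < m" "l < i \<or> i < l" by auto
    then show "L $$ (i, l) * ?X $$ (l, j) = 0" using less zero[of i l] by auto
   qed
  qed (use less.prems in auto)
  then show ?case using prod[of i j] less.prems lower_diag_nonzero[OF L, of i] by auto
 qed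
 show "j < m ==> i < j ==> ?X $$ (i, j) = 0" using upper by simp
 have "(\<Sum>l<m. L $$ (i, l) * ?X $$ (l, i)) = (\<Sum>l\<in>{i}. L $$ (i, l) * ?X $$ (l, i))"
 proof (rule sum.mono_neutral_right)
  show "\<forall>l\<in>{..<m} - {i}. L $$ (i, l) * ?X $$ (l, i) = 0"
  proof
   fix l assume "l \<in> {..<m} - {i}"
   then have "l < m" "l < i \<or> i < l" by auto
   then show "L $$ (i, l) * ?X $$ (l, i) = 0" using upper[of l i] i zero[of i l] by auto
  qed
 qed (use i in auto)
 then show "?X $$ (i, i) = inverse (L $$ (i, i))"
  using prod[OF i i] inverse_unique[of "L $$ (i, i)" "?X $$ (i, i)"] by simp
qed

text \<open>
  On canonical rows a triangular factor acts through a triangular square block, whose determinant is the product of diagonal entries. The enumeration \<open>s\<close> is increasing for the matrix entries and decreasing for the entries of the inverse transpose.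
\<close>

lemma col_det_triangular:
 fixes z y u :: "nat => nat => 'a::comm_ring_1"
 assumes S: "!!a. a < col_length l c ==> S (a, c) = s a"
  and z: "!!a b. a < col_length l c ==> b < col_length l c ==> z (s a) (T (b, c)) = (\<Sum>i<m. u (s a) i * y i (T (b, c)))"
  and tri: "!!a i. a < col_length l c ==> i < m ==> i \<notin> s ` {..a} ==> u (s a) i = 0"
  and s: "inj_on s {..<col_length l c}" "s ` {..<col_length l c} \<subseteq> {..<m}"
 shows "col_det z l S T c = (\<Prod>a<col_length l c. u (s a) (s a)) * col_det y l S T c"
proof -
 let ?k = "col_length l c"
 let ?U = "mat ?k ?k (%(a, b). u (s a) (s b))" and ?Y = "mat ?k ?k (%(a, b). y (S (a, c)) (T (b, c)))"
 have "mat ?k ?k (%(a, b). z (S (a, c)) (T (b, c))) = ?U * ?Y"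
 proof (rule eq_matI)
  fix a b assume "a < dim_row (?U * ?Y)" "b < dim_col (?U * ?Y)"
  then have ab: "a < ?k" "b < ?k" by simp_all
  have "(?U * ?Y) $$ (a, b) = (\<Sum>d<?k. u (s a) (s d) * y (s d) (T (b, c)))"
   using index_mult_mat_sum[of ?U ?k ?k ?Y ?k a b] ab S by simp
  also have "... = (\<Sum>i\<in>s ` {..<?k}. u (s a) i * y i (T (b, c)))"
   by (simp add: sum.reindex[OF s(1)])
  also have "... = (\<Sum>i<m. u (s a) i * y i (T (b, c)))"
  proof (rule sum.mono_neutral_left[OF _ s(2)])
   show "\<forall>i\<in>{..<m} - s ` {..<?k}. u (s a) i * y i (T (b, c)) = 0"
   proof
    fix i assume i: "i \<in> {..<m} - s ` {..<?k}"
    have "s ` {..a} \<subseteq> s ` {..<?k}" using ab by auto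
    then have "i \<notin> s ` {..a}" using i by blast
    then show "u (s a) i * y i (T (b, c)) = 0" using tri[OF ab(1), of i] i by simp
   qed
  qed simp
  finally show "mat ?k ?k (%(a, b). z (S (a, c)) (T (b, c))) $$ (a, b) = (?U * ?Y) $$ (a, b)"
   using ab S z by simp
 qed simp_all
 then have "col_det z l S T c = det ?U * det ?Y" unfolding col_det_def by (simp add: det_mult[of _ ?k])
 moreover have "det ?U = (\<Prod>a<?k. ?U $$ (a, a))"
 proof -
  have "?U $$ (a, b) = 0" if "a < b" "b < ?k" for a b
  proof -
   have "s b ~= s x" if "x \<le> a" for x
    using inj_onD[OF s(1), of b x] that \<open>a < b\<close> \<open>b < ?k\<close> by auto
   then have "s b \<notin> s ` {..a}" by auto
   then show ?thesis using tri[of a "s b"] s(2) that by auto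
  qed
  then have "det ?U = prod_list (diag_mat ?U)" by (intro det_lower_triangular[of ?k]) simp_all
  then show ?thesis by (simp add: prod_list_diag_prod atLeast0LessThan)
 qed
 ultimately show ?thesis by (simp add: col_det_def)
qed

lemma bidet_part_triangular:
 assumes l: "partition_list m l" and T: "T \<in> tableaux m l"
  and S: "!!a c. a < col_length l c ==> S (a, c) = s a"
  and z: "!!i j. i < m ==> j < m ==> z i j = (\<Sum>k<m. u i k * y k j)"
  and tri: "!!a i. a < m ==> i < m ==> i \<notin> s ` {..a} ==> u (s a) i = 0"
  and s: "inj_on s {..<m}" "s ` {..<m} \<subseteq> {..<m}"
 shows "bidet_part z l S T = (\<Prod>i<m. u (s i) (s i) ^ (l ! i)) * bidet_part y l S T"
proof -
 obtain w where w: "fits l w" using ex_fits by blast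
 have col: "col_det z l S T c = (\<Prod>a<col_length l c. u (s a) (s a)) * col_det y l S T c" for c
 proof (rule col_det_triangular[where m = m and u = u and s = s and y = y and z = z])
  have sub: "{..<col_length l c} \<subseteq> {..<m}" using col_length_le[OF l, of c] by auto
  show "inj_on s {..<col_length l c}" "s ` {..<col_length l c} \<subseteq> {..<m}"
   by (rule inj_on_subset[OF s(1) sub]) (rule subset_trans[OF image_mono[OF sub] s(2)])
  show "z (s a) (T (b, c)) = (\<Sum>i<m. u (s a) i * y i (T (b, c)))" if "a < col_length l c" "b < col_length l c" for a b
  proof (rule z[OF _ tableau_entry[OF l T that(2)]])
   show "s a < m" using s(2) col_length_le[OF l, of c] that(1) by (auto simp: image_subset_iff)
  qed
  show "u (s a) i = 0" if "a < col_length l c" "i < m" "i \<notin> s ` {..a}" for a i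
   by (rule tri[OF _ that(2,3)]) (use that(1) col_length_le[OF l, of c] in simp)
 qed (rule S)
 have pow: "(\<Prod>c<w. if P c then x else 1) = x ^ card {c. c < w & P c}" for P and x :: zfrac
  using prod.inter_filter[of "{..<w}" "%_. x" P] by simp
 have "(\<Prod>c<w. \<Prod>a<col_length l c. u (s a) (s a)) = (\<Prod>c<w. \<Prod>a<m. if a < col_length l c then u (s a) (s a) else 1)"
 proof (rule prod.cong[OF refl])
  fix c
  have "{a \<in> {..<m}. a < col_length l c} = {..<col_length l c}" using col_length_le[OF l, of c] by auto
  then show "(\<Prod>a<col_length l c. u (s a) (s a)) = (\<Prod>a<m. if a < col_length l c then u (s a) (s a) else 1)"
   using prod.inter_filter[of "{..<m}" "%a. u (s a) (s a)" "%a. a < col_length l c"] by simp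
 qed
 also have "... = (\<Prod>a<m. \<Prod>c<w. if a < col_length l c then u (s a) (s a) else 1)" by (rule prod.swap)
 also have "... = (\<Prod>a<m. u (s a) (s a) ^ (l ! a))"
  by (rule prod.cong[OF refl]) (simp add: pow partition_nth_card[OF l w])
 finally show ?thesis unfolding bidet_part_eq_prod[OF w] col prod.distrib by simp
qed

lemma canonical_entry:
 assumes sh: "rat_shape m sh"
 shows "i < col_length (fst sh) c ==> fst (canonical_tableau m sh) (i, c) = i"
  "i < col_length (snd sh) c ==> snd (canonical_tableau m sh) (i, c) = m - Suc i"
 using diagram_iff[of m "fst sh" i c] diagram_iff[of m "snd sh" i c] sh
 by (cases sh; simp add: canonical_tableau_def rat_shape_def)+

lemma xcoord_mult: "A \<in> GLF m ==> B \<in> GLF m ==> i < m ==> j < m ==> xcoord (A * B) i j = (\<Sum>k<m. xcoord A i k * xcoord B k j)"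
 by (rule index_mult_mat_sum) (simp_all add: GLF_def)

lemma ycoord_mult:
 assumes "A \<in> GLF m" "B \<in> GLF m" "i < m" "j < m"
 shows "ycoord m (A * B) i j = (\<Sum>k<m. ycoord m A i k * ycoord m B k j)"
 unfolding ycoord_def inv_GLF_mult[OF assms(1,2)]
 using index_mult_mat_sum[OF inv_GLF(1)[OF assms(2)] inv_GLF(1)[OF assms(1)] assms(4,3)] by (simp add: mult.commute)

text \<open>
  The first tableau contributes the diagonal entries to the powers \<open>fst sh\<close>, the second one their inverses to the reversed powers \<open>snd sh\<close>; together this is the character of the bracket.
\<close>

lemma canonical_covariance:
 assumes L: "L \<in> lower_GLF m" and B: "B \<in> GLF m" and sh: "rat_shape m sh" and T: "T \<in> rat_tableaux m sh"
 shows "feval m (L * B) (bideterminant m sh (canonical_tableau m sh) T) =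
  char_at m (bracket (fst sh) (snd sh)) L * feval m B (bideterminant m sh (canonical_tableau m sh) T)"
proof -
 have p: "partition_list m (fst sh)" "partition_list m (snd sh)" using sh by (auto simp: rat_shape_def)
 have t: "fst T \<in> tableaux m (fst sh)" "snd T \<in> tableaux m (snd sh)" using T by (auto simp: rat_tableaux_iff)
 have G: "L \<in> GLF m" using L by (simp add: lower_GLF_def)
 let ?C = "canonical_tableau m sh"
 have x: "bidet_part (xcoord (L * B)) (fst sh) (fst ?C) (fst T) =
  (\<Prod>i<m. L $$ (i, i) ^ (fst sh ! i)) * bidet_part (xcoord B) (fst sh) (fst ?C) (fst T)"
 proof (rule bidet_part_triangular[OF p(1) t(1), where s = "%i. i" and u = "xcoord L"])
  show "xcoord L a i = 0" if "a < m" "i < m" "i \<notin> (%i. i) ` {..a}" for a i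
   using L that by (auto simp: lower_GLF_def not_le)
 qed (use canonical_entry[OF sh] xcoord_mult[OF G B] in auto)
 have y: "bidet_part (ycoord m (L * B)) (snd sh) (snd ?C) (snd T) =
  (\<Prod>i<m. ycoord m L (m - Suc i) (m - Suc i) ^ (snd sh ! i)) * bidet_part (ycoord m B) (snd sh) (snd ?C) (snd T)"
 proof (rule bidet_part_triangular[OF p(2) t(2), where s = "%i. m - Suc i" and u = "ycoord m L"])
  show "ycoord m L (m - Suc a) i = 0" if a: "a < m" "i < m" "i \<notin> (%i. m - Suc i) ` {..a}" for a i
  proof -
   have "i = m - Suc (m - Suc i)" using a by simp
   then have "\<not> m - Suc i \<le> a" using a(3) by blast
   then have "i < m - Suc a" using a by simp
   then show ?thesis unfolding ycoord_def using lower_inverse(1)[OF L a(2), of "m - Suc a"] by simp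
  qed
  show "inj_on (%i. m - Suc i) {..<m}" by (rule inj_onI) auto
 qed (use canonical_entry[OF sh] ycoord_mult[OF G B] in auto)
 have "(\<Prod>i<m. ycoord m L (m - Suc i) (m - Suc i) ^ (snd sh ! i)) =
  (\<Prod>i<m. inverse (L $$ (m - Suc i, m - Suc i)) ^ (snd sh ! (m - Suc (m - Suc i))))"
  by (rule prod.cong) (auto simp: ycoord_def lower_inverse(2)[OF L])
 also have "... = (\<Prod>i<m. inverse (L $$ (i, i)) ^ (snd sh ! (m - Suc i)))"
  by (rule prod.nat_diff_reindex)
 finally have y': "(\<Prod>i<m. ycoord m L (m - Suc i) (m - Suc i) ^ (snd sh ! i)) = (\<Prod>i<m. inverse (L $$ (i, i)) ^ (snd sh ! (m - Suc i)))" .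
 have "char_at m (bracket (fst sh) (snd sh)) L = (\<Prod>i<m. L $$ (i, i) ^ (fst sh ! i) * inverse (L $$ (i, i)) ^ (snd sh ! (m - Suc i)))"
  unfolding char_at_def
 proof (rule prod.cong[OF refl])
  fix i assume "i \<in> {..<m}"
  then show "L $$ (i, i) powi (bracket (fst sh) (snd sh) ! i) = L $$ (i, i) ^ (fst sh ! i) * inverse (L $$ (i, i)) ^ (snd sh ! (m - Suc i))"
   using lower_diag_nonzero[OF L, of i]
   by (simp add: bracket_nth[OF sh] power_int_diff field_simps power_inverse)
 qed
 then have char: "char_at m (bracket (fst sh) (snd sh)) L =
  (\<Prod>i<m. L $$ (i, i) ^ (fst sh ! i)) * (\<Prod>i<m. inverse (L $$ (i, i)) ^ (snd sh ! (m - Suc i)))"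
  by (simp only: prod.distrib)
 show ?thesis
  unfolding feval_bideterminant[OF GLF_mult[OF G B] sh canonical_tableau(1)[OF sh] T]
   feval_bideterminant[OF B sh canonical_tableau(1)[OF sh] T] x y y' char by (simp only: mult_ac)
qed

text \<open>
  The induced module of the lower Borel subgroup with its points restricted to the function field.
\<close>

definition lower_covariant :: "nat => int list => zfrac set" where
 "lower_covariant m lam = {f \<in> coord_ring m. \<forall>L\<in>lower_GLF m. \<forall>B\<in>GLF m. feval m (L * B) f = char_at m lam L * feval m B f}"

text \<open>
  Upper triangular matrices are written as transposes, so that only one triangular theory is needed.
\<close>

definition upper_covariant :: "nat => int list => zfrac set" where
 "upper_covariant m lam = {f \<in> coord_ring m. \<forall>L\<in>lower_GLF m. \<forall>B\<in>GLF m.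
  feval m (B * transpose_mat L) f = char_at m lam L * feval m B f}"

lemma subspace_lower_covariant: "zmod.subspace (lower_covariant m lam)"
proof -
 have "L * B \<in> GLF m" if "L \<in> lower_GLF m" "B \<in> GLF m" for L B using that GLF_mult by (simp add: lower_GLF_def)
 then show ?thesis
  unfolding zmod.subspace_def lower_covariant_def
  by (auto simp: feval_add feval_mult feval_of_int coord_ring_add coord_ring_mult distrib_left)
qed

lemma nabla_lower_covariant: "nabla m lam \<subseteq> lower_covariant m lam"
 unfolding nabla_def
proof (rule zmod.span_minimal[OF _ subspace_lower_covariant], safe)
 fix sh S assume "sh \<in> shapes_of m lam" "S \<in> rat_tableaux m sh"
 then have sh: "rat_shape m sh" "lam = bracket (fst sh) (snd sh)" and S: "S \<in> rat_tableaux m sh" by (auto simp: shapes_of_iff)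
 show "bideterminant m sh (canonical_tableau m sh) S \<in> lower_covariant m lam"
  unfolding lower_covariant_def sh(2)
  using canonical_covariance[OF _ _ sh(1) S] bideterminant_coord_ring[OF sh(1) canonical_tableau(1)[OF sh(1)] S] by simp
qed

section \<open>The comodule structure of a row of bideterminants\<close>

text \<open>
  Expanding only the columns, without collecting terms into minors, keeps the index functions. They are the columns of arbitrary tableaux.
\<close>

lemma det_product_expansion:
 fixes x y :: "nat => nat => 'a::comm_ring_1"
 shows "det (mat k k (%(a, b). \<Sum>l<m. x a l * y l b)) =
  (\<Sum>f\<in>{..<k} \<rightarrow>\<^sub>E {..<m}. (\<Prod>b<k. y (f b) b) * det (mat k k (%(a, b). x a (f b))))"
proof -
 have "det (mat k k (%(a, b). \<Sum>l<m. x a l * y l b)) = det (mat k k (%(b, a). \<Sum>l<m. y l b * x a l))"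
  by (subst det_transpose[symmetric, of _ k]) (auto intro!: arg_cong[where f = det] eq_matI simp: mult.commute)
 also have "... = rdet k (map (%b a. \<Sum>l<m. y l b * x a l) [0..<k] @ [])"
  unfolding rdet_def by (intro arg_cong[where f = det] eq_matI) auto
 also have "... = (\<Sum>f\<in>{..<k} \<rightarrow>\<^sub>E {..<m}. (\<Prod>b<k. y (f b) b) * rdet k (map (%b a. x a (f b)) [0..<k] @ []))"
  by (rule rdet_multilinear) simp
 also have "... = (\<Sum>f\<in>{..<k} \<rightarrow>\<^sub>E {..<m}. (\<Prod>b<k. y (f b) b) * det (mat k k (%(a, b). x a (f b))))"
 proof (rule sum.cong[OF refl])
  fix f
  have "rdet k (map (%b a. x a (f b)) [0..<k] @ []) = det (mat k k (%(b, a). x a (f b)))"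
   unfolding rdet_def by (intro arg_cong[where f = det] eq_matI) auto
  also have "... = det (mat k k (%(a, b). x a (f b)))"
   by (subst det_transpose[symmetric, of _ k]) (auto intro!: arg_cong[where f = det] eq_matI)
  finally show "(\<Prod>b<k. y (f b) b) * rdet k (map (%b a. x a (f b)) [0..<k] @ []) =
   (\<Prod>b<k. y (f b) b) * det (mat k k (%(a, b). x a (f b)))" by simp
 qed
 finally show ?thesis .
qed

lemma prod_diagram:
 assumes l: "partition_list m l" and n: "fits l n"
 shows "prod F (diagram l) = (\<Prod>c<n. \<Prod>b<col_length l c. F (b, c))"
proof -
 have "(\<Prod>c<n. \<Prod>b<col_length l c. F (b, c)) = prod (%(c, b). F (b, c)) (Sigma {..<n} (%c. {..<col_length l c}))"
  by (rule prod.Sigma) simp_all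
 also have "... = prod F (diagram l)"
 proof (rule prod.reindex_bij_witness[where i = prod.swap and j = prod.swap])
  fix bc assume bc: "bc \<in> diagram l"
  obtain b c where [simp]: "bc = (b, c)" by force
  have "b < col_length l c" using bc diagram_iff[OF l] by simp
  then show "prod.swap bc \<in> Sigma {..<n} (%c. {..<col_length l c})" using fits_less[OF n, of c] by simp
 qed (use diagram_iff[OF l] in auto)
 finally show ?thesis ..
qed

text \<open>
  Choosing one index function for each column is the same as choosing a tableau.
\<close>

lemma bidet_part_product:
 assumes l: "partition_list m l" and ST: "S \<in> tableaux m l" "T \<in> tableaux m l"
  and z: "!!i j. i < m ==> j < m ==> z i j = (\<Sum>k<m. x i k * y k j)"
 shows "bidet_part z l S T = (\<Sum>K\<in>tableaux m l. bidet_part x l S K * (\<Prod>ic\<in>diagram l. y (K ic) (T ic)))"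
proof -
 obtain n where n: "fits l n" using ex_fits by blast
 let ?h = "col_length l"
 let ?g = "%c f. (\<Prod>b<?h c. y (f b) (T (b, c))) * det (mat (?h c) (?h c) (%(a, b). x (S (a, c)) (f b)))"
 have col: "col_det z l S T c = (\<Sum>f\<in>{..<?h c} \<rightarrow>\<^sub>E {..<m}. ?g c f)" for c
 proof -
  have "col_det z l S T c = det (mat (?h c) (?h c) (%(a, b). \<Sum>k<m. x (S (a, c)) k * y k (T (b, c))))"
   unfolding col_det_def using tableau_entry[OF l ST(1)] tableau_entry[OF l ST(2)] z
   by (intro arg_cong[where f = det] eq_matI) auto
  then show ?thesis by (simp only: det_product_expansion)
 qed
 have "bidet_part z l S T = (\<Prod>c<n. \<Sum>f\<in>{..<?h c} \<rightarrow>\<^sub>E {..<m}. ?g c f)"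
  unfolding bidet_part_eq_prod[OF n] col ..
 also have "... = (\<Sum>\<phi>\<in>PiE {..<n} (%c. {..<?h c} \<rightarrow>\<^sub>E {..<m}). \<Prod>c<n. ?g c (\<phi> c))"
  by (rule prod_sum_PiE) (auto intro: finite_PiE)
 also have "... = (\<Sum>K\<in>tableaux m l. bidet_part x l S K * (\<Prod>ic\<in>diagram l. y (K ic) (T ic)))"
 proof (rule sum.reindex_bij_witness[where i = "%K. \<lambda>c\<in>{..<n}. \<lambda>b\<in>{..<?h c}. K (b, c)"
    and j = "%\<phi>. restrict (%(b, c). \<phi> c b) (diagram l)"])
  fix \<phi> assume \<phi>: "\<phi> \<in> PiE {..<n} (%c. {..<?h c} \<rightarrow>\<^sub>E {..<m})"
  let ?K = "restrict (%(b, c). \<phi> c b) (diagram l)"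
  have K: "?K (b, c) = \<phi> c b" if "b < ?h c" for b c using that diagram_iff[OF l] by simp
  have ext: "\<phi> c b = undefined" if "c < n" "\<not> b < ?h c" for b c using \<phi> that by (auto simp: PiE_iff extensional_def)
  show "(\<lambda>c\<in>{..<n}. \<lambda>b\<in>{..<?h c}. ?K (b, c)) = \<phi>"
  proof
   fix c show "(\<lambda>c\<in>{..<n}. \<lambda>b\<in>{..<?h c}. ?K (b, c)) c = \<phi> c"
   proof (cases "c < n")
    case True
    have "(\<lambda>b\<in>{..<?h c}. ?K (b, c)) = \<phi> c"
    proof
     fix b show "(\<lambda>b\<in>{..<?h c}. ?K (b, c)) b = \<phi> c b" using K[of b c] ext[OF True, of b] by (cases "b < ?h c") simp_all
    qed
    then show ?thesis using True by simp
   next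
    case False
    then show ?thesis using \<phi> by (auto simp: PiE_iff extensional_def)
   qed
  qed
  show "?K \<in> tableaux m l"
   unfolding tableaux_def
  proof (rule PiE_I)
   fix bc assume bc: "bc \<in> diagram l"
   obtain b c where [simp]: "bc = (b, c)" by force
   have b: "b < ?h c" using bc diagram_iff[OF l] by simp
   then have "c < n" using fits_less[OF n, of c] by simp
   then have "\<phi> c \<in> {..<?h c} \<rightarrow>\<^sub>E {..<m}" using \<phi> by auto
   then show "?K bc \<in> {..<m}" using K[OF b] b by auto
  qed simp
  have "(\<Prod>c<n. ?g c (\<phi> c)) = (\<Prod>c<n. (\<Prod>b<?h c. y (?K (b, c)) (T (b, c))) * col_det x l S ?K c)"
  proof (rule prod.cong[OF refl])
   fix c
   have "(\<Prod>b<?h c. y (\<phi> c b) (T (b, c))) = (\<Prod>b<?h c. y (?K (b, c)) (T (b, c)))"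
    by (rule prod.cong[OF refl]) (use K in \<open>simp del: restrict_apply\<close>)
   moreover have "mat (?h c) (?h c) (%(a, b). x (S (a, c)) (\<phi> c b)) = mat (?h c) (?h c) (%(a, b). x (S (a, c)) (?K (b, c)))"
    by (rule eq_matI) (use K in \<open>simp_all del: restrict_apply\<close>)
   ultimately show "?g c (\<phi> c) = (\<Prod>b<?h c. y (?K (b, c)) (T (b, c))) * col_det x l S ?K c"
    unfolding col_det_def by (simp only:)
  qed
  then show "bidet_part x l S ?K * (\<Prod>ic\<in>diagram l. y (?K ic) (T ic)) = (\<Prod>c<n. ?g c (\<phi> c))"
   unfolding prod_diagram[OF l n] bidet_part_eq_prod[OF n] prod.distrib by (simp only: mult.commute)
 next
  fix K assume K: "K \<in> tableaux m l"
  show "restrict (%(b, c). (\<lambda>c\<in>{..<n}. \<lambda>b\<in>{..<?h c}. K (b, c)) c b) (diagram l) = K"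
  proof
   fix bc :: "nat \<times> nat"
   obtain b c where [simp]: "bc = (b, c)" by force
   show "restrict (%(b, c). (\<lambda>c\<in>{..<n}. \<lambda>b\<in>{..<?h c}. K (b, c)) c b) (diagram l) bc = K bc"
   proof (cases "bc \<in> diagram l")
    case True
    then have b: "b < ?h c" using diagram_iff[OF l] by simp
    then have "c < n" using fits_less[OF n, of c] by simp
    then show ?thesis using True b by simp
   next
    case False
    then show ?thesis using K by (simp add: tableaux_def PiE_iff extensional_def)
   qed
  qed
  show "(\<lambda>c\<in>{..<n}. \<lambda>b\<in>{..<?h c}. K (b, c)) \<in> PiE {..<n} (%c. {..<?h c} \<rightarrow>\<^sub>E {..<m})"
   using tableau_entry[OF l K] by auto
 qed
 finally show ?thesis .
qed

text \<open>
  The matrix coefficients of the span of a row of bideterminants.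
\<close>

definition entry_product :: "nat => shape => rat_tableau => rat_tableau => zfrac" where
 "entry_product m sh K T = (\<Prod>ic\<in>diagram (fst sh). x_fun m (fst K ic) (fst T ic)) *
  (\<Prod>ic\<in>diagram (snd sh). y_fun m (snd K ic) (snd T ic))"

lemma entry_product:
 assumes KT: "K \<in> rat_tableaux m sh" "T \<in> rat_tableaux m sh"
 shows "entry_product m sh K T \<in> coord_ring m"
  "B \<in> GLF m ==> feval m B (entry_product m sh K T) = (\<Prod>ic\<in>diagram (fst sh). xcoord B (fst K ic) (fst T ic)) *
  (\<Prod>ic\<in>diagram (snd sh). ycoord m B (snd K ic) (snd T ic))"
proof -
 have lt: "fst K ic < m" "fst T ic < m" if "ic \<in> diagram (fst sh)" for ic
  using KT that by (auto simp: rat_tableaux_iff tableaux_def)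
 have lt': "snd K ic < m" "snd T ic < m" if "ic \<in> diagram (snd sh)" for ic
  using KT that by (auto simp: rat_tableaux_iff tableaux_def)
 have c: "(\<Prod>ic\<in>diagram (fst sh). x_fun m (fst K ic) (fst T ic)) \<in> coord_ring m"
  "(\<Prod>ic\<in>diagram (snd sh). y_fun m (snd K ic) (snd T ic)) \<in> coord_ring m"
  using x_fun_coord[OF lt] y_fun_coord[OF lt'] by (auto intro!: coord_ring_prod)
 show "entry_product m sh K T \<in> coord_ring m" unfolding entry_product_def by (rule coord_ring_mult[OF c])
 assume B: "B \<in> GLF m"
 have "feval m B (\<Prod>ic\<in>diagram (fst sh). x_fun m (fst K ic) (fst T ic)) = (\<Prod>ic\<in>diagram (fst sh). xcoord B (fst K ic) (fst T ic))"
  by (subst feval_prod[OF B]) (use x_fun_coord[OF lt] feval_x_fun[OF B lt] in \<open>auto intro!: prod.cong\<close>)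
 moreover have "feval m B (\<Prod>ic\<in>diagram (snd sh). y_fun m (snd K ic) (snd T ic)) = (\<Prod>ic\<in>diagram (snd sh). ycoord m B (snd K ic) (snd T ic))"
  by (subst feval_prod[OF B]) (use y_fun_coord[OF lt'] feval_y_fun[OF B lt'] in \<open>auto intro!: prod.cong\<close>)
 ultimately show "feval m B (entry_product m sh K T) = (\<Prod>ic\<in>diagram (fst sh). xcoord B (fst K ic) (fst T ic)) *
  (\<Prod>ic\<in>diagram (snd sh). ycoord m B (snd K ic) (snd T ic))"
  unfolding entry_product_def feval_mult[OF B c] by simp
qed

lemma finite_tableaux: "partition_list m l ==> finite (tableaux m l)"
 unfolding tableaux_def
 by (intro finite_PiE finite_subset[of "diagram l" "Sigma {..<length l} (%i. {..<l ! i})"]) (auto simp: diagram_def)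

lemma rat_tableaux_eq: "rat_tableaux m sh = tableaux m (fst sh) \<times> tableaux m (snd sh)"
 by (cases sh) (simp add: rat_tableaux_def)

lemma finite_rat_tableaux: "rat_shape m sh ==> finite (rat_tableaux m sh)"
 unfolding rat_tableaux_eq by (simp add: rat_shape_def finite_tableaux)

lemma bideterminant_comodule:
 assumes A: "A \<in> GLF m" and B: "B \<in> GLF m" and sh: "rat_shape m sh" and ST: "S \<in> rat_tableaux m sh" "T \<in> rat_tableaux m sh"
 shows "feval m (A * B) (bideterminant m sh S T) =
  (\<Sum>K\<in>rat_tableaux m sh. feval m A (bideterminant m sh S K) * feval m B (entry_product m sh K T))"
proof -
 have p: "partition_list m (fst sh)" "partition_list m (snd sh)" using sh by (auto simp: rat_shape_def)
 have t: "fst S \<in> tableaux m (fst sh)" "fst T \<in> tableaux m (fst sh)" "snd S \<in> tableaux m (snd sh)" "snd T \<in> tableaux m (snd sh)"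
  using ST by (auto simp: rat_tableaux_iff)
 let ?f = "%K1. bidet_part (xcoord A) (fst sh) (fst S) K1 * (\<Prod>ic\<in>diagram (fst sh). xcoord B (K1 ic) (fst T ic))"
 let ?g = "%K2. bidet_part (ycoord m A) (snd sh) (snd S) K2 * (\<Prod>ic\<in>diagram (snd sh). ycoord m B (K2 ic) (snd T ic))"
 have x: "bidet_part (xcoord (A * B)) (fst sh) (fst S) (fst T) = (\<Sum>K1\<in>tableaux m (fst sh). ?f K1)"
  by (rule bidet_part_product[OF p(1) t(1,2)]) (rule xcoord_mult[OF A B])
 have y: "bidet_part (ycoord m (A * B)) (snd sh) (snd S) (snd T) = (\<Sum>K2\<in>tableaux m (snd sh). ?g K2)"
  by (rule bidet_part_product[OF p(2) t(3,4)]) (rule ycoord_mult[OF A B])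
 have "feval m (A * B) (bideterminant m sh S T) = (\<Sum>K1\<in>tableaux m (fst sh). ?f K1) * (\<Sum>K2\<in>tableaux m (snd sh). ?g K2)"
  unfolding feval_bideterminant[OF GLF_mult[OF A B] sh ST] x y ..
 also have "... = (\<Sum>K\<in>rat_tableaux m sh. ?f (fst K) * ?g (snd K))"
  unfolding rat_tableaux_eq sum_product sum.cartesian_product by (rule sum.cong[OF refl]) (simp only: case_prod_beta)
 also have "... = (\<Sum>K\<in>rat_tableaux m sh. feval m A (bideterminant m sh S K) * feval m B (entry_product m sh K T))"
 proof (rule sum.cong[OF refl])
  fix K assume K: "K \<in> rat_tableaux m sh"
  show "?f (fst K) * ?g (snd K) = feval m A (bideterminant m sh S K) * feval m B (entry_product m sh K T)"
   unfolding feval_bideterminant[OF A sh ST(1) K] entry_product(2)[OF K ST(2) B] by (simp only: mult_ac)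
 qed
 finally show ?thesis .
qed

section \<open>Evaluation homomorphisms into a commutative ring\<close>

context cring
begin

lemma add_pow_int_closed: "x \<in> carrier R ==> [(k::int)] \<cdot> x \<in> carrier R"
 unfolding add_pow_def using group.int_pow_closed[OF a_group, of x k] by simp

lemma add_pow_int_add: "x \<in> carrier R ==> [(i + j::int)] \<cdot> x = [i] \<cdot> x \<oplus> [j] \<cdot> x"
 unfolding add_pow_def using group.int_pow_mult[OF a_group, of x i j] by simp

lemma add_pow_int_mult: "x \<in> carrier R ==> [(i * j::int)] \<cdot> x = [i] \<cdot> ([j] \<cdot> x)"
 unfolding add_pow_def using group.int_pow_pow[OF a_group, of x j i] by (simp add: mult.commute[of i j])

lemma add_pow_int_0: "[(0::int)] \<cdot> x = \<zero>"
 unfolding add_pow_def using int_pow_0[of "add_monoid R" x] by simp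

lemma add_pow_int_1: "x \<in> carrier R ==> [(1::int)] \<cdot> x = x"
 unfolding add_pow_def using group.int_pow_1[OF a_group, of x] by simp

end

text \<open>
  A ring homomorphism into \<open>R\<close> that is only meaningful on a subring \<open>D\<close> of its domain. It connects the type-class arithmetic of the source with the ring operations of \<open>R\<close>.
\<close>

locale partial_hom = cring R for R :: "('r, 'x) ring_scheme" (structure) +
 fixes D :: "'b::comm_ring_1 set" and th :: "'b => 'r"
 assumes D_1: "1 \<in> D" and D_uminus: "x \<in> D ==> - x \<in> D"
  and D_add: "x \<in> D ==> y \<in> D ==> x + y \<in> D" and D_mult: "x \<in> D ==> y \<in> D ==> x * y \<in> D"
  and hom_closed: "x \<in> D ==> th x \<in> carrier R" and hom_1: "th 1 = \<one>"
  and hom_add: "x \<in> D ==> y \<in> D ==> th (x + y) = th x \<oplus> th y"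
  and hom_mult: "x \<in> D ==> y \<in> D ==> th (x * y) = th x \<otimes> th y"
begin

lemma D_0: "0 \<in> D" using D_add[OF D_1 D_uminus[OF D_1]] by simp

lemma hom_0: "th 0 = \<zero>"
proof -
 have "th 0 \<oplus> th 0 = th 0 \<oplus> \<zero>" using hom_add[OF D_0 D_0] hom_closed[OF D_0] by simp
 then show ?thesis using hom_closed[OF D_0] monoid.Units_l_cancel[OF a_monoid, of "th 0" "th 0" \<zero>]
   group.Units_eq[OF a_group] by simp
qed

lemma hom_uminus: "x \<in> D ==> th (- x) = \<ominus> th x"
 using minus_equality[of "th (- x)" "th x"] hom_add[OF D_uminus, of x x] hom_0 by (simp add: hom_closed D_uminus)

lemma hom_sum:
 assumes "finite S" "!!x. x \<in> S ==> f x \<in> D"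
 shows "sum f S \<in> D" "th (sum f S) = (\<Oplus>x\<in>S. th (f x))"
proof -
 have "sum f S \<in> D & th (sum f S) = (\<Oplus>x\<in>S. th (f x))"
  using assms by (induction S rule: finite_induct) (auto simp: D_0 hom_0 D_add hom_add hom_closed)
 then show "sum f S \<in> D" "th (sum f S) = (\<Oplus>x\<in>S. th (f x))" by blast+
qed

lemma hom_prod:
 assumes "finite S" "!!x. x \<in> S ==> f x \<in> D"
 shows "prod f S \<in> D" "th (prod f S) = (\<Otimes>x\<in>S. th (f x))"
proof -
 have "prod f S \<in> D & th (prod f S) = (\<Otimes>x\<in>S. th (f x))"
  using assms by (induction S rule: finite_induct) (auto simp: D_1 hom_1 D_mult hom_mult hom_closed)
 then show "prod f S \<in> D" "th (prod f S) = (\<Otimes>x\<in>S. th (f x))" by blast+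
qed

lemma hom_power:
 assumes "x \<in> D"
 shows "x ^ n \<in> D" "th (x ^ n) = th x [^] n"
proof -
 have "x ^ n \<in> D & th (x ^ n) = th x [^] n"
  by (induction n) (auto simp: D_1 hom_1 assms D_mult hom_mult hom_closed m_comm)
 then show "x ^ n \<in> D" "th (x ^ n) = th x [^] n" by blast+
qed

lemma hom_of_int_mult:
 assumes x: "x \<in> D"
 shows "of_int c * x \<in> D" "th (of_int c * x) = [c] \<cdot> th x"
proof -
 have nat: "of_nat n * x \<in> D & th (of_nat n * x) = [(int n)] \<cdot> th x" for n
  by (induction n)
   (auto simp: D_0 hom_0 x D_add hom_add hom_closed distrib_right add_pow_int_0 add_pow_int_add add_pow_int_1)
 have neg: "[(- int n)] \<cdot> th x = \<ominus> ([(int n)] \<cdot> th x)" for n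
  using minus_equality[of "[(- int n)] \<cdot> th x" "[(int n)] \<cdot> th x"] add_pow_int_add[OF hom_closed[OF x], of "- int n" "int n"]
   add_pow_int_closed[OF hom_closed[OF x]] by (simp add: add_pow_int_0)
 have "of_int c * x \<in> D & th (of_int c * x) = [c] \<cdot> th x"
 proof (cases c rule: int_cases2)
  case (nonneg n)
  then show ?thesis using nat[of n] by simp
 next
  case (nonpos n)
  have "of_int c * x = - (of_nat n * x)" using nonpos by simp
  then show ?thesis using nat[of n] neg[of n] nonpos D_uminus hom_uminus by metis
 qed
 then show "of_int c * x \<in> D" "th (of_int c * x) = [c] \<cdot> th x" by blast+
qed

text \<open>
  Homomorphisms commute with the evaluation of integral polynomials; this identifies \<open>poly_value\<close> in \<open>R\<close> with the evaluation over the source.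
\<close>

lemma hom_poly_eval:
 assumes v: "!!k. k \<in> V ==> v k \<in> D" "!!k. k \<in> V ==> w k = th (v k)"
  and p: "!!\<mu>. \<mu> \<in> keys p ==> keys \<mu> \<subseteq> V"
 shows "poly_eval v p \<in> D"
  "(\<Oplus>\<mu>\<in>keys p. [lookup p \<mu>] \<cdot> (\<Otimes>k\<in>keys \<mu>. w k [^] lookup \<mu> k)) =
   th (poly_eval v p)"
proof -
 have mono: "mono_val v \<mu> \<in> D" "(\<Otimes>k\<in>keys \<mu>. w k [^] lookup \<mu> k) = th (mono_val v \<mu>)"
  if "\<mu> \<in> keys p" for \<mu>
 proof -
  have D: "v k ^ lookup \<mu> k \<in> D" "w k [^] lookup \<mu> k = th (v k ^ lookup \<mu> k)"
   if "k \<in> keys \<mu>" for k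
   using v[of k] p[OF \<open>\<mu> \<in> keys p\<close>] that hom_power[of "v k"] by auto
  show "mono_val v \<mu> \<in> D" unfolding mono_val_def by (rule hom_prod(1)) (use D in auto)
  have "th (mono_val v \<mu>) = (\<Otimes>k\<in>keys \<mu>. th (v k ^ lookup \<mu> k))"
   unfolding mono_val_def by (rule hom_prod(2)) (use D in auto)
  also have "... = (\<Otimes>k\<in>keys \<mu>. w k [^] lookup \<mu> k)"
   by (rule finprod_cong') (use D hom_closed in auto)
  finally show "(\<Otimes>k\<in>keys \<mu>. w k [^] lookup \<mu> k) = th (mono_val v \<mu>)" ..
 qed
 note scaled = hom_of_int_mult[OF mono(1)]
 show "poly_eval v p \<in> D" unfolding poly_eval_def by (rule hom_sum(1)) (use scaled in auto)
 have "th (poly_eval v p) = (\<Oplus>\<mu>\<in>keys p. th (of_int (lookup p \<mu>) * mono_val v \<mu>))"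
  unfolding poly_eval_def by (rule hom_sum(2)) (use scaled in auto)
 also have "... = (\<Oplus>\<mu>\<in>keys p. [lookup p \<mu>] \<cdot> (\<Otimes>k\<in>keys \<mu>. w k [^] lookup \<mu> k))"
  by (rule finsum_cong') (use scaled mono hom_closed in \<open>auto simp: add_pow_int_closed\<close>)
 finally show "(\<Oplus>\<mu>\<in>keys p. [lookup p \<mu>] \<cdot> (\<Otimes>k\<in>keys \<mu>. w k [^] lookup \<mu> k)) =
   th (poly_eval v p)" ..
qed

lemma poly_value_hom:
 assumes A: "A \<in> carrier_mat m m" "!!i j. i < m ==> j < m ==> A $$ (i, j) \<in> D" and p: "p \<in> mat_polys m"
 shows "poly_eval (entries A) p \<in> D" "poly_value R (map_mat th A) p = th (poly_eval (entries A) p)"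
proof -
 let ?V = "prod_encode ` ({..<m} \<times> {..<m})"
 have v: "entries A k \<in> D" "map_mat th A $$ prod_decode k = th (entries A k)" if "k \<in> ?V" for k
  using that A by (auto simp: entries_def)
 have k: "keys \<mu> \<subseteq> ?V" if "\<mu> \<in> keys p" for \<mu> using p that by (simp add: mat_polys_def)
 show "poly_eval (entries A) p \<in> D" by (rule hom_poly_eval(1)[OF v k])
 show "poly_value R (map_mat th A) p = th (poly_eval (entries A) p)"
  unfolding poly_value_def by (rule hom_poly_eval(2)[OF v k])
qed

lemma mmul_hom:
 assumes A: "A \<in> carrier_mat m m" "!!i j. i < m ==> j < m ==> A $$ (i, j) \<in> D"
  and B: "B \<in> carrier_mat m m" "!!i j. i < m ==> j < m ==> B $$ (i, j) \<in> D"
 shows "mmul R m (map_mat th A) (map_mat th B) = map_mat th (A * B)"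
  "i < m ==> j < m ==> (A * B) $$ (i, j) \<in> D"
proof -
 have entry: "(A * B) $$ (i, j) \<in> D" "th ((A * B) $$ (i, j)) = (\<Oplus>k\<in>{..<m}. th (A $$ (i, k)) \<otimes> th (B $$ (k, j)))"
  if ij: "i < m" "j < m" for i j
 proof -
  have D: "A $$ (i, k) * B $$ (k, j) \<in> D" if "k < m" for k using A B ij that D_mult by simp
  show "(A * B) $$ (i, j) \<in> D"
   unfolding index_mult_mat_sum[OF A(1) B(1) ij] by (rule hom_sum(1)) (use D in auto)
  have "th ((A * B) $$ (i, j)) = (\<Oplus>k\<in>{..<m}. th (A $$ (i, k) * B $$ (k, j)))"
   unfolding index_mult_mat_sum[OF A(1) B(1) ij] by (rule hom_sum(2)) (use D in auto)
  also have "... = (\<Oplus>k\<in>{..<m}. th (A $$ (i, k)) \<otimes> th (B $$ (k, j)))"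
   by (rule finsum_cong') (use A B ij hom_closed hom_mult in auto)
  finally show "th ((A * B) $$ (i, j)) = (\<Oplus>k\<in>{..<m}. th (A $$ (i, k)) \<otimes> th (B $$ (k, j)))" .
 qed
 show "i < m ==> j < m ==> (A * B) $$ (i, j) \<in> D" by (rule entry(1))
 show "mmul R m (map_mat th A) (map_mat th B) = map_mat th (A * B)"
 proof (rule eq_matI)
  fix i j assume "i < dim_row (map_mat th (A * B))" "j < dim_col (map_mat th (A * B))"
  then have ij: "i < m" "j < m" using A(1) B(1) by auto
  have "mmul R m (map_mat th A) (map_mat th B) $$ (i, j) = (\<Oplus>k\<in>{..<m}. th (A $$ (i, k)) \<otimes> th (B $$ (k, j)))"
   unfolding mmul_def index_mat(1)[OF ij] prod.case
   by (rule finsum_cong') (use A B ij hom_closed in auto)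
  then show "mmul R m (map_mat th A) (map_mat th B) $$ (i, j) = map_mat th (A * B) $$ (i, j)"
   using entry(2)[OF ij] A(1) B(1) ij by simp
 qed (use A(1) B(1) in \<open>simp_all add: mmul_def\<close>)
qed

lemma hom_inverse:
 assumes "x \<in> D" "y \<in> D" "x * y = 1"
 shows "th x \<in> Units R" "inv (th x) = th y"
proof -
 have "th x \<otimes> th y = \<one>" using hom_mult[OF assms(1,2)] assms(3) hom_1 by simp
 then show "th x \<in> Units R" "inv (th x) = th y"
  using comm_inv_char[of "th x" "th y"] assms hom_closed m_comm[of "th x" "th y"] by (auto simp: Units_def)
qed

end

context cring
begin

definition mono_value :: "(nat => 'a) => (nat \<Rightarrow>\<^sub>0 nat) => 'a" where
 "mono_value w \<mu> = (\<Otimes>k\<in>keys \<mu>. w k [^] lookup \<mu> k)"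

text \<open>
  The homomorphism from the polynomial ring that assigns values in \<open>R\<close> to the variables.
\<close>

definition assign_hom :: "(nat => 'a) => zpoly => 'a" where
 "assign_hom w p = (\<Oplus>\<mu>\<in>keys p. [lookup p \<mu>] \<cdot> mono_value w \<mu>)"

lemma zpoly_induct:
 assumes "P 0" "!!\<mu> c. P (single \<mu> c)" "!!p q. P p ==> P q ==> P (p + q)"
 shows "P (p :: zpoly)"
proof -
 have "P (\<Sum>\<mu>\<in>S. single \<mu> (lookup p \<mu>))" if "finite S" for S
  using that by (induction S rule: finite_induct) (auto intro: assms)
 then show ?thesis using poly_as_sum[of p] by (metis finite_keys)
qed

context
 fixes w :: "nat => 'a"
 assumes w: "!!k. w k \<in> carrier R"
begin

lemma mono_value_closed: "mono_value w \<mu> \<in> carrier R"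
 unfolding mono_value_def by (rule finprod_closed) (use w in auto)

lemma mono_value_add: "mono_value w (\<mu> + \<nu>) = mono_value w \<mu> \<otimes> mono_value w \<nu>"
proof -
 let ?S = "keys \<mu> \<union> keys \<nu>"
 have ext: "mono_value w \<xi> = (\<Otimes>k\<in>?S. w k [^] lookup \<xi> k)" if "keys \<xi> \<subseteq> ?S" for \<xi>
  unfolding mono_value_def
  by (rule finprod_mono_neutral_cong_left[OF _ that]) (use w in \<open>auto simp: in_keys_iff\<close>)
 have "mono_value w (\<mu> + \<nu>) = (\<Otimes>k\<in>?S. w k [^] lookup (\<mu> + \<nu>) k)"
  by (rule ext[OF keys_add])
 also have "... = (\<Otimes>k\<in>?S. w k [^] lookup \<mu> k \<otimes> w k [^] lookup \<nu> k)"
  by (rule finprod_cong') (use w in \<open>auto simp: lookup_add nat_pow_mult\<close>)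
 also have "... = mono_value w \<mu> \<otimes> mono_value w \<nu>"
  unfolding ext[of \<mu>, OF Un_upper1] ext[of \<nu>, OF Un_upper2] by (rule finprod_multf) (use w in auto)
 finally show ?thesis .
qed

lemma assign_hom_closed: "assign_hom w p \<in> carrier R"
 unfolding assign_hom_def by (rule finsum_closed) (auto simp: add_pow_int_closed mono_value_closed)

lemma assign_hom_single: "assign_hom w (single \<mu> c) = [c] \<cdot> mono_value w \<mu>"
 by (cases "c = 0") (auto simp: assign_hom_def add_pow_int_0 add_pow_int_closed mono_value_closed)

lemma assign_hom_add: "assign_hom w (p + q) = assign_hom w p \<oplus> assign_hom w q"
proof -
 let ?S = "keys p \<union> keys q"
 have ext: "assign_hom w r = (\<Oplus>\<mu>\<in>?S. [lookup r \<mu>] \<cdot> mono_value w \<mu>)" if "keys r \<subseteq> ?S" for r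
  unfolding assign_hom_def
  by (rule add.finprod_mono_neutral_cong_left[OF _ that])
   (auto simp: in_keys_iff add_pow_int_0 add_pow_int_closed mono_value_closed)
 have "assign_hom w (p + q) = (\<Oplus>\<mu>\<in>?S. [lookup (p + q) \<mu>] \<cdot> mono_value w \<mu>)"
  by (rule ext[OF keys_add])
 also have "... = (\<Oplus>\<mu>\<in>?S. [lookup p \<mu>] \<cdot> mono_value w \<mu> \<oplus> [lookup q \<mu>] \<cdot> mono_value w \<mu>)"
  by (rule finsum_cong') (auto simp: lookup_add add_pow_int_add add_pow_int_closed mono_value_closed)
 also have "... = assign_hom w p \<oplus> assign_hom w q"
  unfolding ext[of p, OF Un_upper1] ext[of q, OF Un_upper2]
  by (rule finsum_addf) (auto simp: add_pow_int_closed mono_value_closed)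
 finally show ?thesis .
qed

lemma assign_hom_0: "assign_hom w 0 = \<zero>"
 by (simp add: assign_hom_def)

lemma assign_hom_mult: "assign_hom w (p * q) = assign_hom w p \<otimes> assign_hom w q"
proof -
 note c = assign_hom_closed
 have single: "assign_hom w (single \<mu> a * q) = assign_hom w (single \<mu> a) \<otimes> assign_hom w q" for \<mu> a q
 proof (induction q rule: zpoly_induct)
  case (2 \<nu> b)
  have "([a] \<cdot> mono_value w \<mu>) \<otimes> ([b] \<cdot> mono_value w \<nu>) = [a] \<cdot> (mono_value w \<mu> \<otimes> ([b] \<cdot> mono_value w \<nu>))"
   by (simp add: add_pow_ldistr_int mono_value_closed add_pow_int_closed)
  also have "... = [(a * b)] \<cdot> (mono_value w \<mu> \<otimes> mono_value w \<nu>)"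
   by (simp add: add_pow_int_mult add_pow_rdistr_int mono_value_closed)
  finally have "[(a * b)] \<cdot> (mono_value w \<mu> \<otimes> mono_value w \<nu>) = ([a] \<cdot> mono_value w \<mu>) \<otimes> ([b] \<cdot> mono_value w \<nu>)" ..
  then show ?case by (simp add: mult_single assign_hom_single mono_value_add)
 qed (simp_all add: assign_hom_0 c assign_hom_add distrib_left r_distr)
 show ?thesis
  by (induction p rule: zpoly_induct) (simp_all add: single assign_hom_0 c assign_hom_add distrib_right l_distr)
qed

lemma assign_partial_hom: "partial_hom R UNIV (assign_hom w)"
proof (unfold_locales; (rule UNIV_I)?)
 show "assign_hom w 1 = \<one>"
  using assign_hom_single[of 0 1] by (simp add: mono_value_def add_pow_int_1)
qed (simp_all add: assign_hom_closed assign_hom_add assign_hom_mult)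

lemma assign_hom_entry_var: "assign_hom w (entry_var i j) = w (prod_encode (i, j))"
 unfolding entry_var_def assign_hom_single by (simp add: mono_value_def w add_pow_int_1)

end

end

locale zpoly_hom = partial_hom R "UNIV :: zpoly set" \<psi> for R :: "('r, 'x) ring_scheme" (structure) and \<psi> :: "zpoly => 'r"
begin

text \<open>
  Fractions with a denominator that becomes a unit: the largest subring of the function field to which the homomorphism extends. The denominator has to be nonzero explicitly because \<open>R\<close> may be the zero ring.
\<close>

definition frac_dom :: "zfrac set" where
 "frac_dom = {x. \<exists>p d. d ~= 0 & \<psi> d \<in> Units R & x * to_fract d = to_fract p}"

definition frac_hom :: "zfrac => 'r" where
 "frac_hom x = (THE r. r \<in> carrier R & (\<exists>p d. d ~= 0 & \<psi> d \<in> Units R & x * to_fract d = to_fract p & r \<otimes> \<psi> d = \<psi> p))"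

lemma psi_closed: "\<psi> p \<in> carrier R" by (rule hom_closed) simp

lemma frac_hom_eq:
 assumes d: "d ~= 0" "\<psi> d \<in> Units R" and x: "x * to_fract d = to_fract p" and r: "r \<in> carrier R" "r \<otimes> \<psi> d = \<psi> p"
 shows "frac_hom x = r"
 unfolding frac_hom_def
proof (rule the_equality)
 fix r' assume r': "r' \<in> carrier R & (\<exists>p d. d ~= 0 & \<psi> d \<in> Units R & x * to_fract d = to_fract p & r' \<otimes> \<psi> d = \<psi> p)"
 then obtain p' d' where d': "d' ~= 0" "\<psi> d' \<in> Units R" and x': "x * to_fract d' = to_fract p'" and e': "r' \<otimes> \<psi> d' = \<psi> p'"
  and c': "r' \<in> carrier R" by blast
 have "to_fract p * to_fract d' = to_fract p' * to_fract d"
  unfolding x[symmetric] x'[symmetric] by (simp only: mult_ac)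
 then have "p * d' = p' * d" by (simp only: to_fract_mult[symmetric] to_fract_eq_iff)
 then have "\<psi> p \<otimes> \<psi> d' = \<psi> p' \<otimes> \<psi> d" using hom_mult by (metis UNIV_I)
 then have "(r \<otimes> \<psi> d) \<otimes> \<psi> d' = (r' \<otimes> \<psi> d') \<otimes> \<psi> d" unfolding r(2) e' .
 moreover have "(r \<otimes> \<psi> d) \<otimes> \<psi> d' = (\<psi> d \<otimes> \<psi> d') \<otimes> r" "(r' \<otimes> \<psi> d') \<otimes> \<psi> d = (\<psi> d \<otimes> \<psi> d') \<otimes> r'"
  using r(1) c' psi_closed[of d] psi_closed[of d'] by (simp_all add: m_ac)
 ultimately have "(\<psi> d \<otimes> \<psi> d') \<otimes> r' = (\<psi> d \<otimes> \<psi> d') \<otimes> r" by simp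
 then show "r' = r" using Units_l_cancel[of "\<psi> d \<otimes> \<psi> d'" r' r] Units_m_closed[OF d(2) d'(2)] r(1) c' by blast
qed (use assms in blast)

lemma frac_domE:
 assumes "x \<in> frac_dom"
 obtains p d where "d ~= 0" "\<psi> d \<in> Units R" "x * to_fract d = to_fract p" "frac_hom x \<in> carrier R" "frac_hom x \<otimes> \<psi> d = \<psi> p"
proof -
 obtain p d where d: "d ~= 0" "\<psi> d \<in> Units R" "x * to_fract d = to_fract p" using assms by (auto simp: frac_dom_def)
 let ?r = "\<psi> p \<otimes> inv (\<psi> d)"
 have r: "?r \<in> carrier R" "?r \<otimes> \<psi> d = \<psi> p" using psi_closed[of p] psi_closed[of d] d(2) by (simp_all add: m_assoc)
 then show ?thesis using that[OF d] frac_hom_eq[OF d r] by simp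
qed

lemma frac_poly: "to_fract p \<in> frac_dom" "frac_hom (to_fract p) = \<psi> p"
proof -
 have one: "\<psi> 1 \<in> Units R" using hom_1 by simp
 show "to_fract p \<in> frac_dom" unfolding frac_dom_def using one by (intro CollectI exI[of _ p] exI[of _ 1]) simp
 show "frac_hom (to_fract p) = \<psi> p"
  by (rule frac_hom_eq[of 1 _ p]) (use one psi_closed[of p] hom_1 in auto)
qed

lemma frac_inverse: "d ~= 0 ==> \<psi> d \<in> Units R ==> inverse (to_fract d) \<in> frac_dom"
 unfolding frac_dom_def by (intro CollectI exI[of _ 1] exI[of _ d]) simp

text \<open>
  The universal property of localisation, on the subring inside the field of fractions.
\<close>

lemma frac_partial_hom: "partial_hom R frac_dom frac_hom"
proof (unfold_locales, goal_cases)
 case 1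
 show ?case using frac_poly(1)[of 1] by simp
next
 case (2 x)
 then obtain p d where d: "d ~= 0" "\<psi> d \<in> Units R" "x * to_fract d = to_fract p" by (auto simp: frac_dom_def)
 then have "- x * to_fract d = to_fract (- p)" by simp
 then show ?case using d unfolding frac_dom_def by blast
next
 case (3 x y)
 from 3(1) obtain p d where d: "d ~= 0" "\<psi> d \<in> Units R" "x * to_fract d = to_fract p" by (auto simp: frac_dom_def)
 from 3(2) obtain q e where e: "e ~= 0" "\<psi> e \<in> Units R" "y * to_fract e = to_fract q" by (auto simp: frac_dom_def)
 have "(x + y) * to_fract (d * e) = (x * to_fract d) * to_fract e + (y * to_fract e) * to_fract d" by (simp add: algebra_simps)
 also have "... = to_fract (p * e + q * d)" unfolding d(3) e(3) by simp
 finally have "(x + y) * to_fract (d * e) = to_fract (p * e + q * d)" .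
 moreover have "\<psi> (d * e) \<in> Units R" "d * e ~= 0" using d(1,2) e(1,2) hom_mult by simp_all
 ultimately show ?case unfolding frac_dom_def by blast
next
 case (4 x y)
 from 4(1) obtain p d where d: "d ~= 0" "\<psi> d \<in> Units R" "x * to_fract d = to_fract p" by (auto simp: frac_dom_def)
 from 4(2) obtain q e where e: "e ~= 0" "\<psi> e \<in> Units R" "y * to_fract e = to_fract q" by (auto simp: frac_dom_def)
 have "(x * y) * to_fract (d * e) = (x * to_fract d) * (y * to_fract e)" by (simp add: algebra_simps)
 also have "... = to_fract (p * q)" unfolding d(3) e(3) by simp
 finally have "(x * y) * to_fract (d * e) = to_fract (p * q)" .
 moreover have "\<psi> (d * e) \<in> Units R" "d * e ~= 0" using d(1,2) e(1,2) hom_mult by simp_all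
 ultimately show ?case unfolding frac_dom_def by blast
next
 case (5 x)
 then show ?case by (rule frac_domE) simp
next
 case 6
 show ?case using frac_poly(2)[of 1] hom_1 by simp
next
 case (7 x y)
 from 7(1) obtain p d where d: "d ~= 0" "\<psi> d \<in> Units R" "x * to_fract d = to_fract p" and x: "frac_hom x \<in> carrier R" "frac_hom x \<otimes> \<psi> d = \<psi> p" by (rule frac_domE)
 from 7(2) obtain q e where e: "e ~= 0" "\<psi> e \<in> Units R" "y * to_fract e = to_fract q" and y: "frac_hom y \<in> carrier R" "frac_hom y \<otimes> \<psi> e = \<psi> q" by (rule frac_domE)
 note c = x(1) y(1) psi_closed[of d] psi_closed[of e]
 have "(x + y) * to_fract (d * e) = (x * to_fract d) * to_fract e + (y * to_fract e) * to_fract d" by (simp add: algebra_simps)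
 also have "... = to_fract (p * e + q * d)" unfolding d(3) e(3) by simp
 finally have xy: "(x + y) * to_fract (d * e) = to_fract (p * e + q * d)" .
 have "(frac_hom x \<oplus> frac_hom y) \<otimes> \<psi> (d * e) = (frac_hom x \<otimes> \<psi> d) \<otimes> \<psi> e \<oplus> (frac_hom y \<otimes> \<psi> e) \<otimes> \<psi> d"
  using c by (simp add: hom_mult l_distr r_distr m_ac)
 also have "... = \<psi> (p * e + q * d)" unfolding x(2) y(2) by (simp add: hom_mult hom_add)
 finally show ?case using d e c xy by (intro frac_hom_eq[of "d * e" _ "p * e + q * d"]) (auto simp: hom_mult simp del: to_fract_mult to_fract_add)
next
 case (8 x y)
 from 8(1) obtain p d where d: "d ~= 0" "\<psi> d \<in> Units R" "x * to_fract d = to_fract p" and x: "frac_hom x \<in> carrier R" "frac_hom x \<otimes> \<psi> d = \<psi> p" by (rule frac_domE)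
 from 8(2) obtain q e where e: "e ~= 0" "\<psi> e \<in> Units R" "y * to_fract e = to_fract q" and y: "frac_hom y \<in> carrier R" "frac_hom y \<otimes> \<psi> e = \<psi> q" by (rule frac_domE)
 note c = x(1) y(1) psi_closed[of d] psi_closed[of e]
 have "(x * y) * to_fract (d * e) = (x * to_fract d) * (y * to_fract e)" by (simp add: algebra_simps)
 also have "... = to_fract (p * q)" unfolding d(3) e(3) by simp
 finally have xy: "(x * y) * to_fract (d * e) = to_fract (p * q)" .
 have "(frac_hom x \<otimes> frac_hom y) \<otimes> \<psi> (d * e) = (frac_hom x \<otimes> \<psi> d) \<otimes> (frac_hom y \<otimes> \<psi> e)"
  using c by (simp add: hom_mult m_ac)
 also have "... = \<psi> (p * q)" unfolding x(2) y(2) by (simp add: hom_mult)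
 finally show ?case using d e c xy by (intro frac_hom_eq[of "d * e" _ "p * q"]) (auto simp: hom_mult simp del: to_fract_mult)
qed

end

section \<open>Induced modules over the function field\<close>

lemma det_fract_cancel:
 assumes "det_fract m ^ N * x = det_fract m ^ N * y"
 shows "x = y"
proof -
 have "det_fract m ^ N ~= 0" by (rule power_not_zero[OF det_fract_nonzero])
 then show ?thesis using assms mult_left_cancel by blast
qed

lemma lookup_diagonal_mono:
 "lookup (\<Sum>i<m. single (prod_encode (i, i)) (d i)) (prod_encode (a, b)) =
  (if a = b & a < m then d a else (0::nat))"
proof -
 have "lookup (\<Sum>i<m. single (prod_encode (i, i)) (d i)) (prod_encode (a, b)) =
  (\<Sum>i<m. if i = a then (if a = b then d i else 0) else 0)"
  unfolding lookup_sum lookup_single by (rule sum.cong) (auto simp: when_def)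
 then show ?thesis by simp
qed

lemma entry_var_power: "entry_var i j ^ n = single (single (prod_encode (i, j)) n) 1"
 unfolding entry_var_def by (induction n) (auto simp: mult_single single_add[symmetric])

lemma prod_monomials: "finite S ==> (\<Prod>x\<in>S. single (\<mu> x) 1) = (single (\<Sum>x\<in>S. \<mu> x) 1 :: zpoly)"
 by (induction S rule: finite_induct) (auto simp: mult_single)

lemma diagonal_monomial:
 "(\<Prod>i<m. entry_var i i ^ d i) = single (\<Sum>i<m. single (prod_encode (i, i)) (d i)) 1"
 by (simp add: entry_var_power prod_monomials)

lemma lookup_of_int_monomial: "lookup (of_int c * single \<mu> 1 :: zpoly) \<nu> = (if \<nu> = \<mu> then c else 0)"
 unfolding of_int_zpoly by (simp add: mult_single lookup_single when_def)

text \<open>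
  The \<open>a\<close>-th element of a set of natural numbers is at least \<open>a\<close>; hence diagonal terms of minors on initial columns only use entries on or below the diagonal.
\<close>

lemma rank_enum_natural:
 assumes rank: "is_rank m r id" and J: "J \<subseteq> {..<m}" and a: "a < card J"
 shows "a \<le> rank_enum m id J a"
 using a
proof (induction a)
 case (Suc a)
 have "rank_enum m id J a < rank_enum m id J (Suc a)"
  using rank_enum_less[OF rank J, of a "Suc a"] Suc.prems by (simp only: id_apply lessI)
 moreover have "a \<le> rank_enum m id J a" using Suc.IH Suc.prems by linarith
 ultimately show ?case by linarith
qed simp

lemma char_at_det_power:
 assumes L: "L \<in> lower_GLF m" and N: "!!i. i < m ==> 0 \<le> lam ! i + int N"
 shows "char_at m lam L * det L ^ N = (\<Prod>i<m. L $$ (i, i) ^ nat (lam ! i + int N))"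
proof -
 have "det L = (\<Prod>i<m. L $$ (i, i))" using L by (intro det_lower) (auto simp: lower_GLF_def GLF_def)
 then have "char_at m lam L * det L ^ N = (\<Prod>i<m. L $$ (i, i) powi (lam ! i) * L $$ (i, i) ^ N)"
  by (simp add: char_at_def prod.distrib prod_power_distrib)
 also have "... = (\<Prod>i<m. L $$ (i, i) ^ nat (lam ! i + int N))"
 proof (rule prod.cong[OF refl])
  fix i assume "i \<in> {..<m}"
  then have i: "i < m" by simp
  have "L $$ (i, i) powi (lam ! i) * L $$ (i, i) ^ N = L $$ (i, i) powi (lam ! i + int N)"
   using lower_diag_nonzero[OF L i] by (simp add: power_int_add)
  then show "L $$ (i, i) powi (lam ! i) * L $$ (i, i) ^ N = L $$ (i, i) ^ nat (lam ! i + int N)"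
   using N[OF i] by (simp add: power_int_def)
 qed
 finally show ?thesis .
qed

text \<open>
  At a generic lower triangular matrix the extracted coefficient is a multiple of a monomial in the diagonal entries. A leading monomial is diagonal only if all row sets are initial segments, so a standard bideterminant with canonical left tableau and bracket \<open>lam\<close> occurs in the expansion. It is in \<open>nabla\<close>, hence covariant, and can be subtracted.
\<close>

theorem lower_covariant_nabla:
 assumes lam: "length lam = m"
 shows "lower_covariant m lam \<subseteq> nabla m lam"
proof
 define r0 :: "(nat \<times> nat) set" where "r0 = {(i, j). i \<le> j & j < m}"
 have rank: "is_rank m r0 id" by (auto simp: is_rank_def r0_def)
 define Z :: "nat => nat => bool" where "Z i j \<longleftrightarrow> j \<le> i" for i j
 define A where "A = mat m m (%(i, j). to_fract (masked_var Z i j))"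
 have cA: "A \<in> carrier_mat m m" by (simp add: A_def)
 have diag: "A $$ (i, i) = to_fract (entry_var i i)" if "i < m" for i using that by (simp add: A_def masked_var_def Z_def)
 have upper: "A $$ (i, j) = 0" if "i < j" "j < m" for i j using that by (simp add: A_def masked_var_def Z_def)
 have "det A = (\<Prod>i<m. A $$ (i, i))" by (rule det_lower[OF cA]) (rule upper)
 also have "... = to_fract (\<Prod>i<m. entry_var i i)"
  unfolding to_fract_prod by (rule prod.cong) (simp_all add: diag)
 finally have "det A = to_fract (\<Prod>i<m. entry_var i i)" .
 moreover have "(\<Prod>i<m. entry_var i i) ~= 0" by (simp add: entry_var_def)
 ultimately have A: "A \<in> lower_GLF m" using cA upper by (simp add: lower_GLF_def GLF_def)
 then have AG: "A \<in> GLF m" by (simp add: lower_GLF_def)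
 have main: "f \<in> nabla m lam" if "card Ks = s" "finite Ks" "Ks \<subseteq> std_bitableaux m r0 (dominant m)" "!!ka. ka \<in> Ks ==> a ka ~= 0"
  "f = (\<Sum>ka\<in>Ks. of_int (a ka) * bidet m ka)" "f \<in> lower_covariant m lam" for s f Ks and a :: "shape \<times> rat_tableau \<times> rat_tableau => int"
  using that
 proof (induction s arbitrary: f Ks)
  case 0
  then have "f = 0" by simp
  then show ?case by (simp add: nabla_def zmod.span_zero)
 next
  case (Suc s)
  note K = Suc.prems(2,3) and nz = Suc.prems(4) and f = Suc.prems(5) and cov = Suc.prems(6)
  note facts = std_bitableau_facts[OF rank subsetD[OF K(2)]]
  have "Ks ~= {}" using Suc.prems(1) by auto
  then obtain ka0 where ka0: "ka0 \<in> Ks" and top: "!!ka. ka \<in> Ks ==>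
    weight_le (bracket (fst (fst ka0)) (snd (fst ka0))) (bracket (fst (fst ka)) (snd (fst ka))) ==> fst ka = fst ka0"
   using ex_top_shape[OF K(1) _ facts(1)] by blast
  define sh where "sh = fst ka0"
  have sh: "rat_shape m sh" using facts(1)[OF ka0] by (simp add: sh_def)
  obtain N0 w where fit0: "!!N n. N0 \<le> N ==> N + w \<le> n ==> \<forall>ka\<in>Ks. rat_fits N n (fst ka)"
   using ex_rat_fits_finite[OF K(1)] by blast
  have fc: "f \<in> coord_ring m" using cov by (simp add: lower_covariant_def)
  then have "\<exists>N0. \<forall>N\<ge>N0. \<forall>b\<in>{()}. \<exists>p\<in>mat_polys m. (%_. f) b * det_fract m ^ N = to_fract p"
   by (intro ex_common_power) simp_all
  then obtain N1 where N1: "!!N. N1 \<le> N ==> \<exists>p\<in>mat_polys m. f * det_fract m ^ N = to_fract p" by auto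
  (* Large enough for the shapes, for the denominator of f and for the negative entries of lam. *)
  define N where "N = N0 + N1 + (\<Sum>i<m. nat \<bar>lam ! i\<bar>)"
  define n where "n = N + w"
  have fit: "rat_fits N n (fst ka)" if "ka \<in> Ks" for ka using fit0[of N n] that by (simp add: N_def n_def)
  obtain p where p: "p \<in> mat_polys m" "f * det_fract m ^ N = to_fract p" using N1[of N] by (auto simp: N_def)
  have N: "0 \<le> lam ! i + int N" if "i < m" for i
  proof -
   have "nat \<bar>lam ! i\<bar> \<le> (\<Sum>i<m. nat \<bar>lam ! i\<bar>)" using that by (intro member_le_sum) auto
   then have "int (nat \<bar>lam ! i\<bar>) \<le> int N" unfolding N_def by linarith
   then show ?thesis by linarith
  qed
  define d where "d i = nat (lam ! i + int N)" for i
  (* The character times the power of the determinant that clears denominators. *)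
  define U where "U = (\<Prod>i<m. entry_var i i ^ d i)"
  have U: "U \<in> mat_polys m" unfolding U_def by (intro mat_polys_prod mat_polys_power mat_polys_entry_var) auto
  have "char_at m lam A * det A ^ N = (\<Prod>i<m. A $$ (i, i) ^ nat (lam ! i + int N))"
   by (rule char_at_det_power[OF A]) (rule N)
  also have "... = to_fract U"
   unfolding U_def to_fract_prod d_def by (rule prod.cong) (simp_all add: diag to_fract_power)
  finally have charU: "char_at m lam A * det A ^ N = to_fract U" .
  have "feval m (A * shifted_generic m) f * det A ^ N = to_fract U * feval m (shifted_generic m) f"
   using cov A shifted_generic_GLF[of m] charU by (simp add: lower_covariant_def mult_ac)
  then have ev: "feval m (A * shifted_generic m) (\<Sum>ka\<in>Ks. of_int (a ka) * bidet m ka) * det A ^ N =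
    (\<Sum>b\<in>{()}. to_fract ((%_. U) b) * feval m (shifted_generic m) ((%_. f) b))"
   unfolding f[symmetric] by simp
  have Zc: "Z (rank_enum m id (row_cols m N ka c) e) e" if ka: "ka \<in> Ks" and "c < n" "e < col_height m N (fst ka) c" for ka c e
   unfolding Z_def
  proof (rule rank_enum_natural[OF rank])
   note c = std_rat_cols_facts[OF rank facts(1,3)[OF ka], of N c]
   show "row_cols m N ka c \<subseteq> {..<m}" by (rule c(1))
   show "e < card (row_cols m N ka c)" unfolding c(2) by fact
  qed
  have shK: "fst ka0 \<in> fst ` Ks" using ka0 by (rule imageI)
  obtain K0 e nb where ext: "K0 \<subseteq> Ks" "\<forall>ka\<in>K0. fst ka = fst ka0"
   "\<exists>ka\<in>K0. lookup (\<Sum>b\<in>{()}. of_int (nb b) * (%_. U) b) (row_lead m id N n ka) ~= 0"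
   using extract_maximal_shape[where U = "%_. U" and p = "%_. p" and v = "%_. f" and B = "{()}",
    OF rank K nz fit shK top A_def AG Zc _ U p(1) p(2) ev] by blast
  then obtain ka where ka: "ka \<in> K0" "lookup (of_int (nb ()) * U) (row_lead m id N n ka) ~= 0" by auto
  have kaK: "ka \<in> Ks" "fst ka = sh" using ka(1) ext(1,2) by (auto simp: sh_def)
  note kaf = facts[OF kaK(1), unfolded kaK(2)]
  note rc = std_rat_cols_facts[OF rank kaf(1,3)]
  let ?h = "col_height m N sh" and ?I = "row_cols m N ka"
  have I: "?I c \<subseteq> {..<m}" "card (?I c) = ?h c" for c using rc(1,2)[of N c] unfolding kaK(2) .
  have lead: "row_lead m id N n ka = (\<Sum>i<m. single (prod_encode (i, i)) (d i))"
   using ka(2) unfolding U_def diagonal_monomial lookup_of_int_monomial by (simp split: if_splits)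
  have inj: "inj (prod_encode \<circ> prod.swap)" using inj_prod_encode[of UNIV] by (intro inj_compose) auto
  have count: "card {c. c < n & x < ?h c & rank_enum m id (?I c) x = j} = (if j = x & x < m then d x else 0)" for x j
  proof -
   have "chain_mono (prod_encode \<circ> prod.swap) n ?h (%c. rank_enum m id (?I c)) =
     (\<Sum>i<m. single (prod_encode (i, i)) (d i))"
    using lead unfolding row_lead_def[OF rank] kaK(2) .
   then have "card {c. c < n & x < ?h c & rank_enum m id (?I c) x = j} =
     lookup (\<Sum>i<m. single (prod_encode (i, i)) (d i)) ((prod_encode \<circ> prod.swap) (x, j))"
    using lookup_chain_mono[OF inj, of n ?h "%c. rank_enum m id (?I c)" x j] by (simp only:)
   then show ?thesis using lookup_diagonal_mono[of d m j x] by (simp cong: conj_cong)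
  qed
  have fixed: "rank_enum m id (?I c) x = x" if "c < n" "x < ?h c" for c x
  proof (rule ccontr)
   let ?j = "rank_enum m id (?I c) x"
   assume "?j ~= x"
   then have "card {c. c < n & x < ?h c & rank_enum m id (?I c) x = ?j} = 0" unfolding count by simp
   then have "{c. c < n & x < ?h c & rank_enum m id (?I c) x = ?j} = {}" by simp
   then show False using that by blast
  qed
  have initial: "?I c = {..<?h c}" if "c < n" for c
  proof -
   have "?I c = rank_enum m id (?I c) ` {..<?h c}" using rank_enum(2)[OF rank I(1)[of c]] I(2)[of c] by simp
   also have "... = {..<?h c}" using fixed[OF that] by (simp add: image_def)
   finally show ?thesis .
  qed
  have "lam = bracket (fst sh) (snd sh)"
  proof (rule nth_equalityI)
   show "length lam = length (bracket (fst sh) (snd sh))" using lam length_bracket[OF sh] by simp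
   fix i assume "i < length lam"
   then have i: "i < m" using lam by simp
   have "{c. c < n & i < ?h c} = {c. c < n & i < ?h c & rank_enum m id (?I c) i = i}" using fixed by blast
   then have "card {c. c < n & i < ?h c} = d i" using count[of i i] i by simp
   then have "bracket (fst sh) (snd sh) ! i + int N = int (d i)"
    using bracket_count[OF sh _ i, of N n] fit[OF kaK(1)] kaK(2) by simp
   then show "lam ! i = bracket (fst sh) (snd sh) ! i" using N[OF i] by (simp add: d_def)
  qed
  then have shl: "sh \<in> shapes_of m lam" using sh by (simp add: shapes_of_iff)
  let ?T = "snd (snd ka)" and ?C = "canonical_tableau m sh"
  have T: "?T \<in> rat_tableaux m sh" using kaf(4) std_rat_iff[OF rank] by blast
  have fitka: "rat_fits N n sh" using fit[OF kaK(1)] kaK(2) by simp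
  have s1: "det_fract m ^ N * bideterminant m sh ?C ?T \<asymp> (\<Prod>c<n. minor (x_fun m) (rat_cols m N sh ?C c) (rat_cols m N sh ?T c))"
   by (rule det_power_bideterminant[OF sh canonical_tableau(1)[OF sh] T canonical_tableau(2)[OF sh] std_rat_inj[OF rank sh kaf(4)] fitka])
  have s2: "det_fract m ^ N * bidet m ka \<asymp> (\<Prod>c<n. minor (x_fun m) (?I c) (col_cols m N ka c))"
   by (rule std_bidet_minors[OF rank subsetD[OF K(2) kaK(1)] fit[OF kaK(1)]])
  have s3: "(\<Prod>c<n. minor (x_fun m) (?I c) (col_cols m N ka c)) = (\<Prod>c<n. minor (x_fun m) (rat_cols m N sh ?C c) (rat_cols m N sh ?T c))"
   by (rule prod.cong[OF refl]) (simp add: initial[unfolded kaK(2)] canonical_tableau(3)[OF sh] kaK(2))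
  have s4: "det_fract m ^ N * bidet m ka \<asymp> det_fract m ^ N * bideterminant m sh ?C ?T"
   by (rule sign_eq_trans[OF s2[unfolded s3] sign_eq_sym[OF s1]])
  have "bidet m ka = bideterminant m sh ?C ?T \<or> bidet m ka = - bideterminant m sh ?C ?T"
   using s4 unfolding sign_eq_def mult_minus_right[symmetric] using det_fract_cancel[of m N] by blast
  moreover have gen: "bideterminant m sh ?C ?T \<in> nabla m lam"
   unfolding nabla_def using shl T by (intro zmod.span_base) blast
  moreover have "- bideterminant m sh ?C ?T \<in> nabla m lam"
   using gen unfolding nabla_def by (rule zmod.span_neg)
  ultimately have bk: "bidet m ka \<in> nabla m lam" by (elim disjE ssubst)
  let ?f = "f - of_int (a ka) * bidet m ka"
  have scaled: "of_int (a ka) * bidet m ka \<in> nabla m lam" using bk unfolding nabla_def by (rule zmod.span_scale)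
  have "?f \<in> nabla m lam"
  proof (rule Suc.IH[of "Ks - {ka}"])
   show "card (Ks - {ka}) = s" using Suc.prems(1) K(1) kaK(1) by simp
   show "?f = (\<Sum>ka\<in>Ks - {ka}. of_int (a ka) * bidet m ka)"
    unfolding f using sum.remove[OF K(1) kaK(1), of "%ka. of_int (a ka) * bidet m ka"] by simp
   show "?f \<in> lower_covariant m lam"
    by (rule zmod.subspace_diff[OF subspace_lower_covariant cov subsetD[OF nabla_lower_covariant scaled]])
  qed (use K nz in auto)
  then have "?f + of_int (a ka) * bidet m ka \<in> nabla m lam" using scaled unfolding nabla_def by (rule zmod.span_add)
  then show ?case by simp
 qed
 fix f assume f: "f \<in> lower_covariant m lam"
 then have fc: "f \<in> coord_ring m" by (simp add: lower_covariant_def)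
 obtain Ks and a :: "shape \<times> rat_tableau \<times> rat_tableau => int" where "finite Ks" "Ks \<subseteq> std_bitableaux m r0 (dominant m)"
  "!!ka. ka \<in> Ks ==> a ka ~= 0" "f = (\<Sum>ka\<in>Ks. of_int (a ka) * bidet m ka)" using span_std_expansion[OF rank fc] by blast
 then show "f \<in> nabla m lam" using main[OF refl] f by blast
qed

corollary nabla_eq_lower_covariant: "length lam = m ==> nabla m lam = lower_covariant m lam"
 using lower_covariant_nabla nabla_lower_covariant by blast

lemma GLF_transpose_mult:
 assumes "A \<in> GLF m" "B \<in> GLF m"
 shows "transpose_mat (A * B) = transpose_mat B * transpose_mat A"
 by (rule transpose_mult[of _ m m _ m]) (use assms in \<open>auto simp: GLF_def\<close>)

lemma span_family_sum:
 assumes "f \<in> zmod.span (g ` X)"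
 obtains Y and c :: "'b => int" where "finite Y" "Y \<subseteq> X" "f = (\<Sum>x\<in>Y. of_int (c x) * g x)"
proof -
 obtain W and a :: "zfrac => int" where W: "finite W" "W \<subseteq> g ` X" "f = (\<Sum>x\<in>W. of_int (a x) * x)"
  using assms by (rule span_finite_sum)
 obtain Y where Y: "Y \<subseteq> X" "inj_on g Y" "W = g ` Y" using W(2) by (meson subset_image_inj)
 have "finite Y" using W(1) Y(2,3) finite_image_iff by blast
 moreover have "f = (\<Sum>x\<in>Y. of_int (a (g x)) * g x)" unfolding W(3) Y(3) by (subst sum.reindex[OF Y(2)]) simp
 ultimately show ?thesis using that[of Y "%x. a (g x)"] Y(1) by blast
qed

text \<open>
  Both inclusions are transposed from those for \<open>nabla\<close>: interchange the tableaux in an expansion, which transposes the argument.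
\<close>

lemma nabla_tilde_eq_upper_covariant:
 assumes lam: "length lam = m"
 shows "nabla_tilde m lam = upper_covariant m lam"
proof
 let ?X = "{(sh, S). sh \<in> shapes_of m lam & S \<in> rat_tableaux m sh}"
 have X: "rat_shape m (fst x)" "snd x \<in> rat_tableaux m (fst x)" "canonical_tableau m (fst x) \<in> rat_tableaux m (fst x)"
  if "x \<in> ?X" for x
  using that canonical_tableau(1)[of m "fst x"] by (auto simp: shapes_of_iff)
 have tilde: "nabla_tilde m lam = zmod.span ((%x. bideterminant m (fst x) (snd x) (canonical_tableau m (fst x))) ` ?X)"
  unfolding nabla_tilde_def by (rule arg_cong[where f = zmod.span]) force
 have plain: "nabla m lam = zmod.span ((%x. bideterminant m (fst x) (canonical_tableau m (fst x)) (snd x)) ` ?X)"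
  unfolding nabla_def by (rule arg_cong[where f = zmod.span]) force
 show "nabla_tilde m lam \<subseteq> upper_covariant m lam"
 proof
  fix f assume "f \<in> nabla_tilde m lam"
  then obtain Y and c :: "shape \<times> rat_tableau => int" where Y: "finite Y" "Y \<subseteq> ?X"
   and f: "f = (\<Sum>x\<in>Y. of_int (c x) * bideterminant m (fst x) (snd x) (canonical_tableau m (fst x)))"
   unfolding tilde by (rule span_family_sum)
  note XY = X[OF subsetD[OF Y(2)]]
  let ?g = "\<Sum>x\<in>Y. of_int (c x) * bideterminant m (fst x) (canonical_tableau m (fst x)) (snd x)"
  have "?g \<in> nabla m lam" unfolding plain using Y(2) by (intro zmod.span_sum zmod.span_scale zmod.span_base) blast
  then have g: "?g \<in> lower_covariant m lam" using nabla_lower_covariant by blast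
  have swap: "feval m (transpose_mat B) ?g = feval m B f" if "B \<in> GLF m" for B
   unfolding f by (rule bideterminant_swap_sum[OF XY(1) XY(3) XY(2) that])
  have "f \<in> coord_ring m"
   unfolding f by (intro coord_ring_sum coord_ring_mult coord_ring_of_int bideterminant_coord_ring XY)
  moreover have "feval m (B * transpose_mat L) f = char_at m lam L * feval m B f" if L: "L \<in> lower_GLF m" and B: "B \<in> GLF m" for L B
  proof -
   have G: "L \<in> GLF m" using L by (simp add: lower_GLF_def)
   have "feval m (B * transpose_mat L) f = feval m (transpose_mat (B * transpose_mat L)) ?g"
    by (rule swap[OF GLF_mult[OF B transpose_GLF[OF G]], symmetric])
   also have "... = feval m (L * transpose_mat B) ?g"
    unfolding GLF_transpose_mult[OF B transpose_GLF[OF G]] by simp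
   also have "... = char_at m lam L * feval m (transpose_mat B) ?g"
    using g L transpose_GLF[OF B] by (simp add: lower_covariant_def)
   also have "... = char_at m lam L * feval m B f" unfolding swap[OF B] ..
   finally show ?thesis .
  qed
  ultimately show "f \<in> upper_covariant m lam" by (simp add: upper_covariant_def)
 qed
 show "upper_covariant m lam \<subseteq> nabla_tilde m lam"
 proof
  fix f assume f: "f \<in> upper_covariant m lam"
  then have fc: "f \<in> coord_ring m" by (simp add: upper_covariant_def)
  have rank: "is_rank m {(i, j). i \<le> j & j < m} id" by (auto simp: is_rank_def)
  obtain Ks and a :: "shape \<times> rat_tableau \<times> rat_tableau => int"
   where K: "finite Ks" "Ks \<subseteq> std_bitableaux m {(i, j). i \<le> j & j < m} (dominant m)"
    "f = (\<Sum>ka\<in>Ks. of_int (a ka) * bidet m ka)" using span_std_expansion[OF rank fc] by blast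
  note facts = std_bitableau_facts[OF rank subsetD[OF K(2)]]
  have tab: "fst (snd ka) \<in> rat_tableaux m (fst ka)" "snd (snd ka) \<in> rat_tableaux m (fst ka)" if "ka \<in> Ks" for ka
   using facts(3,4)[OF that] std_rat_iff[OF rank] by blast+
  let ?g = "\<Sum>ka\<in>Ks. of_int (a ka) * bideterminant m (fst ka) (snd (snd ka)) (fst (snd ka))"
  have f': "f = (\<Sum>ka\<in>Ks. of_int (a ka) * bideterminant m (fst ka) (fst (snd ka)) (snd (snd ka)))"
   unfolding K(3) by (simp add: case_prod_beta)
  have swap: "feval m (transpose_mat B) f = feval m B ?g" if "B \<in> GLF m" for B
   unfolding f' by (rule bideterminant_swap_sum[OF facts(1) tab that])
  have "?g \<in> coord_ring m"
   by (intro coord_ring_sum coord_ring_mult coord_ring_of_int bideterminant_coord_ring facts(1) tab)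
  moreover have "feval m (L * B) ?g = char_at m lam L * feval m B ?g" if L: "L \<in> lower_GLF m" and B: "B \<in> GLF m" for L B
  proof -
   have G: "L \<in> GLF m" using L by (simp add: lower_GLF_def)
   have "feval m (L * B) ?g = feval m (transpose_mat (L * B)) f" by (rule swap[OF GLF_mult[OF G B], symmetric])
   also have "... = feval m (transpose_mat B * transpose_mat L) f" unfolding GLF_transpose_mult[OF G B] ..
   also have "... = char_at m lam L * feval m (transpose_mat B) f"
    using f L transpose_GLF[OF B] by (simp add: upper_covariant_def)
   also have "... = char_at m lam L * feval m B ?g" unfolding swap[OF B] ..
   finally show ?thesis .
  qed
  ultimately have "?g \<in> lower_covariant m lam" by (simp add: lower_covariant_def)
  then have "?g \<in> nabla m lam" using lower_covariant_nabla[OF lam] by blast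
  then obtain Y and c :: "shape \<times> rat_tableau => int" where Y: "finite Y" "Y \<subseteq> ?X"
   and g: "?g = (\<Sum>x\<in>Y. of_int (c x) * bideterminant m (fst x) (canonical_tableau m (fst x)) (snd x))"
   unfolding plain by (rule span_family_sum)
  note XY = X[OF subsetD[OF Y(2)]]
  let ?f = "\<Sum>x\<in>Y. of_int (c x) * bideterminant m (fst x) (snd x) (canonical_tableau m (fst x))"
  have "f = ?f"
  proof (rule coord_ring_eqI[OF fc])
   show "?f \<in> coord_ring m"
    by (intro coord_ring_sum coord_ring_mult coord_ring_of_int bideterminant_coord_ring XY)
   fix B assume B: "B \<in> GLF m"
   have "feval m B f = feval m (transpose_mat B) ?g" using swap[OF transpose_GLF[OF B]] by simp
   also have "... = feval m B ?f"
    unfolding g by (rule bideterminant_swap_sum[OF XY(1) XY(3) XY(2) B])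
   finally show "feval m B f = feval m B ?f" .
  qed
  moreover have "?f \<in> nabla_tilde m lam"
   unfolding tilde using Y(2) by (intro zmod.span_sum zmod.span_scale zmod.span_base) blast
  ultimately show "f \<in> nabla_tilde m lam" by simp
 qed
qed

section \<open>Points of the group scheme as specialisations of generic matrices\<close>

text \<open>
  The matrix \<open>A\<close> over the function field specialises to the point \<open>g\<close>; the determinant has to stay invertible.
\<close>

definition lies_over :: "zfrac set => (zfrac => 'r) => nat => zfrac mat => 'r mat => bool" where
 "lies_over D th m A g \<longleftrightarrow> A \<in> GLF m & inverse (det A) \<in> D & (\<forall>i<m. \<forall>j<m. A $$ (i, j) \<in> D) & map_mat th A = g"

locale fraction_hom = partial_hom R D th for R :: "('r, 'x) ring_scheme" (structure) and D :: "zfrac set" and th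
begin

lemma over_det:
 assumes A: "lies_over D th m A g"
 shows "det A \<in> D" "poly_value R g (det_poly m) = th (det A)"
proof -
 have cA: "A \<in> carrier_mat m m" and e: "!!i j. i < m ==> j < m ==> A $$ (i, j) \<in> D" and g: "g = map_mat th A"
  using A by (auto simp: lies_over_def GLF_def)
 show "det A \<in> D" "poly_value R g (det_poly m) = th (det A)"
  using poly_value_hom[OF cA e det_poly_mat_polys] unfolding g poly_eval_det_poly[OF cA] by simp_all
qed

text \<open>
  Evaluation commutes with specialisation. In particular the value is independent of the fraction that represents the function.
\<close>

lemma value_at_over:
 assumes A: "lies_over D th m A g" and f: "f \<in> coord_ring m"
 shows "feval m A f \<in> D" "value_at R m f g = th (feval m A f)"
proof -
 have G: "A \<in> GLF m" and inv: "inverse (det A) \<in> D" and e: "!!i j. i < m ==> j < m ==> A $$ (i, j) \<in> D" and g: "g = map_mat th A"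
  using A by (auto simp: lies_over_def)
 have cA: "A \<in> carrier_mat m m" and nz: "det A ~= 0" using G by (auto simp: GLF_def)
 note det = over_det[OF A]
 have rep: "feval m A f \<in> D" "poly_value R g p \<otimes> inv (poly_value R g (det_poly m) [^] k) = th (feval m A f)"
  if p: "p \<in> mat_polys m" "f = Fract p (det_poly m ^ k)" for p k
 proof -
  have "f * det_fract m ^ k = to_fract p" unfolding p(2) Fract_det_power by (simp del: to_fract_eq_0_iff add: power_not_zero[OF det_fract_nonzero])
  from feval_eq[OF G p(1) this] have "feval m A f * det A ^ k = poly_eval (entries A) p" .
  then have eq: "feval m A f = poly_eval (entries A) p * inverse (det A) ^ k"
   using nz by (simp add: field_simps)
  note pv = poly_value_hom[OF cA e p(1)]
  have D: "poly_eval (entries A) p \<in> D" using pv(1) by simp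
  note ik = hom_power[OF inv, of k] and dk = hom_power[OF det(1), of k]
  show "feval m A f \<in> D" unfolding eq by (rule D_mult[OF D ik(1)])
  have "inv (th (det A ^ k)) = th (inverse (det A) ^ k)"
   by (rule hom_inverse(2)[OF dk(1) ik(1)]) (use nz in \<open>simp add: power_mult_distrib[symmetric]\<close>)
  then show "poly_value R g p \<otimes> inv (poly_value R g (det_poly m) [^] k) = th (feval m A f)"
   unfolding det(2) dk(2)[symmetric] eq hom_mult[OF D ik(1)] using pv(2) g by simp
 qed
 obtain p k where p: "p \<in> mat_polys m" "f = Fract p (det_poly m ^ k)" using f by (auto simp: coord_ring_def)
 show "feval m A f \<in> D" by (rule rep(1)[OF p])
 show "value_at R m f g = th (feval m A f)"
  unfolding value_at_def
 proof (rule the_equality)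
  show "\<exists>p\<in>mat_polys m. \<exists>k. f = Fract p (det_poly m ^ k) & th (feval m A f) = poly_value R g p \<otimes> inv (poly_value R g (det_poly m) [^] k)"
   by (intro bexI[of _ p] exI[of _ k] conjI p rep(2)[OF p, symmetric])
  fix r assume "\<exists>p\<in>mat_polys m. \<exists>k. f = Fract p (det_poly m ^ k) & r = poly_value R g p \<otimes> inv (poly_value R g (det_poly m) [^] k)"
  then show "r = th (feval m A f)" using rep(2) by auto
 qed
qed

lemma over_mult:
 assumes A: "lies_over D th m A g" and B: "lies_over D th m B h"
 shows "lies_over D th m (A * B) (mmul R m g h)"
proof -
 have c: "A \<in> carrier_mat m m" "B \<in> carrier_mat m m" using A B by (auto simp: lies_over_def GLF_def)
 have e: "!!i j. i < m ==> j < m ==> A $$ (i, j) \<in> D" "!!i j. i < m ==> j < m ==> B $$ (i, j) \<in> D"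
  using A B by (auto simp: lies_over_def)
 note mm = mmul_hom[OF c(1) e(1) c(2) e(2)]
 have "inverse (det (A * B)) \<in> D"
  unfolding det_mult[OF c] inverse_mult_distrib using A B by (auto simp: lies_over_def intro: D_mult)
 then show ?thesis using A B mm GLF_mult[of A m B] by (auto simp: lies_over_def)
qed

lemma hom_power_int:
 assumes x: "x \<in> D" "inverse x \<in> D" "x ~= 0"
 shows "x powi n \<in> D" "th (x powi n) = th x [^] n"
proof -
 note p = hom_power[OF x(1)] and q = hom_power[OF x(2)]
 have "x ^ k * inverse x ^ k = 1" for k by (subst power_mult_distrib[symmetric]) (simp add: x(3))
 then have i: "inv (th x [^] k) = th (inverse x ^ k)" for k :: nat
  using hom_inverse(2)[OF p(1) q(1)] p(2) by metis
 show "x powi n \<in> D" unfolding power_int_def by (cases "n \<ge> 0") (simp_all add: p(1) q(1) del: power_inverse)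
 show "th (x powi n) = th x [^] n"
 proof (cases "n < 0")
  case True
  have "x powi n = inverse x ^ nat (- n)" using True by (simp add: power_int_def del: power_inverse)
  moreover have "th x [^] n = inv (th x [^] nat (- n))" using int_pow_def2[of R "th x" n] True by (simp only: if_True)
  ultimately show ?thesis by (simp only: i)
 next
  case False
  have "x powi n = x ^ nat n" using False by (simp add: power_int_def)
  moreover have "th x [^] n = th x [^] nat n" using int_pow_def2[of R "th x" n] False by (simp only: if_False)
  ultimately show ?thesis by (simp only: p(2))
 qed
qed

lemma weight_char_over:
 assumes A: "lies_over D th m A g" and d: "!!i. i < m ==> A $$ (i, i) ~= 0" "!!i. i < m ==> inverse (A $$ (i, i)) \<in> D"
 shows "char_at m lam A \<in> D" "weight_char R m lam g = th (char_at m lam A)"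
proof -
 have e: "A $$ (i, i) \<in> D" "g $$ (i, i) = th (A $$ (i, i))" if "i < m" for i using A that by (auto simp: lies_over_def GLF_def)
 have pw: "A $$ (i, i) powi (lam ! i) \<in> D" "th (A $$ (i, i) powi (lam ! i)) = g $$ (i, i) [^] (lam ! i)" if "i < m" for i
  using hom_power_int[OF e(1) d(2,1)] e(2) that by simp_all
 show "char_at m lam A \<in> D" unfolding char_at_def by (rule hom_prod(1)) (use pw in auto)
 have "th (char_at m lam A) = (\<Otimes>i\<in>{..<m}. th (A $$ (i, i) powi (lam ! i)))"
  unfolding char_at_def by (rule hom_prod(2)) (use pw in auto)
 also have "... = weight_char R m lam g"
  unfolding weight_char_def
 proof (rule finprod_cong')
  show "(%i. g $$ (i, i) [^] (lam ! i)) \<in> {..<m} \<rightarrow> carrier R"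
  proof
   fix i assume "i \<in> {..<m}"
   then have i: "i < m" by simp
   show "g $$ (i, i) [^] (lam ! i) \<in> carrier R" using hom_closed[OF pw(1)[OF i]] unfolding pw(2)[OF i] .
  qed
 qed (use pw in auto)
 finally show "weight_char R m lam g = th (char_at m lam A)" ..
qed

text \<open>
  For triangular matrices invertibility of the determinant gives invertibility of each diagonal entry.
\<close>

lemma diag_inverse_over:
 assumes A: "lies_over D th m A g" and det: "det A = (\<Prod>i<m. A $$ (i, i))" and i: "i < m"
 shows "A $$ (i, i) ~= 0" "inverse (A $$ (i, i)) \<in> D"
proof -
 have nz: "det A ~= 0" and inv: "inverse (det A) \<in> D" and e: "!!i j. i < m ==> j < m ==> A $$ (i, j) \<in> D"
  using A by (auto simp: lies_over_def GLF_def)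
 let ?P = "\<Prod>j\<in>{..<m} - {i}. A $$ (j, j)"
 have split: "det A = A $$ (i, i) * ?P" unfolding det using i by (subst prod.remove[of _ i]) auto
 show 1: "A $$ (i, i) ~= 0" using nz unfolding split by simp
 have "?P ~= 0" using nz unfolding split by simp
 then have "inverse (A $$ (i, i)) = inverse (det A) * ?P" unfolding split using 1 by (simp add: field_simps)
 moreover have "?P \<in> D" by (rule hom_prod(1)) (use e in auto)
 ultimately show "inverse (A $$ (i, i)) \<in> D" using D_mult[OF inv] by simp
qed

end

context cring
begin

definition block_values :: "nat => 'a mat => 'a mat => nat => 'a" where
 "block_values m g h k = (case prod_decode k of (i, j) =>
  if i < m & j < m then g $$ (i, j)
  else if m \<le> i & i < m + m & m \<le> j & j < m + m then h $$ (i - m, j - m) else \<zero>)"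

lemma block_values:
 assumes "g \<in> mats R m" "h \<in> mats R m"
 shows "block_values m g h k \<in> carrier R"
  "i < m ==> j < m ==> block_values m g h (prod_encode (i, j)) = g $$ (i, j)"
  "i < m ==> j < m ==> block_values m g h (prod_encode (m + i, m + j)) = h $$ (i, j)"
 using assms by (auto simp: block_values_def mats_def split: prod.splits)

text \<open>
  Multiplicativity of the determinant holds for generic matrices and is transported by evaluating at \<open>g\<close> and its inverse.
\<close>

lemma GL_det_unit:
 assumes "g \<in> GL R m"
 shows "poly_value R g (det_poly m) \<in> Units R"
proof -
 obtain g' where g': "g' \<in> mats R m" "mmul R m g g' = mone R m" and g: "g \<in> mats R m" using assms by (auto simp: GL_def)
 note w = block_values[OF g g'(1)]
 let ?\<psi> = "assign_hom (block_values m g g')"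
 interpret partial_hom R UNIV ?\<psi> by (rule assign_partial_hom[OF w(1)])
 define X where "X = mat m m (%(i, j). entry_var i j)"
 define Y where "Y = mat m m (%(i, j). entry_var (m + i) (m + j))"
 have c: "X \<in> carrier_mat m m" "Y \<in> carrier_mat m m" by (simp_all add: X_def Y_def)
 have XY: "map_mat ?\<psi> X = g" "map_mat ?\<psi> Y = g'"
  using g g'(1) by (auto simp: X_def Y_def mats_def assign_hom_entry_var[OF w(1)] w(2,3) intro!: eq_matI)
 have one: "map_mat ?\<psi> (1\<^sub>m m) = mone R m" by (rule eq_matI) (auto simp: mone_def hom_0 hom_1)
 have det: "poly_value R (map_mat ?\<psi> A) (det_poly m) = ?\<psi> (det A)" if "A \<in> carrier_mat m m" for A
  using poly_value_hom(2)[OF that _ det_poly_mat_polys] poly_eval_det_poly[OF that] by simp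
 have "map_mat ?\<psi> (X * Y) = map_mat ?\<psi> (1\<^sub>m m)" using mmul_hom(1)[OF c(1) _ c(2)] g'(2) XY one by simp
 then have "?\<psi> (det (X * Y)) = ?\<psi> (det (1\<^sub>m m))" using det[of "X * Y"] det[of "1\<^sub>m m"] c by simp
 then have unit: "?\<psi> (det X) \<otimes> ?\<psi> (det Y) = \<one>" using det_mult[OF c] hom_mult hom_1 by simp
 then have "?\<psi> (det X) \<in> Units R"
  using m_comm[of "?\<psi> (det X)" "?\<psi> (det Y)"] hom_closed by (auto simp: Units_def)
 then show ?thesis using det[OF c(1)] XY(1) by simp
qed

text \<open>
  Two matrices with independent variables at the positions allowed to be nonzero specialise to \<open>g\<close> and \<open>h\<close>, and their determinants go to units. Universal identities thus hold for all points over all commutative rings.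
\<close>

lemma generic_pair:
 assumes g: "g \<in> GL R m" "!!i. Y i i" "!!i j. i < m ==> j < m ==> \<not> Y i j ==> g $$ (i, j) = \<zero>"
  and h: "h \<in> GL R m" "!!i. Z i i" "!!i j. i < m ==> j < m ==> \<not> Z i j ==> h $$ (i, j) = \<zero>"
 shows "\<exists>D th A B. fraction_hom R D th & lies_over D th m A g & lies_over D th m B h &
  (\<forall>i<m. \<forall>j<m. \<not> Y i j --> A $$ (i, j) = 0) & (\<forall>i<m. \<forall>j<m. \<not> Z i j --> B $$ (i, j) = 0)"
proof -
 have gh: "g \<in> mats R m" "h \<in> mats R m" using g h by (auto simp: GL_def)
 note w = block_values[OF gh]
 let ?\<psi> = "assign_hom (block_values m g h)"
 have ph: "partial_hom R UNIV ?\<psi>" by (rule assign_partial_hom[OF w(1)])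
 then interpret zpoly_hom R ?\<psi> by (rule zpoly_hom.intro)
 define M where "M s P = mat m m (%(i, j). if P i j then entry_var (s + i) (s + j) else (0::zpoly))" for s and P :: "nat => nat => bool"
 have over: "lies_over frac_dom frac_hom m (map_mat to_fract (M s P)) x"
  if x: "x \<in> GL R m" and P: "!!i. P i i" "!!i j. i < m ==> j < m ==> \<not> P i j ==> x $$ (i, j) = \<zero>"
   and s: "!!i j. i < m ==> j < m ==> block_values m g h (prod_encode (s + i, s + j)) = x $$ (i, j)" for s P x
 proof -
  have xc: "x \<in> carrier_mat m m" using x by (simp add: GL_def mats_def)
  have cM: "M s P \<in> carrier_mat m m" by (simp add: M_def)
  have \<psi>M: "map_mat ?\<psi> (M s P) = x"
  proof (rule eq_matI)
   fix i j assume "i < dim_row x" "j < dim_col x"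
   then have ij: "i < m" "j < m" using xc by auto
   then show "map_mat ?\<psi> (M s P) $$ (i, j) = x $$ (i, j)"
    using P(2)[OF ij] s[OF ij] by (simp add: M_def assign_hom_entry_var[OF w(1)] hom_0)
  qed (use xc in \<open>auto simp: M_def\<close>)
  have "?\<psi> (det (M s P)) = poly_value R x (det_poly m)"
   using poly_value_hom(2)[OF cM _ det_poly_mat_polys] poly_eval_det_poly[OF cM] \<psi>M by simp
  then have unit: "?\<psi> (det (M s P)) \<in> Units R" using GL_det_unit[OF x] by simp
  have nz: "det (M s P) ~= 0"
  proof
   assume "det (M s P) = 0"
   (* Specialise to the identity matrix; a unit of the zero ring would not exclude a zero determinant. *)
   then have "poly_eval (%k. if fst (prod_decode k) = snd (prod_decode k) then 1 else (0::int)) (det (M s P)) = 0" by simp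
   moreover have "map_mat (poly_eval (%k. if fst (prod_decode k) = snd (prod_decode k) then 1 else (0::int))) (M s P) = 1\<^sub>m m"
    by (rule eq_matI) (auto simp: M_def poly_eval_entry_var P(1))
   ultimately show False unfolding poly_eval_det by simp
  qed
  have det: "det (map_mat to_fract (M s P)) = to_fract (det (M s P))" by (rule to_fract_det[symmetric])
  have "map_mat to_fract (M s P) \<in> GLF m" using nz cM unfolding GLF_def mem_Collect_eq det to_fract_eq_0_iff by simp
  moreover have "inverse (det (map_mat to_fract (M s P))) \<in> frac_dom" unfolding det by (rule frac_inverse[OF nz unit])
  moreover have "map_mat frac_hom (map_mat to_fract (M s P)) = x"
   unfolding \<psi>M[symmetric] by (rule eq_matI) (simp_all add: frac_poly(2) M_def)
  moreover have "map_mat to_fract (M s P) $$ (i, j) \<in> frac_dom" if "i < m" "j < m" for i j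
   using that cM frac_poly(1) by simp
  ultimately show ?thesis by (simp add: lies_over_def)
 qed
 have h0: "fraction_hom R frac_dom frac_hom" using frac_partial_hom by (rule fraction_hom.intro)
 have A0: "lies_over frac_dom frac_hom m (map_mat to_fract (M 0 Y)) g" by (rule over[OF g]) (simp_all add: w(2))
 have B0: "lies_over frac_dom frac_hom m (map_mat to_fract (M m Z)) h" by (rule over[OF h]) (simp_all add: w(3))
 have "\<forall>i<m. \<forall>j<m. \<not> Y i j --> map_mat to_fract (M 0 Y) $$ (i, j) = 0"
  "\<forall>i<m. \<forall>j<m. \<not> Z i j --> map_mat to_fract (M m Z) $$ (i, j) = 0" by (simp_all add: M_def)
 then show ?thesis using h0 A0 B0 by blast
qed

end

lemma upper_transpose_lower:
 assumes "B \<in> GLF m" "!!i j. i < m ==> j < m ==> \<not> i \<le> j ==> B $$ (i, j) = 0"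
 shows "transpose_mat B \<in> lower_GLF m" "char_at m lam (transpose_mat B) = char_at m lam B" "det B = (\<Prod>i<m. B $$ (i, i))"
proof -
 have c: "B \<in> carrier_mat m m" using assms(1) by (simp add: GLF_def)
 show L: "transpose_mat B \<in> lower_GLF m" using transpose_GLF[OF assms(1)] assms(2) c by (simp add: lower_GLF_def)
 show "char_at m lam (transpose_mat B) = char_at m lam B" unfolding char_at_def by (rule prod.cong) (use c in auto)
 have "det B = det (transpose_mat B)" by (rule det_transpose[OF c, symmetric])
 also have "... = (\<Prod>i<m. transpose_mat B $$ (i, i))" by (rule det_lower) (use L c in \<open>auto simp: lower_GLF_def\<close>)
 also have "... = (\<Prod>i<m. B $$ (i, i))" by (rule prod.cong) (use c in auto)
 finally show "det B = (\<Prod>i<m. B $$ (i, i))" .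
qed

text \<open>
  A covariance identity over the function field holds for the generic lower triangular matrix, hence for all points.
\<close>

lemma lower_covariant_over_rings:
 assumes f: "f \<in> lower_covariant m lam" and R: "cring R" and b: "b \<in> borel_lower R m" and g: "g \<in> GL R m"
 shows "value_at R m f (mmul R m b g) = weight_char R m lam b \<otimes>\<^bsub>R\<^esub> value_at R m f g"
proof -
 interpret cring R by (rule R)
 have fc: "f \<in> coord_ring m" using f by (simp add: lower_covariant_def)
 have b': "b \<in> GL R m" "!!i j. i < m ==> j < m ==> \<not> j \<le> i ==> b $$ (i, j) = \<zero>\<^bsub>R\<^esub>" using b by (auto simp: borel_lower_def)
 have "\<exists>D th A B. fraction_hom R D th & lies_over D th m A b & lies_over D th m B g &
   (\<forall>i<m. \<forall>j<m. \<not> j \<le> i --> A $$ (i, j) = 0) & (\<forall>i<m. \<forall>j<m. \<not> True --> B $$ (i, j) = 0)"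
  by (rule generic_pair) (simp_all add: b' g)
 then obtain D th A B where h: "fraction_hom R D th" and A: "lies_over D th m A b" and B: "lies_over D th m B g"
  and low: "\<forall>i<m. \<forall>j<m. \<not> j \<le> i --> A $$ (i, j) = 0" by blast
 interpret fraction_hom R D th by (rule h)
 have G: "A \<in> GLF m" "B \<in> GLF m" using A B by (auto simp: lies_over_def)
 have L: "A \<in> lower_GLF m" using G low by (auto simp: lower_GLF_def)
 have "det A = (\<Prod>i<m. A $$ (i, i))" by (rule det_lower) (use L in \<open>auto simp: lower_GLF_def GLF_def\<close>)
 note di = diag_inverse_over[OF A this]
 have w: "char_at m lam A \<in> D" "weight_char R m lam b = th (char_at m lam A)"
  by (rule weight_char_over[OF A], use di in blast, use di in blast)+
 have "value_at R m f (mmul R m b g) = th (feval m (A * B) f)" by (rule value_at_over(2)[OF over_mult[OF A B] fc])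
 also have "... = th (char_at m lam A * feval m B f)" using f L G(2) by (simp add: lower_covariant_def)
 also have "... = th (char_at m lam A) \<otimes>\<^bsub>R\<^esub> th (feval m B f)"
  by (rule hom_mult[OF w(1) value_at_over(1)[OF B fc]])
 also have "... = weight_char R m lam b \<otimes>\<^bsub>R\<^esub> value_at R m f g"
  unfolding w(2) value_at_over(2)[OF B fc] ..
 finally show ?thesis .
qed

lemma upper_point:
 assumes R: "cring R" and b: "b \<in> borel_upper R m" and g: "g \<in> GL R m"
 shows "\<exists>D th A B. fraction_hom R D th & lies_over D th m A g & lies_over D th m B b &
  transpose_mat B \<in> lower_GLF m & (\<forall>lam. char_at m lam B \<in> D) & (\<forall>lam. weight_char R m lam b = th (char_at m lam B)) &
  (\<forall>lam. char_at m lam (transpose_mat B) = char_at m lam B) & (\<forall>i<m. B $$ (i, i) ~= 0)"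
proof -
 interpret cring R by (rule R)
 have b': "b \<in> GL R m" "!!i j. i < m ==> j < m ==> \<not> i \<le> j ==> b $$ (i, j) = \<zero>\<^bsub>R\<^esub>" using b by (auto simp: borel_upper_def)
 have "\<exists>D th A B. fraction_hom R D th & lies_over D th m A g & lies_over D th m B b &
   (\<forall>i<m. \<forall>j<m. \<not> True --> A $$ (i, j) = 0) & (\<forall>i<m. \<forall>j<m. \<not> i \<le> j --> B $$ (i, j) = 0)"
  by (rule generic_pair) (simp_all add: b' g)
 then obtain D th A B where h: "fraction_hom R D th" and A: "lies_over D th m A g" and B: "lies_over D th m B b"
  and up': "\<forall>i<m. \<forall>j<m. \<not> i \<le> j --> B $$ (i, j) = 0" by blast
 have up: "B $$ (i, j) = 0" if "i < m" "j < m" "\<not> i \<le> j" for i j using up' that by blast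
 interpret fraction_hom R D th by (rule h)
 have GB: "B \<in> GLF m" using B by (auto simp: lies_over_def)
 have u: "transpose_mat B \<in> lower_GLF m" "char_at m lam (transpose_mat B) = char_at m lam B" "det B = (\<Prod>i<m. B $$ (i, i))" for lam
  by (rule upper_transpose_lower[OF GB], use up in blast)+
 note di = diag_inverse_over[OF B u(3)]
 have w: "char_at m lam B \<in> D" "weight_char R m lam b = th (char_at m lam B)" for lam
  by (rule weight_char_over[OF B], use di in blast, use di in blast)+
 show ?thesis using h A B u(1,2) w di(1) by blast
qed

lemma upper_covariant_over_rings:
 assumes f: "f \<in> upper_covariant m lam" and R: "cring R" and b: "b \<in> borel_upper R m" and g: "g \<in> GL R m"
 shows "value_at R m f (mmul R m g b) = weight_char R m lam b \<otimes>\<^bsub>R\<^esub> value_at R m f g"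
proof -
 have fc: "f \<in> coord_ring m" using f by (simp add: upper_covariant_def)
 obtain D th A B where h: "fraction_hom R D th" and A: "lies_over D th m A g" and B: "lies_over D th m B b"
  and L: "transpose_mat B \<in> lower_GLF m" and w': "\<forall>lam. char_at m lam B \<in> D" "\<forall>lam. weight_char R m lam b = th (char_at m lam B)"
  and t': "\<forall>lam. char_at m lam (transpose_mat B) = char_at m lam B" and nz': "\<forall>i<m. B $$ (i, i) ~= 0"
  using upper_point[OF R b g] by blast
 note w = w'[rule_format]
 note t = t'[rule_format]
 interpret fraction_hom R D th by (rule h)
 have G: "A \<in> GLF m" using A by (auto simp: lies_over_def)
 have eq: "feval m (A * transpose_mat (transpose_mat B)) f = char_at m lam (transpose_mat B) * feval m A f"
  using f L G unfolding upper_covariant_def by blast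
 have "value_at R m f (mmul R m g b) = th (feval m (A * B) f)" by (rule value_at_over(2)[OF over_mult[OF A B] fc])
 also have "... = th (char_at m lam B) \<otimes>\<^bsub>R\<^esub> th (feval m A f)"
  using eq hom_mult[OF w(1) value_at_over(1)[OF A fc]] by (simp add: t)
 also have "... = weight_char R m lam b \<otimes>\<^bsub>R\<^esub> value_at R m f g" unfolding w(2) value_at_over(2)[OF A fc] ..
 finally show ?thesis .
qed

lemma weight_char_uminus:
 assumes lam: "length lam = m" and R: "cring R" and b: "b \<in> borel_upper R m"
 shows "inv\<^bsub>R\<^esub> (weight_char R m (map uminus lam) b) = weight_char R m lam b"
proof -
 have gb: "b \<in> GL R m" using b by (simp add: borel_upper_def)
 obtain D th A B where h: "fraction_hom R D th" and A: "lies_over D th m A b" and B: "lies_over D th m B b"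
  and L: "transpose_mat B \<in> lower_GLF m" and w': "\<forall>lam. char_at m lam B \<in> D" "\<forall>lam. weight_char R m lam b = th (char_at m lam B)"
  and t': "\<forall>lam. char_at m lam (transpose_mat B) = char_at m lam B" and nz': "\<forall>i<m. B $$ (i, i) ~= 0"
  using upper_point[OF R b gb] by blast
 note w = w'[rule_format]
 note nz = nz'[rule_format]
 interpret fraction_hom R D th by (rule h)
 have "char_at m (map uminus lam) B * char_at m lam B = (\<Prod>i<m. 1)"
  unfolding char_at_def prod.distrib[symmetric]
  by (rule prod.cong) (use nz lam in \<open>auto simp: power_int_minus\<close>)
 then show ?thesis unfolding w(2) by (intro hom_inverse(2)[OF w(1) w(1)]) simp
qed

section \<open>A copy of the function field inside an infinite type\<close>

text \<open>
  A finitely supported function is determined by its finite graph over the support.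
\<close>

lemma countable_poly_mapping:
 assumes "countable (UNIV :: 'a set)" "countable (UNIV :: 'b::zero set)"
 shows "countable (UNIV :: ('a \<Rightarrow>\<^sub>0 'b) set)"
proof (rule countable_image_inj_on)
 let ?G = "%p :: 'a \<Rightarrow>\<^sub>0 'b. (%k. (k, lookup p k)) ` keys p"
 have "countable {S :: ('a \<times> 'b) set. finite S & S \<subseteq> UNIV \<times> UNIV}"
  using assms by (intro countable_Collect_finite_subset countable_SIGMA) auto
 then show "countable (range ?G)" by (rule countable_subset[rotated]) auto
 show "inj ?G"
 proof (rule injI)
  fix p q :: "'a \<Rightarrow>\<^sub>0 'b" assume eq: "?G p = ?G q"
  show "p = q"
  proof (rule poly_mapping_eqI)
   fix k
   have "(k, v) \<in> ?G p \<longleftrightarrow> v = lookup p k & v ~= 0" "(k, v) \<in> ?G q \<longleftrightarrow> v = lookup q k & v ~= 0" for v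
    by (auto simp: in_keys_iff)
   then show "lookup p k = lookup q k" unfolding eq by metis
  qed
 qed
qed

lemma countable_zfrac: "countable (UNIV :: zfrac set)"
proof -
 have "countable (UNIV :: zpoly set)" by (intro countable_poly_mapping countableI_type)
 then have "countable (range (%(a, b). Fract (a::zpoly) b))" by (intro countable_image) (auto simp: UNIV_Times_UNIV[symmetric] simp del: UNIV_Times_UNIV)
 moreover have "x \<in> range (%(a, b). Fract (a::zpoly) b)" for x by (cases x) auto
 ultimately show ?thesis by (metis UNIV_eq_I)
qed

text \<open>
  Transport of structure along an injection of the countable function field.
\<close>

lemma ex_function_field_model:
 assumes "infinite (UNIV :: 'r set)"
 shows "\<exists>(R :: 'r ring) th. fraction_hom R UNIV th & inj th"
proof -
 obtain e :: "nat => 'r" where e: "inj e" using infinite_countable_subset[OF assms] by blast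
 define th where "th = e \<circ> to_nat_on (UNIV :: zfrac set)"
 have inj: "inj th" unfolding th_def using inj_on_to_nat_on[OF countable_zfrac] e by (intro comp_inj_on) (auto intro: inj_on_subset)
 let ?u = "inv_into UNIV th"
 have u [simp]: "?u (th x) = x" for x by (rule inv_into_f_f[OF inj UNIV_I])
 define R :: "'r ring" where "R = \<lparr>carrier = range th, mult = (%x y. th (?u x * ?u y)), one = th 1, zero = th 0, add = (%x y. th (?u x + ?u y))\<rparr>"
 have "cring R"
 proof (intro cringI abelian_groupI comm_monoidI)
  fix x assume "x \<in> carrier R"
  then obtain a where "x = th a" by (auto simp: R_def)
  then show "\<exists>y\<in>carrier R. y \<oplus>\<^bsub>R\<^esub> x = \<zero>\<^bsub>R\<^esub>" by (intro bexI[of _ "th (- a)"]) (auto simp: R_def)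
 qed (auto simp: R_def algebra_simps)
 then have "fraction_hom R UNIV th"
  by (intro fraction_hom.intro partial_hom.intro partial_hom_axioms.intro) (auto simp: R_def)
 then show ?thesis using inj by blast
qed

lemma (in fraction_hom) lies_over_UNIV: "D = UNIV ==> A \<in> GLF m ==> lies_over D th m A (map_mat th A)"
 by (simp add: lies_over_def)

lemma (in fraction_hom) map_mat_GL:
 assumes D: "D = UNIV" and A: "A \<in> GLF m"
 shows "map_mat th A \<in> GL R m"
proof -
 have c: "A \<in> carrier_mat m m" using A by (simp add: GLF_def)
 note inv = inv_GLF[OF A]
 have one: "map_mat th (1\<^sub>m m) = mone R m" by (rule eq_matI) (auto simp: mone_def hom_0 hom_1)
 have mats: "map_mat th B \<in> mats R m" if "B \<in> carrier_mat m m" for B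
  using that hom_closed by (simp add: mats_def D)
 have "mmul R m (map_mat th A) (map_mat th (inv_GLF m A)) = mone R m"
  "mmul R m (map_mat th (inv_GLF m A)) (map_mat th A) = mone R m"
  using mmul_hom(1)[OF c _ inv(1)] mmul_hom(1)[OF inv(1) _ c] inv(2,3) one by (simp_all add: D)
 then show ?thesis using mats[OF c] mats[OF inv(1)] by (auto simp: GL_def)
qed

lemma lower_covariantI_over_rings:
 assumes inf: "infinite (UNIV :: 'r set)" and fc: "f \<in> coord_ring m"
  and cov: "!!R b g. cring (R :: 'r ring) ==> b \<in> borel_lower R m ==> g \<in> GL R m ==>
   value_at R m f (mmul R m b g) = weight_char R m lam b \<otimes>\<^bsub>R\<^esub> value_at R m f g"
 shows "f \<in> lower_covariant m lam"
 unfolding lower_covariant_def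
proof (intro CollectI conjI ballI fc)
 fix L B assume L: "L \<in> lower_GLF m" and B: "B \<in> GLF m"
 obtain R :: "'r ring" and th where h: "fraction_hom R UNIV th" and inj: "inj th" using ex_function_field_model[OF inf] by blast
 interpret fraction_hom R UNIV th by (rule h)
 have G: "L \<in> GLF m" using L by (simp add: lower_GLF_def)
 note o = lies_over_UNIV[OF refl G] lies_over_UNIV[OF refl B]
 have b: "map_mat th L \<in> borel_lower R m"
  using map_mat_GL[OF refl G] L by (auto simp: borel_lower_def lower_GLF_def GLF_def hom_0)
 have "weight_char R m lam (map_mat th L) = th (char_at m lam L)"
  by (rule weight_char_over(2)[OF o(1)]) (use lower_diag_nonzero[OF L] in auto)
 then have "th (feval m (L * B) f) = th (char_at m lam L * feval m B f)"
  using cov[OF is_cring b map_mat_GL[OF refl B]] value_at_over(2)[OF over_mult[OF o] fc] value_at_over(2)[OF o(2) fc] hom_mult by simp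
 then show "feval m (L * B) f = char_at m lam L * feval m B f" using inj by (simp add: inj_eq)
qed

lemma right_covariantI_over_rings:
 assumes inf: "infinite (UNIV :: 'r set)" and fc: "f \<in> coord_ring m" and B: "B \<in> GLF m" and L: "L \<in> GLF m"
  and d: "!!i. i < m ==> L $$ (i, i) ~= 0"
  and cov: "!!R th g. fraction_hom (R :: 'r ring) UNIV th ==> g \<in> GL R m ==> map_mat th L \<in> GL R m ==>
   value_at R m f (mmul R m g (map_mat th L)) = weight_char R m lam (map_mat th L) \<otimes>\<^bsub>R\<^esub> value_at R m f g"
 shows "feval m (B * L) f = char_at m lam L * feval m B f"
proof -
 obtain R :: "'r ring" and th where h: "fraction_hom R UNIV th" and inj: "inj th" using ex_function_field_model[OF inf] by blast
 interpret fraction_hom R UNIV th by (rule h)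
 note o = lies_over_UNIV[OF refl L] lies_over_UNIV[OF refl B]
 have "weight_char R m lam (map_mat th L) = th (char_at m lam L)"
  by (rule weight_char_over(2)[OF o(1)]) (use d in auto)
 then have "th (feval m (B * L) f) = th (char_at m lam L * feval m B f)"
  using cov[OF h map_mat_GL[OF refl B] map_mat_GL[OF refl L]] value_at_over(2)[OF over_mult[OF o(2,1)] fc] value_at_over(2)[OF o(2) fc] hom_mult by simp
 then show "feval m (B * L) f = char_at m lam L * feval m B f" using inj by (simp add: inj_eq)
qed

section \<open>Weights of a row of bideterminants\<close>

text \<open>
  Separate the positive and the negative entries of the weight.
\<close>

lemma dominant_shape:
 assumes mu: "mu \<in> dominant m"
 shows "\<exists>sh. rat_shape m sh & bracket (fst sh) (snd sh) = mu"
proof -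
 have len: "length mu = m" and srt: "sorted_wrt (\<ge>) mu" using mu by (auto simp: dominant_def)
 let ?l1 = "map nat mu" and ?l2 = "rev (map (%a. nat (- a)) mu)"
 have srt': "sorted_wrt (\<ge>) ?l1" "sorted_wrt (\<ge>) ?l2"
  unfolding sorted_wrt_rev sorted_wrt_map
  by (rule sorted_wrt_mono_rel[OF _ srt]; simp)+
 have le: "length (filter (%a. 0 < a) xs) + length (filter (%a. a < 0) xs) \<le> length xs" for xs :: "int list"
  by (induction xs) auto
 have "nparts ?l1 + nparts ?l2 \<le> m"
  using le[of mu] len by (simp add: nparts_def filter_map comp_def rev_filter[symmetric])
 moreover have "bracket ?l1 ?l2 = mu"
  unfolding bracket_def by (rule nth_equalityI) auto
 ultimately show ?thesis using len srt' by (intro exI[of _ "(?l1, ?l2)"]) (simp add: rat_shape_def partition_list_def)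
qed

lemma bideterminant_eq_0:
 assumes "\<not> rat_inj sh S \<or> \<not> rat_inj sh T"
 shows "bideterminant m sh S T = 0"
proof -
 have "bidet_part z l S T = 0" if "\<not> col_inj l S" for z l S T
  using bidet_part_swap[of "%i j. z j i" l S T] bidet_part_eq_0[OF that, of "%i j. z j i" T] by simp
 then show ?thesis using assms bidet_part_eq_0 unfolding bideterminant_eq rat_inj_def by auto
qed

lemma minor_column_scale:
 fixes z :: "nat => nat => 'a::comm_ring_1"
 assumes "finite J" "card J = card I"
 shows "minor (%i j. z i j * t j) I J = (\<Prod>j\<in>J. t j) * minor z I J"
proof -
 let ?k = "card I"
 let ?Z = "mat ?k ?k (%(a, b). z (enum_set I a) (enum_set J b))" and ?T = "mat ?k ?k (%(a, b). if a = b then t (enum_set J a) else 0)"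
 have c: "?Z \<in> carrier_mat ?k ?k" "?T \<in> carrier_mat ?k ?k" by simp_all
 have "mat ?k ?k (%(a, b). z (enum_set I a) (enum_set J b) * t (enum_set J b)) = ?Z * ?T"
 proof (rule eq_matI)
  fix a b assume "a < dim_row (?Z * ?T)" "b < dim_col (?Z * ?T)"
  then have ab: "a < ?k" "b < ?k" by simp_all
  have "(?Z * ?T) $$ (a, b) = (\<Sum>l<?k. if l = b then z (enum_set I a) (enum_set J b) * t (enum_set J b) else 0)"
   unfolding index_mult_mat_sum[OF c ab] by (rule sum.cong) (use ab in auto)
  then show "mat ?k ?k (%(a, b). z (enum_set I a) (enum_set J b) * t (enum_set J b)) $$ (a, b) = (?Z * ?T) $$ (a, b)"
   using ab by simp
 qed simp_all
 moreover have "det ?T = (\<Prod>a<?k. t (enum_set J a))"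
 proof -
  have "det ?T = prod_list (diag_mat ?T)" by (rule det_lower_triangular[OF _ c(2)]) simp
  then show ?thesis by (simp add: prod_list_diag_prod atLeast0LessThan)
 qed
 moreover have "(\<Prod>a<?k. t (enum_set J a)) = (\<Prod>j\<in>J. t j)"
  using prod.reindex_bij_betw[OF enum_set_bij[OF assms(1)], of t] assms(2) by simp
 ultimately show ?thesis unfolding minor_def by (simp add: det_mult[OF c] mult.commute)
qed

text \<open>
  Each bideterminant with left tableau \<open>S\<close> is multiplied by a monomial in the entries of a generic diagonal matrix, given by the content of its right column sets. If \<open>f\<close> has weight \<open>mu\<close>, some right tableau has content \<open>mu\<close>, and contents are dominated by the shape.
\<close>

theorem right_weight_dominated:
 assumes sh: "rat_shape m sh" and S: "S \<in> rat_tableaux m sh"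
  and span: "f \<in> zmod.span (bideterminant m sh S ` rat_tableaux m sh)" and f0: "f ~= 0" and mu: "mu \<in> dominant m"
  and cov: "!!A t. A \<in> GLF m ==> t \<in> lower_GLF m ==> (!!i j. i < m ==> j < m ==> i ~= j ==> t $$ (i, j) = 0) ==>
   feval m (A * t) f = char_at m mu t * feval m A f"
 shows "weight_le mu (bracket (fst sh) (snd sh))"
proof -
 obtain sh' where sh': "rat_shape m sh'" "bracket (fst sh') (snd sh') = mu" using dominant_shape[OF mu] by blast
 obtain Y and c :: "rat_tableau => int" where Y: "finite Y" "Y \<subseteq> rat_tableaux m sh"
  and fY: "f = (\<Sum>K\<in>Y. of_int (c K) * bideterminant m sh S K)" using span by (rule span_family_sum)
 have injS: "rat_inj sh S"
 proof (rule ccontr)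
  assume "\<not> rat_inj sh S"
  then have "f = 0" unfolding fY by (simp add: bideterminant_eq_0)
  then show False using f0 by contradiction
 qed
 define Y' where "Y' = {K \<in> Y. rat_inj sh K}"
 have Y': "finite Y'" "!!K. K \<in> Y' ==> K \<in> rat_tableaux m sh" "!!K. K \<in> Y' ==> rat_inj sh K"
  using Y by (auto simp: Y'_def)
 have fY': "f = (\<Sum>K\<in>Y'. of_int (c K) * bideterminant m sh S K)"
  unfolding fY Y'_def using Y(1) by (intro sum.mono_neutral_right) (auto simp: bideterminant_eq_0)
 have fc: "f \<in> coord_ring m"
  unfolding fY' by (intro coord_ring_sum coord_ring_mult coord_ring_of_int bideterminant_coord_ring[OF sh S] Y'(2))
 obtain N0 w0 where fit0: "!!N n. N0 \<le> N ==> N + w0 \<le> n ==> rat_fits N n sh" using ex_rat_fits[of sh] by blast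
 obtain N1 w1 where fit1: "!!N n. N1 \<le> N ==> N + w1 \<le> n ==> rat_fits N n sh'" using ex_rat_fits[of sh'] by blast
 obtain P0 N2 where P0: "P0 \<in> mat_polys m" "f * det_fract m ^ N2 = to_fract P0" using fc by (rule coord_ringE)
 define N where "N = N0 + N1 + N2"
 define n where "n = N + w0 + w1"
 have fit: "rat_fits N n sh" "rat_fits N n sh'" using fit0[of N n] fit1[of N n] by (simp_all add: N_def n_def)
 obtain P where P: "P \<in> mat_polys m" "f * det_fract m ^ N = to_fract P"
  using coord_ring_raise[OF P0, of N] by (auto simp: N_def)
 let ?I = "rat_cols m N sh S" and ?J = "rat_cols m N sh"
 have I: "?I a \<subseteq> {..<m}" "card (?I a) = col_height m N sh a" for a
  using rat_cols_sub[OF sh S] card_rat_cols[OF sh S injS] by auto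
 have J: "?J K a \<subseteq> {..<m}" "card (?J K a) = card (?I a)" "finite (?J K a)" if "K \<in> Y'" for K a
 proof -
  show s: "?J K a \<subseteq> {..<m}" by (rule rat_cols_sub[OF sh Y'(2)[OF that]])
  show "card (?J K a) = card (?I a)" using card_rat_cols[OF sh Y'(2)[OF that] Y'(3)[OF that]] I(2) by simp
  show "finite (?J K a)" using s by (rule finite_subset) simp
 qed
 let ?mx = "%K. \<Prod>a<n. minor (x_fun m) (?I a) (?J K a)"
 have "\<forall>K\<in>Y'. \<exists>e::int. det_fract m ^ N * bideterminant m sh S K = of_int e * ?mx K"
 proof
  fix K assume "K \<in> Y'"
  then have "det_fract m ^ N * bideterminant m sh S K \<asymp> ?mx K"
   using Y'(2,3) by (intro det_power_bideterminant[OF sh S _ injS _ fit(1)]) blast+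
  from sign_eq_witness[OF this] show "\<exists>e::int. det_fract m ^ N * bideterminant m sh S K = of_int e * ?mx K" by blast
 qed
 then obtain e :: "rat_tableau => int" where e: "!!K. K \<in> Y' ==> det_fract m ^ N * bideterminant m sh S K = of_int (e K) * ?mx K"
  by (rule bchoice[THEN exE]) blast
 define b where "b K = c K * e K" for K
 have fm: "f * det_fract m ^ N = (\<Sum>K\<in>Y'. of_int (b K) * ?mx K)"
 proof -
  have "f * det_fract m ^ N = (\<Sum>K\<in>Y'. of_int (c K) * (det_fract m ^ N * bideterminant m sh S K))"
   unfolding fY' sum_distrib_right by (rule sum.cong[OF refl]) (simp only: mult_ac)
  also have "... = (\<Sum>K\<in>Y'. of_int (b K) * ?mx K)"
   by (rule sum.cong[OF refl]) (simp only: e b_def of_int_mult mult.assoc)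
  finally show ?thesis .
 qed
 (* Exponents of the diagonal variables after multiplication by the power of the determinant. *)
 define d where "d i = nat (mu ! i + int N)" for i
 have d: "int (d i) = mu ! i + int N" "d i = card {a. a < n & i < col_height m N sh' a}" if "i < m" for i
  using bracket_count[OF sh'(1) fit(2) that] unfolding sh'(2) d_def by simp_all
 let ?X = "generic_mat m"
 define y where "y j = to_fract (entry_var (m + j) (m + j))" for j
 (* The diagonal entries are variables that do not occur in the generic matrix. *)
 define t where "t = mat m m (%(i, j). if i = j then y i else 0)"
 have ct: "t \<in> carrier_mat m m" by (simp add: t_def)
 have dt: "det t = (\<Prod>i<m. y i)"
 proof -
  have "det t = (\<Prod>i<m. t $$ (i, i))" by (rule det_lower[OF ct]) (simp add: t_def)
  then show ?thesis by (simp add: t_def)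
 qed
 have "y i ~= 0" for i by (simp add: y_def entry_var_def)
 then have t: "t \<in> lower_GLF m" using ct dt by (simp add: lower_GLF_def GLF_def t_def)
 then have G: "t \<in> GLF m" "?X * t \<in> GLF m" using GLF_mult[OF generic_GLF] by (simp_all add: lower_GLF_def)
 have cX: "?X \<in> carrier_mat m m" by (rule generic_mat_carrier)
 have mxc: "minor (x_fun m) (?I a) (?J K a) \<in> coord_ring m" if "K \<in> Y'" for K a by (rule coord_ring_minor[OF I(1) J(1,2)[OF that]])
 have mt: "feval m (?X * t) (minor (x_fun m) (?I a) (?J K a)) = to_fract (minor full_var (?I a) (?J K a) * shift_poly m (\<Prod>j\<in>?J K a. entry_var j j))"
  if K: "K \<in> Y'" for K a
 proof -
  have fin: "finite (?I a)" using I(1) by (rule finite_subset) simp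
  have "feval m (?X * t) (minor (x_fun m) (?I a) (?J K a)) = minor (xcoord (?X * t)) (?I a) (?J K a)"
   by (rule feval_minor[OF G(2) I(1) J(1,2)[OF K]])
  also have "... = minor (%i j. x_fun m i j * y j) (?I a) (?J K a)"
  proof (rule minor_cong[OF fin J(3,2)[OF K]])
   fix i j assume "i \<in> ?I a" "j \<in> ?J K a"
   then have ij: "i < m" "j < m" using I(1)[of a] J(1)[OF K, of a] by auto
   have "xcoord (?X * t) i j = (\<Sum>l<m. if l = j then ?X $$ (i, j) * y j else 0)"
    unfolding index_mult_mat_sum[OF cX ct ij] by (rule sum.cong) (use ij in \<open>auto simp: t_def\<close>)
   then show "xcoord (?X * t) i j = x_fun m i j * y j" using ij by (simp add: x_fun_def)
  qed
  also have "... = (\<Prod>j\<in>?J K a. y j) * minor (x_fun m) (?I a) (?J K a)" by (rule minor_column_scale[OF J(3,2)[OF K]])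
  also have "... = to_fract (minor full_var (?I a) (?J K a) * shift_poly m (\<Prod>j\<in>?J K a. entry_var j j))"
   unfolding to_fract_mult to_fract_full_minor[OF I(1) J(1,2)[OF K]] shift_poly_prod to_fract_prod shift_poly_entry_var y_def
   by (rule mult.commute)
  finally show ?thesis .
 qed
 define q where "q K = of_int (b K) * (\<Prod>a<n. minor full_var (?I a) (?J K a))" for K
 define p where "p K = (\<Prod>a<n. \<Prod>j\<in>?J K a. entry_var j j)" for K
 define U where "U = (\<Prod>i<m. entry_var i i ^ d i)"
 have "feval m (?X * t) (f * det_fract m ^ N) = to_fract (\<Sum>K\<in>Y'. q K * shift_poly m (p K))"
 proof -
  have mp: "of_int (b K) * ?mx K \<in> coord_ring m" if "K \<in> Y'" for K
   by (intro coord_ring_mult coord_ring_of_int coord_ring_prod mxc that)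
  have "feval m (?X * t) (f * det_fract m ^ N) = (\<Sum>K\<in>Y'. feval m (?X * t) (of_int (b K) * ?mx K))"
   unfolding fm by (rule feval_sum[OF G(2) mp])
  also have "... = (\<Sum>K\<in>Y'. to_fract (q K * shift_poly m (p K)))"
  proof (rule sum.cong[OF refl])
   fix K assume K: "K \<in> Y'"
   have "feval m (?X * t) (of_int (b K) * ?mx K) = of_int (b K) * feval m (?X * t) (?mx K)"
    unfolding feval_mult[OF G(2) coord_ring_of_int coord_ring_prod[OF mxc[OF K]]] feval_of_int[OF G(2)] ..
   also have "feval m (?X * t) (?mx K) = (\<Prod>a<n. feval m (?X * t) (minor (x_fun m) (?I a) (?J K a)))"
    by (rule feval_prod[OF G(2) mxc[OF K]])
   also have "of_int (b K) * ... = to_fract (q K * shift_poly m (p K))"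
    unfolding mt[OF K] q_def p_def shift_poly_prod[of m _ "{..<n}"] to_fract_prod[symmetric] to_fract_of_int[symmetric] to_fract_mult[symmetric] prod.distrib
    by (simp only: mult.assoc)
   finally show "feval m (?X * t) (of_int (b K) * ?mx K) = to_fract (q K * shift_poly m (p K))" .
  qed
  finally show ?thesis unfolding to_fract_sum .
 qed
 moreover have "feval m (?X * t) (f * det_fract m ^ N) = to_fract (P * shift_poly m U)"
 proof -
  have dc: "det_fract m \<in> coord_ring m" by (rule coord_ring_poly[OF det_poly_mat_polys])
  have dNc: "det_fract m ^ N \<in> coord_ring m" using coord_ring_prod[of "{..<N}" "%_. det_fract m"] dc by simp
  have off: "!!i j. i < m ==> j < m ==> i ~= j ==> t $$ (i, j) = 0" by (simp add: t_def)
  have "feval m (?X * t) (f * det_fract m ^ N) = feval m (?X * t) f * det (?X * t) ^ N"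
   unfolding feval_mult[OF G(2) fc dNc] feval_power[OF G(2) dc] feval_det_fract[OF G(2)] ..
  also have "feval m (?X * t) f = char_at m mu t * feval m ?X f" by (rule cov[OF generic_GLF t off])
  also have "feval m ?X f = f" by (rule feval_generic[OF fc])
  also have "det (?X * t) = det_fract m * det t" unfolding det_mult[OF cX ct] det_generic ..
  also have "char_at m mu t * f * (det_fract m * det t) ^ N = (f * det_fract m ^ N) * (char_at m mu t * det t ^ N)"
   unfolding power_mult_distrib by (simp only: mult_ac)
  also have "char_at m mu t * det t ^ N = (\<Prod>i<m. t $$ (i, i) ^ nat (mu ! i + int N))"
  proof (rule char_at_det_power[OF t])
   show "0 \<le> mu ! i + int N" if "i < m" for i unfolding d(1)[OF that, symmetric] by simp
  qed
  also have "... = to_fract (shift_poly m U)"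
   unfolding U_def shift_poly_prod to_fract_prod
  proof (rule prod.cong[OF refl])
   fix i assume "i \<in> {..<m}"
   moreover have "shift_poly m (entry_var i i ^ d i) = entry_var (m + i) (m + i) ^ d i"
    using shift_poly_prod[of m "%_. entry_var i i" "{..<d i}"] by (simp add: shift_poly_entry_var)
   ultimately show "t $$ (i, i) ^ nat (mu ! i + int N) = to_fract (shift_poly m (entry_var i i ^ d i))"
    by (simp add: t_def y_def d_def to_fract_power)
  qed
  finally show ?thesis unfolding P(2) to_fract_mult .
 qed
 ultimately have "(\<Sum>K\<in>Y'. q K * shift_poly m (p K)) = P * shift_poly m U" by (simp only: to_fract_eq_iff)
 then have id: "(\<Sum>K\<in>Y'. q K * shift_poly m (p K)) = (\<Sum>x\<in>{()}. (%_. P) x * shift_poly m ((%_. U) x))" by simp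
 define \<beta> where "\<beta> = (\<Sum>i<m. single (prod_encode (i, i)) (d i))"
 have qm: "q K \<in> mat_polys m" if "K \<in> Y'" for K
  unfolding q_def
 proof (intro mat_polys_mult mat_polys_of_int mat_polys_prod)
  fix a
  show "minor full_var (?I a) (?J K a) \<in> mat_polys m"
  proof (rule minor_mat_polys[OF _ J(3,2)[OF that]])
   show "finite (?I a)" using I(1) by (rule finite_subset) simp
   fix i j assume "i \<in> ?I a" "j \<in> ?J K a"
   then have "i < m" "j < m" using I(1)[of a] J(1)[OF that, of a] by auto
   then show "full_var i j \<in> mat_polys m" by (simp add: masked_var_def mat_polys_entry_var)
  qed
 qed
 have "(\<Sum>K\<in>Y'. of_int (lookup (p K) \<beta>) * q K) = (\<Sum>x\<in>{()}. of_int (lookup ((%_. U) x) \<beta>) * (%_. P) x)"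
  by (rule separate_shifted_variables[OF qm P(1) id])
 moreover have "lookup U \<beta> = 1" unfolding U_def diagonal_monomial \<beta>_def by simp
 ultimately have sep: "(\<Sum>K\<in>Y'. of_int (lookup (p K) \<beta>) * q K) = P" by simp
 have "P ~= 0"
 proof
  assume "P = 0"
  then have "f * det_fract m ^ N = 0" using P(2) by simp
  then show False using f0 power_not_zero[OF det_fract_nonzero, of m N] by (simp only: mult_eq_0_iff) blast
 qed
 then obtain K where K: "K \<in> Y'" "lookup (p K) \<beta> ~= 0"
  using sep by (metis (no_types, lifting) mult_zero_left of_int_0 sum.neutral)
 define \<nu> where "\<nu> = (\<Sum>a<n. \<Sum>j\<in>?J K a. single (prod_encode (j, j)) (1::nat))"
 have "p K = single \<nu> 1"
  unfolding p_def \<nu>_def entry_var_def by (simp add: prod_monomials J(3)[OF K(1)])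
 then have \<nu>: "\<nu> = \<beta>" using K(2) by (simp add: lookup_single when_def split: if_splits)
 have content: "card {a. a < n & i \<in> ?J K a} = card {a. a < n & i < col_height m N sh' a}" if i: "i < m" for i
 proof -
  have "lookup \<nu> (prod_encode (i, i)) = (\<Sum>a<n. if i \<in> ?J K a then 1 else 0)"
   unfolding \<nu>_def lookup_sum
  proof (rule sum.cong[OF refl])
   fix a
   have "(\<Sum>j\<in>?J K a. lookup (single (prod_encode (j, j)) (1::nat)) (prod_encode (i, i))) = (\<Sum>j\<in>?J K a. if j = i then 1 else 0)"
    by (rule sum.cong[OF refl]) (simp add: lookup_single when_def)
   then show "(\<Sum>j\<in>?J K a. lookup (single (prod_encode (j, j)) (1::nat)) (prod_encode (i, i))) = (if i \<in> ?J K a then 1 else 0)"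
    using J(3)[OF K(1), of a] by simp
  qed
  also have "... = card {a. a < n & i \<in> ?J K a}" by (rule card_below_as_sum[symmetric])
  finally have "card {a. a < n & i \<in> ?J K a} = d i"
   unfolding \<nu> \<beta>_def lookup_diagonal_mono[of d m i i] using i by simp
  then show ?thesis using d(2)[OF i] by simp
 qed
 have "weight_le (bracket (fst sh') (snd sh')) (bracket (fst sh) (snd sh))"
 proof (rule content_dominance(1)[OF sh'(1) fit(2) sh fit(1), where K = "?J K"])
  show "?J K a \<subseteq> {..<m}" "card (?J K a) = col_height m N sh a" for a using J(1,2)[OF K(1)] I(2) by auto
 qed (rule content)
 then show ?thesis unfolding sh'(2) .
qed

section \<open>The truncation functor\<close>

lemma comodule_over_rings:
 fixes k :: nat
 assumes f: "f \<in> coord_ring m" and uv: "!!i. i < k ==> u i \<in> coord_ring m" "!!i. i < k ==> v i \<in> coord_ring m"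
  and id: "!!A B. A \<in> GLF m ==> B \<in> GLF m ==> feval m (A * B) f = (\<Sum>i<k. feval m A (u i) * feval m B (v i))"
  and R: "cring R" and g: "g \<in> GL R m" and h: "h \<in> GL R m"
 shows "value_at R m f (mmul R m g h) = (\<Oplus>\<^bsub>R\<^esub>i\<in>{..<k}. value_at R m (u i) g \<otimes>\<^bsub>R\<^esub> value_at R m (v i) h)"
proof -
 interpret cring R by (rule R)
 have "\<exists>D th A B. fraction_hom R D th & lies_over D th m A g & lies_over D th m B h &
   (\<forall>i<m. \<forall>j<m. \<not> True --> A $$ (i, j) = 0) & (\<forall>i<m. \<forall>j<m. \<not> True --> B $$ (i, j) = 0)"
  by (rule generic_pair) (simp_all add: g h)
 then obtain D th A B where F: "fraction_hom R D th" and A: "lies_over D th m A g" and B: "lies_over D th m B h" by blast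
 interpret fraction_hom R D th by (rule F)
 have G: "A \<in> GLF m" "B \<in> GLF m" using A B by (auto simp: lies_over_def)
 have t: "feval m A (u i) * feval m B (v i) \<in> D"
  "th (feval m A (u i) * feval m B (v i)) = value_at R m (u i) g \<otimes>\<^bsub>R\<^esub> value_at R m (v i) h"
  "value_at R m (u i) g \<otimes>\<^bsub>R\<^esub> value_at R m (v i) h \<in> carrier R" if "i < k" for i
 proof -
  note a = value_at_over[OF A uv(1)[OF that]] and b = value_at_over[OF B uv(2)[OF that]]
  show "feval m A (u i) * feval m B (v i) \<in> D" by (rule D_mult[OF a(1) b(1)])
  show "th (feval m A (u i) * feval m B (v i)) = value_at R m (u i) g \<otimes>\<^bsub>R\<^esub> value_at R m (v i) h"
   unfolding a(2) b(2) by (rule hom_mult[OF a(1) b(1)])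
  show "value_at R m (u i) g \<otimes>\<^bsub>R\<^esub> value_at R m (v i) h \<in> carrier R"
   unfolding a(2) b(2) by (rule m_closed[OF hom_closed[OF a(1)] hom_closed[OF b(1)]])
 qed
 have "value_at R m f (mmul R m g h) = th (feval m (A * B) f)" by (rule value_at_over(2)[OF over_mult[OF A B] f])
 also have "... = (\<Oplus>\<^bsub>R\<^esub>i\<in>{..<k}. th (feval m A (u i) * feval m B (v i)))"
  unfolding id[OF G] by (rule hom_sum(2)) (use t(1) in auto)
 also have "... = (\<Oplus>\<^bsub>R\<^esub>i\<in>{..<k}. value_at R m (u i) g \<otimes>\<^bsub>R\<^esub> value_at R m (v i) h)"
  by (rule finsum_cong') (use t in auto)
 finally show ?thesis .
qed

lemma comodule_over_field:
 fixes k :: nat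
 assumes inf: "infinite (UNIV :: 'r set)" and f: "f \<in> coord_ring m"
  and uv: "!!i. i < k ==> u i \<in> coord_ring m" "!!i. i < k ==> v i \<in> coord_ring m"
  and id: "!!R g h. cring (R :: 'r ring) ==> g \<in> GL R m ==> h \<in> GL R m ==>
   value_at R m f (mmul R m g h) = (\<Oplus>\<^bsub>R\<^esub>i\<in>{..<k}. value_at R m (u i) g \<otimes>\<^bsub>R\<^esub> value_at R m (v i) h)"
  and A: "A \<in> GLF m" and B: "B \<in> GLF m"
 shows "feval m (A * B) f = (\<Sum>i<k. feval m A (u i) * feval m B (v i))"
proof -
 obtain R :: "'r ring" and th where F: "fraction_hom R UNIV th" and inj: "inj th" using ex_function_field_model[OF inf] by blast
 interpret fraction_hom R UNIV th by (rule F)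
 note o = lies_over_UNIV[OF refl A] lies_over_UNIV[OF refl B]
 have "th (feval m (A * B) f) = (\<Oplus>\<^bsub>R\<^esub>i\<in>{..<k}. value_at R m (u i) (map_mat th A) \<otimes>\<^bsub>R\<^esub> value_at R m (v i) (map_mat th B))"
  using id[OF is_cring map_mat_GL[OF refl A] map_mat_GL[OF refl B]] unfolding value_at_over(2)[OF over_mult[OF o] f] .
 also have "... = (\<Oplus>\<^bsub>R\<^esub>i\<in>{..<k}. th (feval m A (u i) * feval m B (v i)))"
 proof (rule finsum_cong'[OF refl])
  fix i assume "i \<in> {..<k}"
  then have i: "i < k" by simp
  show "value_at R m (u i) (map_mat th A) \<otimes>\<^bsub>R\<^esub> value_at R m (v i) (map_mat th B) = th (feval m A (u i) * feval m B (v i))"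
   unfolding value_at_over(2)[OF o(1) uv(1)[OF i]] value_at_over(2)[OF o(2) uv(2)[OF i]]
   by (rule hom_mult[OF UNIV_I UNIV_I, symmetric])
 qed (simp add: hom_closed)
 also have "... = th (\<Sum>i<k. feval m A (u i) * feval m B (v i))" by (rule hom_sum(2)[symmetric]) simp_all
 finally show ?thesis using inj by (simp only: inj_eq)
qed

lemma torus_borel_upper: "torus R m \<subseteq> borel_upper R m"
 by (auto simp: torus_def borel_upper_def)

lemma zero_upper_covariant: "0 \<in> upper_covariant m lam"
proof -
 have "B * transpose_mat L \<in> GLF m" if "L \<in> lower_GLF m" "B \<in> GLF m" for L B
  using GLF_mult[OF that(2) transpose_GLF] that(1) by (simp add: lower_GLF_def)
 then show ?thesis by (simp add: upper_covariant_def)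
qed

lemma upper_covariant_weight_space:
 assumes "f \<in> M" "f \<in> upper_covariant m mu"
 shows "f \<in> weight_space TYPE('r) m M mu"
 unfolding weight_space_def
 using assms(1) upper_covariant_over_rings[OF assms(2)] torus_borel_upper by fast

text \<open>
  A function of a submodule that involves a shape outside \<open>\<pi>\<close> gives rise to a nonzero weight vector of that dominant weight in the submodule.
\<close>

lemma O_trunc_subset:
 assumes inf: "infinite (UNIV :: 'r set)" and rank: "is_rank m r ro" and \<pi>: "saturated m \<pi>"
 shows "O_trunc TYPE('r) m \<pi> \<subseteq> zmod.span (bidet m ` std_bitableaux m r \<pi>)"
 unfolding O_trunc_def
proof (rule zmod.span_minimal[OF _ zmod.subspace_span], rule Union_least)
 fix M assume "M \<in> {M. gl_submodule TYPE('r) m M & (\<exists>B. finite B & M = zmod.span B) &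
  (\<forall>mu\<in>dominant m. weight_space TYPE('r) m M mu ~= {0} --> mu \<in> \<pi>)}"
 then have gl: "gl_submodule TYPE('r) m M" and wt: "!!mu. mu \<in> dominant m ==> weight_space TYPE('r) m M mu ~= {0} ==> mu \<in> \<pi>" by blast+
 have M: "M \<subseteq> coord_ring m" "zmod.subspace M" using gl by (auto simp: gl_submodule_def)
 show "M \<subseteq> zmod.span (bidet m ` std_bitableaux m r \<pi>)"
 proof (rule subsetI, rule ccontr)
  fix f assume f: "f \<in> M" and notin: "f \<notin> zmod.span (bidet m ` std_bitableaux m r \<pi>)"
  obtain k :: nat and u v where uv: "\<forall>i<k. u i \<in> M & v i \<in> coord_ring m"
   and id: "\<forall>R :: 'r ring. cring R --> (\<forall>g\<in>GL R m. \<forall>h\<in>GL R m.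
     value_at R m f (mmul R m g h) = (\<Oplus>\<^bsub>R\<^esub>i\<in>{..<k}. value_at R m (u i) g \<otimes>\<^bsub>R\<^esub> value_at R m (v i) h))"
   using gl f unfolding gl_submodule_def by blast
  have u: "u i \<in> M" "v i \<in> coord_ring m" if "i < k" for i using uv that by blast+
  have fc: "f \<in> coord_ring m" using f M(1) by blast
  have "feval m (A * B) f = (\<Sum>i<k. feval m A (u i) * feval m B (v i))" if "A \<in> GLF m" "B \<in> GLF m" for A B
  proof (rule comodule_over_field[OF inf fc _ u(2) _ that])
   show "u i \<in> coord_ring m" if "i < k" for i using u(1)[OF that] M(1) by blast
  qed (use id in blast)+
  from extract_from_submodule[OF rank M(2,1) fc \<pi> u this notin]
  obtain sh F where sh: "rat_shape m sh" "bracket (fst sh) (snd sh) \<notin> \<pi>" and F: "F \<in> M" "F ~= 0"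
   "F \<in> zmod.span {bideterminant m sh S (canonical_tableau m sh) | S. S \<in> rat_tableaux m sh}" by blast
  let ?lam = "bracket (fst sh) (snd sh)"
  have "{bideterminant m sh S (canonical_tableau m sh) | S. S \<in> rat_tableaux m sh} \<subseteq>
    {bideterminant m sh S (canonical_tableau m sh) | sh S. sh \<in> shapes_of m ?lam & S \<in> rat_tableaux m sh}"
   using sh(1) unfolding shapes_of_iff by blast
  then have "F \<in> nabla_tilde m ?lam" unfolding nabla_tilde_def using F(3) zmod.span_mono by blast
  then have "F \<in> upper_covariant m ?lam" unfolding nabla_tilde_eq_upper_covariant[OF length_bracket[OF sh(1)]] .
  then have "F \<in> weight_space TYPE('r) m M ?lam" by (rule upper_covariant_weight_space[OF F(1)])
  then have "?lam \<in> \<pi>" using wt[OF bracket_dominant[OF sh(1)]] F(2) by blast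
  then show False using sh(2) by contradiction
 qed
qed

text \<open>
  The submodule is the span of all bideterminants with left tableau \<open>S\<close>. Its dominant weights are at most the weight of the shape, so they lie in the saturated set.
\<close>

lemma bideterminants_in_O_trunc:
 assumes inf: "infinite (UNIV :: 'r set)" and \<pi>: "saturated m \<pi>"
  and sh: "rat_shape m sh" "bracket (fst sh) (snd sh) \<in> \<pi>" and S: "S \<in> rat_tableaux m sh" and T: "T \<in> rat_tableaux m sh"
 shows "bideterminant m sh S T \<in> O_trunc TYPE('r) m \<pi>"
proof -
 let ?X = "rat_tableaux m sh"
 let ?M = "zmod.span (bideterminant m sh S ` ?X)"
 have Mc: "?M \<subseteq> coord_ring m"
  by (rule zmod.span_minimal[OF _ subspace_coord_ring]) (use bideterminant_coord_ring[OF sh(1) S] in blast)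
 have fin: "finite ?X" by (rule finite_rat_tableaux[OF sh(1)])
 obtain e where e: "bij_betw e {0..<card ?X} ?X" using ex_bij_betw_nat_finite[OF fin] by blast
 have eX: "e i \<in> ?X" if "i < card ?X" for i using bij_betwE[OF e] that by simp
 have "gl_submodule TYPE('r) m ?M"
  unfolding gl_submodule_def
 proof (intro conjI ballI Mc zmod.subspace_span)
  fix f assume f: "f \<in> ?M"
  then have fc: "f \<in> coord_ring m" using Mc by blast
  obtain Y and c :: "rat_tableau => int" where Y: "finite Y" "Y \<subseteq> ?X" and fY: "f = (\<Sum>K\<in>Y. of_int (c K) * bideterminant m sh S K)"
   using f by (rule span_family_sum)
  note YX = subsetD[OF Y(2)]
  note bc = bideterminant_coord_ring[OF sh(1) S]
  let ?u = "%i. bideterminant m sh S (e i)" and ?w = "%K. \<Sum>T\<in>Y. of_int (c T) * entry_product m sh K T"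
  have u: "?u i \<in> ?M" "?u i \<in> coord_ring m" if "i < card ?X" for i
   using eX[OF that] bc by (auto intro: zmod.span_base)
  have w: "?w K \<in> coord_ring m" if "K \<in> ?X" for K
   by (intro coord_ring_sum coord_ring_mult coord_ring_of_int entry_product(1) that YX)
  have id: "feval m (A * B) f = (\<Sum>i<card ?X. feval m A (?u i) * feval m B (?w (e i)))" if A: "A \<in> GLF m" and B: "B \<in> GLF m" for A B
  proof -
   note AB = GLF_mult[OF A B]
   have "feval m (A * B) f = (\<Sum>T\<in>Y. of_int (c T) * feval m (A * B) (bideterminant m sh S T))"
    unfolding fY
   proof (subst feval_sum[OF AB])
    show "of_int (c K) * bideterminant m sh S K \<in> coord_ring m" if "K \<in> Y" for K
     by (intro coord_ring_mult coord_ring_of_int bc YX that)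
    show "(\<Sum>K\<in>Y. feval m (A * B) (of_int (c K) * bideterminant m sh S K)) = (\<Sum>T\<in>Y. of_int (c T) * feval m (A * B) (bideterminant m sh S T))"
     by (rule sum.cong[OF refl]) (simp only: feval_mult[OF AB coord_ring_of_int bc[OF YX]] feval_of_int[OF AB])
   qed
   also have "... = (\<Sum>T\<in>Y. \<Sum>K\<in>?X. feval m A (bideterminant m sh S K) * (of_int (c T) * feval m B (entry_product m sh K T)))"
   proof (rule sum.cong[OF refl])
    fix T assume T: "T \<in> Y"
    show "of_int (c T) * feval m (A * B) (bideterminant m sh S T) =
     (\<Sum>K\<in>?X. feval m A (bideterminant m sh S K) * (of_int (c T) * feval m B (entry_product m sh K T)))"
     unfolding bideterminant_comodule[OF A B sh(1) S YX[OF T]] sum_distrib_left by (simp only: mult_ac)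
   qed
   also have "... = (\<Sum>K\<in>?X. feval m A (bideterminant m sh S K) * (\<Sum>T\<in>Y. of_int (c T) * feval m B (entry_product m sh K T)))"
    unfolding sum_distrib_left by (rule sum.swap)
   also have "... = (\<Sum>K\<in>?X. feval m A (bideterminant m sh S K) * feval m B (?w K))"
   proof (rule sum.cong[OF refl])
    fix K assume K: "K \<in> ?X"
    have "feval m B (?w K) = (\<Sum>T\<in>Y. feval m B (of_int (c T) * entry_product m sh K T))"
     by (rule feval_sum[OF B]) (intro coord_ring_mult coord_ring_of_int entry_product(1) K YX)
    also have "... = (\<Sum>T\<in>Y. of_int (c T) * feval m B (entry_product m sh K T))"
     by (rule sum.cong[OF refl]) (simp only: feval_mult[OF B coord_ring_of_int entry_product(1)[OF K YX]] feval_of_int[OF B])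
    finally show "feval m A (bideterminant m sh S K) * (\<Sum>T\<in>Y. of_int (c T) * feval m B (entry_product m sh K T)) =
     feval m A (bideterminant m sh S K) * feval m B (?w K)" by simp
   qed
   also have "... = (\<Sum>i\<in>{0..<card ?X}. feval m A (?u i) * feval m B (?w (e i)))"
    by (rule sum.reindex_bij_betw[OF e, symmetric])
   finally show ?thesis unfolding atLeast0LessThan .
  qed
  have "\<forall>i<card ?X. ?u i \<in> ?M & ?w (e i) \<in> coord_ring m" using u(1) w eX by blast
  moreover have "\<forall>R :: 'r ring. cring R --> (\<forall>g\<in>GL R m. \<forall>h\<in>GL R m. value_at R m f (mmul R m g h) =
    (\<Oplus>\<^bsub>R\<^esub>i\<in>{..<card ?X}. value_at R m (?u i) g \<otimes>\<^bsub>R\<^esub> value_at R m (?w (e i)) h))"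
  proof (intro allI impI ballI)
   fix R :: "'r ring" and g h assume "cring R" "g \<in> GL R m" "h \<in> GL R m"
   then show "value_at R m f (mmul R m g h) = (\<Oplus>\<^bsub>R\<^esub>i\<in>{..<card ?X}. value_at R m (?u i) g \<otimes>\<^bsub>R\<^esub> value_at R m (?w (e i)) h)"
    by (intro comodule_over_rings[where u = ?u and v = "%i. ?w (e i)", OF fc] u(2) w eX id)
  qed
  ultimately show "\<exists>(n::nat) u v. (\<forall>i<n. u i \<in> ?M & v i \<in> coord_ring m) &
   (\<forall>R :: 'r ring. cring R --> (\<forall>g\<in>GL R m. \<forall>h\<in>GL R m.
     value_at R m f (mmul R m g h) = (\<Oplus>\<^bsub>R\<^esub>i\<in>{..<n}. value_at R m (u i) g \<otimes>\<^bsub>R\<^esub> value_at R m (v i) h)))"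
   by (intro exI[of _ "card ?X"] exI[of _ ?u] exI[of _ "%i. ?w (e i)"] conjI)
 qed
 moreover have "\<exists>B. finite B & ?M = zmod.span B" using fin by blast
 moreover have "mu \<in> \<pi>" if mu: "mu \<in> dominant m" and ne: "weight_space TYPE('r) m ?M mu ~= {0}" for mu
 proof -
  have "0 \<in> weight_space TYPE('r) m ?M mu" by (rule upper_covariant_weight_space[OF zmod.span_zero zero_upper_covariant])
  then obtain f where f: "f \<in> weight_space TYPE('r) m ?M mu" "f ~= 0" using ne by blast
  have fM: "f \<in> ?M" using f(1) by (simp add: weight_space_def)
  have fR: "value_at R m f (mmul R m g t) = weight_char R m mu t \<otimes>\<^bsub>R\<^esub> value_at R m f g"
   if "cring R" "g \<in> GL R m" "t \<in> torus R m" for R :: "'r ring" and g t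
   using f(1) that by (simp add: weight_space_def)
  have "weight_le mu (bracket (fst sh) (snd sh))"
  proof (rule right_weight_dominated[OF sh(1) S fM f(2) mu])
   fix A t assume A: "A \<in> GLF m" and t: "t \<in> lower_GLF m" and off: "!!i j. i < m ==> j < m ==> i ~= j ==> t $$ (i, j) = 0"
   have tG: "t \<in> GLF m" using t by (simp add: lower_GLF_def)
   show "feval m (A * t) f = char_at m mu t * feval m A f"
   proof (rule right_covariantI_over_rings[OF inf subsetD[OF Mc fM] A tG lower_diag_nonzero[OF t]])
    fix R :: "'r ring" and th g assume F: "fraction_hom R UNIV th" and g: "g \<in> GL R m" and tR: "map_mat th t \<in> GL R m"
    interpret fraction_hom R UNIV th by (rule F)
    have "map_mat th t \<in> torus R m" using tR off tG by (auto simp: torus_def GLF_def hom_0)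
    then show "value_at R m f (mmul R m g (map_mat th t)) = weight_char R m mu (map_mat th t) \<otimes>\<^bsub>R\<^esub> value_at R m f g"
     by (rule fR[OF is_cring g])
   qed
  qed
  then show "mu \<in> \<pi>" using \<pi> mu sh(2) unfolding saturated_def by blast
 qed
 ultimately have "?M \<in> {M. gl_submodule TYPE('r) m M & (\<exists>B. finite B & M = zmod.span B) &
  (\<forall>mu\<in>dominant m. weight_space TYPE('r) m M mu ~= {0} --> mu \<in> \<pi>)}" by blast
 moreover have "bideterminant m sh S T \<in> ?M" using T by (intro zmod.span_base imageI)
 ultimately show ?thesis unfolding O_trunc_def by (intro zmod.span_base UnionI)
qed

lemma upper_covariant_iff_rings:
 assumes inf: "infinite (UNIV :: 'r set)"
 shows "upper_covariant m lam = {f \<in> coord_ring m. \<forall>R :: 'r ring. cring R --> (\<forall>g\<in>GL R m. \<forall>b\<in>borel_upper R m.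
  value_at R m f (mmul R m g b) = weight_char R m lam b \<otimes>\<^bsub>R\<^esub> value_at R m f g)}" (is "_ = ?T")
proof
 show "upper_covariant m lam \<subseteq> ?T"
 proof
  fix f assume f: "f \<in> upper_covariant m lam"
  then have "f \<in> coord_ring m" by (simp add: upper_covariant_def)
  then show "f \<in> ?T" using upper_covariant_over_rings[OF f] by blast
 qed
 show "?T \<subseteq> upper_covariant m lam"
 proof
  fix f assume f: "f \<in> ?T"
  then have fc: "f \<in> coord_ring m" by blast
  have "feval m (B * transpose_mat L) f = char_at m lam L * feval m B f" if L: "L \<in> lower_GLF m" and B: "B \<in> GLF m" for L B
  proof -
   have LG: "L \<in> GLF m" using L by (simp add: lower_GLF_def)
   then have cL: "L \<in> carrier_mat m m" by (simp add: GLF_def)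
   have "feval m (B * transpose_mat L) f = char_at m lam (transpose_mat L) * feval m B f"
   proof (rule right_covariantI_over_rings[OF inf fc B transpose_GLF[OF LG]])
    show "transpose_mat L $$ (i, i) ~= 0" if "i < m" for i using lower_diag_nonzero[OF L that] cL that by simp
    fix R :: "'r ring" and th g assume F: "fraction_hom R UNIV th" and g: "g \<in> GL R m" and tR: "map_mat th (transpose_mat L) \<in> GL R m"
    interpret fraction_hom R UNIV th by (rule F)
    have "map_mat th (transpose_mat L) \<in> borel_upper R m"
     using tR L cL by (auto simp: borel_upper_def lower_GLF_def hom_0)
    then show "value_at R m f (mmul R m g (map_mat th (transpose_mat L))) =
      weight_char R m lam (map_mat th (transpose_mat L)) \<otimes>\<^bsub>R\<^esub> value_at R m f g"
     using f is_cring g by blast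
   qed
   moreover have "char_at m lam (transpose_mat L) = char_at m lam L"
    unfolding char_at_def by (rule prod.cong) (use cL in auto)
   ultimately show ?thesis by simp
  qed
  then show "f \<in> upper_covariant m lam" using fc by (simp add: upper_covariant_def)
 qed
qed

lemma lower_covariant_ind_lower:
 assumes inf: "infinite (UNIV :: 'r set)"
 shows "lower_covariant m lam = ind_lower TYPE('r) m lam"
proof
 show "lower_covariant m lam \<subseteq> ind_lower TYPE('r) m lam"
 proof
  fix f assume f: "f \<in> lower_covariant m lam"
  then have "f \<in> coord_ring m" by (simp add: lower_covariant_def)
  then show "f \<in> ind_lower TYPE('r) m lam" unfolding ind_lower_def using lower_covariant_over_rings[OF f] by blast
 qed
 show "ind_lower TYPE('r) m lam \<subseteq> lower_covariant m lam"
 proof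
  fix f assume f: "f \<in> ind_lower TYPE('r) m lam"
  then have fc: "f \<in> coord_ring m" by (simp add: ind_lower_def)
  show "f \<in> lower_covariant m lam"
   by (rule lower_covariantI_over_rings[OF inf fc]) (use f in \<open>unfold ind_lower_def, blast\<close>)
 qed
qed

lemma jantzen_ind_upper:
 assumes "length lam = m"
 shows "jantzen_ind m (%R :: 'r ring. borel_upper R m) (%R. weight_char R m (map uminus lam)) =
  {f \<in> coord_ring m. \<forall>R :: 'r ring. cring R --> (\<forall>g\<in>GL R m. \<forall>b\<in>borel_upper R m.
   value_at R m f (mmul R m g b) = weight_char R m lam b \<otimes>\<^bsub>R\<^esub> value_at R m f g)}"
 unfolding jantzen_ind_def by (rule Collect_cong) (auto simp: weight_char_uminus[OF assms])

lemma std_bideterminants_inj: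
 assumes rank: "is_rank m r ro" and \<pi>: "\<pi> \<subseteq> dominant m"
 shows "inj_on (bidet m) (std_bitableaux m r \<pi>)" "zmod.independent (bidet m ` std_bitableaux m r \<pi>)"
proof -
 have sub: "std_bitableaux m r \<pi> \<subseteq> std_bitableaux m r (dominant m)" using \<pi> by (auto simp: std_bitableaux_def)
 show inj: "inj_on (bidet m) (std_bitableaux m r \<pi>)"
 proof (rule inj_onI, rule ccontr)
  fix ka ka' assume k: "ka \<in> std_bitableaux m r \<pi>" "ka' \<in> std_bitableaux m r \<pi>" "bidet m ka = bidet m ka'" "ka ~= ka'"
  let ?a = "%x. if x = ka then 1 else - 1 :: int"
  have "(\<Sum>x\<in>{ka, ka'}. of_int (?a x) * bidet m x) = of_int (?a ka) * bidet m ka + (\<Sum>x\<in>{ka'}. of_int (?a x) * bidet m x)"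
   by (rule sum.insert) (use k(4) in simp_all)
  also have "... = 0" using k(3) k(4)[symmetric] by simp
  finally have zero: "(\<Sum>x\<in>{ka, ka'}. of_int (?a x) * bidet m x) = 0" .
  have "?a ka = 0" by (rule std_bideterminants_independent[OF rank _ _ zero]) (use k sub in auto)
  then show False by simp
 qed
 show "zmod.independent (bidet m ` std_bitableaux m r \<pi>)"
  unfolding zmod.dependent_explicit
 proof
  assume "\<exists>t u. finite t & t \<subseteq> bidet m ` std_bitableaux m r \<pi> & (\<Sum>v\<in>t. of_int (u v) * v) = 0 & (\<exists>v\<in>t. u v ~= 0)"
  then obtain t and u :: "zfrac => int" and v where t: "finite t" "t \<subseteq> bidet m ` std_bitableaux m r \<pi>" "(\<Sum>v\<in>t. of_int (u v) * v) = 0"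
   and v: "v \<in> t" "u v ~= 0" by blast
  obtain Ks where Ks: "Ks \<subseteq> std_bitableaux m r \<pi>" "inj_on (bidet m) Ks" "t = bidet m ` Ks" using t(2) by (meson subset_image_inj)
  have fin: "finite Ks" using t(1) Ks(2,3) finite_image_iff by blast
  have "(\<Sum>ka\<in>Ks. of_int (u (bidet m ka)) * bidet m ka) = 0"
   using t(3) unfolding Ks(3) sum.reindex[OF Ks(2)] by (simp only: comp_def)
  moreover obtain ka where "ka \<in> Ks" "v = bidet m ka" using v(1) Ks(3) by blast
  ultimately have "u v = 0" using std_bideterminants_independent[OF rank fin, of "%ka. u (bidet m ka)" ka] Ks(1) sub by blast
  then show False using v(2) by contradiction
 qed
qed

theorem corollary5:
  fixes m :: nat and r :: "(nat \<times> nat) set"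
  assumes "m \<ge> 1"
    and "linear_order_on {..<m} r"
    and "infinite (UNIV :: 'r set)"
  shows "(\<forall>lam\<in>dominant m.
      nabla m lam = ind_lower TYPE('r) m lam \<and>
      nabla_tilde m lam = jantzen_ind m (\<lambda>R :: 'r ring. borel_upper R m)
        (\<lambda>R. weight_char R m (map uminus lam)) \<and>
      nabla_tilde m lam = {f \<in> coord_ring m. \<forall>R :: 'r ring. cring R \<longrightarrow>
        (\<forall>g\<in>GL R m. \<forall>b\<in>borel_upper R m.
          value_at R m f (mmul R m g b) = weight_char R m lam b \<otimes>\<^bsub>R\<^esub> value_at R m f g)}) \<and>
    (\<forall>\<pi>. saturated m \<pi> \<longrightarrow>
      O_trunc TYPE('r) m \<pi> = zmod.span ((\<lambda>(sh, S, T). bideterminant m sh S T) ` bitableaux m \<pi>) \<and>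
      inj_on (\<lambda>(sh, S, T). bideterminant m sh S T) (std_bitableaux m r \<pi>) \<and>
      zmod.independent ((\<lambda>(sh, S, T). bideterminant m sh S T) ` std_bitableaux m r \<pi>) \<and>
      zmod.span ((\<lambda>(sh, S, T). bideterminant m sh S T) ` std_bitableaux m r \<pi>) =
        O_trunc TYPE('r) m \<pi>)"
proof (intro conjI ballI allI impI)
 note inf = assms(3)
 fix lam assume "lam \<in> dominant m"
 then have lam: "length lam = m" by (simp add: dominant_def)
 show "nabla m lam = ind_lower TYPE('r) m lam"
  unfolding nabla_eq_lower_covariant[OF lam] by (rule lower_covariant_ind_lower[OF inf])
 show tilde: "nabla_tilde m lam = {f \<in> coord_ring m. \<forall>R :: 'r ring. cring R -->
    (\<forall>g\<in>GL R m. \<forall>b\<in>borel_upper R m.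
     value_at R m f (mmul R m g b) = weight_char R m lam b \<otimes>\<^bsub>R\<^esub> value_at R m f g)}"
  unfolding nabla_tilde_eq_upper_covariant[OF lam] by (rule upper_covariant_iff_rings[OF inf])
 show "nabla_tilde m lam = jantzen_ind m (%R :: 'r ring. borel_upper R m) (%R. weight_char R m (map uminus lam))"
  unfolding tilde jantzen_ind_upper[OF lam] ..
next
 note inf = assms(3)
 fix \<pi> assume \<pi>: "saturated m \<pi>"
 then have dom: "\<pi> \<subseteq> dominant m" by (simp add: saturated_def)
 obtain ro where rank: "is_rank m r ro" using ex_rank[OF assms(2)] by blast
 let ?V = "zmod.span (bidet m ` std_bitableaux m r \<pi>)" and ?W = "zmod.span (bidet m ` bitableaux m \<pi>)"
 have "std_bitableaux m r \<pi> \<subseteq> bitableaux m \<pi>"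
  using std_rat_iff[OF rank] by (auto simp: std_bitableaux_def bitableaux_def)
 then have VW: "?V \<subseteq> ?W" by (intro zmod.span_mono image_mono)
 have "bidet m ` bitableaux m \<pi> \<subseteq> O_trunc TYPE('r) m \<pi>"
 proof (rule image_subsetI)
  fix ka assume ka: "ka \<in> bitableaux m \<pi>"
  obtain sh S T where e: "ka = (sh, S, T)" by (rule prod_cases3)
  have "rat_shape m sh" "bracket (fst sh) (snd sh) \<in> \<pi>" "S \<in> rat_tableaux m sh" "T \<in> rat_tableaux m sh"
   using ka unfolding e bitableaux_iff by blast+
  then show "bidet m ka \<in> O_trunc TYPE('r) m \<pi>" unfolding e prod.case by (rule bideterminants_in_O_trunc[OF inf \<pi>])
 qed
 then have WO: "?W \<subseteq> O_trunc TYPE('r) m \<pi>"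
  by (rule zmod.span_minimal) (simp only: O_trunc_def zmod.subspace_span)
 note OV = O_trunc_subset[OF inf rank \<pi>]
 show "O_trunc TYPE('r) m \<pi> = ?W" using VW WO OV by blast
 show "?V = O_trunc TYPE('r) m \<pi>" using VW WO OV by blast
 show "inj_on (bidet m) (std_bitableaux m r \<pi>)" by (rule std_bideterminants_inj(1)[OF rank dom])
 show "zmod.independent (bidet m ` std_bitableaux m r \<pi>)" by (rule std_bideterminants_inj(2)[OF rank dom])
qed

end
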